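(* Let $R$ be a Cohen--Macaulay local ring of dimension $d$ with maximal ideal $\mathfrak m$, and let $M$ be a non-Cohen--Macaulay $R$-module of dimension $d_0<d-1$ and depth $t\le d-2$. Then $H^d_{\mathfrak m}(R)$ is not tor-rigid.
   Context: Rings are commutative and Noetherian. $H^i_{\mathfrak m}(-)$ denotes local cohomology with support in $\mathfrak m$, and $H^d_{\mathfrak m}(R)$ is the top local cohomology module. The dimension of a module is the dimension of its support; its depth is the least $i$ with $H^i_{\mathfrak m}(M)\ne 0$; $M$ is non-Cohen--Macaulay if its depth differs from its dimension. An $R$-module $N$ is tor-rigid if, for every $R$-module $L$ and every $i\ge 1$, $\operatorname{Tor}_i^R(L,N)=0$ implies $\operatorname{Tor}_j^R(L,N)=0$ for all $j\ge i$. *)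

theory Defs
  imports "HOL-Algebra.Algebra" "HOL-Library.Extended_Real"
begin

section \<open>Modules\<close>

definition regular_module :: "'a ring \<Rightarrow> ('a, 'a) module" where
  "regular_module R =
     \<lparr>carrier = carrier R, monoid.mult = monoid.mult R, one = one R,
      ring.zero = ring.zero R, ring.add = ring.add R, smult = monoid.mult R\<rparr>"

definition mod_hom :: "'a ring \<Rightarrow> ('a, 'b) module \<Rightarrow> ('a, 'c) module \<Rightarrow> ('b \<Rightarrow> 'c) set" where
  "mod_hom R M N =
     {h \<in> carrier M \<rightarrow> carrier N.
        (\<forall>x\<in>carrier M. \<forall>y\<in>carrier M. h (x \<oplus>\<^bsub>M\<^esub> y) = h x \<oplus>\<^bsub>N\<^esub> h y) \<and>
        (\<forall>r\<in>carrier R. \<forall>x\<in>carrier M. h (r \<odot>\<^bsub>M\<^esub> x) = r \<odot>\<^bsub>N\<^esub> h x)}"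

definition is_zero_module :: "('a, 'b) module \<Rightarrow> bool" where
  "is_zero_module M \<longleftrightarrow> carrier M = {\<zero>\<^bsub>M\<^esub>}"

text \<open>A module record extends a ring record, but modules have no multiplication: the fields
  \<open>mult\<close> and \<open>one\<close> are never used and are left unspecified below.\<close>

definition quot_module :: "('a, 'b) module \<Rightarrow> 'b set \<Rightarrow> ('a, 'b set) module" where
  "quot_module M N =
     \<lparr>carrier = a_rcosets\<^bsub>M\<^esub> N, monoid.mult = undefined, one = undefined,
      ring.zero = N, ring.add = set_add M, smult = (\<lambda>r C. \<Union>x\<in>C. N +>\<^bsub>M\<^esub> (r \<odot>\<^bsub>M\<^esub> x))\<rparr>"

definition generated_submodule :: "'a ring \<Rightarrow> ('a, 'b) module \<Rightarrow> 'b set \<Rightarrow> 'b set" where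
  "generated_submodule R M S = \<Inter>{N. submodule N R M \<and> S \<subseteq> N}"

text \<open>The free module on a set \<open>T\<close>, as finitely supported functions.\<close>

definition free_module_on :: "'a ring \<Rightarrow> 'x set \<Rightarrow> ('a, 'x \<Rightarrow> 'a) module" where
  "free_module_on R T =
     \<lparr>carrier = {\<phi>. \<phi> \<in> UNIV \<rightarrow> carrier R \<and>
                    finite {x. \<phi> x \<noteq> \<zero>\<^bsub>R\<^esub>} \<and> {x. \<phi> x \<noteq> \<zero>\<^bsub>R\<^esub>} \<subseteq> T},
      monoid.mult = undefined, one = undefined,
      ring.zero = (\<lambda>_. \<zero>\<^bsub>R\<^esub>), ring.add = (\<lambda>\<phi> \<psi> x. \<phi> x \<oplus>\<^bsub>R\<^esub> \<psi> x),
      smult = (\<lambda>r \<phi> x. r \<otimes>\<^bsub>R\<^esub> \<phi> x)\<rparr>"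

text \<open>Every element of \<open>M\<close> is a unique finite linear combination of elements of \<open>T\<close>.\<close>

definition is_basis :: "'a ring \<Rightarrow> ('a, 'b) module \<Rightarrow> 'b set \<Rightarrow> bool" where
  "is_basis R M T \<longleftrightarrow> T \<subseteq> carrier M \<and>
     bij_betw (\<lambda>c. finsum M (\<lambda>b. c b \<odot>\<^bsub>M\<^esub> b) {b. c b \<noteq> \<zero>\<^bsub>R\<^esub>})
       (carrier (free_module_on R T)) (carrier M)"

definition is_free_module :: "'a ring \<Rightarrow> ('a, 'b) module \<Rightarrow> bool" where
  "is_free_module R M \<longleftrightarrow> Module.module R M \<and> (\<exists>T. is_basis R M T)"

text \<open>HOL cannot quantify over types inside a definition, so the lifting property ranges over all
  modules carried by the type of \<open>E\<close>. By Baer's criterion this is full injectivity as soon as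
  the ideals of \<open>R\<close> can be copied into that type, as is the case for the carrier type used for
  resolutions below.\<close>

definition is_injective_module :: "'a ring \<Rightarrow> ('a, 'c) module \<Rightarrow> bool" where
  "is_injective_module R E \<longleftrightarrow> Module.module R E \<and>
     (\<forall>(B :: ('a, 'c) module) A f.
        Module.module R B \<and> submodule A R B \<and> f \<in> mod_hom R (B\<lparr>carrier := A\<rparr>) E \<longrightarrow>
        (\<exists>g\<in>mod_hom R B E. \<forall>x\<in>A. g x = f x))"


section \<open>Tensor products\<close>

definition free_gen :: "'a ring \<Rightarrow> 'x \<Rightarrow> 'x \<Rightarrow> 'a" where
  "free_gen R x = (\<lambda>y. if y = x then \<one>\<^bsub>R\<^esub> else \<zero>\<^bsub>R\<^esub>)"

definition bilinear_relations ::
    "'a ring \<Rightarrow> ('a, 'b) module \<Rightarrow> ('a, 'c) module \<Rightarrow> ('b \<times> 'c \<Rightarrow> 'a) set" where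
  "bilinear_relations R M N =
     (let F = free_module_on R (carrier M \<times> carrier N); e = free_gen R in
      {e (x \<oplus>\<^bsub>M\<^esub> x', y) \<ominus>\<^bsub>F\<^esub> (e (x, y) \<oplus>\<^bsub>F\<^esub> e (x', y)) |x x' y.
         x \<in> carrier M \<and> x' \<in> carrier M \<and> y \<in> carrier N} \<union>
      {e (x, y \<oplus>\<^bsub>N\<^esub> y') \<ominus>\<^bsub>F\<^esub> (e (x, y) \<oplus>\<^bsub>F\<^esub> e (x, y')) |x y y'.
         x \<in> carrier M \<and> y \<in> carrier N \<and> y' \<in> carrier N} \<union>
      {e (r \<odot>\<^bsub>M\<^esub> x, y) \<ominus>\<^bsub>F\<^esub> (r \<odot>\<^bsub>F\<^esub> e (x, y)) |r x y.
         r \<in> carrier R \<and> x \<in> carrier M \<and> y \<in> carrier N} \<union>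
      {e (x, r \<odot>\<^bsub>N\<^esub> y) \<ominus>\<^bsub>F\<^esub> (r \<odot>\<^bsub>F\<^esub> e (x, y)) |r x y.
         r \<in> carrier R \<and> x \<in> carrier M \<and> y \<in> carrier N})"

definition tensor_relations ::
    "'a ring \<Rightarrow> ('a, 'b) module \<Rightarrow> ('a, 'c) module \<Rightarrow> ('b \<times> 'c \<Rightarrow> 'a) set" where
  "tensor_relations R M N =
     generated_submodule R (free_module_on R (carrier M \<times> carrier N)) (bilinear_relations R M N)"

definition tensor ::
    "'a ring \<Rightarrow> ('a, 'b) module \<Rightarrow> ('a, 'c) module \<Rightarrow> ('a, ('b \<times> 'c \<Rightarrow> 'a) set) module" where
  "tensor R M N =
     quot_module (free_module_on R (carrier M \<times> carrier N)) (tensor_relations R M N)"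

definition pure_tensor ::
    "'a ring \<Rightarrow> ('a, 'b) module \<Rightarrow> ('a, 'c) module \<Rightarrow> 'b \<Rightarrow> 'c \<Rightarrow> ('b \<times> 'c \<Rightarrow> 'a) set" where
  "pure_tensor R M N x y =
     tensor_relations R M N +>\<^bsub>free_module_on R (carrier M \<times> carrier N)\<^esub> free_gen R (x, y)"

text \<open>The map \<open>f \<otimes> N\<close>. Its values on the carrier are determined, since the pure tensors
  generate.\<close>

definition tensor_map ::
    "'a ring \<Rightarrow> ('a, 'b) module \<Rightarrow> ('a, 'b') module \<Rightarrow> ('a, 'c) module \<Rightarrow> ('b \<Rightarrow> 'b')
      \<Rightarrow> ('b \<times> 'c \<Rightarrow> 'a) set \<Rightarrow> ('b' \<times> 'c \<Rightarrow> 'a) set" where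
  "tensor_map R M M' N f =
     (SOME h. h \<in> mod_hom R (tensor R M N) (tensor R M' N) \<and>
        (\<forall>x\<in>carrier M. \<forall>y\<in>carrier N. h (pure_tensor R M N x y) = pure_tensor R M' N (f x) y))"


section \<open>Complexes and resolutions\<close>

text \<open>Chain complexes have differentials \<open>\<Delta> n : C (n + 1) \<rightarrow> C n\<close>, cochain complexes
  \<open>\<delta> n : C n \<rightarrow> C (n + 1)\<close>; both are zero in negative degrees.\<close>

definition chain_homology ::
    "(nat \<Rightarrow> ('a, 'c) module) \<Rightarrow> (nat \<Rightarrow> 'c \<Rightarrow> 'c) \<Rightarrow> nat \<Rightarrow> ('a, 'c set) module" where
  "chain_homology C \<Delta> i =
     quot_module
       ((C i)\<lparr>carrier :=
          (case i of 0 \<Rightarrow> carrier (C 0)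
           | Suc k \<Rightarrow> {x \<in> carrier (C (Suc k)). \<Delta> k x = \<zero>\<^bsub>C k\<^esub>})\<rparr>)
       (\<Delta> i ` carrier (C (Suc i)))"

definition cochain_cohomology ::
    "(nat \<Rightarrow> ('a, 'c) module) \<Rightarrow> (nat \<Rightarrow> 'c \<Rightarrow> 'c) \<Rightarrow> nat \<Rightarrow> ('a, 'c set) module" where
  "cochain_cohomology C \<delta> i =
     quot_module
       ((C i)\<lparr>carrier := {x \<in> carrier (C i). \<delta> i x = \<zero>\<^bsub>C (Suc i)\<^esub>}\<rparr>)
       (case i of 0 \<Rightarrow> {\<zero>\<^bsub>C 0\<^esub>} | Suc k \<Rightarrow> \<delta> k ` carrier (C k))"

definition is_free_resolution ::
    "'a ring \<Rightarrow> ('a, 'b) module \<Rightarrow>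
     (nat \<Rightarrow> ('a, 'c) module) \<times> (nat \<Rightarrow> 'c \<Rightarrow> 'c) \<times> ('c \<Rightarrow> 'b) \<Rightarrow> bool" where
  "is_free_resolution R M = (\<lambda>(F, \<Delta>, \<epsilon>).
     (\<forall>n. is_free_module R (F n)) \<and>
     (\<forall>n. \<Delta> n \<in> mod_hom R (F (Suc n)) (F n)) \<and>
     \<epsilon> \<in> mod_hom R (F 0) M \<and>
     \<epsilon> ` carrier (F 0) = carrier M \<and>
     \<Delta> 0 ` carrier (F 1) = {x \<in> carrier (F 0). \<epsilon> x = \<zero>\<^bsub>M\<^esub>} \<and>
     (\<forall>n. \<Delta> (Suc n) ` carrier (F (Suc (Suc n))) = {x \<in> carrier (F (Suc n)). \<Delta> n x = \<zero>\<^bsub>F n\<^esub>}))"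

definition is_injective_resolution ::
    "'a ring \<Rightarrow> ('a, 'b) module \<Rightarrow>
     (nat \<Rightarrow> ('a, 'c) module) \<times> (nat \<Rightarrow> 'c \<Rightarrow> 'c) \<times> ('b \<Rightarrow> 'c) \<Rightarrow> bool" where
  "is_injective_resolution R M = (\<lambda>(E, \<delta>, \<eta>).
     (\<forall>n. is_injective_module R (E n)) \<and>
     (\<forall>n. \<delta> n \<in> mod_hom R (E n) (E (Suc n))) \<and>
     \<eta> \<in> mod_hom R M (E 0) \<and>
     inj_on \<eta> (carrier M) \<and>
     \<eta> ` carrier M = {x \<in> carrier (E 0). \<delta> 0 x = \<zero>\<^bsub>E 1\<^esub>} \<and>
     (\<forall>n. \<delta> n ` carrier (E n) = {x \<in> carrier (E (Suc n)). \<delta> (Suc n) x = \<zero>\<^bsub>E (Suc (Suc n))\<^esub>}))"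

text \<open>A type large enough to carry the terms of resolutions of an \<open>R\<close>-module \<open>M\<close>: its
  cardinality is the maximum of \<open>\<aleph>\<^sub>0\<close> and those of the two parameter types. A free module on at most
  that many generators has at most that many elements, so \<open>M\<close> has a free resolution in this
  type. If \<open>R\<close> is Noetherian, \<open>M\<close> also has an injective resolution in it: inside any injective
  module containing \<open>M\<close>, close off \<open>M\<close> under solutions of the extension problems of Baer's
  criterion; ideals being finitely generated, countably many steps suffice and the cardinality does
  not grow.\<close>

datatype ('a, 'b) res_elem =
  Ring_Elem 'a | Mod_Elem 'b | Res_Node "('a, 'b) res_elem list"

definition free_resolution ::
    "'a ring \<Rightarrow> ('a, 'b) module \<Rightarrow>
     (nat \<Rightarrow> ('a, ('a, 'b) res_elem) module) \<times>
     (nat \<Rightarrow> ('a, 'b) res_elem \<Rightarrow> ('a, 'b) res_elem) \<times> (('a, 'b) res_elem \<Rightarrow> 'b)" where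
  "free_resolution R M = (SOME P. is_free_resolution R M P)"

definition injective_resolution ::
    "'a ring \<Rightarrow> ('a, 'b) module \<Rightarrow>
     (nat \<Rightarrow> ('a, ('a, 'b) res_elem) module) \<times>
     (nat \<Rightarrow> ('a, 'b) res_elem \<Rightarrow> ('a, 'b) res_elem) \<times> ('b \<Rightarrow> ('a, 'b) res_elem)" where
  "injective_resolution R M = (SOME I. is_injective_resolution R M I)"


section \<open>Tor and local cohomology\<close>

definition Tor ::
    "'a ring \<Rightarrow> nat \<Rightarrow> ('a, 'b) module \<Rightarrow> ('a, 'c) module \<Rightarrow>
     ('a, (('a, 'b) res_elem \<times> 'c \<Rightarrow> 'a) set set) module" where
  "Tor R i L N = (case free_resolution R L of (F, \<Delta>, \<epsilon>) \<Rightarrow>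
     chain_homology (\<lambda>n. tensor R (F n) N) (\<lambda>n. tensor_map R (F (Suc n)) (F n) N (\<Delta> n)) i)"

primrec ideal_power :: "'a ring \<Rightarrow> 'a set \<Rightarrow> nat \<Rightarrow> 'a set" where
  "ideal_power R I 0 = carrier R"
| "ideal_power R I (Suc n) = ideal_prod R (ideal_power R I n) I"

definition torsion_submodule :: "'a ring \<Rightarrow> 'a set \<Rightarrow> ('a, 'b) module \<Rightarrow> ('a, 'b) module" where
  "torsion_submodule R I M =
     M\<lparr>carrier := {x \<in> carrier M. \<exists>n. \<forall>r\<in>ideal_power R I n. r \<odot>\<^bsub>M\<^esub> x = \<zero>\<^bsub>M\<^esub>}\<rparr>"

text \<open>\<open>local_cohomology R I i M\<close> is the \<open>i\<close>-th right derived functor of the \<open>I\<close>-torsion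
  functor at \<open>M\<close>.\<close>

definition local_cohomology ::
    "'a ring \<Rightarrow> 'a set \<Rightarrow> nat \<Rightarrow> ('a, 'b) module \<Rightarrow> ('a, ('a, 'b) res_elem set) module" where
  "local_cohomology R I i M = (case injective_resolution R M of (E, \<delta>, \<eta>) \<Rightarrow>
     cochain_cohomology (\<lambda>n. torsion_submodule R I (E n)) \<delta> i)"

text \<open>The test modules \<open>L\<close> range over all modules carried by the type \<open>'l\<close>, as HOL cannot
  quantify over types inside a definition. Failure for one \<open>'l\<close> exhibits an actual test module, hence
  is failure of tor-rigidity outright.\<close>

definition tor_rigid :: "'l itself \<Rightarrow> 'a ring \<Rightarrow> ('a, 'c) module \<Rightarrow> bool" where
  "tor_rigid _ R N \<longleftrightarrow>
     (\<forall>L :: ('a, 'l) module. Module.module R L \<longrightarrow>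
        (\<forall>i\<ge>1. is_zero_module (Tor R i L N) \<longrightarrow> (\<forall>j\<ge>i. is_zero_module (Tor R j L N))))"


section \<open>Dimension, depth and the Cohen--Macaulay property\<close>

text \<open>The set underlying \<open>S\<^sup>-\<^sup>1M\<close>, that is, \<open>M \<times> S\<close> modulo equality of fractions.\<close>

definition fraction_rel ::
    "'a ring \<Rightarrow> 'a set \<Rightarrow> ('a, 'b) module \<Rightarrow> (('b \<times> 'a) \<times> ('b \<times> 'a)) set" where
  "fraction_rel R S M =
     {((x, s), (y, t)) |x s y t. x \<in> carrier M \<and> y \<in> carrier M \<and> s \<in> S \<and> t \<in> S \<and>
        (\<exists>u\<in>S. u \<odot>\<^bsub>M\<^esub> (t \<odot>\<^bsub>M\<^esub> x \<ominus>\<^bsub>M\<^esub> s \<odot>\<^bsub>M\<^esub> y) = \<zero>\<^bsub>M\<^esub>)}"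

definition fractions :: "'a ring \<Rightarrow> 'a set \<Rightarrow> ('a, 'b) module \<Rightarrow> ('b \<times> 'a) set set" where
  "fractions R S M = (carrier M \<times> S) // fraction_rel R S M"

definition support :: "'a ring \<Rightarrow> ('a, 'b) module \<Rightarrow> 'a set set" where
  "support R M =
     {P. primeideal P R \<and>
         fractions R (carrier R - P) M \<noteq>
           {fraction_rel R (carrier R - P) M `` {(\<zero>\<^bsub>M\<^esub>, \<one>\<^bsub>R\<^esub>)}}}"

text \<open>Supremum of the lengths \<open>n\<close> of chains \<open>P\<^sub>0 \<subset> \<dots> \<subset> P\<^sub>n\<close> in a set of primes; the empty set has
  dimension \<open>-\<infinity>\<close>.\<close>

definition chain_dim :: "'a set set \<Rightarrow> ereal" where
  "chain_dim T =
     Sup {ereal (real n) |n. \<exists>P :: nat \<Rightarrow> 'a set. (\<forall>i\<le>n. P i \<in> T) \<and> (\<forall>i<n. P i \<subset> P (Suc i))}"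

definition krull_dim :: "'a ring \<Rightarrow> ereal" where
  "krull_dim R = chain_dim {P. primeideal P R}"

definition module_dim :: "'a ring \<Rightarrow> ('a, 'b) module \<Rightarrow> ereal" where
  "module_dim R M = chain_dim (support R M)"

text \<open>The depth is infinite if all local cohomology modules vanish.\<close>

definition depth :: "'a ring \<Rightarrow> 'a set \<Rightarrow> ('a, 'b) module \<Rightarrow> enat" where
  "depth R \<mm> M = Inf {enat i |i. \<not> is_zero_module (local_cohomology R \<mm> i M)}"

definition noetherian_local_ring :: "'a ring \<Rightarrow> 'a set \<Rightarrow> bool" where
  "noetherian_local_ring R \<mm> \<longleftrightarrow>
     cring R \<and> noetherian_ring R \<and> maximalideal \<mm> R \<and> (\<forall>J. maximalideal J R \<longrightarrow> J = \<mm>)"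

definition cohen_macaulay_module :: "'a ring \<Rightarrow> 'a set \<Rightarrow> ('a, 'b) module \<Rightarrow> bool" where
  "cohen_macaulay_module R \<mm> M \<longleftrightarrow> ereal_of_enat (depth R \<mm> M) = module_dim R M"

definition cohen_macaulay_local_ring :: "'a ring \<Rightarrow> 'a set \<Rightarrow> bool" where
  "cohen_macaulay_local_ring R \<mm> \<longleftrightarrow>
     noetherian_local_ring R \<mm> \<and> cohen_macaulay_module R \<mm> (regular_module R)"

end

theory Submission
  imports Defs
begin

text \<open>
  Let \<open>L \<noteq> 0\<close> be a module killed by \<open>\<mm>\<close>, obtained as a subquotient of \<open>M\<close>, let \<open>F\<close> be a free
  resolution of \<open>L\<close> and \<open>E\<close> an injective resolution of \<open>R\<close>, and let \<open>G\<close> be the \<open>\<mm>\<close>-torsion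
  subcomplex of \<open>E\<close>; a system of parameters \<open>y\<close> describes it as power torsion with respect to each
  \<open>y\<^sub>l\<close>. Multiplication by an element of \<open>\<mm>\<close> is null-homotopic on \<open>F\<close>, so \<open>Tor(L, Q) = 0\<close> in all degrees
  as soon as some \<open>y\<^sub>l\<close> is bijective on \<open>Q\<close>. Filtering by torsion with respect to the first
  \<open>l\<close> parameters yields \<open>Tor(L, E\<^sup>i / G\<^sup>i) = 0\<close>. Put \<open>S\<^sup>i = {e \<in> E\<^sup>i. \<delta> e \<in> G}\<close> and \<open>V = \<delta> E\<^bsup>d-2\<^esup> + G\<^bsup>d-1\<^esup>\<close>. Torsion with
  respect to \<open>j\<close> elements has no cohomology above degree \<open>j\<close>, whence likewise \<open>Tor(L, S\<^bsup>d-1\<^esup> / G\<^bsup>d-1\<^esup>) = 0\<close>;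
  and \<open>\<delta>\<close> identifies \<open>S\<^bsup>d-1\<^esup> / V\<close> with the top local cohomology \<open>H\<close>. Thus \<open>Tor\<^sub>1(L, H)\<close> embeds into
  \<open>Tor\<^sub>0(L, V / G\<^bsup>d-1\<^esup>)\<close>, which vanishes because \<open>V / G\<^bsup>d-1\<^esup>\<close> is an image of \<open>E\<^bsup>d-2\<^esup> / G\<^bsup>d-2\<^esup>\<close>. Since
  \<open>R\<close> is Cohen--Macaulay, \<open>G\<close> is exact below degree \<open>d\<close>, and shifting dimensions down along \<open>E\<close>
  turns \<open>Tor\<^sub>d(L, H) = 0\<close> into \<open>Tor\<^sub>0(L, R) = 0\<close>, that is, \<open>L = 0\<close>.
\<close>

text \<open>Why it should be true: for Cohen--Macaulay \<open>R\<close> the Cech complex on a system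
  of parameters is a flat resolution of H, so Tor_i(L, H) is the local cohomology of
  \<open>L\<close> in degree d - i. For \<open>L\<close> killed by the maximal ideal this is
  concentrated in i = d, so rigidity is refuted as soon as 1 < d; that is what
  \<open>d\<^sub>0 < d - 1\<close> supplies. \<open>L\<close> is taken from \<open>M\<close> because
  the rigidity in question concerns test modules carried by the type of \<open>M\<close>. The
  computation stays on the injective resolution that defines H, without localization: an injective
  module over a Noetherian ring enters only through the fact that it is divisible by y up to power
  torsion of y. Long exact sequences become statements about chains C \<subseteq> B \<subseteq> A of
  submodules of one fixed module. The remaining weight comes from the definitions: they choose
  resolutions in a prescribed carrier type, so injective and free resolutions must be shown to exist
  inside that type before anything is known about the chosen ones.\<close>

lemma mod_hom_closed: "h \<in> mod_hom R M N \<Longrightarrow> x \<in> carrier M \<Longrightarrow> h x \<in> carrier N"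
  by (auto simp: mod_hom_def)

lemma mod_hom_add:
  "h \<in> mod_hom R M N \<Longrightarrow> x \<in> carrier M \<Longrightarrow> y \<in> carrier M \<Longrightarrow> h (x \<oplus>\<^bsub>M\<^esub> y) = h x \<oplus>\<^bsub>N\<^esub> h y"
  by (auto simp: mod_hom_def)

lemma mod_hom_smult:
  "h \<in> mod_hom R M N \<Longrightarrow> r \<in> carrier R \<Longrightarrow> x \<in> carrier M \<Longrightarrow> h (r \<odot>\<^bsub>M\<^esub> x) = r \<odot>\<^bsub>N\<^esub> h x"
  by (auto simp: mod_hom_def)

lemma mod_homI:
  assumes "\<And>x. x \<in> carrier M \<Longrightarrow> h x \<in> carrier N"
    and "\<And>x y. x \<in> carrier M \<Longrightarrow> y \<in> carrier M \<Longrightarrow> h (x \<oplus>\<^bsub>M\<^esub> y) = h x \<oplus>\<^bsub>N\<^esub> h y"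
    and "\<And>r x. r \<in> carrier R \<Longrightarrow> x \<in> carrier M \<Longrightarrow> h (r \<odot>\<^bsub>M\<^esub> x) = r \<odot>\<^bsub>N\<^esub> h x"
  shows "h \<in> mod_hom R M N"
  using assms by (auto simp: mod_hom_def)

lemma mod_hom_zero:
  assumes "Module.module R M" "Module.module R N" "h \<in> mod_hom R M N"
  shows "h \<zero>\<^bsub>M\<^esub> = \<zero>\<^bsub>N\<^esub>"
proof -
  interpret M: Module.module R M by fact
  interpret N: Module.module R N by fact
  have "h (\<zero>\<^bsub>R\<^esub> \<odot>\<^bsub>M\<^esub> \<zero>\<^bsub>M\<^esub>) = \<zero>\<^bsub>R\<^esub> \<odot>\<^bsub>N\<^esub> h \<zero>\<^bsub>M\<^esub>"
    by (rule mod_hom_smult[OF assms(3)]) auto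
  thus ?thesis using mod_hom_closed[OF assms(3) M.M.zero_closed] by simp
qed

lemma mod_hom_minus:
  assumes "Module.module R M" "Module.module R N" "h \<in> mod_hom R M N" "x \<in> carrier M" "y \<in> carrier M"
  shows "h (x \<ominus>\<^bsub>M\<^esub> y) = h x \<ominus>\<^bsub>N\<^esub> h y"
proof -
  interpret M: Module.module R M by fact
  interpret N: Module.module R N by fact
  have c: "h (\<ominus>\<^bsub>M\<^esub> y) \<in> carrier N" "h y \<in> carrier N" "h x \<in> carrier N"
    using mod_hom_closed[OF assms(3)] assms(4,5) by auto
  have "h (\<ominus>\<^bsub>M\<^esub> y) \<oplus>\<^bsub>N\<^esub> h y = h (\<ominus>\<^bsub>M\<^esub> y \<oplus>\<^bsub>M\<^esub> y)"
    using mod_hom_add[OF assms(3), of "\<ominus>\<^bsub>M\<^esub> y" y] assms by simp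
  also have "\<dots> = \<zero>\<^bsub>N\<^esub>" using M.M.l_neg[OF assms(5)] mod_hom_zero[OF assms(1-3)] by simp
  finally have "h (\<ominus>\<^bsub>M\<^esub> y) = \<ominus>\<^bsub>N\<^esub> h y" using c by (metis N.M.minus_equality)
  thus ?thesis
    using mod_hom_add[OF assms(3), of x "\<ominus>\<^bsub>M\<^esub> y"] assms(4,5) by (simp add: a_minus_def)
qed

lemma mod_hom_compose:
  "f \<in> mod_hom R M N \<Longrightarrow> g \<in> mod_hom R N P \<Longrightarrow> (\<lambda>x. g (f x)) \<in> mod_hom R M P"
  by (auto simp: mod_hom_def Pi_iff)

lemma mod_hom_id: "(\<lambda>x. x) \<in> mod_hom R M M"
  by (rule mod_homI) auto

lemma mod_hom_add_hom:
  assumes "Module.module R N" "f \<in> mod_hom R M N" "g \<in> mod_hom R M N"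
  shows "(\<lambda>x. f x \<oplus>\<^bsub>N\<^esub> g x) \<in> mod_hom R M N"
proof -
  interpret N: Module.module R N by fact
  have c: "f x \<in> carrier N" "g x \<in> carrier N" if "x \<in> carrier M" for x
    using mod_hom_closed[OF assms(2) that] mod_hom_closed[OF assms(3) that] by auto
  show ?thesis
    by (rule mod_homI)
      (auto simp: c mod_hom_add[OF assms(2)] mod_hom_add[OF assms(3)] mod_hom_smult[OF assms(2)]
        mod_hom_smult[OF assms(3)] N.smult_r_distr N.M.a_ac)
qed

lemma mod_hom_scale:
  assumes "Module.module R N" "f \<in> mod_hom R M N" "r \<in> carrier R"
  shows "(\<lambda>x. r \<odot>\<^bsub>N\<^esub> f x) \<in> mod_hom R M N"
proof -
  interpret N: Module.module R N by fact
  have c: "f x \<in> carrier N" if "x \<in> carrier M" for x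
    using mod_hom_closed[OF assms(2) that] by auto
  show ?thesis
    by (rule mod_homI)
      (auto simp: c mod_hom_add[OF assms(2)] mod_hom_smult[OF assms(2)] assms(3)
        N.smult_r_distr N.smult_assoc1[symmetric] N.R.m_comm)
qed

lemma mod_hom_diff_hom:
  assumes "Module.module R M" "Module.module R N" "f \<in> mod_hom R M N" "g \<in> mod_hom R M N"
  shows "(\<lambda>x. f x \<ominus>\<^bsub>N\<^esub> g x) \<in> mod_hom R M N"
proof -
  interpret M: Module.module R M by fact
  interpret N: Module.module R N by fact
  have "(\<lambda>x. f x \<oplus>\<^bsub>N\<^esub> (\<ominus>\<^bsub>R\<^esub> \<one>\<^bsub>R\<^esub>) \<odot>\<^bsub>N\<^esub> g x) \<in> mod_hom R M N"
    by (intro mod_hom_add_hom mod_hom_scale assms) auto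
  moreover have "f x \<oplus>\<^bsub>N\<^esub> (\<ominus>\<^bsub>R\<^esub> \<one>\<^bsub>R\<^esub>) \<odot>\<^bsub>N\<^esub> g x = f x \<ominus>\<^bsub>N\<^esub> g x" if "x \<in> carrier M" for x
    using mod_hom_closed[OF assms(4) that] by (simp add: a_minus_def N.smult_l_minus)
  ultimately show ?thesis
    by (auto simp: mod_hom_def Pi_iff)
qed

lemma regular_module_simps [simp]:
  "carrier (regular_module R) = carrier R" "\<zero>\<^bsub>regular_module R\<^esub> = \<zero>\<^bsub>R\<^esub>"
  "x \<oplus>\<^bsub>regular_module R\<^esub> y = x \<oplus>\<^bsub>R\<^esub> y" "r \<odot>\<^bsub>regular_module R\<^esub> x = r \<otimes>\<^bsub>R\<^esub> x"
  by (auto simp: regular_module_def)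

lemma module_self:
  assumes "cring R" shows "Module.module R (regular_module R)"
proof -
  interpret cring R by fact
  have ag: "abelian_group (regular_module R)"
    by (rule abelian_groupI) (auto simp: regular_module_def a_ac intro: add.l_inv_ex)
  show ?thesis
    by (rule moduleI) (use ag in \<open>auto simp: assms regular_module_def l_distr r_distr m_assoc\<close>)
qed

section \<open>Submodules, images and preimages\<close>

lemma submodule_simps:
  assumes "Module.module R N" "submodule A R N"
  shows "\<And>x. x \<in> A \<Longrightarrow> x \<in> carrier N" "\<zero>\<^bsub>N\<^esub> \<in> A"
    "\<And>x y. x \<in> A \<Longrightarrow> y \<in> A \<Longrightarrow> x \<oplus>\<^bsub>N\<^esub> y \<in> A"
    "\<And>x y. x \<in> A \<Longrightarrow> y \<in> A \<Longrightarrow> x \<ominus>\<^bsub>N\<^esub> y \<in> A"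
    "\<And>x. x \<in> A \<Longrightarrow> \<ominus>\<^bsub>N\<^esub> x \<in> A"
    "\<And>r x. r \<in> carrier R \<Longrightarrow> x \<in> A \<Longrightarrow> r \<odot>\<^bsub>N\<^esub> x \<in> A"
proof -
  interpret N: Module.module R N by fact
  note E = N.submoduleE[OF assms(2)]
  show "\<zero>\<^bsub>N\<^esub> \<in> A"
    using submodule.axioms(1)[OF assms(2)] subgroup.one_closed by fastforce
  show "\<And>x. x \<in> A \<Longrightarrow> x \<in> carrier N"
    "\<And>x y. x \<in> A \<Longrightarrow> y \<in> A \<Longrightarrow> x \<oplus>\<^bsub>N\<^esub> y \<in> A"
    "\<And>x y. x \<in> A \<Longrightarrow> y \<in> A \<Longrightarrow> x \<ominus>\<^bsub>N\<^esub> y \<in> A"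
    "\<And>x. x \<in> A \<Longrightarrow> \<ominus>\<^bsub>N\<^esub> x \<in> A"
    "\<And>r x. r \<in> carrier R \<Longrightarrow> x \<in> A \<Longrightarrow> r \<odot>\<^bsub>N\<^esub> x \<in> A"
    using E by (auto simp: a_minus_def)
qed

lemma submodule_zero:
  assumes "Module.module R N" shows "submodule {\<zero>\<^bsub>N\<^esub>} R N"
proof -
  interpret N: Module.module R N by fact
  show ?thesis by (rule N.submoduleI) auto
qed

lemma submodule_image:
  assumes "Module.module R M" "Module.module R N" "h \<in> mod_hom R M N" "submodule A R M"
  shows "submodule (h ` A) R N"
proof -
  interpret M: Module.module R M by fact
  interpret N: Module.module R N by fact
  note s = submodule_simps[OF assms(1,4)]
  have m: "\<ominus>\<^bsub>N\<^esub> h a = h (\<ominus>\<^bsub>M\<^esub> a)" if "a \<in> A" for a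
    using mod_hom_minus[OF assms(1-3), of "\<zero>\<^bsub>M\<^esub>" a] s(1)[OF that] mod_hom_zero[OF assms(1-3)]
      mod_hom_closed[OF assms(3)] by (simp add: a_minus_def)
  show ?thesis
  proof (rule N.submoduleI)
    show "h ` A \<subseteq> carrier N" using s(1) mod_hom_closed[OF assms(3)] by blast
    show "\<zero>\<^bsub>N\<^esub> \<in> h ` A" using mod_hom_zero[OF assms(1-3)] s(2) by force
  next
    fix a assume "a \<in> h ` A" thus "\<ominus>\<^bsub>N\<^esub> a \<in> h ` A" using m s(5) by force
  next
    fix a b assume "a \<in> h ` A" "b \<in> h ` A"
    then obtain x y where xy: "x \<in> A" "y \<in> A" "a = h x" "b = h y" by blast
    have "a \<oplus>\<^bsub>N\<^esub> b = h (x \<oplus>\<^bsub>M\<^esub> y)" using xy mod_hom_add[OF assms(3)] s(1) by auto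
    thus "a \<oplus>\<^bsub>N\<^esub> b \<in> h ` A" using xy s(3) by blast
  next
    fix r a assume r: "r \<in> carrier R" "a \<in> h ` A"
    then obtain x where x: "x \<in> A" "a = h x" by blast
    have "r \<odot>\<^bsub>N\<^esub> a = h (r \<odot>\<^bsub>M\<^esub> x)" using x r mod_hom_smult[OF assms(3)] s(1) by auto
    thus "r \<odot>\<^bsub>N\<^esub> a \<in> h ` A" using x r s(6) by blast
  qed
qed

lemma submodule_vimage:
  assumes "Module.module R M" "Module.module R N" "h \<in> mod_hom R M N" "submodule B R N"
  shows "submodule {x \<in> carrier M. h x \<in> B} R M"
proof -
  interpret M: Module.module R M by fact
  interpret N: Module.module R N by fact
  note s = submodule_simps[OF assms(2,4)]
  have m: "h (\<ominus>\<^bsub>M\<^esub> a) = \<ominus>\<^bsub>N\<^esub> h a" if "a \<in> carrier M" for a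
    using mod_hom_minus[OF assms(1-3), of "\<zero>\<^bsub>M\<^esub>" a] that mod_hom_zero[OF assms(1-3)]
      mod_hom_closed[OF assms(3)] by (simp add: a_minus_def)
  show ?thesis
    by (rule M.submoduleI)
      (auto simp: m s mod_hom_zero[OF assms(1-3)] mod_hom_add[OF assms(3)] mod_hom_smult[OF assms(3)])
qed

lemma submodule_Int:
  assumes "Module.module R M" "submodule A R M" "submodule B R M"
  shows "submodule (A \<inter> B) R M"
proof -
  interpret M: Module.module R M by fact
  show ?thesis
    by (rule M.submoduleI)
      (auto simp: submodule_simps[OF assms(1,2)] submodule_simps[OF assms(1,3)])
qed

context
  fixes R :: "'a ring" and N :: "('a, 'b) module" and A :: "'b set"
  assumes N: "Module.module R N" and A: "submodule A R N"
begin

text \<open>The inverse in a restricted record is the one found inside the smaller carrier; its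
  agreement with the ambient inverse rests on uniqueness of inverses.\<close>

lemma restrict_a_inv:
  assumes "y \<in> A" shows "\<ominus>\<^bsub>N\<lparr>carrier := A\<rparr>\<^esub> y = \<ominus>\<^bsub>N\<^esub> y"
proof -
  interpret N: Module.module R N by (rule N)
  interpret N': Module.module R "N\<lparr>carrier := A\<rparr>" by (rule submodule.submodule_is_module[OF A N])
  show ?thesis
    using N'.M.l_neg[of y] N'.M.a_inv_closed[of y] assms submodule_simps(1)[OF N A]
    by (intro N.M.minus_equality[symmetric]) auto
qed

lemma restrict_minus:
  assumes "y \<in> A" shows "x \<ominus>\<^bsub>N\<lparr>carrier := A\<rparr>\<^esub> y = x \<ominus>\<^bsub>N\<^esub> y"
  using restrict_a_inv[OF assms] by (simp add: a_minus_def)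

lemma submodule_restrict:
  assumes B: "submodule B R N" and "B \<subseteq> A" shows "submodule B R (N\<lparr>carrier := A\<rparr>)"
proof -
  interpret N': Module.module R "N\<lparr>carrier := A\<rparr>" by (rule submodule.submodule_is_module[OF A N])
  show ?thesis
    by (rule N'.submoduleI) (use submodule_simps[OF N B] assms(2) restrict_a_inv in auto)
qed

end

section \<open>Direct sums of copies of a module\<close>

text \<open>The allowed values \<open>A\<close> are kept apart from the module \<open>N\<close> that
  supplies the zero: for a submodule \<open>A\<close> this describes the families with coordinates
  in \<open>A\<close> inside the direct sum of copies of \<open>N\<close>, with no change of
  module.\<close>

definition fin_supp :: "'x set \<Rightarrow> ('a, 'b) module \<Rightarrow> 'b set \<Rightarrow> ('x \<Rightarrow> 'b) set" where
  "fin_supp T N A = {\<phi>. (\<forall>x. \<phi> x \<in> A) \<and> finite {x. \<phi> x \<noteq> \<zero>\<^bsub>N\<^esub>} \<and> {x. \<phi> x \<noteq> \<zero>\<^bsub>N\<^esub>} \<subseteq> T}"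

definition copower :: "'x set \<Rightarrow> ('a, 'b) module \<Rightarrow> ('a, 'x \<Rightarrow> 'b) module" where
  "copower T N =
     \<lparr>carrier = fin_supp T N (carrier N), monoid.mult = undefined, one = undefined,
      ring.zero = (\<lambda>_. \<zero>\<^bsub>N\<^esub>), ring.add = (\<lambda>\<phi> \<psi> x. \<phi> x \<oplus>\<^bsub>N\<^esub> \<psi> x),
      smult = (\<lambda>r \<phi> x. r \<odot>\<^bsub>N\<^esub> \<phi> x)\<rparr>"

definition single :: "('a, 'b) module \<Rightarrow> 'x \<Rightarrow> 'b \<Rightarrow> 'x \<Rightarrow> 'b" where
  "single N b a = (\<lambda>x. if x = b then a else \<zero>\<^bsub>N\<^esub>)"

lemma copower_simps [simp]:
  "carrier (copower T N) = fin_supp T N (carrier N)"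
  "\<zero>\<^bsub>copower T N\<^esub> = (\<lambda>_. \<zero>\<^bsub>N\<^esub>)" "\<phi> \<oplus>\<^bsub>copower T N\<^esub> \<psi> = (\<lambda>x. \<phi> x \<oplus>\<^bsub>N\<^esub> \<psi> x)"
  "r \<odot>\<^bsub>copower T N\<^esub> \<phi> = (\<lambda>x. r \<odot>\<^bsub>N\<^esub> \<phi> x)"
  by (auto simp: copower_def)

lemma free_module_on_copower: "free_module_on R T = copower T (regular_module R)"
  by (auto simp: free_module_on_def copower_def fin_supp_def regular_module_def Pi_def)

lemma fin_supp_add:
  assumes "Module.module R N" "submodule A R N" "\<phi> \<in> fin_supp T N A" "\<psi> \<in> fin_supp T N A"
  shows "(\<lambda>x. \<phi> x \<oplus>\<^bsub>N\<^esub> \<psi> x) \<in> fin_supp T N A"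
proof -
  interpret N: Module.module R N by fact
  have "{x. \<phi> x \<oplus>\<^bsub>N\<^esub> \<psi> x \<noteq> \<zero>\<^bsub>N\<^esub>} \<subseteq> {x. \<phi> x \<noteq> \<zero>\<^bsub>N\<^esub>} \<union> {x. \<psi> x \<noteq> \<zero>\<^bsub>N\<^esub>}" by auto
  thus ?thesis
    using assms(3,4) submodule_simps[OF assms(1,2)]
    unfolding fin_supp_def by (auto intro: finite_subset)
qed

lemma fin_supp_map:
  assumes "\<phi> \<in> fin_supp T N A" "\<And>a. a \<in> A \<Longrightarrow> h a \<in> A'" "h \<zero>\<^bsub>N\<^esub> = \<zero>\<^bsub>N'\<^esub>"
  shows "(\<lambda>x. h (\<phi> x)) \<in> fin_supp T N' A'"
proof -
  have "{x. h (\<phi> x) \<noteq> \<zero>\<^bsub>N'\<^esub>} \<subseteq> {x. \<phi> x \<noteq> \<zero>\<^bsub>N\<^esub>}" using assms(3) by auto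
  thus ?thesis using assms by (auto simp: fin_supp_def intro: finite_subset)
qed

lemma fin_supp_smult:
  assumes "Module.module R N" "submodule A R N" "\<phi> \<in> fin_supp T N A" "r \<in> carrier R"
  shows "(\<lambda>x. r \<odot>\<^bsub>N\<^esub> \<phi> x) \<in> fin_supp T N A"
proof -
  interpret N: Module.module R N by fact
  show ?thesis by (rule fin_supp_map[OF assms(3)]) (use submodule_simps[OF assms(1,2)] assms(4) in auto)
qed

lemma fin_supp_minus:
  assumes "Module.module R N" "submodule A R N" "\<phi> \<in> fin_supp T N A" "\<psi> \<in> fin_supp T N A"
  shows "(\<lambda>x. \<phi> x \<ominus>\<^bsub>N\<^esub> \<psi> x) \<in> fin_supp T N A"
proof -
  interpret N: Module.module R N by fact
  have "(\<lambda>x. \<ominus>\<^bsub>N\<^esub> \<psi> x) \<in> fin_supp T N A"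
    by (rule fin_supp_map[OF assms(4)]) (use submodule_simps[OF assms(1,2)] in auto)
  from fin_supp_add[OF assms(1-3) this] show ?thesis by (simp add: a_minus_def)
qed

lemma fin_supp_mono: "\<phi> \<in> fin_supp T N A \<Longrightarrow> A \<subseteq> B \<Longrightarrow> \<phi> \<in> fin_supp T N B"
  by (auto simp: fin_supp_def)

lemma fin_supp_single: "a \<in> A \<Longrightarrow> \<zero>\<^bsub>N\<^esub> \<in> A \<Longrightarrow> b \<in> T \<Longrightarrow> single N b a \<in> fin_supp T N A"
  by (auto simp: fin_supp_def single_def)

lemma fin_supp_zero: "\<zero>\<^bsub>N\<^esub> \<in> A \<Longrightarrow> (\<lambda>_. \<zero>\<^bsub>N\<^esub>) \<in> fin_supp T N A"
  by (auto simp: fin_supp_def)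

lemma module_copower:
  assumes "Module.module R N" shows "Module.module R (copower T N)"
proof -
  interpret N: Module.module R N by fact
  note c = N.carrier_is_submodule
  have s: "\<phi> x \<in> carrier N" if "\<phi> \<in> fin_supp T N (carrier N)" for \<phi> x
    using that by (auto simp: fin_supp_def)
  have ag: "abelian_group (copower T N)"
  proof (rule abelian_groupI)
    fix \<phi> assume p: "\<phi> \<in> carrier (copower T N)"
    have "(\<lambda>x. \<ominus>\<^bsub>N\<^esub> \<phi> x) \<in> fin_supp T N (carrier N)"
      by (rule fin_supp_map[where N=N and A="carrier N"]) (use p in auto)
    thus "\<exists>\<psi>\<in>carrier (copower T N). \<psi> \<oplus>\<^bsub>copower T N\<^esub> \<phi> = \<zero>\<^bsub>copower T N\<^esub>"
      using p by (intro bexI[of _ "\<lambda>x. \<ominus>\<^bsub>N\<^esub> \<phi> x"]) (auto simp: s N.M.l_neg)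
  qed (use s in \<open>auto simp: N.M.a_ac intro!: fin_supp_add[OF assms c] fin_supp_zero\<close>)
  show ?thesis
    by (rule moduleI)
      (use s in \<open>auto simp: ag N.R.is_cring N.smult_l_distr N.smult_r_distr N.smult_assoc1
        intro!: fin_supp_smult[OF assms c]\<close>)
qed

lemma fin_supp_induct [consumes 3, case_names zero single add]:
  assumes "Module.module R N" "submodule A R N" "\<phi> \<in> fin_supp T N A"
    and zero: "P (\<lambda>_. \<zero>\<^bsub>N\<^esub>)"
    and single: "\<And>b a. b \<in> T \<Longrightarrow> a \<in> A \<Longrightarrow> P (single N b a)"
    and add: "\<And>\<phi> \<psi>. \<phi> \<in> fin_supp T N A \<Longrightarrow> \<psi> \<in> fin_supp T N A \<Longrightarrow> P \<phi> \<Longrightarrow> P \<psi> \<Longrightarrow>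
      P (\<lambda>x. \<phi> x \<oplus>\<^bsub>N\<^esub> \<psi> x)"
  shows "P \<phi>"
proof -
  interpret N: Module.module R N by fact
  note s = submodule_simps[OF assms(1,2)]
  have "finite S \<Longrightarrow> \<phi> \<in> fin_supp T N A \<Longrightarrow> {x. \<phi> x \<noteq> \<zero>\<^bsub>N\<^esub>} \<subseteq> S \<Longrightarrow> S \<subseteq> T \<Longrightarrow> P \<phi>" for S \<phi>
  proof (induction S arbitrary: \<phi> rule: finite_induct)
    case empty
    hence "\<phi> = (\<lambda>_. \<zero>\<^bsub>N\<^esub>)" by auto
    thus ?case using zero by simp
  next
    case (insert b S)
    have A: "\<phi> x \<in> A" for x using insert.prems(1) by (auto simp: fin_supp_def)
    define \<psi> where "\<psi> = \<phi>(b := \<zero>\<^bsub>N\<^esub>)"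
    have ps: "\<psi> \<in> fin_supp T N A"
      using insert.prems(1) s(2) by (auto simp: fin_supp_def \<psi>_def elim!: rev_finite_subset)
    have "P \<psi>" using insert.prems by (intro insert.IH ps) (auto simp: \<psi>_def)
    moreover have "\<phi> = (\<lambda>x. single N b (\<phi> b) x \<oplus>\<^bsub>N\<^esub> \<psi> x)"
      using s(1)[OF A] by (auto simp: single_def \<psi>_def)
    ultimately show ?case
      using add[OF fin_supp_single ps] single insert.prems(3) A s(2) by (metis insert_subset)
  qed
  thus ?thesis using assms(3) by (auto simp: fin_supp_def)
qed

text \<open>The map that the universal property of the direct sum assigns to the components
  \<open>g b\<close>.\<close>

definition copower_ext :: "('a, 'b) module \<Rightarrow> ('a, 'c) module \<Rightarrow> ('x \<Rightarrow> 'b \<Rightarrow> 'c) \<Rightarrow> ('x \<Rightarrow> 'b) \<Rightarrow> 'c" where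
  "copower_ext N Q g \<phi> = finsum Q (\<lambda>b. g b (\<phi> b)) {x. \<phi> x \<noteq> \<zero>\<^bsub>N\<^esub>}"

context
  fixes R :: "'a ring" and N :: "('a, 'b) module" and Q :: "('a, 'c) module" and T :: "'x set"
    and g :: "'x \<Rightarrow> 'b \<Rightarrow> 'c"
  assumes N: "Module.module R N" and Q: "Module.module R Q"
    and g: "\<And>b. b \<in> T \<Longrightarrow> g b \<in> mod_hom R N Q"
begin

lemma copower_ext_superset:
  assumes "\<phi> \<in> fin_supp T N (carrier N)" "finite S" "{x. \<phi> x \<noteq> \<zero>\<^bsub>N\<^esub>} \<subseteq> S" "S \<subseteq> T"
  shows "copower_ext N Q g \<phi> = finsum Q (\<lambda>b. g b (\<phi> b)) S"
proof -
  interpret Q: Module.module R Q by (rule Q)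
  have "\<phi> b \<in> carrier N" for b using assms(1) by (auto simp: fin_supp_def)
  hence "g b (\<phi> b) \<in> carrier Q" if "b \<in> S" for b
    using mod_hom_closed[OF g] that assms(4) by blast
  moreover have "g b (\<phi> b) = \<zero>\<^bsub>Q\<^esub>" if "b \<in> S - {x. \<phi> x \<noteq> \<zero>\<^bsub>N\<^esub>}" for b
    using mod_hom_zero[OF N Q g] that assms(4) by auto
  ultimately show ?thesis unfolding copower_ext_def
    using assms by (intro Q.M.add.finprod_mono_neutral_cong_left) auto
qed

lemma copower_ext_hom: "copower_ext N Q g \<in> mod_hom R (copower T N) Q"
proof (rule mod_homI)
  interpret N: Module.module R N by (rule N)
  interpret Q: Module.module R Q by (rule Q)
  note c = N.carrier_is_submodule
  have cN: "\<phi> b \<in> carrier N" if "\<phi> \<in> fin_supp T N (carrier N)" for \<phi> b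
    using that by (auto simp: fin_supp_def)
  have cQ: "g b (\<phi> b) \<in> carrier Q" if "\<phi> \<in> fin_supp T N (carrier N)" "b \<in> T" for \<phi> b
    using mod_hom_closed[OF g[OF that(2)]] cN that by blast
  show "copower_ext N Q g \<phi> \<in> carrier Q" if "\<phi> \<in> carrier (copower T N)" for \<phi>
    unfolding copower_ext_def using that cQ by (intro Q.M.finsum_closed) (auto simp: fin_supp_def)
  fix \<phi> assume "\<phi> \<in> carrier (copower T N)"
  hence p: "\<phi> \<in> fin_supp T N (carrier N)" by simp
  let ?S = "{x. \<phi> x \<noteq> \<zero>\<^bsub>N\<^esub>}"
  have S: "finite ?S" "?S \<subseteq> T" using p by (auto simp: fin_supp_def)
  {
    fix \<psi> assume "\<psi> \<in> carrier (copower T N)"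
    hence q: "\<psi> \<in> fin_supp T N (carrier N)" by simp
    let ?S' = "?S \<union> {x. \<psi> x \<noteq> \<zero>\<^bsub>N\<^esub>}"
    have S': "finite ?S'" "?S' \<subseteq> T" using p q by (auto simp: fin_supp_def)
    have "copower_ext N Q g (\<lambda>x. \<phi> x \<oplus>\<^bsub>N\<^esub> \<psi> x) = finsum Q (\<lambda>b. g b (\<phi> b \<oplus>\<^bsub>N\<^esub> \<psi> b)) ?S'"
      using S' by (intro copower_ext_superset fin_supp_add[OF N c] p q) auto
    also have "\<dots> = finsum Q (\<lambda>b. g b (\<phi> b) \<oplus>\<^bsub>Q\<^esub> g b (\<psi> b)) ?S'"
      using S' cQ[OF p] cQ[OF q] mod_hom_add[OF g cN[OF p] cN[OF q]]
      by (intro Q.M.finsum_cong') auto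
    also have "\<dots> = finsum Q (\<lambda>b. g b (\<phi> b)) ?S' \<oplus>\<^bsub>Q\<^esub> finsum Q (\<lambda>b. g b (\<psi> b)) ?S'"
      using S' cQ[OF p] cQ[OF q] by (intro Q.M.finsum_addf) blast+
    also have "\<dots> = copower_ext N Q g \<phi> \<oplus>\<^bsub>Q\<^esub> copower_ext N Q g \<psi>"
      using S' by (subst (1 2) copower_ext_superset[where S="?S'"]) (auto simp: p q)
    finally show "copower_ext N Q g (\<phi> \<oplus>\<^bsub>copower T N\<^esub> \<psi>) = copower_ext N Q g \<phi> \<oplus>\<^bsub>Q\<^esub> copower_ext N Q g \<psi>"
      by simp
  }
  fix r assume r: "r \<in> carrier R"
  have "copower_ext N Q g (\<lambda>x. r \<odot>\<^bsub>N\<^esub> \<phi> x) = finsum Q (\<lambda>b. g b (r \<odot>\<^bsub>N\<^esub> \<phi> b)) ?S"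
    using S r by (intro copower_ext_superset fin_supp_smult[OF N c] p) auto
  also have "\<dots> = finsum Q (\<lambda>b. r \<odot>\<^bsub>Q\<^esub> g b (\<phi> b)) ?S"
    using S cQ[OF p] r mod_hom_smult[OF g r cN[OF p]] by (intro Q.M.finsum_cong') auto
  also have "\<dots> = r \<odot>\<^bsub>Q\<^esub> copower_ext N Q g \<phi>"
    unfolding copower_ext_def using S cQ[OF p] by (intro Q.finsum_smult_ldistr[symmetric] r) auto
  finally show "copower_ext N Q g (r \<odot>\<^bsub>copower T N\<^esub> \<phi>) = r \<odot>\<^bsub>Q\<^esub> copower_ext N Q g \<phi>" by simp
qed

lemma copower_ext_single:
  assumes "b \<in> T" "a \<in> carrier N"
  shows "copower_ext N Q g (single N b a) = g b a"
proof -
  interpret N: Module.module R N by (rule N)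
  interpret Q: Module.module R Q by (rule Q)
  have "copower_ext N Q g (single N b a) = finsum Q (\<lambda>x. g x (single N b a x)) {b}"
    using assms by (intro copower_ext_superset fin_supp_single) (auto simp: single_def)
  also have "\<dots> = g b a"
    using mod_hom_closed[OF g[OF assms(1)] assms(2)] by (simp add: single_def)
  finally show ?thesis .
qed

end

lemma copower_hom_eqI:
  assumes "Module.module R N" "Module.module R Q" "f \<in> mod_hom R (copower T N) Q" "g \<in> mod_hom R (copower T N) Q"
    and "\<And>b a. b \<in> T \<Longrightarrow> a \<in> carrier N \<Longrightarrow> f (single N b a) = g (single N b a)"
    and "\<phi> \<in> fin_supp T N (carrier N)"
  shows "f \<phi> = g \<phi>"
proof -
  interpret N: Module.module R N by fact
  note z = mod_hom_zero[OF module_copower[OF assms(1)] assms(2)]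
  show ?thesis using assms(1) N.carrier_is_submodule assms(6)
  proof (induction rule: fin_supp_induct)
    case zero show ?case using z[OF assms(3)] z[OF assms(4)] by simp
  next
    case (single b a) thus ?case using assms(5) by simp
  next
    case (add \<phi> \<psi>)
    thus ?case using mod_hom_add[OF assms(3), of \<phi> \<psi>] mod_hom_add[OF assms(4), of \<phi> \<psi>] by simp
  qed
qed

section \<open>Free modules, and maps between them tensored with a module\<close>

lemma free_carrier: "carrier (free_module_on R T) = fin_supp T (regular_module R) (carrier R)"
  by (simp add: free_module_on_copower)

lemma free_simps [simp]:
  "\<zero>\<^bsub>free_module_on R T\<^esub> = (\<lambda>_. \<zero>\<^bsub>R\<^esub>)" "\<phi> \<oplus>\<^bsub>free_module_on R T\<^esub> \<psi> = (\<lambda>x. \<phi> x \<oplus>\<^bsub>R\<^esub> \<psi> x)"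
  "r \<odot>\<^bsub>free_module_on R T\<^esub> \<phi> = (\<lambda>x. r \<otimes>\<^bsub>R\<^esub> \<phi> x)"
  by (auto simp: free_module_on_def)

lemma module_free: "cring R \<Longrightarrow> Module.module R (free_module_on R T)"
  by (simp add: free_module_on_copower module_copower module_self)

lemma free_carrierD:
  assumes "u \<in> carrier (free_module_on R T)"
  shows "\<And>x. u x \<in> carrier R" "finite {x. u x \<noteq> \<zero>\<^bsub>R\<^esub>}" "{x. u x \<noteq> \<zero>\<^bsub>R\<^esub>} \<subseteq> T"
  using assms by (auto simp: free_module_on_def)

lemma free_gen_closed: "cring R \<Longrightarrow> b \<in> T \<Longrightarrow> free_gen R b \<in> carrier (free_module_on R T)"
  by (auto simp: free_module_on_def free_gen_def cring.cring_simprules)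

lemma free_gen_single: "free_gen R b = single (regular_module R) b \<one>\<^bsub>R\<^esub>"
  by (auto simp: free_gen_def single_def)

lemma free_hom_eqI:
  assumes "cring R" "Module.module R Q" "f \<in> mod_hom R (free_module_on R T) Q"
    "g \<in> mod_hom R (free_module_on R T) Q"
    and "\<And>b. b \<in> T \<Longrightarrow> f (free_gen R b) = g (free_gen R b)"
    and u: "u \<in> carrier (free_module_on R T)"
  shows "f u = g u"
proof -
  interpret cring R by fact
  have eq: "single (regular_module R) b a = a \<odot>\<^bsub>free_module_on R T\<^esub> free_gen R b" if "a \<in> carrier R" for a b
    using that by (auto simp: single_def regular_module_def free_gen_def)
  show ?thesis
  proof (rule copower_hom_eqI[where N="regular_module R" and T=T and Q=Q and R=R])
    fix b a assume b: "b \<in> T" and "a \<in> carrier (regular_module R)"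
    hence a: "a \<in> carrier R" by (simp add: regular_module_def)
    show "f (single (regular_module R) b a) = g (single (regular_module R) b a)"
      unfolding eq[OF a]
      using mod_hom_smult[OF assms(3) a] mod_hom_smult[OF assms(4) a] assms(5)[OF b] free_gen_closed[OF assms(1) b]
      by presburger
  qed (use assms in \<open>auto simp: module_self free_module_on_copower\<close>)
qed

text \<open>The pure tensor of \<open>u\<close> and \<open>n\<close>, once a free module tensored
  with \<open>N\<close> is identified with a direct sum of copies of \<open>N\<close>.\<close>

definition tens :: "('a, 'b) module \<Rightarrow> ('x \<Rightarrow> 'a) \<Rightarrow> 'b \<Rightarrow> 'x \<Rightarrow> 'b" where
  "tens N u n = (\<lambda>b. u b \<odot>\<^bsub>N\<^esub> n)"

text \<open>With \<open>F \<otimes> N\<close> modelled by \<open>copower T N\<close> for \<open>F\<close> free on \<open>T\<close>, this is \<open>f \<otimes> N\<close>.\<close>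

definition base_change ::
    "'a ring \<Rightarrow> ('a, 'b) module \<Rightarrow> (('x \<Rightarrow> 'a) \<Rightarrow> ('y \<Rightarrow> 'a)) \<Rightarrow> ('x \<Rightarrow> 'b) \<Rightarrow> ('y \<Rightarrow> 'b)" where
  "base_change R N f = copower_ext N (copower UNIV N) (\<lambda>b n. tens N (f (free_gen R b)) n)"

lemma tens_fin_supp:
  assumes "Module.module R N" "submodule A R N" "u \<in> carrier (free_module_on R T)" "n \<in> A"
  shows "tens N u n \<in> fin_supp T N A"
proof -
  interpret N: Module.module R N by fact
  note u = free_carrierD[OF assms(3)]
  have "{x. tens N u n x \<noteq> \<zero>\<^bsub>N\<^esub>} \<subseteq> {x. u x \<noteq> \<zero>\<^bsub>R\<^esub>}"
    using submodule_simps(1)[OF assms(1,2,4)] by (auto simp: tens_def)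
  thus ?thesis using u submodule_simps(6)[OF assms(1,2) _ assms(4)]
    by (auto simp: fin_supp_def tens_def intro: finite_subset)
qed

lemma tens_hom_left:
  assumes "Module.module R N" "n \<in> carrier N"
  shows "(\<lambda>u. tens N u n) \<in> mod_hom R (free_module_on R T) (copower T N)"
proof -
  interpret N: Module.module R N by fact
  show ?thesis
  proof (rule mod_homI)
    fix u assume u: "u \<in> carrier (free_module_on R T)"
    show "tens N u n \<in> carrier (copower T N)"
      using tens_fin_supp[OF assms(1) N.carrier_is_submodule u assms(2)] by simp
    show "tens N (u \<oplus>\<^bsub>free_module_on R T\<^esub> v) n = tens N u n \<oplus>\<^bsub>copower T N\<^esub> tens N v n"
      if v: "v \<in> carrier (free_module_on R T)" for v
      using free_carrierD(1)[OF u] free_carrierD(1)[OF v] assms(2) by (simp add: tens_def N.smult_l_distr)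
    show "tens N (r \<odot>\<^bsub>free_module_on R T\<^esub> u) n = r \<odot>\<^bsub>copower T N\<^esub> tens N u n" if "r \<in> carrier R" for r
      using free_carrierD(1)[OF u] assms(2) that by (simp add: tens_def N.smult_assoc1)
  qed
qed

lemma tens_hom_right:
  assumes "Module.module R N" "u \<in> carrier (free_module_on R T)"
  shows "tens N u \<in> mod_hom R N (copower T N)"
proof -
  interpret N: Module.module R N by fact
  note u = free_carrierD(1)[OF assms(2)]
  show ?thesis
  proof (rule mod_homI)
    fix n assume n: "n \<in> carrier N"
    show "tens N u n \<in> carrier (copower T N)"
      using tens_fin_supp[OF assms(1) N.carrier_is_submodule assms(2) n] by simp
    show "tens N u (n \<oplus>\<^bsub>N\<^esub> m) = tens N u n \<oplus>\<^bsub>copower T N\<^esub> tens N u m" if "m \<in> carrier N" for m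
      using u n that by (simp add: tens_def N.smult_r_distr)
    show "tens N u (r \<odot>\<^bsub>N\<^esub> n) = r \<odot>\<^bsub>copower T N\<^esub> tens N u n" if "r \<in> carrier R" for r
      using u n that by (simp add: tens_def N.smult_assoc1[symmetric] N.R.m_comm)
  qed
qed

lemma tens_free_gen:
  assumes "Module.module R N" "n \<in> carrier N"
  shows "tens N (free_gen R b) n = single N b n"
proof -
  interpret N: Module.module R N by fact
  show ?thesis using assms(2) by (auto simp: tens_def free_gen_def single_def)
qed

text \<open>\<open>base_change\<close> does not know the basis of its target and takes values over
  the index set \<open>UNIV\<close>; maps into the copower over the actual basis are regarded as
  maps into this larger one.\<close>

lemma copower_UNIV_hom:
  "h \<in> mod_hom R M (copower T N) \<Longrightarrow> h \<in> mod_hom R M (copower UNIV N)"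
  by (auto simp: mod_hom_def Pi_iff fin_supp_def)

context
  fixes R :: "'a ring" and N :: "('a, 'b) module" and T :: "'x set" and T' :: "'y set"
    and f :: "('x \<Rightarrow> 'a) \<Rightarrow> 'y \<Rightarrow> 'a"
  assumes N: "Module.module R N"
    and f: "f \<in> mod_hom R (free_module_on R T) (free_module_on R T')"
begin

lemma base_change_gen:
  assumes "b \<in> T" shows "tens N (f (free_gen R b)) \<in> mod_hom R N (copower T' N)"
proof -
  interpret N: Module.module R N by (rule N)
  show ?thesis
    by (rule tens_hom_right[OF N mod_hom_closed[OF f]])
      (use assms in \<open>simp add: free_gen_closed N.R.is_cring\<close>)
qed

lemma base_change_single:
  assumes "b \<in> T" "n \<in> carrier N"
  shows "base_change R N f (single N b n) = tens N (f (free_gen R b)) n"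
  unfolding base_change_def
  by (rule copower_ext_single[OF N module_copower[OF N] copower_UNIV_hom, where T=T, OF base_change_gen assms])

lemma base_change_hom_UNIV: "base_change R N f \<in> mod_hom R (copower T N) (copower UNIV N)"
  unfolding base_change_def
  by (rule copower_ext_hom[OF N module_copower[OF N] copower_UNIV_hom[OF base_change_gen]])

lemma base_change_fin_supp:
  assumes "submodule A R N" "\<phi> \<in> fin_supp T N A"
  shows "base_change R N f \<phi> \<in> fin_supp T' N A"
  using N assms
proof (induction rule: fin_supp_induct)
  case zero
  show ?case
    using mod_hom_zero[OF module_copower[OF N] module_copower[OF N] base_change_hom_UNIV]
      submodule_simps(2)[OF N assms(1)] by (simp add: fin_supp_zero)
next
  case (single b a)
  interpret N: Module.module R N by (rule N)
  show ?case
    unfolding base_change_single[OF single(1) submodule_simps(1)[OF N assms(1) single(2)]]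
    by (rule tens_fin_supp[OF N assms(1) mod_hom_closed[OF f] single(2)])
      (use single in \<open>simp add: free_gen_closed N.R.is_cring\<close>)
next
  case (add \<phi> \<psi>)
  have s: "A \<subseteq> carrier N" using submodule_simps(1)[OF N assms(1)] by blast
  have "base_change R N f (\<lambda>x. \<phi> x \<oplus>\<^bsub>N\<^esub> \<psi> x) = (\<lambda>x. base_change R N f \<phi> x \<oplus>\<^bsub>N\<^esub> base_change R N f \<psi> x)"
    using mod_hom_add[OF base_change_hom_UNIV, of \<phi> \<psi>] fin_supp_mono[OF add(1) s] fin_supp_mono[OF add(2) s]
    by simp
  thus ?case using fin_supp_add[OF N assms(1) add(3,4)] by simp
qed

lemma base_change_hom: "base_change R N f \<in> mod_hom R (copower T N) (copower T' N)"
proof -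
  interpret N: Module.module R N by (rule N)
  show ?thesis
    using base_change_hom_UNIV base_change_fin_supp[OF N.carrier_is_submodule]
    by (auto simp: mod_hom_def Pi_iff)
qed

lemma base_change_tens:
  assumes "u \<in> carrier (free_module_on R T)" "n \<in> carrier N"
  shows "base_change R N f (tens N u n) = tens N (f u) n"
proof -
  interpret N: Module.module R N by (rule N)
  show ?thesis
  proof (rule free_hom_eqI[OF N.R.is_cring module_copower[OF N, of T'] _ _ _ assms(1)])
    show "(\<lambda>u. base_change R N f (tens N u n)) \<in> mod_hom R (free_module_on R T) (copower T' N)"
      by (rule mod_hom_compose[OF tens_hom_left[OF N assms(2)] base_change_hom])
    show "(\<lambda>u. tens N (f u) n) \<in> mod_hom R (free_module_on R T) (copower T' N)"
      by (rule mod_hom_compose[OF f tens_hom_left[OF N assms(2)]])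
    show "base_change R N f (tens N (free_gen R b) n) = tens N (f (free_gen R b)) n" if "b \<in> T" for b
      by (simp add: tens_free_gen[OF N assms(2)] base_change_single[OF that assms(2)])
  qed
qed

text \<open>Functoriality in the coefficient module. It is what lets exactness be compared along
  inclusions of coefficients and along maps that are isomorphisms of subquotients.\<close>

lemma base_change_natural:
  assumes N': "Module.module R N'" and h: "h \<in> mod_hom R N N'" and p: "\<phi> \<in> fin_supp T N (carrier N)"
  shows "base_change R N' f (\<lambda>x. h (\<phi> x)) = (\<lambda>x. h (base_change R N f \<phi> x))"
  using N module.carrier_is_submodule[OF N] p
proof (induction rule: fin_supp_induct)
  interpret N: Module.module R N by (rule N)
  have z: "h \<zero>\<^bsub>N\<^esub> = \<zero>\<^bsub>N'\<^esub>" by (rule mod_hom_zero[OF N N' h])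
  have hom': "base_change R N' f \<in> mod_hom R (copower T N') (copower UNIV N')"
    unfolding base_change_def
    by (rule copower_ext_hom[OF N' module_copower[OF N']], rule copower_UNIV_hom,
        rule tens_hom_right[OF N' mod_hom_closed[OF f]])
      (simp add: free_gen_closed N.R.is_cring)
  {
    case zero
    show ?case
      using mod_hom_zero[OF module_copower[OF N] module_copower[OF N] base_change_hom_UNIV]
        mod_hom_zero[OF module_copower[OF N'] module_copower[OF N'] hom'] by (simp add: z)
  next
    case (single b a)
    have g: "f (free_gen R b) \<in> carrier (free_module_on R T')"
      by (rule mod_hom_closed[OF f]) (use single in \<open>simp add: free_gen_closed N.R.is_cring\<close>)
    have "(\<lambda>x. h (single N b a x)) = single N' b (h a)" by (auto simp: single_def z)
    moreover have "base_change R N' f (single N' b (h a)) = tens N' (f (free_gen R b)) (h a)"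
      unfolding base_change_def
      by (rule copower_ext_single[OF N' module_copower[OF N'], where T=T], rule copower_UNIV_hom,
          rule tens_hom_right[OF N' mod_hom_closed[OF f]])
        (use single mod_hom_closed[OF h] in \<open>auto simp: free_gen_closed N.R.is_cring\<close>)
    ultimately show ?case
      using mod_hom_smult[OF h _ single(2)] free_carrierD(1)[OF g] single
      by (simp add: base_change_single tens_def)
  next
    case (add \<phi> \<psi>)
    have c: "(\<lambda>x. h (\<phi> x)) \<in> fin_supp T N' (carrier N')" if "\<phi> \<in> fin_supp T N (carrier N)" for \<phi>
      by (rule fin_supp_map[OF that mod_hom_closed[OF h]]) (auto simp: z)
    have v: "\<phi> x \<in> carrier N" if "\<phi> \<in> fin_supp S N (carrier N)" for \<phi> :: "'z \<Rightarrow> 'b" and x S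
      using that by (auto simp: fin_supp_def)
    have 1: "(\<lambda>x. h (\<phi> x \<oplus>\<^bsub>N\<^esub> \<psi> x)) = (\<lambda>x. h (\<phi> x) \<oplus>\<^bsub>N'\<^esub> h (\<psi> x))"
      using v[OF add(1)] v[OF add(2)] mod_hom_add[OF h] by auto
    have 2: "base_change R N f (\<lambda>x. \<phi> x \<oplus>\<^bsub>N\<^esub> \<psi> x) =
        (\<lambda>x. base_change R N f \<phi> x \<oplus>\<^bsub>N\<^esub> base_change R N f \<psi> x)"
      using mod_hom_add[OF base_change_hom_UNIV, of \<phi> \<psi>] add(1,2) by simp
    have 3: "h (base_change R N f \<phi> x \<oplus>\<^bsub>N\<^esub> base_change R N f \<psi> x) =
        h (base_change R N f \<phi> x) \<oplus>\<^bsub>N'\<^esub> h (base_change R N f \<psi> x)" for x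
      by (rule mod_hom_add[OF h];
          rule v, rule base_change_fin_supp[OF N.carrier_is_submodule], rule add(1) add(2))
    show ?case
      using mod_hom_add[OF hom', of "\<lambda>x. h (\<phi> x)" "\<lambda>x. h (\<psi> x)"] c[OF add(1)] c[OF add(2)] add(3,4)
      by (simp add: 1 2 3)
  }
qed

end

lemma base_change_compose:
  assumes N: "Module.module R N"
    and f: "f \<in> mod_hom R (free_module_on R T) (free_module_on R T')"
    and g: "g \<in> mod_hom R (free_module_on R T') (free_module_on R T'')"
    and p: "\<phi> \<in> fin_supp T N (carrier N)"
  shows "base_change R N (\<lambda>u. g (f u)) \<phi> = base_change R N g (base_change R N f \<phi>)"
proof -
  interpret N: Module.module R N by (rule N)
  note gf = mod_hom_compose[OF f g]
  show ?thesis
  proof (rule copower_hom_eqI[OF N module_copower[OF N, of T''] _ _ _ p])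
    show "base_change R N (\<lambda>u. g (f u)) \<in> mod_hom R (copower T N) (copower T'' N)"
      by (rule base_change_hom[OF N gf])
    show "(\<lambda>\<phi>. base_change R N g (base_change R N f \<phi>)) \<in> mod_hom R (copower T N) (copower T'' N)"
      by (rule mod_hom_compose[OF base_change_hom[OF N f] base_change_hom[OF N g]])
    fix b n assume b: "b \<in> T" "n \<in> carrier N"
    have "f (free_gen R b) \<in> carrier (free_module_on R T')"
      by (rule mod_hom_closed[OF f]) (use b in \<open>simp add: free_gen_closed N.R.is_cring\<close>)
    thus "base_change R N (\<lambda>u. g (f u)) (single N b n) = base_change R N g (base_change R N f (single N b n))"
      using b by (simp add: base_change_single[OF N f] base_change_single[OF N gf] base_change_tens[OF N g])
  qed
qed

lemma base_change_cong:
  assumes N: "Module.module R N"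
    and f: "f \<in> mod_hom R (free_module_on R T) (free_module_on R T')"
    and g: "g \<in> mod_hom R (free_module_on R T) (free_module_on R T')"
    and eq: "\<And>u. u \<in> carrier (free_module_on R T) \<Longrightarrow> f u = g u"
    and p: "\<phi> \<in> fin_supp T N (carrier N)"
  shows "base_change R N f \<phi> = base_change R N g \<phi>"
proof (rule copower_hom_eqI[OF N module_copower[OF N, of T'] base_change_hom[OF N f] base_change_hom[OF N g] _ p])
  interpret N: Module.module R N by (rule N)
  fix b n assume b: "b \<in> T" "n \<in> carrier N"
  show "base_change R N f (single N b n) = base_change R N g (single N b n)"
    using b by (simp add: base_change_single[OF N f] base_change_single[OF N g] eq free_gen_closed N.R.is_cring)
qed

lemma base_change_add:
  assumes N: "Module.module R N"
    and f: "f \<in> mod_hom R (free_module_on R T) (free_module_on R T')"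
    and g: "g \<in> mod_hom R (free_module_on R T) (free_module_on R T')"
    and p: "\<phi> \<in> fin_supp T N (carrier N)"
  shows "base_change R N (\<lambda>u x. f u x \<oplus>\<^bsub>R\<^esub> g u x) \<phi> = (\<lambda>x. base_change R N f \<phi> x \<oplus>\<^bsub>N\<^esub> base_change R N g \<phi> x)"
proof -
  interpret N: Module.module R N by (rule N)
  have fg: "(\<lambda>u x. f u x \<oplus>\<^bsub>R\<^esub> g u x) \<in> mod_hom R (free_module_on R T) (free_module_on R T')"
    using mod_hom_add_hom[OF module_free[OF N.R.is_cring] f g] by simp
  show ?thesis
  proof (rule copower_hom_eqI[OF N module_copower[OF N, of T'] base_change_hom[OF N fg] _ _ p])
    show "(\<lambda>\<phi> x. base_change R N f \<phi> x \<oplus>\<^bsub>N\<^esub> base_change R N g \<phi> x) \<in> mod_hom R (copower T N) (copower T' N)"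
      using mod_hom_add_hom[OF module_copower[OF N] base_change_hom[OF N f] base_change_hom[OF N g]] by simp
    fix b n assume b: "b \<in> T" "n \<in> carrier N"
    have c: "h (free_gen R b) x \<in> carrier R" if "h \<in> mod_hom R (free_module_on R T) (free_module_on R T')" for h x
      using free_carrierD(1)[OF mod_hom_closed[OF that free_gen_closed[OF N.R.is_cring b(1)]]] by auto
    show "base_change R N (\<lambda>u x. f u x \<oplus>\<^bsub>R\<^esub> g u x) (single N b n) =
        (\<lambda>x. base_change R N f (single N b n) x \<oplus>\<^bsub>N\<^esub> base_change R N g (single N b n) x)"
      using b c[OF f] c[OF g]
      by (simp add: base_change_single[OF N f] base_change_single[OF N g] base_change_single[OF N fg]
          tens_def N.smult_l_distr)
  qed
qed

lemma base_change_scale: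
  assumes N: "Module.module R N" and r: "r \<in> carrier R" and p: "\<phi> \<in> fin_supp T N (carrier N)"
  shows "base_change R N (\<lambda>u x. r \<otimes>\<^bsub>R\<^esub> u x) \<phi> = (\<lambda>x. r \<odot>\<^bsub>N\<^esub> \<phi> x)"
proof -
  interpret N: Module.module R N by (rule N)
  have id: "(\<lambda>x. x) \<in> mod_hom R L L" for L :: "('a, 'z) module" by (rule mod_homI) auto
  have f: "(\<lambda>u x. r \<otimes>\<^bsub>R\<^esub> u x) \<in> mod_hom R (free_module_on R T) (free_module_on R T)"
    using mod_hom_scale[OF module_free[OF N.R.is_cring] id r] by simp
  have g: "(\<lambda>\<phi> x. r \<odot>\<^bsub>N\<^esub> \<phi> x) \<in> mod_hom R (copower T N) (copower T N)"
    using mod_hom_scale[OF module_copower[OF N] id r] by simp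
  show ?thesis
  proof (rule copower_hom_eqI[OF N module_copower[OF N] base_change_hom[OF N f] g _ p])
    fix b n assume b: "b \<in> T" "n \<in> carrier N"
    show "base_change R N (\<lambda>u x. r \<otimes>\<^bsub>R\<^esub> u x) (single N b n) = (\<lambda>x. r \<odot>\<^bsub>N\<^esub> single N b n x)"
      using b r by (subst base_change_single[OF N f]) (auto simp: tens_def free_gen_def single_def)
  qed
qed

text \<open>Tensoring with \<open>R\<close> changes nothing. At the end of the dimension shifting,
  where the coefficients have become \<open>R\<close>, this gives back the resolution
  itself.\<close>

lemma base_change_regular:
  assumes R: "cring R" and f: "f \<in> mod_hom R (free_module_on R T) (free_module_on R T')"
    and u: "u \<in> carrier (free_module_on R T)"
  shows "base_change R (regular_module R) f u = f u"
proof (rule free_hom_eqI[OF R module_free[OF R] _ f _ u])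
  interpret cring R by (rule R)
  note M = module_self[OF R]
  show "base_change R (regular_module R) f \<in> mod_hom R (free_module_on R T) (free_module_on R T')"
    using base_change_hom[OF M f] by (simp add: free_module_on_copower)
  fix b assume b: "b \<in> T"
  have "f (free_gen R b) x \<in> carrier R" for x
    using free_carrierD(1)[OF mod_hom_closed[OF f free_gen_closed[OF R b]]] .
  moreover have "base_change R (regular_module R) f (single (regular_module R) b \<one>\<^bsub>R\<^esub>) =
      tens (regular_module R) (f (free_gen R b)) \<one>\<^bsub>R\<^esub>"
    by (rule base_change_single[OF M f b]) (simp add: regular_module_def)
  ultimately show "base_change R (regular_module R) f (free_gen R b) = f (free_gen R b)"
    by (simp add: free_gen_single[symmetric] tens_def)
qed
lemma (in abelian_group) diff_zero_right: "x \<in> carrier G \<Longrightarrow> x \<ominus> \<zero> = x"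
  using add.inv_one by (simp add: a_minus_def a_inv_def)

lemma (in abelian_group) diff_eq_zero_iff:
  assumes "x \<in> carrier G" "y \<in> carrier G" shows "x \<ominus> y = \<zero> \<longleftrightarrow> x = y"
proof
  assume "x \<ominus> y = \<zero>"
  hence "x = \<ominus> (\<ominus> y)" using assms by (intro minus_equality[symmetric]) (simp_all add: a_minus_def)
  thus "x = y" using assms by simp
qed (use assms in \<open>simp add: a_minus_def r_neg\<close>)

lemma (in abelian_group) add_diff_cancel_left: "x \<in> carrier G \<Longrightarrow> y \<in> carrier G \<Longrightarrow> (x \<oplus> y) \<ominus> x = y"
  by (simp add: a_minus_def a_comm[of x y] a_assoc r_neg)

section \<open>Exactness of a free complex modulo submodules\<close>

context
  fixes R :: "'a ring" and N :: "('a, 'b) module" and B :: "'b set"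
  assumes N: "Module.module R N" and B: "submodule B R N"
begin

lemma submodule_diff_sym:
  assumes "x \<in> carrier N" "y \<in> carrier N" "x \<ominus>\<^bsub>N\<^esub> y \<in> B"
  shows "y \<ominus>\<^bsub>N\<^esub> x \<in> B"
proof -
  interpret N: Module.module R N by (rule N)
  have "y \<ominus>\<^bsub>N\<^esub> x = \<ominus>\<^bsub>N\<^esub> (x \<ominus>\<^bsub>N\<^esub> y)"
    using assms(1,2) by (simp add: a_minus_def N.M.minus_add N.M.a_ac)
  thus ?thesis using submodule_simps(5)[OF N B assms(3)] by simp
qed

lemma submodule_diff_trans:
  assumes "x \<in> carrier N" "y \<in> carrier N" "z \<in> carrier N" "x \<ominus>\<^bsub>N\<^esub> y \<in> B" "y \<ominus>\<^bsub>N\<^esub> z \<in> B"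
  shows "x \<ominus>\<^bsub>N\<^esub> z \<in> B"
proof -
  interpret N: Module.module R N by (rule N)
  have "x \<ominus>\<^bsub>N\<^esub> z = (x \<ominus>\<^bsub>N\<^esub> y) \<oplus>\<^bsub>N\<^esub> (y \<ominus>\<^bsub>N\<^esub> z)"
    using assms(1-3) by (simp add: a_minus_def N.M.a_assoc N.M.r_neg1)
  thus ?thesis using submodule_simps(3)[OF N B assms(4,5)] by simp
qed

lemma submodule_diff_mem:
  assumes "x \<in> carrier N" "x \<ominus>\<^bsub>N\<^esub> y \<in> B" "y \<in> B"
  shows "x \<in> B"
proof -
  interpret N: Module.module R N by (rule N)
  have "x = (x \<ominus>\<^bsub>N\<^esub> y) \<oplus>\<^bsub>N\<^esub> y"
    using assms(1) submodule_simps(1)[OF N B assms(3)] by (simp add: a_minus_def N.M.a_assoc N.M.l_neg)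
  thus ?thesis using submodule_simps(3)[OF N B assms(2,3)] by simp
qed

lemma submodule_diff_mem':
  assumes "y \<in> carrier N" "x \<ominus>\<^bsub>N\<^esub> y \<in> B" "x \<in> B"
  shows "y \<in> B"
  by (rule submodule_diff_mem[OF assms(1) submodule_diff_sym[OF submodule_simps(1)[OF N B assms(3)] assms(1,2)] assms(3)])

lemma fin_supp_submodule: "submodule (fin_supp T N B) R (copower T N)"
proof -
  interpret N: Module.module R N by (rule N)
  interpret P: Module.module R "copower T N" by (rule module_copower[OF N])
  note s = submodule_simps[OF N B]
  have sub: "fin_supp T N B \<subseteq> fin_supp T N (carrier N)" using s(1) by (auto simp: fin_supp_def)
  show ?thesis
  proof (rule P.submoduleI)
    fix \<phi> assume p: "\<phi> \<in> fin_supp T N B"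
    have m: "(\<lambda>x. (\<ominus>\<^bsub>R\<^esub> \<one>\<^bsub>R\<^esub>) \<odot>\<^bsub>N\<^esub> \<phi> x) \<in> fin_supp T N B"
      by (rule fin_supp_smult[OF N B p]) simp
    have "\<ominus>\<^bsub>copower T N\<^esub> \<phi> = (\<ominus>\<^bsub>R\<^esub> \<one>\<^bsub>R\<^esub>) \<odot>\<^bsub>copower T N\<^esub> \<phi>"
      using P.smult_l_minus[of "\<one>\<^bsub>R\<^esub>" \<phi>] P.smult_one[of \<phi>] p sub by auto
    thus "\<ominus>\<^bsub>copower T N\<^esub> \<phi> \<in> fin_supp T N B" using m by simp
  qed (use sub s in \<open>auto intro: fin_supp_zero fin_supp_add[OF N B] fin_supp_smult[OF N B]\<close>)
qed

end

lemma copower_minus: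
  assumes N: "Module.module R N" and p: "\<phi> \<in> fin_supp T N (carrier N)" "\<psi> \<in> fin_supp T N (carrier N)"
  shows "\<phi> \<ominus>\<^bsub>copower T N\<^esub> \<psi> = (\<lambda>x. \<phi> x \<ominus>\<^bsub>N\<^esub> \<psi> x)"
proof -
  interpret N: Module.module R N by (rule N)
  interpret P: Module.module R "copower T N" by (rule module_copower[OF N])
  have c: "\<phi> x \<in> carrier N" "\<psi> x \<in> carrier N" for x using p by (auto simp: fin_supp_def)
  have "\<ominus>\<^bsub>copower T N\<^esub> \<psi> = (\<ominus>\<^bsub>R\<^esub> \<one>\<^bsub>R\<^esub>) \<odot>\<^bsub>copower T N\<^esub> \<psi>"
    using P.smult_l_minus[of "\<one>\<^bsub>R\<^esub>" \<psi>] P.smult_one[of \<psi>] p by simp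
  thus ?thesis
    using c N.smult_l_minus[of "\<one>\<^bsub>R\<^esub>"] by (auto simp: a_minus_def)
qed

text \<open>Choices are made coordinatewise. The support stays finite because zero can be answered
  by zero, which is why \<open>P\<close> has to relate the two zeros.\<close>

lemma fin_supp_choice:
  assumes "\<phi> \<in> fin_supp T N A" "\<And>a. a \<in> A \<Longrightarrow> \<exists>b\<in>A'. P a b" "P \<zero>\<^bsub>N\<^esub> \<zero>\<^bsub>N'\<^esub>" "\<zero>\<^bsub>N'\<^esub> \<in> A'"
  shows "\<exists>\<psi>\<in>fin_supp T N' A'. \<forall>x. P (\<phi> x) (\<psi> x)"
proof -
  have "\<forall>a\<in>A. \<exists>b\<in>A'. P a b \<and> (a = \<zero>\<^bsub>N\<^esub> \<longrightarrow> b = \<zero>\<^bsub>N'\<^esub>)" using assms(2-4) by metis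
  then obtain f where f: "\<And>a. a \<in> A \<Longrightarrow> f a \<in> A' \<and> P a (f a) \<and> (a = \<zero>\<^bsub>N\<^esub> \<longrightarrow> f a = \<zero>\<^bsub>N'\<^esub>)" by metis
  have A: "\<phi> x \<in> A" for x using assms(1) by (auto simp: fin_supp_def)
  have "{x. f (\<phi> x) \<noteq> \<zero>\<^bsub>N'\<^esub>} \<subseteq> {x. \<phi> x \<noteq> \<zero>\<^bsub>N\<^esub>}" using f A by blast
  hence "(\<lambda>x. f (\<phi> x)) \<in> fin_supp T N' A'"
    using assms(1) f A by (auto simp: fin_supp_def intro: finite_subset)
  moreover have "\<forall>x. P (\<phi> x) (f (\<phi> x))" using f A by simp
  ultimately show ?thesis by (intro bexI[of _ "\<lambda>x. f (\<phi> x)"])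
qed

section \<open>Vanishing of homology with coefficients in a subquotient\<close>

locale free_complex =
  fixes R :: "'a ring" and T :: "nat \<Rightarrow> 'x set" and D :: "nat \<Rightarrow> ('x \<Rightarrow> 'a) \<Rightarrow> 'x \<Rightarrow> 'a"
  assumes R: "cring R"
    and D: "D n \<in> mod_hom R (free_module_on R (T (Suc n))) (free_module_on R (T n))"
    and D_D: "u \<in> carrier (free_module_on R (T (Suc (Suc n)))) \<Longrightarrow> D n (D (Suc n) u) = (\<lambda>_. \<zero>\<^bsub>R\<^esub>)"
begin

abbreviation d :: "('a, 'b) module \<Rightarrow> nat \<Rightarrow> ('x \<Rightarrow> 'b) \<Rightarrow> 'x \<Rightarrow> 'b" where
  "d N n \<equiv> base_change R N (D n)"

text \<open>Cycles for coefficients modulo \<open>B\<close>, in terms of representatives. All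
  coefficients thus remain in one module \<open>N\<close>, and chains of submodules replace exact
  sequences of quotients.\<close>

definition rel_cycle :: "('a, 'b) module \<Rightarrow> nat \<Rightarrow> 'b set \<Rightarrow> ('x \<Rightarrow> 'b) \<Rightarrow> bool" where
  "rel_cycle N i B \<phi> \<longleftrightarrow> (case i of 0 \<Rightarrow> True | Suc k \<Rightarrow> d N k \<phi> \<in> fin_supp (T k) N B)"

text \<open>Exactness at \<open>i\<close> of the complex with coefficients in \<open>A / B\<close>.\<close>

definition rel_exact :: "('a, 'b) module \<Rightarrow> nat \<Rightarrow> 'b set \<Rightarrow> 'b set \<Rightarrow> bool" where
  "rel_exact N i A B \<longleftrightarrow>
     (\<forall>\<phi>\<in>fin_supp (T i) N A. rel_cycle N i B \<phi> \<longrightarrow>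
        (\<exists>\<psi>\<in>fin_supp (T (Suc i)) N A. \<phi> \<ominus>\<^bsub>copower (T i) N\<^esub> d N i \<psi> \<in> fin_supp (T i) N B))"

lemma d_hom: "Module.module R N \<Longrightarrow> d N n \<in> mod_hom R (copower (T (Suc n)) N) (copower (T n) N)"
  by (rule base_change_hom[OF _ D])

lemma d_fin_supp:
  "Module.module R N \<Longrightarrow> submodule A R N \<Longrightarrow> \<phi> \<in> fin_supp (T (Suc n)) N A \<Longrightarrow> d N n \<phi> \<in> fin_supp (T n) N A"
  by (rule base_change_fin_supp[OF _ D])

lemma d_d:
  assumes N: "Module.module R N" and p: "\<phi> \<in> fin_supp (T (Suc (Suc n))) N (carrier N)"
  shows "d N n (d N (Suc n) \<phi>) = (\<lambda>_. \<zero>\<^bsub>N\<^esub>)"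
proof -
  interpret N: Module.module R N by (rule N)
  note DD = mod_hom_compose[OF D[of "Suc n"] D[of n]]
  have z: "(\<lambda>_ _. \<zero>\<^bsub>R\<^esub>) \<in> mod_hom R (free_module_on R S) (free_module_on R S')" for S S'
    by (rule mod_homI) (auto simp: free_module_on_def)
  have "d N n (d N (Suc n) \<phi>) = base_change R N (\<lambda>u. D n (D (Suc n) u)) \<phi>"
    by (rule base_change_compose[OF N D D p, symmetric])
  also have "\<dots> = base_change R N (\<lambda>_ _. \<zero>\<^bsub>R\<^esub>) \<phi>"
    by (rule base_change_cong[OF N DD z _ p]) (rule D_D)
  also have "\<dots> = (\<lambda>_. \<zero>\<^bsub>N\<^esub>)"
  proof (rule copower_hom_eqI[OF N module_copower[OF N] base_change_hom[OF N z] _ _ p])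
    show "(\<lambda>_ _. \<zero>\<^bsub>N\<^esub>) \<in> mod_hom R (copower (T (Suc (Suc n))) N) (copower UNIV N)"
      by (rule mod_homI) (auto intro: fin_supp_zero)
    show "base_change R N (\<lambda>_ _. \<zero>\<^bsub>R\<^esub>) (single N b a) = (\<lambda>_. \<zero>\<^bsub>N\<^esub>)"
      if "b \<in> T (Suc (Suc n))" "a \<in> carrier N" for b a
      using that by (simp add: base_change_single[OF N z] tens_def)
  qed
  finally show ?thesis .
qed

lemma d_diff:
  assumes N: "Module.module R N" and B: "submodule B R N"
    and "\<phi> \<in> fin_supp (T (Suc n)) N (carrier N)" "\<psi> \<in> fin_supp (T (Suc n)) N (carrier N)"
    and "\<phi> \<ominus>\<^bsub>copower (T (Suc n)) N\<^esub> \<psi> \<in> fin_supp (T (Suc n)) N B"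
  shows "d N n \<phi> \<ominus>\<^bsub>copower (T n) N\<^esub> d N n \<psi> \<in> fin_supp (T n) N B"
  using d_fin_supp[OF N B assms(5)] mod_hom_minus[OF module_copower[OF N] module_copower[OF N] d_hom[OF N]]
    assms(3,4) by simp

lemma rel_exact_restrict:
  assumes N: "Module.module R N" and A: "submodule A R N"
  shows "rel_exact (N\<lparr>carrier := A\<rparr>) i A B \<longleftrightarrow> rel_exact N i A B"
proof -
  interpret N: Module.module R N by (rule N)
  let ?N = "N\<lparr>carrier := A\<rparr>"
  have N': "Module.module R ?N" by (rule submodule.submodule_is_module[OF A N])
  have h: "(\<lambda>x. x) \<in> mod_hom R ?N N" by (rule mod_homI) (auto simp: submodule_simps[OF N A])
  have fs: "fin_supp S ?N C = fin_supp S N C" for S :: "'x set" and C by (simp add: fin_supp_def)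
  have bc: "d ?N n \<phi> = d N n \<phi>" if "\<phi> \<in> fin_supp (T (Suc n)) N A" for n \<phi>
    using base_change_natural[OF N' D N h, of \<phi>] that by (simp add: fs)
  have sub: "\<phi> \<in> fin_supp S N (carrier N)" if "\<phi> \<in> fin_supp S N A" for \<phi> and S :: "'x set"
    using that submodule_simps(1)[OF N A] by (auto simp: fin_supp_def)
  have cm: "\<phi> \<ominus>\<^bsub>copower S ?N\<^esub> \<psi> = \<phi> \<ominus>\<^bsub>copower S N\<^esub> \<psi>"
    if "\<phi> \<in> fin_supp S N A" "\<psi> \<in> fin_supp S N A" for \<phi> \<psi> and S :: "'x set"
  proof -
    have "\<phi> x \<in> A" "\<psi> x \<in> A" for x using that by (auto simp: fin_supp_def)
    thus ?thesis using copower_minus[OF N' , of \<phi> S \<psi>] copower_minus[OF N sub[OF that(1)] sub[OF that(2)]] that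
      by (simp add: fs restrict_minus[OF N A])
  qed
  have rc: "rel_cycle ?N i B \<phi> \<longleftrightarrow> rel_cycle N i B \<phi>" if "\<phi> \<in> fin_supp (T i) N A" for \<phi>
    using that by (cases i) (auto simp: rel_cycle_def fs bc)
  have "\<phi> \<ominus>\<^bsub>copower (T i) ?N\<^esub> d ?N i \<psi> = \<phi> \<ominus>\<^bsub>copower (T i) N\<^esub> d N i \<psi>"
    if "\<phi> \<in> fin_supp (T i) N A" "\<psi> \<in> fin_supp (T (Suc i)) N A" for \<phi> \<psi>
    using cm[OF that(1) d_fin_supp[OF N A that(2)]] bc[OF that(2)] by simp
  thus ?thesis by (auto simp: rel_exact_def fs rc)
qed

text \<open>The hypotheses say that \<open>h\<close> induces an isomorphism from A/B onto A'/B':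
  \<open>hB\<close> gives well-definedness and injectivity, \<open>surj\<close> surjectivity. Chains
  are moved across by choosing representatives coordinatewise (\<open>lift\<close>), and the
  resulting errors lie over \<open>B'\<close>.\<close>

lemma rel_exact_iso:
  assumes N: "Module.module R N" and N': "Module.module R N'"
    and A: "submodule A R N" and B: "submodule B R N" and A': "submodule A' R N'" and B': "submodule B' R N'"
    and h: "h \<in> mod_hom R (N\<lparr>carrier := A\<rparr>) N'"
    and BA: "B \<subseteq> A" "B' \<subseteq> A'"
    and hA: "\<And>a. a \<in> A \<Longrightarrow> h a \<in> A'"
    and hB: "\<And>a. a \<in> A \<Longrightarrow> h a \<in> B' \<longleftrightarrow> a \<in> B"
    and surj: "\<And>a'. a' \<in> A' \<Longrightarrow> \<exists>a\<in>A. a' \<ominus>\<^bsub>N'\<^esub> h a \<in> B'"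
  shows "rel_exact N i A B \<longleftrightarrow> rel_exact N' i A' B'"
proof -
  let ?N = "N\<lparr>carrier := A\<rparr>"
  have N0: "Module.module R ?N" by (rule submodule.submodule_is_module[OF A N])
  interpret N': Module.module R N' by (rule N')
  interpret N0: Module.module R ?N by (rule N0)
  have A0: "submodule A R ?N" using N0.carrier_is_submodule by simp
  have B0: "submodule B R ?N" by (rule submodule_restrict[OF N A B BA(1)])
  have hz: "h \<zero>\<^bsub>?N\<^esub> = \<zero>\<^bsub>N'\<^esub>" by (rule mod_hom_zero[OF N0 N' h])
  have sA: "\<phi> \<in> fin_supp S ?N (carrier ?N)" if "\<phi> \<in> fin_supp S ?N A" for \<phi> and S :: "'x set"
    using that by simp
  have sA': "\<phi> \<in> fin_supp S N' (carrier N')" if "\<phi> \<in> fin_supp S N' A'" for \<phi> and S :: "'x set"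
    using that submodule_simps(1)[OF N' A'] by (auto simp: fin_supp_def)
  have sB': "\<phi> \<in> fin_supp S N' A'" if "\<phi> \<in> fin_supp S N' B'" for \<phi> and S :: "'x set"
    using that BA(2) by (auto simp: fin_supp_def)
  have hp: "(\<lambda>x. h (\<phi> x)) \<in> fin_supp S N' A'" if "\<phi> \<in> fin_supp S ?N A" for \<phi> and S :: "'x set"
    by (rule fin_supp_map[OF that hA]) (auto simp: hz[simplified])
  have hpB: "(\<lambda>x. h (\<phi> x)) \<in> fin_supp S N' B' \<longleftrightarrow> \<phi> \<in> fin_supp S ?N B"
    if "\<phi> \<in> fin_supp S ?N A" for \<phi> and S :: "'x set"
  proof
    assume "\<phi> \<in> fin_supp S ?N B"
    thus "(\<lambda>x. h (\<phi> x)) \<in> fin_supp S N' B'"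
      by (rule fin_supp_map) (use hB BA in \<open>auto simp: hz[simplified]\<close>)
  next
    assume "(\<lambda>x. h (\<phi> x)) \<in> fin_supp S N' B'"
    thus "\<phi> \<in> fin_supp S ?N B" using that hB by (auto simp: fin_supp_def)
  qed
  have hom_h: "(\<lambda>\<phi> x. h (\<phi> x)) \<in> mod_hom R (copower S ?N) (copower S N')" for S :: "'x set"
  proof (rule mod_homI)
    fix \<phi> assume p: "\<phi> \<in> carrier (copower S ?N)"
    hence a: "\<phi> x \<in> A" for x by (auto simp: fin_supp_def)
    show "(\<lambda>x. h (\<phi> x)) \<in> carrier (copower S N')" using sA'[OF hp, of \<phi> S] p by simp
    show "(\<lambda>x. h ((\<phi> \<oplus>\<^bsub>copower S ?N\<^esub> \<psi>) x)) = (\<lambda>x. h (\<phi> x)) \<oplus>\<^bsub>copower S N'\<^esub> (\<lambda>x. h (\<psi> x))"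
      if "\<psi> \<in> carrier (copower S ?N)" for \<psi>
      using that a mod_hom_add[OF h] by (auto simp: fin_supp_def)
    show "(\<lambda>x. h ((r \<odot>\<^bsub>copower S ?N\<^esub> \<phi>) x)) = r \<odot>\<^bsub>copower S N'\<^esub> (\<lambda>x. h (\<phi> x))" if "r \<in> carrier R" for r
      using a mod_hom_smult[OF h that] by auto
  qed
  have nat: "d N' n (\<lambda>x. h (\<phi> x)) = (\<lambda>x. h (d ?N n \<phi> x))" if "\<phi> \<in> fin_supp (T (Suc n)) ?N A" for \<phi> n
    by (rule base_change_natural[OF N0 D N' h sA[OF that]])
  have lift: "\<exists>\<psi>\<in>fin_supp S ?N A. \<phi> \<ominus>\<^bsub>copower S N'\<^esub> (\<lambda>x. h (\<psi> x)) \<in> fin_supp S N' B'"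
    if p: "\<phi> \<in> fin_supp S N' A'" for \<phi> and S :: "'x set"
  proof -
    have "\<zero>\<^bsub>N'\<^esub> \<ominus>\<^bsub>N'\<^esub> h \<zero>\<^bsub>?N\<^esub> \<in> B'"
      unfolding hz by (rule submodule_simps(4)[OF N' B']; rule submodule_simps(2)[OF N' B'])
    from fin_supp_choice[OF p, of A "\<lambda>a b. a \<ominus>\<^bsub>N'\<^esub> h b \<in> B'" ?N, OF surj this submodule_simps(2)[OF N0 A0]]
    obtain \<psi> where q: "\<psi> \<in> fin_supp S ?N A" "\<And>x. \<phi> x \<ominus>\<^bsub>N'\<^esub> h (\<psi> x) \<in> B'" by blast
    have "(\<lambda>x. \<phi> x \<ominus>\<^bsub>N'\<^esub> h (\<psi> x)) \<in> fin_supp S N' (carrier N')"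
      by (rule fin_supp_minus[OF N' N'.carrier_is_submodule sA'[OF p] sA'[OF hp[OF q(1)]]])
    hence "(\<lambda>x. \<phi> x \<ominus>\<^bsub>N'\<^esub> h (\<psi> x)) \<in> fin_supp S N' B'" using q(2) by (simp add: fin_supp_def)
    thus ?thesis using q(1) copower_minus[OF N' sA'[OF p] sA'[OF hp[OF q(1)]]] by metis
  qed
  note fsB = fin_supp_submodule[OF N' B']
  note P' = module_copower[OF N']
  have c': "\<phi> \<in> carrier (copower S N')" if "\<phi> \<in> fin_supp S N' A'" for \<phi> and S :: "'x set"
    using sA'[OF that] by simp
  have "rel_exact ?N i A B \<longleftrightarrow> rel_exact N' i A' B'"
  proof
    assume ex: "rel_exact ?N i A B"
    show "rel_exact N' i A' B'"
      unfolding rel_exact_def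
    proof (intro ballI impI)
      fix \<phi>' assume p': "\<phi>' \<in> fin_supp (T i) N' A'" and cyc: "rel_cycle N' i B' \<phi>'"
      obtain \<phi> where p: "\<phi> \<in> fin_supp (T i) ?N A"
        and e: "\<phi>' \<ominus>\<^bsub>copower (T i) N'\<^esub> (\<lambda>x. h (\<phi> x)) \<in> fin_supp (T i) N' B'"
        using lift[OF p'] by blast
      have "rel_cycle ?N i B \<phi>"
      proof (cases i)
        case (Suc k)
        have "d N' k \<phi>' \<ominus>\<^bsub>copower (T k) N'\<^esub> d N' k (\<lambda>x. h (\<phi> x)) \<in> fin_supp (T k) N' B'"
          using e p' p Suc sA'[OF hp[OF p]] sA'[OF p'] by (intro d_diff[OF N' B']) auto
        hence "d N' k (\<lambda>x. h (\<phi> x)) \<in> fin_supp (T k) N' B'"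
          using cyc Suc p c'[OF d_fin_supp[OF N' A' hp]]
          by (auto simp: rel_cycle_def intro: submodule_diff_mem'[OF P' fsB])
        thus ?thesis using p Suc hpB[OF d_fin_supp[OF N0 A0]] nat by (auto simp: rel_cycle_def)
      qed (simp add: rel_cycle_def)
      then obtain \<psi> where q: "\<psi> \<in> fin_supp (T (Suc i)) ?N A" "\<phi> \<ominus>\<^bsub>copower (T i) ?N\<^esub> d ?N i \<psi> \<in> fin_supp (T i) ?N B"
        using ex p by (auto simp: rel_exact_def)
      have dq: "d ?N i \<psi> \<in> fin_supp (T i) ?N A" by (rule d_fin_supp[OF N0 A0 q(1)])
      have "\<phi> \<ominus>\<^bsub>copower (T i) ?N\<^esub> d ?N i \<psi> \<in> fin_supp (T i) ?N A"
        using q(2) BA by (auto simp: fin_supp_def)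
      hence "(\<lambda>x. h ((\<phi> \<ominus>\<^bsub>copower (T i) ?N\<^esub> d ?N i \<psi>) x)) \<in> fin_supp (T i) N' B'"
        using hpB q(2) by blast
      hence "(\<lambda>x. h (\<phi> x)) \<ominus>\<^bsub>copower (T i) N'\<^esub> d N' i (\<lambda>x. h (\<psi> x)) \<in> fin_supp (T i) N' B'"
        using mod_hom_minus[OF module_copower[OF N0] P' hom_h, of \<phi> "T i" "d ?N i \<psi>"] p dq nat[OF q(1)] by simp
      hence "\<phi>' \<ominus>\<^bsub>copower (T i) N'\<^esub> d N' i (\<lambda>x. h (\<psi> x)) \<in> fin_supp (T i) N' B'"
        using submodule_diff_trans[OF P' fsB _ _ _ e] c'[OF p'] c'[OF hp[OF p]] c'[OF d_fin_supp[OF N' A' hp[OF q(1)]]]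
        by blast
      thus "\<exists>\<psi>\<in>fin_supp (T (Suc i)) N' A'. \<phi>' \<ominus>\<^bsub>copower (T i) N'\<^esub> d N' i \<psi> \<in> fin_supp (T i) N' B'"
        using hp[OF q(1)] by blast
    qed
  next
    assume ex: "rel_exact N' i A' B'"
    show "rel_exact ?N i A B"
      unfolding rel_exact_def
    proof (intro ballI impI)
      fix \<phi> assume p: "\<phi> \<in> fin_supp (T i) ?N A" and cyc: "rel_cycle ?N i B \<phi>"
      have "rel_cycle N' i B' (\<lambda>x. h (\<phi> x))"
        using cyc p hpB[OF d_fin_supp[OF N0 A0]] nat by (cases i) (auto simp: rel_cycle_def)
      then obtain \<psi>' where q': "\<psi>' \<in> fin_supp (T (Suc i)) N' A'"
        "(\<lambda>x. h (\<phi> x)) \<ominus>\<^bsub>copower (T i) N'\<^esub> d N' i \<psi>' \<in> fin_supp (T i) N' B'"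
        using ex hp[OF p] by (auto simp: rel_exact_def)
      obtain \<psi> where q: "\<psi> \<in> fin_supp (T (Suc i)) ?N A"
        and e: "\<psi>' \<ominus>\<^bsub>copower (T (Suc i)) N'\<^esub> (\<lambda>x. h (\<psi> x)) \<in> fin_supp (T (Suc i)) N' B'"
        using lift[OF q'(1)] by blast
      have "d N' i \<psi>' \<ominus>\<^bsub>copower (T i) N'\<^esub> d N' i (\<lambda>x. h (\<psi> x)) \<in> fin_supp (T i) N' B'"
        using e sA'[OF q'(1)] sA'[OF hp[OF q]] by (intro d_diff[OF N' B'])
      hence "(\<lambda>x. h (\<phi> x)) \<ominus>\<^bsub>copower (T i) N'\<^esub> d N' i (\<lambda>x. h (\<psi> x)) \<in> fin_supp (T i) N' B'"
        using submodule_diff_trans[OF P' fsB _ _ _ q'(2)] c'[OF hp[OF p]] c'[OF d_fin_supp[OF N' A' q'(1)]]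
          c'[OF d_fin_supp[OF N' A' hp[OF q]]] by blast
      moreover have dq: "d ?N i \<psi> \<in> fin_supp (T i) ?N A" by (rule d_fin_supp[OF N0 A0 q])
      ultimately have "(\<lambda>x. h ((\<phi> \<ominus>\<^bsub>copower (T i) ?N\<^esub> d ?N i \<psi>) x)) \<in> fin_supp (T i) N' B'"
        using mod_hom_minus[OF module_copower[OF N0] P' hom_h, of \<phi> "T i" "d ?N i \<psi>"] p dq nat[OF q] by simp
      moreover have "\<phi> \<ominus>\<^bsub>copower (T i) ?N\<^esub> d ?N i \<psi> \<in> fin_supp (T i) ?N A"
        by (rule submodule_simps(4)[OF module_copower[OF N0] fin_supp_submodule[OF N0 A0] p dq])
      ultimately show "\<exists>\<psi>\<in>fin_supp (T (Suc i)) ?N A. \<phi> \<ominus>\<^bsub>copower (T i) ?N\<^esub> d ?N i \<psi> \<in> fin_supp (T i) ?N B"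
        using q hpB by blast
    qed
  qed
  thus ?thesis using rel_exact_restrict[OF N A] by simp
qed

text \<open>The middle term of the long exact sequence of 0 -> B/C -> A/C -> A/B -> 0. A cycle is
  first bounded modulo \<open>B\<close>; what remains is a cycle over \<open>B\<close> modulo
  \<open>C\<close>, which is bounded in turn.\<close>

lemma rel_exact_trans:
  assumes N: "Module.module R N" and A: "submodule A R N" and B: "submodule B R N" and C: "submodule C R N"
    and sub: "C \<subseteq> B" "B \<subseteq> A" and AB: "rel_exact N i A B" and BC: "rel_exact N i B C"
  shows "rel_exact N i A C"
  unfolding rel_exact_def
proof (intro ballI impI)
  note P = module_copower[OF N]
  fix \<phi> assume p: "\<phi> \<in> fin_supp (T i) N A" and cyc: "rel_cycle N i C \<phi>"
  have s: "S \<subseteq> S' \<Longrightarrow> \<chi> \<in> fin_supp U N S \<Longrightarrow> \<chi> \<in> fin_supp U N S'" for S S' \<chi> and U :: "'x set"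
    by (auto simp: fin_supp_def)
  have sA: "\<chi> \<in> carrier (copower U N)" if "\<chi> \<in> fin_supp U N A" for \<chi> and U :: "'x set"
    using that submodule_simps(1)[OF N A] by (auto simp: fin_supp_def)
  have "rel_cycle N i B \<phi>" using cyc s[OF sub(1)] by (auto simp: rel_cycle_def split: nat.splits)
  then obtain \<psi> where q: "\<psi> \<in> fin_supp (T (Suc i)) N A" "\<phi> \<ominus>\<^bsub>copower (T i) N\<^esub> d N i \<psi> \<in> fin_supp (T i) N B"
    using AB p by (auto simp: rel_exact_def)
  let ?\<phi> = "\<phi> \<ominus>\<^bsub>copower (T i) N\<^esub> d N i \<psi>"
  have dq: "d N i \<psi> \<in> fin_supp (T i) N A" by (rule d_fin_supp[OF N A q(1)])
  have "rel_cycle N i C ?\<phi>"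
  proof (cases i)
    case (Suc k)
    have "d N k ?\<phi> = d N k \<phi> \<ominus>\<^bsub>copower (T k) N\<^esub> d N k (d N (Suc k) \<psi>)"
      using mod_hom_minus[OF P P d_hom[OF N], of \<phi> k "d N i \<psi>"] sA[OF p] sA[OF dq] Suc by simp
    also have "\<dots> = d N k \<phi> \<ominus>\<^bsub>copower (T k) N\<^esub> \<zero>\<^bsub>copower (T k) N\<^esub>"
      using d_d[OF N, of \<psi> k] sA[OF q(1)] Suc by simp
    also have "\<dots> \<in> fin_supp (T k) N C"
      by (rule submodule_simps(4)[OF P fin_supp_submodule[OF N C] _ submodule_simps(2)[OF P fin_supp_submodule[OF N C]]])
        (use cyc Suc in \<open>simp add: rel_cycle_def\<close>)
    finally show ?thesis using Suc by (simp add: rel_cycle_def)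
  qed (simp add: rel_cycle_def)
  then obtain \<chi> where x: "\<chi> \<in> fin_supp (T (Suc i)) N B" "?\<phi> \<ominus>\<^bsub>copower (T i) N\<^esub> d N i \<chi> \<in> fin_supp (T i) N C"
    using BC q(2) by (auto simp: rel_exact_def)
  let ?\<psi> = "\<psi> \<oplus>\<^bsub>copower (T (Suc i)) N\<^esub> \<chi>"
  have xA: "\<chi> \<in> fin_supp (T (Suc i)) N A" by (rule s[OF sub(2) x(1)])
  have dx: "d N i \<chi> \<in> fin_supp (T i) N A" by (rule d_fin_supp[OF N A xA])
  have "d N i ?\<psi> = d N i \<psi> \<oplus>\<^bsub>copower (T i) N\<^esub> d N i \<chi>"
    by (rule mod_hom_add[OF d_hom[OF N] sA[OF q(1)] sA[OF xA]])
  moreover interpret P: Module.module R "copower (T i) N" by (rule P)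
  have "\<phi> \<ominus>\<^bsub>copower (T i) N\<^esub> (d N i \<psi> \<oplus>\<^bsub>copower (T i) N\<^esub> d N i \<chi>) = ?\<phi> \<ominus>\<^bsub>copower (T i) N\<^esub> d N i \<chi>"
    using sA[OF p] sA[OF dq] sA[OF dx] unfolding a_minus_def
    by (metis P.M.a_assoc P.M.a_inv_closed P.M.minus_add)
  ultimately show "\<exists>\<psi>\<in>fin_supp (T (Suc i)) N A. \<phi> \<ominus>\<^bsub>copower (T i) N\<^esub> d N i \<psi> \<in> fin_supp (T i) N C"
    using x(2) submodule_simps(3)[OF module_copower[OF N] fin_supp_submodule[OF N A] q(1) xA] by metis
qed

text \<open>From the same long exact sequence, the segment H_(i+1)(A/B) -> H_i(B/C) -> H_i(A/C),
  whose outer terms vanish.\<close>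

lemma rel_exact_shift_down:
  assumes N: "Module.module R N" and A: "submodule A R N" and B: "submodule B R N" and C: "submodule C R N"
    and sub: "C \<subseteq> B" "B \<subseteq> A" and AC: "rel_exact N i A C" and AB: "rel_exact N (Suc i) A B"
  shows "rel_exact N i B C"
  unfolding rel_exact_def
proof (intro ballI impI)
  note P = module_copower[OF N]
  fix \<phi> assume p: "\<phi> \<in> fin_supp (T i) N B" and cyc: "rel_cycle N i C \<phi>"
  have s: "S \<subseteq> S' \<Longrightarrow> \<chi> \<in> fin_supp U N S \<Longrightarrow> \<chi> \<in> fin_supp U N S'" for S S' \<chi> and U :: "'x set"
    by (auto simp: fin_supp_def)
  have sA: "\<chi> \<in> carrier (copower U N)" if "\<chi> \<in> fin_supp U N A" for \<chi> and U :: "'x set"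
    using that submodule_simps(1)[OF N A] by (auto simp: fin_supp_def)
  note pA = s[OF sub(2) p]
  obtain \<psi> where q: "\<psi> \<in> fin_supp (T (Suc i)) N A" "\<phi> \<ominus>\<^bsub>copower (T i) N\<^esub> d N i \<psi> \<in> fin_supp (T i) N C"
    using AC pA cyc by (auto simp: rel_exact_def)
  have dq: "d N i \<psi> \<in> fin_supp (T i) N A" by (rule d_fin_supp[OF N A q(1)])
  \<comment> \<open>Hence \<psi> is a cycle modulo \<open>B\<close>, the one that the connecting map
    sends to the class of \<phi>. Subtracting a boundary moves \<psi> into \<open>B\<close> without
    changing its own boundary.\<close>
  have "d N i \<psi> \<in> fin_supp (T i) N B"
    by (rule submodule_diff_mem'[OF P fin_supp_submodule[OF N B] sA[OF dq] s[OF sub(1) q(2)] p])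
  hence "rel_cycle N (Suc i) B \<psi>" by (simp add: rel_cycle_def)
  then obtain \<chi> where x: "\<chi> \<in> fin_supp (T (Suc (Suc i))) N A"
    "\<psi> \<ominus>\<^bsub>copower (T (Suc i)) N\<^esub> d N (Suc i) \<chi> \<in> fin_supp (T (Suc i)) N B"
    using AB q(1) by (auto simp: rel_exact_def)
  let ?\<psi> = "\<psi> \<ominus>\<^bsub>copower (T (Suc i)) N\<^esub> d N (Suc i) \<chi>"
  have dx: "d N (Suc i) \<chi> \<in> fin_supp (T (Suc i)) N A" by (rule d_fin_supp[OF N A x(1)])
  have "d N i ?\<psi> = d N i \<psi> \<ominus>\<^bsub>copower (T i) N\<^esub> \<zero>\<^bsub>copower (T i) N\<^esub>"
    using mod_hom_minus[OF P P d_hom[OF N] sA[OF q(1)] sA[OF dx]] d_d[OF N, of \<chi> i] sA[OF x(1)] by simp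
  also have "\<dots> = d N i \<psi>"
  proof -
    interpret P: Module.module R "copower (T i) N" by (rule P)
    show ?thesis using sA[OF dq] by (rule P.M.diff_zero_right)
  qed
  finally show "\<exists>\<psi>\<in>fin_supp (T (Suc i)) N B. \<phi> \<ominus>\<^bsub>copower (T i) N\<^esub> d N i \<psi> \<in> fin_supp (T i) N C"
    using q(2) x(2) by metis
qed

text \<open>The segment H_1(A/C) -> H_1(A/B) -> H_0(B/C). A cycle modulo \<open>B\<close> has its
  boundary over \<open>B\<close>; bounding that boundary modulo \<open>C\<close> by a chain over
  \<open>B\<close> and subtracting this chain yields a cycle modulo \<open>C\<close>.\<close>

lemma rel_exact_shift_up:
  assumes N: "Module.module R N" and A: "submodule A R N" and B: "submodule B R N" and C: "submodule C R N"
    and sub: "C \<subseteq> B" "B \<subseteq> A" and AC: "rel_exact N 1 A C" and BC: "rel_exact N 0 B C"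
  shows "rel_exact N 1 A B"
  unfolding rel_exact_def
proof (intro ballI impI)
  note P = module_copower[OF N]
  fix \<phi> assume p: "\<phi> \<in> fin_supp (T 1) N A" and cyc: "rel_cycle N 1 B \<phi>"
  have s: "S \<subseteq> S' \<Longrightarrow> \<chi> \<in> fin_supp U N S \<Longrightarrow> \<chi> \<in> fin_supp U N S'" for S S' \<chi> and U :: "'x set"
    by (auto simp: fin_supp_def)
  have sA: "\<chi> \<in> carrier (copower U N)" if "\<chi> \<in> fin_supp U N A" for \<chi> and U :: "'x set"
    using that submodule_simps(1)[OF N A] by (auto simp: fin_supp_def)
  have c: "d N 0 \<phi> \<in> fin_supp (T 0) N B" using cyc by (simp add: rel_cycle_def)
  obtain \<psi> where q: "\<psi> \<in> fin_supp (T 1) N B" "d N 0 \<phi> \<ominus>\<^bsub>copower (T 0) N\<^esub> d N 0 \<psi> \<in> fin_supp (T 0) N C"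
    using BC c by (auto simp: rel_exact_def rel_cycle_def)
  note qA = s[OF sub(2) q(1)]
  let ?\<phi> = "\<phi> \<ominus>\<^bsub>copower (T 1) N\<^esub> \<psi>"
  have pA: "?\<phi> \<in> fin_supp (T 1) N A"
    by (rule submodule_simps(4)[OF P fin_supp_submodule[OF N A] p qA])
  have "d N 0 ?\<phi> \<in> fin_supp (T 0) N C"
    using mod_hom_minus[OF P P d_hom[OF N, of 0], of \<phi> \<psi>] sA[OF p] sA[OF qA] q(2) by simp
  then obtain \<chi> where x: "\<chi> \<in> fin_supp (T 2) N A" "?\<phi> \<ominus>\<^bsub>copower (T 1) N\<^esub> d N 1 \<chi> \<in> fin_supp (T 1) N C"
    using AC pA by (auto simp: rel_exact_def rel_cycle_def numeral_2_eq_2)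
  have dx: "d N 1 \<chi> \<in> fin_supp (T 1) N A"
    using d_fin_supp[OF N A, of \<chi> 1] x(1) by (simp add: numeral_2_eq_2)
  have "?\<phi> \<ominus>\<^bsub>copower (T 1) N\<^esub> d N 1 \<chi> = (\<phi> \<ominus>\<^bsub>copower (T 1) N\<^esub> d N 1 \<chi>) \<ominus>\<^bsub>copower (T 1) N\<^esub> \<psi>"
  proof -
    interpret P: Module.module R "copower (T 1) N" by (rule P)
    show ?thesis using sA[OF p] sA[OF qA] sA[OF dx] unfolding a_minus_def
      by (metis P.M.a_assoc P.M.a_comm P.M.a_inv_closed)
  qed
  hence "(\<phi> \<ominus>\<^bsub>copower (T 1) N\<^esub> d N 1 \<chi>) \<ominus>\<^bsub>copower (T 1) N\<^esub> \<psi> \<in> fin_supp (T 1) N B"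
    using s[OF sub(1) x(2)] by simp
  hence "\<phi> \<ominus>\<^bsub>copower (T 1) N\<^esub> d N 1 \<chi> \<in> fin_supp (T 1) N B"
    by (rule submodule_diff_mem[OF P fin_supp_submodule[OF N B] _ _ q(1), rotated])
      (rule sA[OF submodule_simps(4)[OF P fin_supp_submodule[OF N A] p dx]])
  thus "\<exists>\<psi>\<in>fin_supp (T (Suc 1)) N A. \<phi> \<ominus>\<^bsub>copower (T 1) N\<^esub> d N 1 \<psi> \<in> fin_supp (T 1) N B"
    using x(1) by (auto simp: numeral_2_eq_2)
qed

text \<open>Right exactness: A/B is an image of A/C, and in degree 0 every chain is a cycle.\<close>

lemma rel_exact_0_mono:
  assumes "rel_exact N 0 A C" "C \<subseteq> B"
  shows "rel_exact N 0 A B"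
  unfolding rel_exact_def
proof (intro ballI impI)
  fix \<phi> assume p: "\<phi> \<in> fin_supp (T 0) N A"
  then obtain \<psi> where "\<psi> \<in> fin_supp (T (Suc 0)) N A" "\<phi> \<ominus>\<^bsub>copower (T 0) N\<^esub> d N 0 \<psi> \<in> fin_supp (T 0) N C"
    using assms(1) by (auto simp: rel_exact_def rel_cycle_def)
  thus "\<exists>\<psi>\<in>fin_supp (T (Suc 0)) N A. \<phi> \<ominus>\<^bsub>copower (T 0) N\<^esub> d N 0 \<psi> \<in> fin_supp (T 0) N B"
    using fin_supp_mono[OF _ assms(2)] by blast
qed

definition null_homotopic :: "'a \<Rightarrow> bool" where
  "null_homotopic y \<longleftrightarrow> (\<exists>s. (\<forall>n. s n \<in> mod_hom R (free_module_on R (T n)) (free_module_on R (T (Suc n)))) \<and>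
     (\<forall>u\<in>carrier (free_module_on R (T 0)). D 0 (s 0 u) = (\<lambda>x. y \<otimes>\<^bsub>R\<^esub> u x)) \<and>
     (\<forall>n. \<forall>u\<in>carrier (free_module_on R (T (Suc n))).
        (\<lambda>x. D (Suc n) (s (Suc n) u) x \<oplus>\<^bsub>R\<^esub> s n (D n u) x) = (\<lambda>x. y \<otimes>\<^bsub>R\<^esub> u x)))"

text \<open>On homology with coefficients in A/B, multiplication by \<open>y\<close> is zero by the
  homotopy and bijective by \<open>inj\<close> and \<open>surj\<close>, so the homology vanishes.
  Explicitly: a cycle \<phi> is y \<psi> modulo \<open>B\<close>, injectivity makes \<psi> a cycle
  modulo \<open>B\<close>, and the homotopy applied to \<psi> yields a chain bounding y
  \<psi>.\<close>

lemma rel_exact_invertible: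
  assumes N: "Module.module R N" and A: "submodule A R N" and B: "submodule B R N" and sub: "B \<subseteq> A"
    and y: "y \<in> carrier R" and null: "null_homotopic y"
    and inj: "\<And>a. a \<in> A \<Longrightarrow> y \<odot>\<^bsub>N\<^esub> a \<in> B \<Longrightarrow> a \<in> B"
    and surj: "\<And>a. a \<in> A \<Longrightarrow> \<exists>a'\<in>A. a \<ominus>\<^bsub>N\<^esub> y \<odot>\<^bsub>N\<^esub> a' \<in> B"
  shows "rel_exact N i A B"
  unfolding rel_exact_def
proof (intro ballI impI)
  interpret N: Module.module R N by (rule N)
  note P = module_copower[OF N]
  fix \<phi> assume p: "\<phi> \<in> fin_supp (T i) N A" and cyc: "rel_cycle N i B \<phi>"
  have sA: "\<chi> \<in> fin_supp U N (carrier N)" if "\<chi> \<in> fin_supp U N A" for \<chi> and U :: "'x set"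
    using that submodule_simps(1)[OF N A] by (auto simp: fin_supp_def)
  obtain s where s: "\<And>n. s n \<in> mod_hom R (free_module_on R (T n)) (free_module_on R (T (Suc n)))"
     "\<And>u. u \<in> carrier (free_module_on R (T 0)) \<Longrightarrow> D 0 (s 0 u) = (\<lambda>x. y \<otimes>\<^bsub>R\<^esub> u x)"
     "\<And>n u. u \<in> carrier (free_module_on R (T (Suc n))) \<Longrightarrow>
        (\<lambda>x. D (Suc n) (s (Suc n) u) x \<oplus>\<^bsub>R\<^esub> s n (D n u) x) = (\<lambda>x. y \<otimes>\<^bsub>R\<^esub> u x)"
    using null unfolding null_homotopic_def by blast
  have "\<zero>\<^bsub>N\<^esub> \<ominus>\<^bsub>N\<^esub> y \<odot>\<^bsub>N\<^esub> \<zero>\<^bsub>N\<^esub> \<in> B"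
    using submodule_simps(2)[OF N B] y N.M.diff_zero_right by simp
  from fin_supp_choice[OF p, of A "\<lambda>a b. a \<ominus>\<^bsub>N\<^esub> y \<odot>\<^bsub>N\<^esub> b \<in> B" N, OF surj this submodule_simps(2)[OF N A]]
  obtain \<psi> where q: "\<psi> \<in> fin_supp (T i) N A" "\<And>x. \<phi> x \<ominus>\<^bsub>N\<^esub> y \<odot>\<^bsub>N\<^esub> \<psi> x \<in> B" by blast
  have yq: "(\<lambda>x. y \<odot>\<^bsub>N\<^esub> \<psi> x) \<in> fin_supp (T i) N A" by (rule fin_supp_smult[OF N A q(1) y])
  have e: "\<phi> \<ominus>\<^bsub>copower (T i) N\<^esub> (\<lambda>x. y \<odot>\<^bsub>N\<^esub> \<psi> x) \<in> fin_supp (T i) N B"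
    using fin_supp_minus[OF N A p yq] q(2) copower_minus[OF N sA[OF p] sA[OF yq]] by (auto simp: fin_supp_def)
  define \<chi> where "\<chi> = base_change R N (s i) \<psi>"
  have x: "\<chi> \<in> fin_supp (T (Suc i)) N A" unfolding \<chi>_def by (rule base_change_fin_supp[OF N s(1) A q(1)])
  have dx: "d N i \<chi> \<in> fin_supp (T i) N A" by (rule d_fin_supp[OF N A x])
  have c: "\<chi> \<in> carrier (copower U N)" if "\<chi> \<in> fin_supp U N A" for \<chi> and U :: "'x set"
    using sA[OF that] by simp
  note Ds = mod_hom_compose[OF s(1) D]
  have yfree: "(\<lambda>u x. y \<otimes>\<^bsub>R\<^esub> u x) \<in> mod_hom R (free_module_on R U) (free_module_on R U)" for U :: "'x set"
    using mod_hom_scale[OF module_free[OF R] mod_hom_id y] by simp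
  have "(\<lambda>x. y \<odot>\<^bsub>N\<^esub> \<psi> x) \<ominus>\<^bsub>copower (T i) N\<^esub> d N i \<chi> \<in> fin_supp (T i) N B"
  proof (cases i)
    case 0
    have "d N i \<chi> = base_change R N (\<lambda>u. D 0 (s 0 u)) \<psi>"
      unfolding \<chi>_def 0 using base_change_compose[OF N s(1) D sA] q(1) 0 by simp
    also have "\<dots> = base_change R N (\<lambda>u x. y \<otimes>\<^bsub>R\<^esub> u x) \<psi>"
      using q(1) 0 by (intro base_change_cong[OF N Ds yfree s(2)]) (auto intro: sA)
    also have "\<dots> = (\<lambda>x. y \<odot>\<^bsub>N\<^esub> \<psi> x)" by (rule base_change_scale[OF N y sA[OF q(1)]])
    finally have "d N i \<chi> = (\<lambda>x. y \<odot>\<^bsub>N\<^esub> \<psi> x)" .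
    moreover interpret P: Module.module R "copower (T i) N" by (rule P)
    have "(\<lambda>x. y \<odot>\<^bsub>N\<^esub> \<psi> x) \<ominus>\<^bsub>copower (T i) N\<^esub> (\<lambda>x. y \<odot>\<^bsub>N\<^esub> \<psi> x) = \<zero>\<^bsub>copower (T i) N\<^esub>"
      using c[OF yq] unfolding a_minus_def by (rule P.M.r_neg)
    ultimately show ?thesis using submodule_simps(2)[OF P fin_supp_submodule[OF N B]] by metis
  next
    case (Suc k)
    have "d N k \<phi> \<ominus>\<^bsub>copower (T k) N\<^esub> d N k (\<lambda>x. y \<odot>\<^bsub>N\<^esub> \<psi> x) \<in> fin_supp (T k) N B"
      using e sA[OF p] sA[OF yq] Suc by (intro d_diff[OF N B]) auto
    hence "d N k (\<lambda>x. y \<odot>\<^bsub>N\<^esub> \<psi> x) \<in> fin_supp (T k) N B"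
      by (rule submodule_diff_mem'[OF P fin_supp_submodule[OF N B], rotated])
        (use cyc yq Suc in \<open>auto simp: rel_cycle_def intro!: sA d_fin_supp[OF N A]\<close>)
    moreover have "d N k (\<lambda>x. y \<odot>\<^bsub>N\<^esub> \<psi> x) = (\<lambda>x. y \<odot>\<^bsub>N\<^esub> d N k \<psi> x)"
      using mod_hom_smult[OF d_hom[OF N] y, of \<psi> k] sA[OF q(1)] Suc by simp
    moreover have dA: "d N k \<psi> \<in> fin_supp (T k) N A" using d_fin_supp[OF N A] q(1) Suc by auto
    ultimately have dB: "d N k \<psi> \<in> fin_supp (T k) N B" using inj by (auto simp: fin_supp_def)
    \<comment> \<open>The second half of the homotopy formula, so the difference between y \<psi>
      and the boundary of \<chi>. It lies over \<open>B\<close> because the boundary of \<psi>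
      does.\<close>
    let ?sd = "base_change R N (s k) (d N k \<psi>)"
    have sd: "?sd \<in> fin_supp (T i) N B"
      using base_change_fin_supp[OF N s(1) B dB] Suc by simp
    have sdA: "?sd \<in> fin_supp (T i) N A" using sd sub by (auto simp: fin_supp_def)
    have pq: "\<psi> \<in> fin_supp (T (Suc k)) N (carrier N)" using sA[OF q(1)] Suc by simp
    have sD: "(\<lambda>u. s k (D k u)) \<in> mod_hom R (free_module_on R (T (Suc k))) (free_module_on R (T (Suc k)))"
      by (rule mod_hom_compose[OF D s(1)])
    have sum: "(\<lambda>u x. D (Suc k) (s (Suc k) u) x \<oplus>\<^bsub>R\<^esub> s k (D k u) x) \<in>
        mod_hom R (free_module_on R (T (Suc k))) (free_module_on R (T (Suc k)))"
      using mod_hom_add_hom[OF module_free[OF R] Ds sD] by simp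
    have "(\<lambda>x. y \<odot>\<^bsub>N\<^esub> \<psi> x) = base_change R N (\<lambda>u x. y \<otimes>\<^bsub>R\<^esub> u x) \<psi>"
      by (rule base_change_scale[OF N y sA[OF q(1)], symmetric])
    also have "\<dots> = base_change R N (\<lambda>u x. D (Suc k) (s (Suc k) u) x \<oplus>\<^bsub>R\<^esub> s k (D k u) x) \<psi>"
      using s(3) by (intro base_change_cong[OF N yfree sum _ pq]) auto
    also have "\<dots> = (\<lambda>x. base_change R N (\<lambda>u. D (Suc k) (s (Suc k) u)) \<psi> x \<oplus>\<^bsub>N\<^esub>
        base_change R N (\<lambda>u. s k (D k u)) \<psi> x)"
      by (rule base_change_add[OF N Ds sD pq])
    also have "\<dots> = d N i \<chi> \<oplus>\<^bsub>copower (T i) N\<^esub> ?sd"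
      using base_change_compose[OF N D s(1) pq] base_change_compose[OF N s(1) D pq]
      by (simp add: \<chi>_def Suc)
    finally have eq: "(\<lambda>x. y \<odot>\<^bsub>N\<^esub> \<psi> x) = d N i \<chi> \<oplus>\<^bsub>copower (T i) N\<^esub> ?sd" .
    interpret P: Module.module R "copower (T i) N" by (rule P)
    have "(\<lambda>x. y \<odot>\<^bsub>N\<^esub> \<psi> x) \<ominus>\<^bsub>copower (T i) N\<^esub> d N i \<chi> = ?sd"
      unfolding eq using c[OF dx] c[OF sdA] by (rule P.M.add_diff_cancel_left)
    thus ?thesis using sd by simp
  qed
  hence "\<phi> \<ominus>\<^bsub>copower (T i) N\<^esub> d N i \<chi> \<in> fin_supp (T i) N B"
    using submodule_diff_trans[OF P fin_supp_submodule[OF N B] c[OF p] c[OF yq] c[OF dx] e] by blast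
  thus "\<exists>\<psi>\<in>fin_supp (T (Suc i)) N A. \<phi> \<ominus>\<^bsub>copower (T i) N\<^esub> d N i \<psi> \<in> fin_supp (T i) N B"
    using x by blast
qed

end
section \<open>Cohomology of the torsion subcomplexes\<close>

text \<open>\<open>divisible\<close> is an elementwise substitute for the surjectivity of an
  injective module onto its localization at \<open>r\<close>: \<open>e'\<close> is the quotient of
  \<open>e\<close> by r^n up to r-power torsion, and the factor r^N absorbs that torsion. The clause
  on annihilators keeps \<open>e'\<close> torsion with respect to every element for which
  \<open>e\<close> is.\<close>

locale divisible_complex =
  fixes R :: "'a ring" and E :: "nat \<Rightarrow> ('a, 'c) module" and \<delta> :: "nat \<Rightarrow> 'c \<Rightarrow> 'c" and y :: "nat \<Rightarrow> 'a"
  assumes E: "Module.module R (E i)"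
    and \<delta>: "\<delta> i \<in> mod_hom R (E i) (E (Suc i))"
    and exact: "\<delta> i ` carrier (E i) = {x \<in> carrier (E (Suc i)). \<delta> (Suc i) x = \<zero>\<^bsub>E (Suc (Suc i))\<^esub>}"
    and y: "y l \<in> carrier R"
    and divisible: "r \<in> carrier R \<Longrightarrow> e \<in> carrier (E i) \<Longrightarrow>
      \<exists>N::nat. \<exists>e'\<in>carrier (E i). r [^]\<^bsub>R\<^esub> (N + n) \<odot>\<^bsub>E i\<^esub> e' = r [^]\<^bsub>R\<^esub> N \<odot>\<^bsub>E i\<^esub> e \<and>
        (\<forall>s\<in>carrier R. s \<odot>\<^bsub>E i\<^esub> e = \<zero>\<^bsub>E i\<^esub> \<longrightarrow> s \<odot>\<^bsub>E i\<^esub> e' = \<zero>\<^bsub>E i\<^esub>)"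
begin

sublocale R: cring R
  using E module.axioms(1) by blast

lemma pow_closed [simp]: "y l [^]\<^bsub>R\<^esub> (n::nat) \<in> carrier R"
  using y by simp

definition tors :: "nat \<Rightarrow> nat \<Rightarrow> 'c set" where
  "tors j i = {e \<in> carrier (E i). \<forall>l<j. \<exists>n::nat. y l [^]\<^bsub>R\<^esub> n \<odot>\<^bsub>E i\<^esub> e = \<zero>\<^bsub>E i\<^esub>}"

lemma tors_0: "tors 0 i = carrier (E i)"
  by (simp add: tors_def)

lemma tors_Suc: "tors (Suc j) i = {e \<in> tors j i. \<exists>n::nat. y j [^]\<^bsub>R\<^esub> n \<odot>\<^bsub>E i\<^esub> e = \<zero>\<^bsub>E i\<^esub>}"
  by (auto simp: tors_def less_Suc_eq)

lemma tors_carrier: "e \<in> tors j i \<Longrightarrow> e \<in> carrier (E i)"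
  by (simp add: tors_def)

lemma tors_Suc_subset: "tors (Suc j) i \<subseteq> tors j i"
  by (auto simp: tors_Suc)

lemma tors_submodule: "submodule (tors j i) R (E i)"
proof -
  interpret M: Module.module R "E i" by (rule E)
  have more: "y l [^]\<^bsub>R\<^esub> (m + n) \<odot>\<^bsub>E i\<^esub> e = \<zero>\<^bsub>E i\<^esub>"
    if "y l [^]\<^bsub>R\<^esub> n \<odot>\<^bsub>E i\<^esub> e = \<zero>\<^bsub>E i\<^esub>" "e \<in> carrier (E i)" for l e and m n :: nat
    using that y by (simp add: R.nat_pow_mult[symmetric] M.smult_assoc1)
  show ?thesis
  proof (rule M.submoduleI)
    fix a b assume ab: "a \<in> tors j i" "b \<in> tors j i"
    show "a \<oplus>\<^bsub>E i\<^esub> b \<in> tors j i"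
      unfolding tors_def
    proof (intro CollectI conjI allI impI)
      fix l assume "l < j"
      then obtain m n :: nat where "y l [^]\<^bsub>R\<^esub> m \<odot>\<^bsub>E i\<^esub> a = \<zero>\<^bsub>E i\<^esub>" "y l [^]\<^bsub>R\<^esub> n \<odot>\<^bsub>E i\<^esub> b = \<zero>\<^bsub>E i\<^esub>"
        using ab unfolding tors_def by blast
      hence "y l [^]\<^bsub>R\<^esub> (m + n) \<odot>\<^bsub>E i\<^esub> (a \<oplus>\<^bsub>E i\<^esub> b) = \<zero>\<^bsub>E i\<^esub>"
        using more[of l n b m] more[of l m a n] ab y
        by (simp add: tors_carrier M.smult_r_distr add.commute[of m])
      thus "\<exists>n::nat. y l [^]\<^bsub>R\<^esub> n \<odot>\<^bsub>E i\<^esub> (a \<oplus>\<^bsub>E i\<^esub> b) = \<zero>\<^bsub>E i\<^esub>" by blast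
    qed (use ab in \<open>simp add: tors_carrier\<close>)
  next
    fix r e assume r: "r \<in> carrier R" and e: "e \<in> tors j i"
    show "r \<odot>\<^bsub>E i\<^esub> e \<in> tors j i"
      unfolding tors_def
    proof (intro CollectI conjI allI impI)
      fix l assume "l < j"
      then obtain n :: nat where "y l [^]\<^bsub>R\<^esub> n \<odot>\<^bsub>E i\<^esub> e = \<zero>\<^bsub>E i\<^esub>" using e by (auto simp: tors_def)
      hence "y l [^]\<^bsub>R\<^esub> n \<odot>\<^bsub>E i\<^esub> (r \<odot>\<^bsub>E i\<^esub> e) = \<zero>\<^bsub>E i\<^esub>"
        using r e by (simp add: tors_carrier M.smult_assoc1[symmetric] R.m_comm[of "y l [^]\<^bsub>R\<^esub> n"])
          (simp add: tors_carrier M.smult_assoc1)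
      thus "\<exists>n::nat. y l [^]\<^bsub>R\<^esub> n \<odot>\<^bsub>E i\<^esub> (r \<odot>\<^bsub>E i\<^esub> e) = \<zero>\<^bsub>E i\<^esub>" by blast
    qed (use r e in \<open>simp add: tors_carrier\<close>)
  qed (auto simp: tors_def M.smult_r_minus)
qed

lemma \<delta>_tors:
  assumes "e \<in> tors j i" shows "\<delta> i e \<in> tors j (Suc i)"
  unfolding tors_def
proof (intro CollectI conjI allI impI)
  fix l assume "l < j"
  then obtain n :: nat where "y l [^]\<^bsub>R\<^esub> n \<odot>\<^bsub>E i\<^esub> e = \<zero>\<^bsub>E i\<^esub>" using assms by (auto simp: tors_def)
  hence "y l [^]\<^bsub>R\<^esub> n \<odot>\<^bsub>E (Suc i)\<^esub> \<delta> i e = \<zero>\<^bsub>E (Suc i)\<^esub>"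
    using mod_hom_smult[OF \<delta> pow_closed tors_carrier[OF assms], of l n] mod_hom_zero[OF E E \<delta>, of i]
    by simp
  thus "\<exists>n::nat. y l [^]\<^bsub>R\<^esub> n \<odot>\<^bsub>E (Suc i)\<^esub> \<delta> i e = \<zero>\<^bsub>E (Suc i)\<^esub>" by blast
qed (use assms in \<open>auto intro: mod_hom_closed[OF \<delta>] tors_carrier\<close>)

lemma \<delta>_\<delta>: "e \<in> carrier (E i) \<Longrightarrow> \<delta> (Suc i) (\<delta> i e) = \<zero>\<^bsub>E (Suc (Suc i))\<^esub>"
  using exact[of i] by blast

lemma divisible_tors:
  fixes n :: nat
  assumes "e \<in> tors j i" "r \<in> carrier R"
  shows "\<exists>N::nat. \<exists>e'\<in>tors j i. r [^]\<^bsub>R\<^esub> (N + n) \<odot>\<^bsub>E i\<^esub> e' = r [^]\<^bsub>R\<^esub> N \<odot>\<^bsub>E i\<^esub> e"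
proof -
  obtain N :: nat and e' where e': "e' \<in> carrier (E i)" "r [^]\<^bsub>R\<^esub> (N + n) \<odot>\<^bsub>E i\<^esub> e' = r [^]\<^bsub>R\<^esub> N \<odot>\<^bsub>E i\<^esub> e"
    "\<And>s. s \<in> carrier R \<Longrightarrow> s \<odot>\<^bsub>E i\<^esub> e = \<zero>\<^bsub>E i\<^esub> \<Longrightarrow> s \<odot>\<^bsub>E i\<^esub> e' = \<zero>\<^bsub>E i\<^esub>"
    using divisible[OF assms(2) tors_carrier[OF assms(1)], of n] by blast
  hence "e' \<in> tors j i" using assms(1) e'(3)[OF pow_closed] unfolding tors_def by blast
  thus ?thesis using e'(2) by blast
qed

text \<open>\<open>tors j\<close> is the torsion functor of the ideal generated by \<open>j\<close> elements; each of them raises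
  the cohomological dimension by at most one.\<close>

lemma tors_vanishing:
  assumes "j \<le> i" "z \<in> tors j (Suc i)" "\<delta> (Suc i) z = \<zero>\<^bsub>E (Suc (Suc i))\<^esub>"
  shows "\<exists>w\<in>tors j i. \<delta> i w = z"
  using assms
proof (induction j arbitrary: i z)
  case 0
  hence "z \<in> \<delta> i ` carrier (E i)" unfolding exact by (simp add: tors_0)
  thus ?case by (auto simp: tors_0)
next
  case (Suc j)
  interpret M: Module.module R "E i" by (rule E)
  interpret M': Module.module R "E (Suc i)" by (rule E)
  \<comment> \<open>The induction hypothesis is needed once more, one degree lower and with one
    element fewer; this keeps the bound \<open>j \<le> i\<close> in balance.\<close>
  obtain k where k: "i = Suc k" "j \<le> k" using Suc.prems(1) by (cases i) auto
  interpret K: Module.module R "E k" by (rule E)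
  have z: "z \<in> tors j (Suc i)" using Suc.prems(2) tors_Suc_subset by blast
  obtain w where w: "w \<in> tors j i" "\<delta> i w = z"
    using Suc.IH[OF _ z Suc.prems(3)] Suc.prems(1) by auto
  obtain n :: nat where n: "y j [^]\<^bsub>R\<^esub> n \<odot>\<^bsub>E (Suc i)\<^esub> z = \<zero>\<^bsub>E (Suc i)\<^esub>"
    using Suc.prems(2) by (auto simp: tors_Suc)
  have yw: "y j [^]\<^bsub>R\<^esub> n \<odot>\<^bsub>E i\<^esub> w \<in> tors j i"
    using submodule_simps(6)[OF E tors_submodule _ w(1)] by simp
  have "\<delta> i (y j [^]\<^bsub>R\<^esub> n \<odot>\<^bsub>E i\<^esub> w) = \<zero>\<^bsub>E (Suc i)\<^esub>"
    using mod_hom_smult[OF \<delta> pow_closed tors_carrier[OF w(1)]] w(2) n by simp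
  then obtain u where u: "u \<in> tors j k" "\<delta> k u = y j [^]\<^bsub>R\<^esub> n \<odot>\<^bsub>E i\<^esub> w"
    using Suc.IH[OF k(2), of "y j [^]\<^bsub>R\<^esub> n \<odot>\<^bsub>E i\<^esub> w"] yw k(1) by auto
  \<comment> \<open>\<open>w\<close> lifts \<open>z\<close> but is torsion only for the first
    \<open>j\<close> elements. As (y j)^n w is the coboundary of \<open>u\<close>, dividing
    \<open>u\<close> by (y j)^n up to a further power N gives \<open>u'\<close> such that w -
    \<delta> u' is killed by (y j)^(N+n) and still has coboundary \<open>z\<close>.\<close>
  obtain N :: nat and u' where u': "u' \<in> tors j k" "y j [^]\<^bsub>R\<^esub> (N + n) \<odot>\<^bsub>E k\<^esub> u' = y j [^]\<^bsub>R\<^esub> N \<odot>\<^bsub>E k\<^esub> u"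
    using divisible_tors[OF u(1) y[of j], of n] by blast
  have du': "\<delta> k u' \<in> tors j i" using \<delta>_tors[OF u'(1)] k(1) by simp
  let ?w = "w \<ominus>\<^bsub>E i\<^esub> \<delta> k u'"
  have wt: "?w \<in> tors j i" by (rule submodule_simps(4)[OF E tors_submodule w(1) du'])
  have "y j [^]\<^bsub>R\<^esub> (N + n) \<odot>\<^bsub>E i\<^esub> \<delta> k u' = \<delta> k (y j [^]\<^bsub>R\<^esub> N \<odot>\<^bsub>E k\<^esub> u)"
    using mod_hom_smult[OF \<delta>[of k] pow_closed tors_carrier[OF u'(1)], of j "N + n"] u'(2) k(1) by simp
  also have "\<dots> = y j [^]\<^bsub>R\<^esub> N \<odot>\<^bsub>E i\<^esub> (y j [^]\<^bsub>R\<^esub> n \<odot>\<^bsub>E i\<^esub> w)"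
    using mod_hom_smult[OF \<delta>[of k] pow_closed tors_carrier[OF u(1)], of j N] u(2) k(1) by simp
  also have "\<dots> = y j [^]\<^bsub>R\<^esub> (N + n) \<odot>\<^bsub>E i\<^esub> w"
    using tors_carrier[OF w(1)] y by (simp add: R.nat_pow_mult[symmetric] M.smult_assoc1)
  finally have "y j [^]\<^bsub>R\<^esub> (N + n) \<odot>\<^bsub>E i\<^esub> ?w = \<zero>\<^bsub>E i\<^esub>"
    using tors_carrier[OF w(1)] tors_carrier[OF du'] M.smult_closed[OF pow_closed[of j "N + n"]]
    by (simp add: a_minus_def M.smult_r_distr M.smult_r_minus M.M.r_neg)
  hence "?w \<in> tors (Suc j) i" using wt by (auto simp: tors_Suc)
  moreover have "\<delta> i ?w = z"
  proof -
    have "\<delta> i ?w = \<delta> i w \<ominus>\<^bsub>E (Suc i)\<^esub> \<delta> i (\<delta> k u')"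
      by (rule mod_hom_minus[OF E E \<delta> tors_carrier[OF w(1)] tors_carrier[OF du']])
    also have "\<delta> i (\<delta> k u') = \<zero>\<^bsub>E (Suc i)\<^esub>" using \<delta>_\<delta>[OF tors_carrier[OF u'(1)]] k(1) by simp
    finally show ?thesis using w(2) tors_carrier[OF z] M'.M.diff_zero_right by simp
  qed
  ultimately show ?case by blast
qed

text \<open>Together with \<open>tors_Suc_reflect\<close> this makes \<open>y j\<close> bijective on
  \<open>tors j\<close> modulo \<open>tors (Suc j)\<close>. The equation relating \<open>e'\<close>
  and \<open>e\<close> is recorded as well, since it also controls the coboundary of
  \<open>e'\<close>.\<close>

lemma tors_near_divisible:
  assumes e: "e \<in> tors j i"
  shows "\<exists>e'\<in>tors j i. e \<ominus>\<^bsub>E i\<^esub> y j \<odot>\<^bsub>E i\<^esub> e' \<in> tors (Suc j) i \<and>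
    (\<exists>N::nat. y j [^]\<^bsub>R\<^esub> (N + 1) \<odot>\<^bsub>E i\<^esub> e' = y j [^]\<^bsub>R\<^esub> N \<odot>\<^bsub>E i\<^esub> e)"
proof -
  interpret M: Module.module R "E i" by (rule E)
  obtain N :: nat and e' where e': "e' \<in> tors j i" "y j [^]\<^bsub>R\<^esub> (N + 1) \<odot>\<^bsub>E i\<^esub> e' = y j [^]\<^bsub>R\<^esub> N \<odot>\<^bsub>E i\<^esub> e"
    using divisible_tors[OF e y[of j], of 1] by blast
  have c: "e \<in> carrier (E i)" "e' \<in> carrier (E i)" using e e' tors_carrier by auto
  have eq: "y j [^]\<^bsub>R\<^esub> N \<odot>\<^bsub>E i\<^esub> (y j \<odot>\<^bsub>E i\<^esub> e') = y j [^]\<^bsub>R\<^esub> N \<odot>\<^bsub>E i\<^esub> e"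
    using e'(2) c y[of j] by (simp add: M.smult_assoc1)
  have "y j [^]\<^bsub>R\<^esub> N \<odot>\<^bsub>E i\<^esub> (e \<ominus>\<^bsub>E i\<^esub> y j \<odot>\<^bsub>E i\<^esub> e') = \<zero>\<^bsub>E i\<^esub>"
    using c y M.smult_closed[OF pow_closed[of j N] c(1)]
    by (simp add: a_minus_def M.smult_r_distr M.smult_r_minus eq M.M.r_neg)
  moreover have "e \<ominus>\<^bsub>E i\<^esub> y j \<odot>\<^bsub>E i\<^esub> e' \<in> tors j i"
    by (intro submodule_simps(4,6)[OF E tors_submodule] e e' y)
  ultimately show ?thesis using e' by (auto simp: tors_Suc)
qed

lemma tors_Suc_reflect:
  assumes "e \<in> tors j i" "y j \<odot>\<^bsub>E i\<^esub> e \<in> tors (Suc j) i"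
  shows "e \<in> tors (Suc j) i"
proof -
  interpret M: Module.module R "E i" by (rule E)
  obtain n :: nat where "y j [^]\<^bsub>R\<^esub> n \<odot>\<^bsub>E i\<^esub> (y j \<odot>\<^bsub>E i\<^esub> e) = \<zero>\<^bsub>E i\<^esub>" using assms(2) by (auto simp: tors_Suc)
  hence "y j [^]\<^bsub>R\<^esub> (Suc n) \<odot>\<^bsub>E i\<^esub> e = \<zero>\<^bsub>E i\<^esub>"
    using tors_carrier[OF assms(1)] y by (simp add: M.smult_assoc1)
  thus ?thesis using assms(1) unfolding tors_Suc by blast
qed

end

text \<open>Here d = p + 2. The last two assumptions say that the torsion subcomplex has no
  cohomology in degrees 0 and 1, ..., p + 1, that is, below d; this is how the depth of
  \<open>R\<close> is used.\<close>

locale tor_setup = free_complex R T D + divisible_complex R E \<delta> y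
  for R :: "'a ring" and T :: "nat \<Rightarrow> 'x set" and D :: "nat \<Rightarrow> ('x \<Rightarrow> 'a) \<Rightarrow> 'x \<Rightarrow> 'a"
    and E :: "nat \<Rightarrow> ('a, 'c) module" and \<delta> :: "nat \<Rightarrow> 'c \<Rightarrow> 'c" and y :: "nat \<Rightarrow> 'a" +
  fixes p :: nat
  assumes null: "l < Suc (Suc p) \<Longrightarrow> null_homotopic (y l)"
    and below_0: "z \<in> tors (Suc (Suc p)) 0 \<Longrightarrow> \<delta> 0 z = \<zero>\<^bsub>E 1\<^esub> \<Longrightarrow> z = \<zero>\<^bsub>E 0\<^esub>"
    and below_Suc: "i < Suc p \<Longrightarrow> z \<in> tors (Suc (Suc p)) (Suc i) \<Longrightarrow> \<delta> (Suc i) z = \<zero>\<^bsub>E (Suc (Suc i))\<^esub> \<Longrightarrow>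
      \<exists>w\<in>tors (Suc (Suc p)) i. \<delta> i w = z"
begin

abbreviation G :: "nat \<Rightarrow> 'c set" where "G \<equiv> tors (Suc (Suc p))"

text \<open>The module called \<open>S\<^sup>i\<close> in the overview.\<close>

definition pre_G :: "nat \<Rightarrow> 'c set" where
  "pre_G i = {e \<in> carrier (E i). \<delta> i e \<in> G (Suc i)}"

text \<open>Coboundaries plus torsion, indexed by the degree from which the coboundaries come: the
  elements lie in degree \<open>Suc i\<close>, and \<open>im_plus_G p\<close> is the V of the
  overview.\<close>

definition im_plus_G :: "nat \<Rightarrow> 'c set" where
  "im_plus_G i = {x \<in> carrier (E (Suc i)). \<exists>w\<in>carrier (E i). x \<ominus>\<^bsub>E (Suc i)\<^esub> \<delta> i w \<in> G (Suc i)}"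

lemma pre_G_submodule: "submodule (pre_G i) R (E i)"
  unfolding pre_G_def by (rule submodule_vimage[OF E E \<delta> tors_submodule])

lemma G_sub_pre_G: "G i \<subseteq> pre_G i"
  using \<delta>_tors tors_carrier by (auto simp: pre_G_def)

lemma im_plus_G_submodule: "submodule (im_plus_G i) R (E (Suc i))"
proof -
  interpret M: Module.module R "E i" by (rule E)
  interpret M': Module.module R "E (Suc i)" by (rule E)
  note c = mod_hom_closed[OF \<delta>[of i]]
  note s = submodule_simps[OF E tors_submodule]
  show ?thesis
  proof (rule M'.submoduleI)
    show "\<zero>\<^bsub>E (Suc i)\<^esub> \<in> im_plus_G i"
      using s(2)[of "Suc i"] mod_hom_zero[OF E E \<delta>[of i]] M'.M.diff_zero_right
      by (auto simp: im_plus_G_def intro!: bexI[of _ "\<zero>\<^bsub>E i\<^esub>"])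
  next
    fix a b assume "a \<in> im_plus_G i" "b \<in> im_plus_G i"
    then obtain v w where vw: "a \<in> carrier (E (Suc i))" "b \<in> carrier (E (Suc i))"
      "v \<in> carrier (E i)" "w \<in> carrier (E i)"
      "a \<ominus>\<^bsub>E (Suc i)\<^esub> \<delta> i v \<in> G (Suc i)" "b \<ominus>\<^bsub>E (Suc i)\<^esub> \<delta> i w \<in> G (Suc i)"
      by (auto simp: im_plus_G_def)
    have "(a \<oplus>\<^bsub>E (Suc i)\<^esub> b) \<ominus>\<^bsub>E (Suc i)\<^esub> \<delta> i (v \<oplus>\<^bsub>E i\<^esub> w) =
        (a \<ominus>\<^bsub>E (Suc i)\<^esub> \<delta> i v) \<oplus>\<^bsub>E (Suc i)\<^esub> (b \<ominus>\<^bsub>E (Suc i)\<^esub> \<delta> i w)"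
      using vw(1-4) c mod_hom_add[OF \<delta>[of i]] by (simp add: a_minus_def M'.M.minus_add M'.M.a_ac)
    thus "a \<oplus>\<^bsub>E (Suc i)\<^esub> b \<in> im_plus_G i"
      using s(3)[OF vw(5,6)] vw(1-4) by (auto simp: im_plus_G_def intro!: bexI[of _ "v \<oplus>\<^bsub>E i\<^esub> w"])
  next
    fix r a assume r: "r \<in> carrier R" and "a \<in> im_plus_G i"
    then obtain v where v: "a \<in> carrier (E (Suc i))" "v \<in> carrier (E i)" "a \<ominus>\<^bsub>E (Suc i)\<^esub> \<delta> i v \<in> G (Suc i)"
      by (auto simp: im_plus_G_def)
    have "(r \<odot>\<^bsub>E (Suc i)\<^esub> a) \<ominus>\<^bsub>E (Suc i)\<^esub> \<delta> i (r \<odot>\<^bsub>E i\<^esub> v) = r \<odot>\<^bsub>E (Suc i)\<^esub> (a \<ominus>\<^bsub>E (Suc i)\<^esub> \<delta> i v)"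
      using v(1,2) c r mod_hom_smult[OF \<delta>[of i]] by (simp add: a_minus_def M'.smult_r_distr M'.smult_r_minus)
    thus "r \<odot>\<^bsub>E (Suc i)\<^esub> a \<in> im_plus_G i"
      using s(6)[OF r v(3)] v(1,2) r by (auto simp: im_plus_G_def intro!: bexI[of _ "r \<odot>\<^bsub>E i\<^esub> v"])
  next
    fix a assume "a \<in> im_plus_G i"
    then obtain v where v: "a \<in> carrier (E (Suc i))" "v \<in> carrier (E i)" "a \<ominus>\<^bsub>E (Suc i)\<^esub> \<delta> i v \<in> G (Suc i)"
      by (auto simp: im_plus_G_def)
    have "\<delta> i (\<ominus>\<^bsub>E i\<^esub> v) = \<ominus>\<^bsub>E (Suc i)\<^esub> \<delta> i v"
      using mod_hom_minus[OF E E \<delta>, of "\<zero>\<^bsub>E i\<^esub>" i v] v(2) c mod_hom_zero[OF E E \<delta>[of i]]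
      by (simp add: a_minus_def)
    hence "(\<ominus>\<^bsub>E (Suc i)\<^esub> a) \<ominus>\<^bsub>E (Suc i)\<^esub> \<delta> i (\<ominus>\<^bsub>E i\<^esub> v) = \<ominus>\<^bsub>E (Suc i)\<^esub> (a \<ominus>\<^bsub>E (Suc i)\<^esub> \<delta> i v)"
      using v(1,2) c by (simp add: a_minus_def M'.M.minus_add)
    thus "\<ominus>\<^bsub>E (Suc i)\<^esub> a \<in> im_plus_G i"
      using s(5)[OF v(3)] v(1,2) by (auto simp: im_plus_G_def intro!: bexI[of _ "\<ominus>\<^bsub>E i\<^esub> v"])
  qed (auto simp: im_plus_G_def)
qed

lemma G_sub_im_plus_G: "G (Suc i) \<subseteq> im_plus_G i"
proof
  interpret M: Module.module R "E i" by (rule E)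
  interpret M': Module.module R "E (Suc i)" by (rule E)
  fix g assume g: "g \<in> G (Suc i)"
  thus "g \<in> im_plus_G i"
    using mod_hom_zero[OF E E \<delta>[of i]] M'.M.diff_zero_right tors_carrier[OF g]
    by (auto simp: im_plus_G_def intro!: bexI[of _ "\<zero>\<^bsub>E i\<^esub>"])
qed

lemma im_plus_G_sub_pre_G: "im_plus_G i \<subseteq> pre_G (Suc i)"
proof
  fix x assume "x \<in> im_plus_G i"
  then obtain w where w: "x \<in> carrier (E (Suc i))" "w \<in> carrier (E i)" "x \<ominus>\<^bsub>E (Suc i)\<^esub> \<delta> i w \<in> G (Suc i)"
    by (auto simp: im_plus_G_def)
  interpret M': Module.module R "E (Suc (Suc i))" by (rule E)
  have "\<delta> (Suc i) (x \<ominus>\<^bsub>E (Suc i)\<^esub> \<delta> i w) = \<delta> (Suc i) x"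
    using mod_hom_minus[OF E E \<delta> w(1) mod_hom_closed[OF \<delta> w(2)]] \<delta>_\<delta>[OF w(2)]
      mod_hom_closed[OF \<delta> w(1)] M'.M.diff_zero_right by simp
  thus "x \<in> pre_G (Suc i)" using \<delta>_tors[OF w(3)] w(1) by (simp add: pre_G_def)
qed

text \<open>If the coboundary of x lies in \<open>G\<close>, it is a cocycle there, hence the
  coboundary of some g in \<open>G\<close>. Then x - g is a cocycle of \<open>E\<close>, so a
  coboundary. The bound on \<open>i\<close> keeps the degree \<open>i + 2\<close> of the cocycle
  below d.\<close>

lemma pre_G_Suc:
  assumes "i < p" shows "pre_G (Suc i) = im_plus_G i"
proof
  show "pre_G (Suc i) \<subseteq> im_plus_G i"
  proof
    interpret M: Module.module R "E (Suc i)" by (rule E)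
    interpret M': Module.module R "E (Suc (Suc i))" by (rule E)
    fix x assume "x \<in> pre_G (Suc i)"
    hence x: "x \<in> carrier (E (Suc i))" "\<delta> (Suc i) x \<in> G (Suc (Suc i))" by (auto simp: pre_G_def)
    obtain g where g: "g \<in> G (Suc i)" "\<delta> (Suc i) g = \<delta> (Suc i) x"
      using below_Suc[OF _ x(2)] \<delta>_\<delta>[OF x(1)] assms by auto
    have "\<delta> (Suc i) (x \<ominus>\<^bsub>E (Suc i)\<^esub> g) = \<zero>\<^bsub>E (Suc (Suc i))\<^esub>"
      using mod_hom_minus[OF E E \<delta> x(1) tors_carrier[OF g(1)]] g(2) mod_hom_closed[OF \<delta> x(1)]
      by (simp add: a_minus_def M'.M.r_neg)
    hence "x \<ominus>\<^bsub>E (Suc i)\<^esub> g \<in> \<delta> i ` carrier (E i)"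
      unfolding exact using x(1) tors_carrier[OF g(1)] by simp
    then obtain w where w: "w \<in> carrier (E i)" "\<delta> i w = x \<ominus>\<^bsub>E (Suc i)\<^esub> g" by force
    have "x \<ominus>\<^bsub>E (Suc i)\<^esub> \<delta> i w = g"
      using x(1) tors_carrier[OF g(1)] unfolding w(2)
      by (simp add: a_minus_def M.M.minus_add M.M.r_neg2)
    thus "x \<in> im_plus_G i" using x(1) w(1) g(1) by (auto simp: im_plus_G_def)
  qed
qed (rule im_plus_G_sub_pre_G)

lemma rel_exact_refl:
  assumes N: "Module.module R N" and A: "submodule A R N"
  shows "rel_exact N n A A"
  unfolding rel_exact_def
proof (intro ballI impI)
  fix \<phi> assume "\<phi> \<in> fin_supp (T n) N A"
  moreover have z: "(\<lambda>_. \<zero>\<^bsub>N\<^esub>) \<in> fin_supp (T (Suc n)) N A"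
    by (rule fin_supp_zero[OF submodule_simps(2)[OF N A]])
  ultimately show "\<exists>\<psi>\<in>fin_supp (T (Suc n)) N A. \<phi> \<ominus>\<^bsub>copower (T n) N\<^esub> d N n \<psi> \<in> fin_supp (T n) N A"
    using submodule_simps(4)[OF module_copower[OF N] fin_supp_submodule[OF N A] _ d_fin_supp[OF N A z]] by blast
qed

lemma E_mod_G_exact: "rel_exact (E i) n (carrier (E i)) (G i)"
proof -
  interpret M: Module.module R "E i" by (rule E)
  have "j \<le> Suc (Suc p) \<Longrightarrow> rel_exact (E i) n (tors 0 i) (tors j i)" for j
  proof (induction j)
    case 0 show ?case by (rule rel_exact_refl[OF E tors_submodule])
  next
    case (Suc j)
    have "rel_exact (E i) n (tors j i) (tors (Suc j) i)"
      using Suc.prems tors_near_divisible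
      by (intro rel_exact_invertible[OF E tors_submodule tors_submodule tors_Suc_subset y[of j] null])
        (blast intro: tors_Suc_reflect | simp)+
    moreover have "tors j i \<subseteq> tors 0 i" by (auto simp: tors_def)
    moreover have "rel_exact (E i) n (tors 0 i) (tors j i)" using Suc by simp
    ultimately show ?case
      by (blast intro: rel_exact_trans[OF E tors_submodule tors_submodule tors_submodule tors_Suc_subset])
  qed
  thus ?thesis by (simp add: tors_0)
qed

text \<open>The filtration by \<open>tors j\<close> is intersected with \<open>pre_G\<close>.
  Injectivity of \<open>y j\<close> on the successive quotients is inherited; surjectivity is the
  difficulty, because the quotient of an element by \<open>y j\<close> need not have its coboundary
  in \<open>G\<close>.\<close>

lemma pre_G_mod_G_exact: "rel_exact (E (Suc p)) n (pre_G (Suc p)) (G (Suc p))"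
proof -
  let ?E = "E (Suc p)" and ?E' = "E (Suc (Suc p))"
  interpret M: Module.module R ?E by (rule E)
  interpret M': Module.module R ?E' by (rule E)
  define P where "P j = tors j (Suc p) \<inter> pre_G (Suc p)" for j
  have Psub: "submodule (P j) R ?E" for j
    unfolding P_def by (rule submodule_Int[OF E tors_submodule pre_G_submodule])
  have P_Suc: "P (Suc j) \<subseteq> P j" for j using tors_Suc_subset by (auto simp: P_def)
  have surj: "\<exists>a'\<in>P j. a \<ominus>\<^bsub>?E\<^esub> y j \<odot>\<^bsub>?E\<^esub> a' \<in> P (Suc j)" if a: "a \<in> P j" and j: "j < Suc (Suc p)" for a j
  proof -
    have aE: "a \<in> tors j (Suc p)" "a \<in> carrier ?E" "\<delta> (Suc p) a \<in> G (Suc (Suc p))"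
      using a by (auto simp: P_def pre_G_def)
    obtain e and N :: nat where e: "e \<in> tors j (Suc p)" "a \<ominus>\<^bsub>?E\<^esub> y j \<odot>\<^bsub>?E\<^esub> e \<in> tors (Suc j) (Suc p)"
      "y j [^]\<^bsub>R\<^esub> (N + 1) \<odot>\<^bsub>?E\<^esub> e = y j [^]\<^bsub>R\<^esub> N \<odot>\<^bsub>?E\<^esub> a"
      using tors_near_divisible[OF aE(1)] by blast
    note eE = tors_carrier[OF e(1)]
    \<comment> \<open>The relation between \<open>e\<close> and \<open>a\<close> passes to
      coboundaries; since that of \<open>a\<close> is power torsion for \<open>y j\<close>, so is
      that of \<open>e\<close>.\<close>
    have "y j [^]\<^bsub>R\<^esub> (N + 1) \<odot>\<^bsub>?E'\<^esub> \<delta> (Suc p) e = y j [^]\<^bsub>R\<^esub> N \<odot>\<^bsub>?E'\<^esub> \<delta> (Suc p) a"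
      using mod_hom_smult[OF \<delta> pow_closed eE] mod_hom_smult[OF \<delta> pow_closed aE(2)] e(3) by metis
    also have "\<dots> \<in> tors (Suc j) (Suc (Suc p))"
    proof -
      have "\<delta> (Suc p) a \<in> tors (Suc j) (Suc (Suc p))" using aE(3) j by (auto simp: tors_def)
      thus ?thesis using submodule_simps(6)[OF E tors_submodule pow_closed] by blast
    qed
    finally obtain n :: nat where "y j [^]\<^bsub>R\<^esub> n \<odot>\<^bsub>?E'\<^esub> (y j [^]\<^bsub>R\<^esub> (N + 1) \<odot>\<^bsub>?E'\<^esub> \<delta> (Suc p) e) = \<zero>\<^bsub>?E'\<^esub>"
      by (auto simp: tors_Suc)
    hence "y j [^]\<^bsub>R\<^esub> (n + (N + 1)) \<odot>\<^bsub>?E'\<^esub> \<delta> (Suc p) e = \<zero>\<^bsub>?E'\<^esub>"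
      using M'.smult_assoc1[OF pow_closed pow_closed mod_hom_closed[OF \<delta> eE], of j n j "N + 1"]
        R.nat_pow_mult[OF y, of j n "N + 1"] by metis
    hence de: "\<delta> (Suc p) e \<in> tors (Suc j) (Suc (Suc p))" using \<delta>_tors[OF e(1)] unfolding tors_Suc by blast
    \<comment> \<open>\<open>e\<close> may be corrected by an element of the next filtration step.
      For j < p + 1, \<open>tors_vanishing\<close> provides \<open>f\<close> with the same
      coboundary as \<open>e\<close>. For j = p + 1 that result no longer reaches, but
      \<open>tors (Suc j)\<close> is then \<open>G\<close>, the coboundary of \<open>e\<close> lies
      in it already, and f = 0 works.\<close>
    have "\<exists>f\<in>tors (Suc j) (Suc p). \<delta> (Suc p) (e \<ominus>\<^bsub>?E\<^esub> f) \<in> G (Suc (Suc p))"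
    proof (cases "j = Suc p")
      case True
      hence "\<delta> (Suc p) (e \<ominus>\<^bsub>?E\<^esub> \<zero>\<^bsub>?E\<^esub>) \<in> G (Suc (Suc p))" using de eE M.M.diff_zero_right by simp
      thus ?thesis using submodule_simps(2)[OF E tors_submodule] by blast
    next
      case False
      then obtain f where f: "f \<in> tors (Suc j) (Suc p)" "\<delta> (Suc p) f = \<delta> (Suc p) e"
        using tors_vanishing[OF _ de \<delta>_\<delta>[OF eE]] j by auto
      have "\<delta> (Suc p) (e \<ominus>\<^bsub>?E\<^esub> f) = \<zero>\<^bsub>?E'\<^esub>"
        using mod_hom_minus[OF E E \<delta> eE tors_carrier[OF f(1)]] f(2) mod_hom_closed[OF \<delta> eE]
        by (simp add: a_minus_def M'.M.r_neg)
      thus ?thesis using f(1) submodule_simps(2)[OF E tors_submodule] by metis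
    qed
    then obtain f where f: "f \<in> tors (Suc j) (Suc p)" "\<delta> (Suc p) (e \<ominus>\<^bsub>?E\<^esub> f) \<in> G (Suc (Suc p))" by blast
    let ?a' = "e \<ominus>\<^bsub>?E\<^esub> f"
    have "?a' \<in> tors j (Suc p)"
      using submodule_simps(4)[OF E tors_submodule e(1)] f(1) tors_Suc_subset by blast
    hence a': "?a' \<in> P j" using f(2) tors_carrier by (auto simp: P_def pre_G_def)
    have fE: "f \<in> carrier ?E" by (rule tors_carrier[OF f(1)])
    have eq: "a \<ominus>\<^bsub>?E\<^esub> y j \<odot>\<^bsub>?E\<^esub> ?a' = (a \<ominus>\<^bsub>?E\<^esub> y j \<odot>\<^bsub>?E\<^esub> e) \<oplus>\<^bsub>?E\<^esub> y j \<odot>\<^bsub>?E\<^esub> f"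
      using aE(2) eE fE y by (simp add: a_minus_def M.smult_r_distr M.smult_r_minus M.M.minus_add M.M.a_assoc)
    have "a \<ominus>\<^bsub>?E\<^esub> y j \<odot>\<^bsub>?E\<^esub> ?a' \<in> tors (Suc j) (Suc p)"
      unfolding eq by (rule submodule_simps(3)[OF E tors_submodule e(2) submodule_simps(6)[OF E tors_submodule y f(1)]])
    moreover have "a \<ominus>\<^bsub>?E\<^esub> y j \<odot>\<^bsub>?E\<^esub> ?a' \<in> P j"
      by (rule submodule_simps(4)[OF E Psub a submodule_simps(6)[OF E Psub y a']])
    ultimately show ?thesis using a' by (auto simp: P_def)
  qed
  have "j \<le> Suc (Suc p) \<Longrightarrow> rel_exact ?E n (P 0) (P j)" for j
  proof (induction j)
    case 0 show ?case by (rule rel_exact_refl[OF E Psub])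
  next
    case (Suc j)
    have "rel_exact ?E n (P j) (P (Suc j))"
      using Suc.prems surj
      by (intro rel_exact_invertible[OF E Psub Psub P_Suc y[of j] null])
        (simp, force simp: P_def intro: tors_Suc_reflect, simp)
    moreover have "P j \<subseteq> P 0" by (auto simp: P_def tors_def)
    moreover have "rel_exact ?E n (P 0) (P j)" using Suc by simp
    ultimately show ?case
      by (blast intro: rel_exact_trans[OF E Psub Psub Psub P_Suc])
  qed
  from this[of "Suc (Suc p)"] have "rel_exact ?E n (P 0) (P (Suc (Suc p)))" by simp
  moreover have "P 0 = pre_G (Suc p)" by (auto simp: P_def tors_0 pre_G_def)
  moreover have "P (Suc (Suc p)) = G (Suc p)" using G_sub_pre_G by (auto simp: P_def)
  ultimately show ?thesis by simp
qed

text \<open>The differential induces an isomorphism from \<open>E i\<close> modulo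
  \<open>pre_G i\<close> onto \<open>im_plus_G i\<close> modulo \<open>G (Suc i)\<close>, as
  \<open>pre_G i\<close> is the preimage of \<open>G (Suc i)\<close>.\<close>

lemma rel_exact_\<delta>:
  "rel_exact (E i) n (carrier (E i)) (pre_G i) \<longleftrightarrow> rel_exact (E (Suc i)) n (im_plus_G i) (G (Suc i))"
proof -
  interpret M: Module.module R "E i" by (rule E)
  interpret M': Module.module R "E (Suc i)" by (rule E)
  have "\<delta> i a \<in> im_plus_G i" if "a \<in> carrier (E i)" for a
    using that mod_hom_closed[OF \<delta> that] submodule_simps(2)[OF E tors_submodule]
    by (auto simp: im_plus_G_def a_minus_def M'.M.r_neg intro!: bexI[of _ a])
  thus ?thesis
    by (intro rel_exact_iso[OF E E M.carrier_is_submodule pre_G_submodule im_plus_G_submodule tors_submodule])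
      (use \<delta>[of i] G_sub_im_plus_G in \<open>auto simp: pre_G_def im_plus_G_def\<close>)
qed

theorem rel_exact_1: "rel_exact (E (Suc p)) 1 (pre_G (Suc p)) (im_plus_G p)"
proof (rule rel_exact_shift_up[OF E pre_G_submodule im_plus_G_submodule tors_submodule
      G_sub_im_plus_G im_plus_G_sub_pre_G pre_G_mod_G_exact])
  show "rel_exact (E (Suc p)) 0 (im_plus_G p) (G (Suc p))"
    unfolding rel_exact_\<delta>[symmetric] by (rule rel_exact_0_mono[OF E_mod_G_exact G_sub_pre_G])
qed

text \<open>Homological and cohomological degree fall together. One shift turns Tor in degree d for
  pre_G/im_plus_G into degree d - 1 for im_plus_G/G; each further step lowers both degrees by one,
  until Tor_0 with coefficients \<open>N\<close> is reached.\<close>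

theorem rel_exact_top:
  assumes ex: "rel_exact (E (Suc p)) (Suc (Suc p)) (pre_G (Suc p)) (im_plus_G p)"
    and N: "Module.module R N" and \<eta>: "\<eta> \<in> mod_hom R N (E 0)" "inj_on \<eta> (carrier N)"
      "\<eta> ` carrier N = {x \<in> carrier (E 0). \<delta> 0 x = \<zero>\<^bsub>E 1\<^esub>}"
  shows "rel_exact N 0 (carrier N) {\<zero>\<^bsub>N\<^esub>}"
proof -
  interpret N: Module.module R N by (rule N)
  interpret E0: Module.module R "E 0" by (rule E)
  interpret E1: Module.module R "E 1" by (rule E)
  \<comment> \<open>The differential moves the hypothesis to \<open>E j\<close> modulo
    \<open>pre_G j\<close>; since Tor with coefficients \<open>E j\<close> modulo \<open>G j\<close>
    vanishes, the remaining piece \<open>pre_G j\<close> modulo \<open>G j\<close> inherits the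
    vanishing in degree j.\<close>
  have down: "rel_exact (E j) j (pre_G j) (G j)" if "rel_exact (E (Suc j)) (Suc j) (im_plus_G j) (G (Suc j))" for j
  proof -
    interpret M: Module.module R "E j" by (rule E)
    show ?thesis
      by (rule rel_exact_shift_down[OF E M.carrier_is_submodule pre_G_submodule tors_submodule
            G_sub_pre_G _ E_mod_G_exact])
        (use that rel_exact_\<delta> in \<open>auto simp: pre_G_def\<close>)
  qed
  have "rel_exact (E (Suc p)) (Suc p) (im_plus_G p) (G (Suc p))"
    by (rule rel_exact_shift_down[OF E pre_G_submodule im_plus_G_submodule tors_submodule
          G_sub_im_plus_G im_plus_G_sub_pre_G pre_G_mod_G_exact ex])
  hence start: "rel_exact (E p) p (pre_G p) (G p)" by (rule down)
  have "rel_exact (E 0) 0 (pre_G 0) (G 0)"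
    using start
  \<comment> \<open>Descending induction from \<open>p\<close> to 0; below \<open>p\<close>,
    \<open>pre_G_Suc\<close> gives the previous result the shape that \<open>down\<close>
    expects.\<close>
  proof (rule inc_induct[of 0 p, rotated])
    show "rel_exact (E j) j (pre_G j) (G j)"
      if "j < p" "rel_exact (E (Suc j)) (Suc j) (pre_G (Suc j)) (G (Suc j))" for j
      using that down pre_G_Suc by simp
  qed simp
  \<comment> \<open>At the bottom \<eta> identifies \<open>N\<close> with \<open>pre_G 0\<close>
    modulo \<open>G 0\<close>: nonzero elements of the kernel of \<delta> are not in
    \<open>G 0\<close>, and any element of \<open>pre_G 0\<close> becomes a cocycle after
    subtracting an element of \<open>G 0\<close>.\<close>
  moreover have "rel_exact N 0 (carrier N) {\<zero>\<^bsub>N\<^esub>} \<longleftrightarrow> rel_exact (E 0) 0 (pre_G 0) (G 0)"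
  proof (rule rel_exact_iso[OF N E N.carrier_is_submodule submodule_zero[OF N] pre_G_submodule tors_submodule])
    show "\<eta> \<in> mod_hom R (N\<lparr>carrier := carrier N\<rparr>) (E 0)" using \<eta>(1) by simp
    show "G 0 \<subseteq> pre_G 0" by (rule G_sub_pre_G)
    have ker: "\<delta> 0 (\<eta> a) = \<zero>\<^bsub>E 1\<^esub>" if "a \<in> carrier N" for a using \<eta>(3) that by blast
    show "\<eta> a \<in> pre_G 0" if "a \<in> carrier N" for a
      using ker[OF that] mod_hom_closed[OF \<eta>(1) that] submodule_simps(2)[OF E tors_submodule, of 1 "Suc (Suc p)"]
      by (simp add: pre_G_def)
    show "\<eta> a \<in> G 0 \<longleftrightarrow> a \<in> {\<zero>\<^bsub>N\<^esub>}" if a: "a \<in> carrier N" for a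
    proof
      assume "\<eta> a \<in> G 0"
      hence "\<eta> a = \<eta> \<zero>\<^bsub>N\<^esub>" using below_0 ker[OF a] mod_hom_zero[OF N E \<eta>(1)] by simp
      thus "a \<in> {\<zero>\<^bsub>N\<^esub>}" using \<eta>(2) a by (simp add: inj_on_eq_iff)
    next
      assume "a \<in> {\<zero>\<^bsub>N\<^esub>}"
      thus "\<eta> a \<in> G 0" using mod_hom_zero[OF N E \<eta>(1)] submodule_simps(2)[OF E tors_submodule] by simp
    qed
    show "\<exists>a\<in>carrier N. a' \<ominus>\<^bsub>E 0\<^esub> \<eta> a \<in> G 0" if "a' \<in> pre_G 0" for a'
    proof -
      have a': "a' \<in> carrier (E 0)" "\<delta> 0 a' \<in> G 1" using that by (auto simp: pre_G_def)
      obtain g where g: "g \<in> G 0" "\<delta> 0 g = \<delta> 0 a'"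
        using below_Suc[of 0 "\<delta> 0 a'"] a'(2) \<delta>_\<delta>[OF a'(1)] by auto
      note gE = tors_carrier[OF g(1)]
      have "\<delta> 0 (a' \<ominus>\<^bsub>E 0\<^esub> g) = \<zero>\<^bsub>E 1\<^esub>"
        using mod_hom_minus[OF E E \<delta> a'(1) gE] g(2) mod_hom_closed[OF \<delta> a'(1)] E1.M.r_neg
        by (simp add: a_minus_def)
      moreover have "a' \<ominus>\<^bsub>E 0\<^esub> g \<in> carrier (E 0)" using a'(1) gE by simp
      ultimately have "a' \<ominus>\<^bsub>E 0\<^esub> g \<in> \<eta> ` carrier N" unfolding \<eta>(3) by simp
      then obtain a where a: "a \<in> carrier N" "\<eta> a = a' \<ominus>\<^bsub>E 0\<^esub> g" by force
      have "a' \<ominus>\<^bsub>E 0\<^esub> \<eta> a = g"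
        using a'(1) gE unfolding a(2) by (simp add: a_minus_def E0.M.minus_add E0.M.r_neg2)
      thus ?thesis using a(1) g(1) by auto
    qed
  qed (use submodule_simps(2)[OF E tors_submodule] in auto)
  ultimately show ?thesis by simp
qed

end
section \<open>Baer's criterion\<close>

lemma submodule_regular_iff_ideal:
  assumes "cring R"
  shows "submodule I R (regular_module R) \<longleftrightarrow> ideal I R"
proof -
  interpret cring R by fact
  interpret M: Module.module R "regular_module R" by (rule module_self[OF assms])
  have ainv: "\<ominus>\<^bsub>regular_module R\<^esub> x = \<ominus>\<^bsub>R\<^esub> x" if "x \<in> carrier R" for x
    using that M.M.minus_equality[of "\<ominus>\<^bsub>R\<^esub> x" x] by (simp add: l_neg)
  show ?thesis
  proof
    assume I: "submodule I R (regular_module R)"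
    note s = submodule_simps[OF module_self[OF assms] I, simplified]
    show "ideal I R"
    proof (rule idealI[OF ring_axioms])
      show "subgroup I (add_monoid R)"
      proof (rule subgroup.intro)
        show "inv\<^bsub>add_monoid R\<^esub> x \<in> I" if "x \<in> I" for x
          using s(5)[OF that] ainv[OF s(1)[OF that]] by (simp add: a_inv_def)
      qed (use s in auto)
      show l: "x \<otimes>\<^bsub>R\<^esub> a \<in> I" if "a \<in> I" "x \<in> carrier R" for a x using s(6) that by simp
      show "a \<otimes>\<^bsub>R\<^esub> x \<in> I" if "a \<in> I" "x \<in> carrier R" for a x
        using l[OF that] m_comm[OF s(1)[OF that(1)] that(2)] by simp
    qed
  next
    assume "ideal I R"
    then interpret I: ideal I R .
    show "submodule I R (regular_module R)"
      by (rule M.submoduleI) (use I.a_subset I.a_closed I.I_l_closed ainv in auto)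
  qed
qed

text \<open>Unlike \<open>is_injective_module\<close>, this quantifies over ideals only. It
  therefore means the same in every carrier type and can be carried from one type to
  another.\<close>

definition baer :: "'a ring \<Rightarrow> ('a, 'c) module \<Rightarrow> bool" where
  "baer R E \<longleftrightarrow> Module.module R E \<and>
     (\<forall>I f. submodule I R (regular_module R) \<and> f \<in> mod_hom R ((regular_module R)\<lparr>carrier := I\<rparr>) E \<longrightarrow>
        (\<exists>e\<in>carrier E. \<forall>r\<in>I. f r = r \<odot>\<^bsub>E\<^esub> e))"

text \<open>A copy of \<open>M\<close> in another type. Resolutions have to live in a prescribed
  type, and all modules used to build them are brought there in this way.\<close>

definition transport :: "('b \<Rightarrow> 'c) \<Rightarrow> ('a, 'b) module \<Rightarrow> ('a, 'c) module" where
  "transport h M = (let g = inv_into (carrier M) h in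
     \<lparr>carrier = h ` carrier M, monoid.mult = undefined, one = undefined, ring.zero = h \<zero>\<^bsub>M\<^esub>,
      ring.add = (\<lambda>x y. h (g x \<oplus>\<^bsub>M\<^esub> g y)), smult = (\<lambda>r x. h (r \<odot>\<^bsub>M\<^esub> g x))\<rparr>)"

context
  fixes R :: "'a ring" and M :: "('a, 'b) module" and h :: "'b \<Rightarrow> 'c"
  assumes M: "Module.module R M" and h: "inj_on h (carrier M)"
begin

lemma transport_simps:
  "carrier (transport h M) = h ` carrier M" "\<zero>\<^bsub>transport h M\<^esub> = h \<zero>\<^bsub>M\<^esub>"
  "x \<in> carrier M \<Longrightarrow> y \<in> carrier M \<Longrightarrow> h x \<oplus>\<^bsub>transport h M\<^esub> h y = h (x \<oplus>\<^bsub>M\<^esub> y)"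
  "x \<in> carrier M \<Longrightarrow> r \<odot>\<^bsub>transport h M\<^esub> h x = h (r \<odot>\<^bsub>M\<^esub> x)"
  using h by (auto simp: transport_def Let_def)

lemma module_transport: "Module.module R (transport h M)"
proof -
  interpret M: Module.module R M by (rule M)
  note t = transport_simps
  have ag: "abelian_group (transport h M)"
  proof (rule abelian_groupI)
    fix x assume "x \<in> carrier (transport h M)"
    then obtain a where "a \<in> carrier M" "x = h a" by (auto simp: t)
    thus "\<exists>y\<in>carrier (transport h M). y \<oplus>\<^bsub>transport h M\<^esub> x = \<zero>\<^bsub>transport h M\<^esub>"
      by (intro bexI[of _ "h (\<ominus>\<^bsub>M\<^esub> a)"]) (auto simp: t M.M.l_neg)
  qed (auto simp: t M.M.a_ac)
  show ?thesis
    by (rule moduleI)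
      (auto simp: t ag M.R.is_cring M.smult_l_distr M.smult_r_distr M.smult_assoc1)
qed

lemma transport_hom: "h \<in> mod_hom R M (transport h M)"
  by (rule mod_homI) (auto simp: transport_simps)

lemma transport_inv_hom: "inv_into (carrier M) h \<in> mod_hom R (transport h M) M"
proof -
  interpret M: Module.module R M by (rule M)
  show ?thesis
    by (rule mod_homI) (use h in \<open>auto simp: transport_simps\<close>)
qed

lemma baer_transport:
  assumes "baer R M" shows "baer R (transport h M)"
  unfolding baer_def
proof (intro conjI allI impI module_transport)
  fix I f assume f: "submodule I R (regular_module R) \<and> f \<in> mod_hom R ((regular_module R)\<lparr>carrier := I\<rparr>) (transport h M)"
  hence "(\<lambda>r. inv_into (carrier M) h (f r)) \<in> mod_hom R ((regular_module R)\<lparr>carrier := I\<rparr>) M"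
    by (blast intro: mod_hom_compose transport_inv_hom)
  then obtain e where e: "e \<in> carrier M" "\<forall>r\<in>I. inv_into (carrier M) h (f r) = r \<odot>\<^bsub>M\<^esub> e"
    using assms f unfolding baer_def by blast
  have "f r = r \<odot>\<^bsub>transport h M\<^esub> h e" if "r \<in> I" for r
  proof -
    have "f r \<in> h ` carrier M" using f that by (auto simp: mod_hom_def transport_simps)
    hence "f r = h (inv_into (carrier M) h (f r))" by (simp add: f_inv_into_f)
    thus ?thesis using e that by (simp add: transport_simps)
  qed
  thus "\<exists>e\<in>carrier (transport h M). \<forall>r\<in>I. f r = r \<odot>\<^bsub>transport h M\<^esub> e"
    using e(1) by (auto simp: transport_simps)
qed

end

text \<open>The lifting property in \<open>is_injective_module\<close> speaks only of modules in the
  type of \<open>E\<close>. That type contains the copy of \<open>R\<close> given by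
  \<open>Ring_Elem\<close>, so ideals of \<open>R\<close> are among the available test cases; the
  image of the copy of 1 is the required element.\<close>

lemma injective_module_baer:
  fixes R :: "'a ring" and E :: "('a, ('a, 'b) res_elem) module"
  assumes inj: "is_injective_module R E"
  shows "baer R E"
proof -
  have E: "Module.module R E" using inj by (simp add: is_injective_module_def)
  interpret E: Module.module R E by (rule E)
  note RR = module_self[OF E.R.is_cring]
  let ?h = "Ring_Elem :: 'a \<Rightarrow> ('a, 'b) res_elem"
  have rinj: "inj_on ?h (carrier (regular_module R))" by (simp add: inj_on_def)
  let ?B = "transport ?h (regular_module R)"
  note B = module_transport[OF RR rinj] and hB = transport_hom[OF RR rinj]
  show ?thesis
    unfolding baer_def
  proof (intro conjI allI impI E)
    fix I f assume If: "submodule I R (regular_module R) \<and> f \<in> mod_hom R ((regular_module R)\<lparr>carrier := I\<rparr>) E"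
    note s = submodule_simps[OF RR conjunct1[OF If], simplified]
    have sub: "submodule (Ring_Elem ` I) R ?B" by (rule submodule_image[OF RR B hB conjunct1[OF If]])
    define g where "g x = (case x of Ring_Elem r \<Rightarrow> f r | _ \<Rightarrow> undefined)" for x :: "('a, 'b) res_elem"
    have "g \<in> mod_hom R (?B\<lparr>carrier := Ring_Elem ` I\<rparr>) E"
      using conjunct2[OF If] s by (auto simp: mod_hom_def g_def transport_simps[OF RR rinj, simplified])
    then obtain k where k: "k \<in> mod_hom R ?B E" "\<forall>x\<in>Ring_Elem ` I. k x = g x"
      using inj B sub unfolding is_injective_module_def by blast
    have "f r = r \<odot>\<^bsub>E\<^esub> k (Ring_Elem \<one>\<^bsub>R\<^esub>)" if r: "r \<in> I" for r
    proof -
      have "f r = k (r \<odot>\<^bsub>?B\<^esub> Ring_Elem \<one>\<^bsub>R\<^esub>)"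
        using k(2) r s(1)[OF r] transport_simps(4)[OF RR rinj, of "\<one>\<^bsub>R\<^esub>" r] by (simp add: g_def)
      also have "\<dots> = r \<odot>\<^bsub>E\<^esub> k (Ring_Elem \<one>\<^bsub>R\<^esub>)"
        by (rule mod_hom_smult[OF k(1) s(1)[OF r]]) (simp add: transport_simps[OF RR rinj])
      finally show ?thesis .
    qed
    moreover have "k (Ring_Elem \<one>\<^bsub>R\<^esub>) \<in> carrier E"
      by (rule mod_hom_closed[OF k(1)]) (simp add: transport_simps[OF RR rinj])
    ultimately show "\<exists>e\<in>carrier E. \<forall>r\<in>I. f r = r \<odot>\<^bsub>E\<^esub> e" by blast
  qed
qed

lemma ideal_sequence_stationary:
  assumes "noetherian_ring R" "\<And>n. ideal (J n) R" "\<And>n. J n \<subseteq> J (Suc n)"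
  shows "\<exists>N. \<forall>n\<ge>N. J n = J N"
proof -
  have mono: "J m \<subseteq> J n" if "m \<le> n" for m n using assms(3) that by (rule lift_Suc_mono_le)
  have "\<Union>(range J) \<in> range J"
  proof (rule noetherian_ring.ideal_chain_is_trivial[OF assms(1)])
    show "subset.chain {I. ideal I R} (range J)"
      using assms(2) mono nat_le_linear unfolding pred_on.chain_def by blast
  qed simp
  then obtain N where "\<Union>(range J) = J N" by blast
  thus ?thesis using mono by blast
qed

text \<open>The annihilators of y^k e increase with k; let them be constant from N on. On the ideal
  ann(e) + (z) with z = y^(N+n), send a + r z to r y^N e. This is well defined because r y^(N+n) e =
  0 forces r y^N e = 0. Baer's criterion writes the map as multiplication by some \<open>e'\<close>:
  the value at z is the desired equation, and the map vanishes on ann(e).\<close>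

lemma baer_divisible:
  fixes n :: nat
  assumes noeth: "noetherian_ring R" and baer: "baer R E" and y: "y \<in> carrier R" and e: "e \<in> carrier E"
  shows "\<exists>N::nat. \<exists>e'\<in>carrier E. y [^]\<^bsub>R\<^esub> (N + n) \<odot>\<^bsub>E\<^esub> e' = y [^]\<^bsub>R\<^esub> N \<odot>\<^bsub>E\<^esub> e \<and>
    (\<forall>s\<in>carrier R. s \<odot>\<^bsub>E\<^esub> e = \<zero>\<^bsub>E\<^esub> \<longrightarrow> s \<odot>\<^bsub>E\<^esub> e' = \<zero>\<^bsub>E\<^esub>)"
proof -
  have E: "Module.module R E" using baer by (simp add: baer_def)
  interpret E: Module.module R E by (rule E)
  note RR = module_self[OF E.R.is_cring]
  interpret RM: Module.module R "regular_module R" by (rule RR)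
  define J where "J k = {r \<in> carrier R. (r \<otimes>\<^bsub>R\<^esub> y [^]\<^bsub>R\<^esub> k) \<odot>\<^bsub>E\<^esub> e = \<zero>\<^bsub>E\<^esub>}" for k :: nat
  have "(\<lambda>r. (r \<otimes>\<^bsub>R\<^esub> z) \<odot>\<^bsub>E\<^esub> e) \<in> mod_hom R (regular_module R) E" if "z \<in> carrier R" for z
    using that e by (auto intro!: mod_homI simp: E.R.l_distr E.smult_l_distr E.R.m_assoc E.smult_assoc1)
  hence Jsub: "submodule (J k) R (regular_module R)" for k
    using submodule_vimage[OF RR E _ submodule_zero[OF E], of "\<lambda>r. (r \<otimes>\<^bsub>R\<^esub> y [^]\<^bsub>R\<^esub> k) \<odot>\<^bsub>E\<^esub> e"] y
    by (simp add: J_def)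
  have "J k \<subseteq> J (Suc k)" for k
  proof
    fix r assume r: "r \<in> J k"
    hence "r \<otimes>\<^bsub>R\<^esub> y [^]\<^bsub>R\<^esub> Suc k = y \<otimes>\<^bsub>R\<^esub> (r \<otimes>\<^bsub>R\<^esub> y [^]\<^bsub>R\<^esub> k)"
      using y by (simp add: J_def E.R.m_ac)
    hence "(r \<otimes>\<^bsub>R\<^esub> y [^]\<^bsub>R\<^esub> Suc k) \<odot>\<^bsub>E\<^esub> e = y \<odot>\<^bsub>E\<^esub> ((r \<otimes>\<^bsub>R\<^esub> y [^]\<^bsub>R\<^esub> k) \<odot>\<^bsub>E\<^esub> e)"
      using y e r by (simp add: J_def E.smult_assoc1)
    thus "r \<in> J (Suc k)" using r y by (simp add: J_def)
  qed
  then obtain N where N: "\<And>k. k \<ge> N \<Longrightarrow> J k = J N"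
    using ideal_sequence_stationary[OF noeth, of J] Jsub submodule_regular_iff_ideal[OF E.R.is_cring] by blast
  let ?z = "y [^]\<^bsub>R\<^esub> (N + n)"
  have z: "?z \<in> carrier R" using y by simp
  define K where "K = {k \<in> carrier R. \<exists>r\<in>carrier R. k \<ominus>\<^bsub>R\<^esub> r \<otimes>\<^bsub>R\<^esub> ?z \<in> J 0}"
  \<comment> \<open>\<open>P k r\<close> says that r is an admissible coefficient of z in k. The
    coefficient is not unique, but \<open>uniq\<close> shows that the value attached to k
    is.\<close>
  define P where "P k r \<longleftrightarrow> r \<in> carrier R \<and> k \<ominus>\<^bsub>R\<^esub> r \<otimes>\<^bsub>R\<^esub> ?z \<in> J 0" for k r
  have J0: "r \<in> J 0 \<longleftrightarrow> r \<in> carrier R \<and> r \<odot>\<^bsub>E\<^esub> e = \<zero>\<^bsub>E\<^esub>" for r by (auto simp: J_def)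
  have Pe: "P k r \<longleftrightarrow> r \<in> carrier R \<and> k \<odot>\<^bsub>E\<^esub> e = (r \<otimes>\<^bsub>R\<^esub> ?z) \<odot>\<^bsub>E\<^esub> e" if "k \<in> carrier R" for k r
  proof -
    have "(k \<ominus>\<^bsub>R\<^esub> r \<otimes>\<^bsub>R\<^esub> ?z) \<odot>\<^bsub>E\<^esub> e = k \<odot>\<^bsub>E\<^esub> e \<ominus>\<^bsub>E\<^esub> (r \<otimes>\<^bsub>R\<^esub> ?z) \<odot>\<^bsub>E\<^esub> e"
      if "r \<in> carrier R"
      using that \<open>k \<in> carrier R\<close> z e by (simp add: E.R.minus_eq a_minus_def E.smult_l_distr E.smult_l_minus)
    thus ?thesis
      using that z e E.M.diff_eq_zero_iff[of "k \<odot>\<^bsub>E\<^esub> e" "(r \<otimes>\<^bsub>R\<^esub> ?z) \<odot>\<^bsub>E\<^esub> e"]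
      unfolding P_def J0 by auto
  qed
  have uniq: "(r \<otimes>\<^bsub>R\<^esub> y [^]\<^bsub>R\<^esub> N) \<odot>\<^bsub>E\<^esub> e = (r' \<otimes>\<^bsub>R\<^esub> y [^]\<^bsub>R\<^esub> N) \<odot>\<^bsub>E\<^esub> e"
    if "k \<in> carrier R" "P k r" "P k r'" for k r r'
  proof -
    have r: "r \<in> carrier R" "r' \<in> carrier R" using that by (auto simp: P_def)
    have diff: "((r \<ominus>\<^bsub>R\<^esub> r') \<otimes>\<^bsub>R\<^esub> w) \<odot>\<^bsub>E\<^esub> e = (r \<otimes>\<^bsub>R\<^esub> w) \<odot>\<^bsub>E\<^esub> e \<ominus>\<^bsub>E\<^esub> (r' \<otimes>\<^bsub>R\<^esub> w) \<odot>\<^bsub>E\<^esub> e"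
      if "w \<in> carrier R" for w
      using that r e by (simp add: E.R.minus_eq a_minus_def E.R.l_distr E.smult_l_distr E.smult_l_minus E.R.l_minus)
    have "r \<ominus>\<^bsub>R\<^esub> r' \<in> J (N + n)"
      using that r z e Pe[OF that(1)] by (simp add: J_def diff E.M.diff_eq_zero_iff)
    hence "r \<ominus>\<^bsub>R\<^esub> r' \<in> J N" using N[of "N + n"] by simp
    thus ?thesis using r y e by (simp add: J_def diff E.M.diff_eq_zero_iff)
  qed
  define f where "f k = ((SOME r. P k r) \<otimes>\<^bsub>R\<^esub> y [^]\<^bsub>R\<^esub> N) \<odot>\<^bsub>E\<^esub> e" for k
  have f: "f k = (r \<otimes>\<^bsub>R\<^esub> y [^]\<^bsub>R\<^esub> N) \<odot>\<^bsub>E\<^esub> e" if "k \<in> carrier R" "P k r" for k r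
    unfolding f_def by (rule uniq[OF that(1) someI[of "P k", OF that(2)] that(2)])
  have K: "k \<in> K \<longleftrightarrow> k \<in> carrier R \<and> (\<exists>r. P k r)" for k by (auto simp: K_def P_def)
  have Padd: "P (k \<oplus>\<^bsub>R\<^esub> l) (r \<oplus>\<^bsub>R\<^esub> s)" if "k \<in> carrier R" "l \<in> carrier R" "P k r" "P l s" for k l r s
    using that z e Pe[of k] Pe[of l] Pe[of "k \<oplus>\<^bsub>R\<^esub> l"] by (simp add: E.smult_l_distr E.R.l_distr)
  have Pmul: "P (s \<otimes>\<^bsub>R\<^esub> k) (s \<otimes>\<^bsub>R\<^esub> r)" if "k \<in> carrier R" "s \<in> carrier R" "P k r" for k r s
    using that z e Pe[of k] Pe[of "s \<otimes>\<^bsub>R\<^esub> k"] by (simp add: E.smult_assoc1 E.R.m_assoc)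
  have Ksub: "submodule K R (regular_module R)"
    unfolding submodule_regular_iff_ideal[OF E.R.is_cring]
  proof (rule idealI[OF E.R.ring_axioms])
    show KR: "x \<otimes>\<^bsub>R\<^esub> k \<in> K" if "k \<in> K" "x \<in> carrier R" for k x
      using that Pmul[of k x] unfolding K by blast
    show "k \<otimes>\<^bsub>R\<^esub> x \<in> K" if "k \<in> K" "x \<in> carrier R" for k x
      using KR[OF that] that E.R.m_comm[of k x] by (simp add: K)
    show "subgroup K (add_monoid R)"
    proof (rule subgroup.intro)
      have "P \<zero>\<^bsub>R\<^esub> \<zero>\<^bsub>R\<^esub>" using Pe[of "\<zero>\<^bsub>R\<^esub>"] z e by simp
      thus "\<one>\<^bsub>add_monoid R\<^esub> \<in> K" by (auto simp: K)
      show "k \<otimes>\<^bsub>add_monoid R\<^esub> l \<in> K" if "k \<in> K" "l \<in> K" for k l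
        using that Padd unfolding K by (auto, blast)
      show "inv\<^bsub>add_monoid R\<^esub> k \<in> K" if "k \<in> K" for k
        using KR[OF that, of "\<ominus>\<^bsub>R\<^esub> \<one>\<^bsub>R\<^esub>"] that unfolding a_inv_def[symmetric]
        by (simp add: K E.R.l_minus)
    qed (auto simp: K)
  qed
  have fh: "f \<in> mod_hom R ((regular_module R)\<lparr>carrier := K\<rparr>) E"
  proof (rule mod_homI)
    fix k assume "k \<in> carrier ((regular_module R)\<lparr>carrier := K\<rparr>)"
    then obtain r where k: "k \<in> carrier R" "P k r" by (auto simp: K)
    hence r: "r \<in> carrier R" by (simp add: P_def)
    show "f k \<in> carrier E" using f[OF k] r y e by simp
    show "f (k \<oplus>\<^bsub>(regular_module R)\<lparr>carrier := K\<rparr>\<^esub> l) = f k \<oplus>\<^bsub>E\<^esub> f l"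
      if "l \<in> carrier ((regular_module R)\<lparr>carrier := K\<rparr>)" for l
    proof -
      have "l \<in> K" using that by simp
      then obtain s where l: "l \<in> carrier R" "P l s" unfolding K by blast
      hence s: "s \<in> carrier R" by (simp add: P_def)
      show ?thesis using f[OF _ Padd[OF k(1) l(1) k(2) l(2)]] f[OF k] f[OF l] k(1) l(1) r s y e
        by (simp add: E.R.l_distr E.smult_l_distr)
    qed
    show "f (s \<odot>\<^bsub>(regular_module R)\<lparr>carrier := K\<rparr>\<^esub> k) = s \<odot>\<^bsub>E\<^esub> f k" if s: "s \<in> carrier R" for s
      using f[OF _ Pmul[OF k(1) s k(2)]] f[OF k] k(1) r s y e
      by (simp add: E.R.m_assoc E.smult_assoc1)
  qed
  obtain e' where e': "e' \<in> carrier E" "\<And>k. k \<in> K \<Longrightarrow> f k = k \<odot>\<^bsub>E\<^esub> e'"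
    using baer Ksub fh unfolding baer_def by blast
  have Pz: "P ?z \<one>\<^bsub>R\<^esub>" using Pe[OF z] z by simp
  hence "?z \<in> K" using z unfolding K by blast
  hence 1: "?z \<odot>\<^bsub>E\<^esub> e' = y [^]\<^bsub>R\<^esub> N \<odot>\<^bsub>E\<^esub> e"
    using e'(2)[of ?z] f[OF z Pz] y by simp
  have 2: "s \<odot>\<^bsub>E\<^esub> e' = \<zero>\<^bsub>E\<^esub>" if s: "s \<in> carrier R" "s \<odot>\<^bsub>E\<^esub> e = \<zero>\<^bsub>E\<^esub>" for s
  proof -
    have Ps: "P s \<zero>\<^bsub>R\<^esub>" using Pe[OF s(1)] s(2) z e by simp
    hence "s \<in> K" using s(1) unfolding K by blast
    thus ?thesis using e'(2)[of s] f[OF s(1) Ps] y e by simp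
  qed
  show ?thesis using e'(1) 1 2 by blast
qed
text \<open>Zorn's lemma is applied to graphs of partial homomorphisms.\<close>

theorem baer_extend:
  fixes R :: "'a ring" and E :: "('a, 'c) module" and M :: "('a, 'b) module"
  assumes baer: "baer R E" and M: "Module.module R M" and A: "submodule A R M"
    and f: "f \<in> mod_hom R (M\<lparr>carrier := A\<rparr>) E"
  shows "\<exists>g\<in>mod_hom R M E. \<forall>x\<in>A. g x = f x"
proof -
  have E: "Module.module R E" using baer by (simp add: baer_def)
  interpret E: Module.module R E by (rule E)
  interpret M: Module.module R M by (rule M)
  note RR = module_self[OF E.R.is_cring]
  \<comment> \<open>The partial homomorphisms extending f. Being closed under the module operations,
    such a relation is single-valued as soon as it is so at zero.\<close>
  define H :: "('b \<times> 'c) set set" where "H = {G. G \<subseteq> carrier M \<times> carrier E \<and>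
      (\<forall>x u y v. (x, u) \<in> G \<longrightarrow> (y, v) \<in> G \<longrightarrow> (x \<oplus>\<^bsub>M\<^esub> y, u \<oplus>\<^bsub>E\<^esub> v) \<in> G) \<and>
      (\<forall>r\<in>carrier R. \<forall>x u. (x, u) \<in> G \<longrightarrow> (r \<odot>\<^bsub>M\<^esub> x, r \<odot>\<^bsub>E\<^esub> u) \<in> G) \<and>
      (\<forall>u. (\<zero>\<^bsub>M\<^esub>, u) \<in> G \<longrightarrow> u = \<zero>\<^bsub>E\<^esub>) \<and> (\<lambda>x. (x, f x)) ` A \<subseteq> G}"
  note sA = submodule_simps[OF M A]
  have fA: "f x \<in> carrier E" "f (x \<oplus>\<^bsub>M\<^esub> y) = f x \<oplus>\<^bsub>E\<^esub> f y" "r \<in> carrier R \<Longrightarrow> f (r \<odot>\<^bsub>M\<^esub> x) = r \<odot>\<^bsub>E\<^esub> f x"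
    if "x \<in> A" "y \<in> A" for x y r
    using that f by (auto simp: mod_hom_def)
  have f0: "f \<zero>\<^bsub>M\<^esub> = \<zero>\<^bsub>E\<^esub>"
    using mod_hom_zero[OF submodule.submodule_is_module[OF A M] E f] by simp
  have start: "(\<lambda>x. (x, f x)) ` A \<in> H"
    unfolding H_def using sA fA f0 by (auto simp: image_iff)
  have H1: "x \<in> carrier M \<and> u \<in> carrier E" if "G \<in> H" "(x, u) \<in> G" for G x u
    using that by (auto simp: H_def)
  have H2: "(x \<oplus>\<^bsub>M\<^esub> y, u \<oplus>\<^bsub>E\<^esub> v) \<in> G" if "G \<in> H" "(x, u) \<in> G" "(y, v) \<in> G" for G x u y v
    using that by (simp add: H_def)
  have H3: "(r \<odot>\<^bsub>M\<^esub> x, r \<odot>\<^bsub>E\<^esub> u) \<in> G" if "G \<in> H" "r \<in> carrier R" "(x, u) \<in> G" for G r x u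
    using that by (simp add: H_def)
  have H4: "u = \<zero>\<^bsub>E\<^esub>" if "G \<in> H" "(\<zero>\<^bsub>M\<^esub>, u) \<in> G" for G u
    using that by (simp add: H_def)
  have H5: "(x, f x) \<in> G" if "G \<in> H" "x \<in> A" for G x
    using that by (auto simp: H_def)
  have HI: "G \<in> H" if "\<And>x u. (x, u) \<in> G \<Longrightarrow> x \<in> carrier M \<and> u \<in> carrier E"
    "\<And>x u y v. (x, u) \<in> G \<Longrightarrow> (y, v) \<in> G \<Longrightarrow> (x \<oplus>\<^bsub>M\<^esub> y, u \<oplus>\<^bsub>E\<^esub> v) \<in> G"
    "\<And>r x u. r \<in> carrier R \<Longrightarrow> (x, u) \<in> G \<Longrightarrow> (r \<odot>\<^bsub>M\<^esub> x, r \<odot>\<^bsub>E\<^esub> u) \<in> G"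
    "\<And>u. (\<zero>\<^bsub>M\<^esub>, u) \<in> G \<Longrightarrow> u = \<zero>\<^bsub>E\<^esub>" "\<And>x. x \<in> A \<Longrightarrow> (x, f x) \<in> G" for G
    unfolding H_def using that by auto
  have "H \<noteq> {}" using start by blast
  moreover have "\<Union>C \<in> H" if C: "C \<noteq> {}" "subset.chain H C" for C
  proof -
    have CH: "\<And>G. G \<in> C \<Longrightarrow> G \<in> H" and lin: "\<And>G G'. G \<in> C \<Longrightarrow> G' \<in> C \<Longrightarrow> G \<subseteq> G' \<or> G' \<subseteq> G"
      using C(2) unfolding pred_on.chain_def by blast+
    have both: "\<exists>G\<in>C. p \<in> G \<and> q \<in> G" if pq: "p \<in> \<Union>C" "q \<in> \<Union>C" for p q
    proof -
      obtain G1 G2 where G: "G1 \<in> C" "p \<in> G1" "G2 \<in> C" "q \<in> G2" using pq by blast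
      thus ?thesis using lin[OF G(1,3)] by blast
    qed
    show ?thesis
    proof (rule HI)
      show "(x \<oplus>\<^bsub>M\<^esub> y, u \<oplus>\<^bsub>E\<^esub> v) \<in> \<Union>C" if "(x, u) \<in> \<Union>C" "(y, v) \<in> \<Union>C" for x u y v
        using both[OF that] H2[OF CH] by blast
      show "(x, f x) \<in> \<Union>C" if "x \<in> A" for x using C(1) H5[OF CH that] by blast
      show "u = \<zero>\<^bsub>E\<^esub>" if "(\<zero>\<^bsub>M\<^esub>, u) \<in> \<Union>C" for u using that H4[OF CH] by blast
      show "(r \<odot>\<^bsub>M\<^esub> x, r \<odot>\<^bsub>E\<^esub> u) \<in> \<Union>C" if "r \<in> carrier R" "(x, u) \<in> \<Union>C" for r x u
        using that H3[OF CH] by blast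
      show "x \<in> carrier M \<and> u \<in> carrier E" if "(x, u) \<in> \<Union>C" for x u using that H1[OF CH] by blast
    qed
  qed
  ultimately obtain G where G: "G \<in> H" and maximal: "\<And>G'. G' \<in> H \<Longrightarrow> G \<subseteq> G' \<Longrightarrow> G' = G"
    using subset_Zorn_nonempty[of H] by blast
  have Gc: "x \<in> carrier M" "u \<in> carrier E" if "(x, u) \<in> G" for x u using H1[OF G that] by auto
  note Gadd = H2[OF G] and Gsm = H3[OF G] and G0 = H4[OF G] and Gf = H5[OF G]
  have G00: "(\<zero>\<^bsub>M\<^esub>, \<zero>\<^bsub>E\<^esub>) \<in> G" using Gf[OF sA(2)] f0 by simp
  have Gneg: "(\<ominus>\<^bsub>M\<^esub> x, \<ominus>\<^bsub>E\<^esub> u) \<in> G" if "(x, u) \<in> G" for x u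
    using Gsm[OF _ that, of "\<ominus>\<^bsub>R\<^esub> \<one>\<^bsub>R\<^esub>"] Gc[OF that] by (simp add: M.smult_l_minus E.smult_l_minus)
  have Gfun: "u = v" if "(x, u) \<in> G" "(x, v) \<in> G" for x u v
  proof -
    have "(\<zero>\<^bsub>M\<^esub>, u \<ominus>\<^bsub>E\<^esub> v) \<in> G"
      using Gadd[OF that(1) Gneg[OF that(2)]] Gc[OF that(1)] by (simp add: M.M.r_neg a_minus_def)
    thus ?thesis using G0 E.M.diff_eq_zero_iff Gc that by metis
  qed
  have dom: "\<exists>u. (x, u) \<in> G" if x: "x \<in> carrier M" for x
  proof -
    \<comment> \<open>The multiples of x already in the domain form an ideal, on which the partial
      map is multiplication by some e; this e is the value that x can be given consistently.\<close>
    define I where "I = {r \<in> carrier R. \<exists>u. (r \<odot>\<^bsub>M\<^esub> x, u) \<in> G}"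
    define \<phi> where "\<phi> r = (THE u. (r \<odot>\<^bsub>M\<^esub> x, u) \<in> G)" for r
    have \<phi>: "\<phi> r = u" if "(r \<odot>\<^bsub>M\<^esub> x, u) \<in> G" for r u
      unfolding \<phi>_def using that Gfun by blast
    have I\<phi>: "(r \<odot>\<^bsub>M\<^esub> x, \<phi> r) \<in> G" if "r \<in> I" for r using that \<phi> by (auto simp: I_def)
    have Iadd: "(( r \<oplus>\<^bsub>R\<^esub> s) \<odot>\<^bsub>M\<^esub> x, \<phi> r \<oplus>\<^bsub>E\<^esub> \<phi> s) \<in> G" if "r \<in> I" "s \<in> I" for r s
      using Gadd[OF I\<phi>[OF that(1)] I\<phi>[OF that(2)]] that x by (simp add: I_def M.smult_l_distr)
    have Imul: "((s \<otimes>\<^bsub>R\<^esub> r) \<odot>\<^bsub>M\<^esub> x, s \<odot>\<^bsub>E\<^esub> \<phi> r) \<in> G" if "r \<in> I" "s \<in> carrier R" for r s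
      using Gsm[OF that(2) I\<phi>[OF that(1)]] that x by (simp add: I_def M.smult_assoc1)
    have "ideal I R"
    proof (rule idealI[OF E.R.ring_axioms])
      show l: "s \<otimes>\<^bsub>R\<^esub> r \<in> I" if "r \<in> I" "s \<in> carrier R" for r s
        using Imul[OF that] that by (auto simp: I_def)
      show "r \<otimes>\<^bsub>R\<^esub> s \<in> I" if "r \<in> I" "s \<in> carrier R" for r s
        using l[OF that] that E.R.m_comm[of r s] by (auto simp: I_def)
      show "subgroup I (add_monoid R)"
      proof (rule subgroup.intro)
        show "r \<otimes>\<^bsub>add_monoid R\<^esub> s \<in> I" if "r \<in> I" "s \<in> I" for r s
          using Iadd[OF that] that by (auto simp: I_def)
        show "\<one>\<^bsub>add_monoid R\<^esub> \<in> I" using G00 x by (auto simp: I_def)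
        show "inv\<^bsub>add_monoid R\<^esub> r \<in> I" if "r \<in> I" for r
          using l[OF that, of "\<ominus>\<^bsub>R\<^esub> \<one>\<^bsub>R\<^esub>"] that unfolding a_inv_def[symmetric]
          by (simp add: I_def E.R.l_minus)
      qed (auto simp: I_def)
    qed
    hence I: "submodule I R (regular_module R)" by (simp add: submodule_regular_iff_ideal[OF E.R.is_cring])
    have "\<phi> \<in> mod_hom R ((regular_module R)\<lparr>carrier := I\<rparr>) E"
      by (rule mod_homI) (use Gc(2)[OF I\<phi>] \<phi>[OF Iadd] \<phi>[OF Imul] in auto)
    then obtain e where e: "e \<in> carrier E" "\<And>r. r \<in> I \<Longrightarrow> \<phi> r = r \<odot>\<^bsub>E\<^esub> e"
      using baer I unfolding baer_def by blast
    define G' where "G' = {(a \<oplus>\<^bsub>M\<^esub> r \<odot>\<^bsub>M\<^esub> x, u \<oplus>\<^bsub>E\<^esub> r \<odot>\<^bsub>E\<^esub> e) | a u r. (a, u) \<in> G \<and> r \<in> carrier R}"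
    have XI: "(a \<oplus>\<^bsub>M\<^esub> r \<odot>\<^bsub>M\<^esub> x, u \<oplus>\<^bsub>E\<^esub> r \<odot>\<^bsub>E\<^esub> e) \<in> G'" if "(a, u) \<in> G" "r \<in> carrier R" for a u r
      using that by (auto simp: G'_def)
    have GX: "G \<subseteq> G'"
    proof
      fix q assume q: "q \<in> G"
      obtain a u where au: "q = (a, u)" by (cases q)
      show "q \<in> G'" using XI[of a u "\<zero>\<^bsub>R\<^esub>"] q Gc[of a u] x e(1) by (simp add: au)
    qed
    have "G' \<in> H"
    proof (rule HI)
      show "z \<in> carrier M \<and> w \<in> carrier E" if "(z, w) \<in> G'" for z w
        using that Gc x e(1) by (auto simp: G'_def)
      show "(z, f z) \<in> G'" if "z \<in> A" for z using GX Gf[OF that] by blast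
      fix z w assume "(z, w) \<in> G'"
      then obtain a u r where 1: "z = a \<oplus>\<^bsub>M\<^esub> r \<odot>\<^bsub>M\<^esub> x" "w = u \<oplus>\<^bsub>E\<^esub> r \<odot>\<^bsub>E\<^esub> e" "(a, u) \<in> G" "r \<in> carrier R"
        by (auto simp: G'_def)
      note c1 = Gc[OF 1(3)]
      {
        fix z' w' assume "(z', w') \<in> G'"
        then obtain b v s where 2: "z' = b \<oplus>\<^bsub>M\<^esub> s \<odot>\<^bsub>M\<^esub> x" "w' = v \<oplus>\<^bsub>E\<^esub> s \<odot>\<^bsub>E\<^esub> e" "(b, v) \<in> G" "s \<in> carrier R"
          by (auto simp: G'_def)
        note c2 = Gc[OF 2(3)]
        have "z \<oplus>\<^bsub>M\<^esub> z' = (a \<oplus>\<^bsub>M\<^esub> b) \<oplus>\<^bsub>M\<^esub> (r \<oplus>\<^bsub>R\<^esub> s) \<odot>\<^bsub>M\<^esub> x"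
          using 1 2 c1 c2 x by (simp add: M.smult_l_distr M.M.a_ac)
        moreover have "w \<oplus>\<^bsub>E\<^esub> w' = (u \<oplus>\<^bsub>E\<^esub> v) \<oplus>\<^bsub>E\<^esub> (r \<oplus>\<^bsub>R\<^esub> s) \<odot>\<^bsub>E\<^esub> e"
          using 1 2 c1 c2 e(1) by (simp add: E.smult_l_distr E.M.a_ac)
        ultimately show "(z \<oplus>\<^bsub>M\<^esub> z', w \<oplus>\<^bsub>E\<^esub> w') \<in> G'"
          using XI[OF Gadd[OF 1(3) 2(3)], of "r \<oplus>\<^bsub>R\<^esub> s"] 1(4) 2(4) by simp
      }
      show "(s \<odot>\<^bsub>M\<^esub> z, s \<odot>\<^bsub>E\<^esub> w) \<in> G'" if s: "s \<in> carrier R" for s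
        using XI[OF Gsm[OF s 1(3)], of "s \<otimes>\<^bsub>R\<^esub> r"] 1 c1 x e(1) s
        by (simp add: M.smult_r_distr M.smult_assoc1 E.smult_r_distr E.smult_assoc1)
    next
      fix w assume "(\<zero>\<^bsub>M\<^esub>, w) \<in> G'"
      then obtain a u r where 1: "\<zero>\<^bsub>M\<^esub> = a \<oplus>\<^bsub>M\<^esub> r \<odot>\<^bsub>M\<^esub> x" "w = u \<oplus>\<^bsub>E\<^esub> r \<odot>\<^bsub>E\<^esub> e" "(a, u) \<in> G" "r \<in> carrier R"
        by (auto simp: G'_def)
      note c1 = Gc[OF 1(3)]
      have "r \<odot>\<^bsub>M\<^esub> x = \<ominus>\<^bsub>M\<^esub> a"
        using 1(1,4) c1(1) x M.M.minus_equality[of "r \<odot>\<^bsub>M\<^esub> x" a] by (simp add: M.M.a_comm)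
      hence rx: "(r \<odot>\<^bsub>M\<^esub> x, \<ominus>\<^bsub>E\<^esub> u) \<in> G" using Gneg[OF 1(3)] by simp
      hence "r \<in> I" using 1(4) by (auto simp: I_def)
      hence "r \<odot>\<^bsub>E\<^esub> e = \<ominus>\<^bsub>E\<^esub> u" using e(2) \<phi>[OF rx] by simp
      thus "w = \<zero>\<^bsub>E\<^esub>" using 1(2) c1(2) by (simp add: E.M.r_neg)
    qed
    hence "G' = G" using maximal GX by blast
    moreover have "(x, e) \<in> G'" using XI[OF G00 E.R.one_closed] x e(1) by simp
    ultimately show ?thesis by blast
  qed
  define g where "g x = (THE u. (x, u) \<in> G)" for x
  have g: "g x = u" if "(x, u) \<in> G" for x u unfolding g_def using that Gfun by blast
  have gG: "(x, g x) \<in> G" if "x \<in> carrier M" for x using dom[OF that] g by blast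
  show ?thesis
  proof (rule bexI[of _ g])
    show "\<forall>x\<in>A. g x = f x" using g Gf by blast
    show "g \<in> mod_hom R M E"
      by (rule mod_homI) (use gG Gc(2)[OF gG] g[OF Gadd] g[OF Gsm] in auto)
  qed
qed

lemma baer_injective_module:
  assumes "baer R E" shows "is_injective_module R E"
  unfolding is_injective_module_def
proof (intro conjI allI impI)
  show "Module.module R E" using assms by (simp add: baer_def)
qed (use baer_extend[OF assms] in blast)

section \<open>Characters\<close>

text \<open>The nonzero complex numbers, written additively, in the role often given to Q/Z:
  divisible, since roots exist, and with nontrivial roots of unity of every order above one.\<close>

definition C_star :: "(int, complex) module" where
  "C_star = \<lparr>carrier = {z. z \<noteq> 0}, monoid.mult = undefined, one = undefined, ring.zero = 1, ring.add = (*),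
     smult = (\<lambda>k z. z powi k)\<rparr>"

definition Z_module :: "('a, 'b) module \<Rightarrow> (int, 'b) module" where
  "Z_module M = \<lparr>carrier = carrier M, monoid.mult = undefined, one = undefined, ring.zero = \<zero>\<^bsub>M\<^esub>,
     ring.add = ring.add M, smult = (\<lambda>k x. add_pow M k x)\<rparr>"

lemma C_star_simps [simp]:
  "carrier C_star = {z. z \<noteq> 0}" "\<zero>\<^bsub>C_star\<^esub> = 1" "x \<oplus>\<^bsub>C_star\<^esub> y = x * y" "k \<odot>\<^bsub>C_star\<^esub> x = x powi k"
  by (auto simp: C_star_def)

lemma Z_module_simps [simp]:
  "carrier (Z_module M) = carrier M" "\<zero>\<^bsub>Z_module M\<^esub> = \<zero>\<^bsub>M\<^esub>" "x \<oplus>\<^bsub>Z_module M\<^esub> y = x \<oplus>\<^bsub>M\<^esub> y"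
  "k \<odot>\<^bsub>Z_module M\<^esub> x = add_pow M k x"
  by (auto simp: Z_module_def)

lemma module_Z_module:
  assumes "Module.module R M" shows "Module.module \<Z> (Z_module M)"
proof -
  interpret M: Module.module R M by fact
  have ag: "abelian_group (Z_module M)"
    by (rule abelian_groupI) (auto simp: M.M.a_ac intro: M.M.add.l_inv_ex)
  show ?thesis
    by (rule moduleI)
      (auto simp: ag int_is_cring M.M.add.int_pow_mult M.M.add.int_pow_distrib M.M.add.int_pow_pow mult.commute
        intro: M.M.add.int_pow_closed)
qed

lemma module_C_star: "Module.module \<Z> C_star"
proof -
  have ag: "abelian_group C_star"
  proof (rule abelian_groupI)
    fix x assume "x \<in> carrier C_star"
    thus "\<exists>y\<in>carrier C_star. y \<oplus>\<^bsub>C_star\<^esub> x = \<zero>\<^bsub>C_star\<^esub>" by (intro bexI[of _ "inverse x"]) auto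
  qed auto
  have as: "x powi (a * b) = (x powi b) powi a" for x :: complex and a b
    by (metis mult.commute power_int_mult)
  show ?thesis
    by (rule moduleI)
      (use as in \<open>auto simp: ag int_is_cring power_int_add power_int_mult_distrib\<close>)
qed

lemma int_ideal_generator:
  assumes "ideal I \<Z>"
  shows "\<exists>n::nat. I = {k. int n dvd k}"
proof -
  interpret ideal I \<Z> by fact
  have neg: "- k \<in> I" if "k \<in> I" for k using I_l_closed[OF that, of "-1"] by simp
  have add: "k + l \<in> I" if "k \<in> I" "l \<in> I" for k l using a_closed[OF that] by simp
  have mul: "l * k \<in> I" if "k \<in> I" for k l using I_l_closed[OF that, of l] by simp
  show ?thesis
  proof (cases "\<exists>m>0. int m \<in> I")
    case False
    have "k = 0" if "k \<in> I" for k
    proof (rule ccontr)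
      assume "k \<noteq> 0"
      have "int (nat \<bar>k\<bar>) \<in> I" using that neg by (cases "k \<ge> 0") auto
      thus False using False \<open>k \<noteq> 0\<close> by (metis zero_less_abs_iff zero_less_nat_eq)
    qed
    moreover have "0 \<in> I" using zero_closed by simp
    ultimately have "I = {k. int 0 dvd k}" by auto
    thus ?thesis by blast
  next
    case True
    define n where "n = (LEAST m. m > 0 \<and> int m \<in> I)"
    have n: "n > 0" "int n \<in> I" using LeastI_ex[OF True[unfolded bex_simps]] by (auto simp: n_def)
    have min: "n \<le> m" if "m > 0" "int m \<in> I" for m unfolding n_def using that by (intro Least_le) auto
    have "int n dvd k" if k: "k \<in> I" for k
    proof (rule ccontr)
      assume nd: "\<not> int n dvd k"
      have "k mod int n = k + (- (k div int n)) * int n" by (simp add: minus_div_mult_eq_mod[symmetric])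
      hence "k mod int n \<in> I" using add[OF k mul[OF n(2)]] by metis
      hence "int (nat (k mod int n)) \<in> I" using n(1) by simp
      moreover have "nat (k mod int n) > 0" using nd n(1)
        by (metis dvd_eq_mod_eq_0 of_nat_0_less_iff order_le_less pos_mod_sign zero_less_nat_eq)
      ultimately have "n \<le> nat (k mod int n)" by (intro min)
      moreover have "k mod int n < int n" using n(1) by simp
      ultimately show False using n(1) by linarith
    qed
    hence "I = {k. int n dvd k}" using mul[OF n(2)] by (auto simp: dvd_def mult.commute)
    thus ?thesis by blast
  qed
qed

lemma complex_root_exists:
  assumes "n > 0" "(c::complex) \<noteq> 0" shows "\<exists>z. z \<noteq> 0 \<and> z ^ n = c"
proof -
  have "card {z. z ^ n = c} = n" by (rule card_nth_roots[OF assms(2,1)])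
  then obtain z where "z ^ n = c" using assms(1) by (metis (mono_tags) card.empty empty_Collect_eq less_irrefl)
  thus ?thesis using assms by (metis power_0_left less_irrefl)
qed

text \<open>Ideals of the integers are principal, so extending a map means taking an n-th root of
  its value at the generator n; for n = 0 the element 1 serves.\<close>

lemma baer_C_star: "baer \<Z> C_star"
  unfolding baer_def
proof (intro conjI allI impI module_C_star)
  fix I f assume If: "submodule I \<Z> (regular_module \<Z>) \<and> f \<in> mod_hom \<Z> ((regular_module \<Z>)\<lparr>carrier := I\<rparr>) C_star"
  have "ideal I \<Z>" using If submodule_regular_iff_ideal[OF int_is_cring] by blast
  then obtain n :: nat where n: "I = {k. int n dvd k}" using int_ideal_generator by blast
  have fn: "f (int n) \<noteq> 0" using If n by (auto simp: mod_hom_def)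
  have fk: "f (k * int n) = f (int n) powi k" for k
    using mod_hom_smult[OF conjunct2[OF If], of k "int n"] n by simp
  obtain z where z: "z \<noteq> 0" "z ^ n = f (int n)"
  proof (cases "n = 0")
    case True
    have "f (int n) = 1" using fk[of 0] True by simp
    thus ?thesis using that[of 1] True by simp
  next
    case False thus ?thesis using complex_root_exists[OF _ fn] that by blast
  qed
  have "f r = z powi r" if "r \<in> I" for r
  proof -
    obtain k where k: "r = k * int n" using \<open>r \<in> I\<close> n by (auto simp: dvd_def mult.commute)
    have "f r = (z powi int n) powi k" using fk[of k] z(2) k by simp
    also have "\<dots> = z powi (int n * k)" by (rule power_int_mult[symmetric])
    finally show ?thesis by (simp add: k mult.commute)
  qed
  thus "\<exists>e\<in>carrier C_star. \<forall>r\<in>I. f r = r \<odot>\<^bsub>C_star\<^esub> e" using z(1) by auto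
qed

text \<open>Modulo \<open>B\<close> the element x generates a cyclic group of order n, with n = 0
  for infinite order, and n is not 1. A number z other than 0 and 1 with z^n = 1 defines a character
  on B + Zx that is trivial on \<open>B\<close> and takes x to z. It extends since
  \<open>C_star\<close> is injective over the integers.\<close>

lemma character_separates:
  assumes M: "Module.module R M" and B: "submodule B R M" and x: "x \<in> carrier M" "x \<notin> B"
  shows "\<exists>\<chi>\<in>mod_hom \<Z> (Z_module M) C_star. (\<forall>b\<in>B. \<chi> b = 1) \<and> \<chi> x \<noteq> 1"
proof -
  interpret M: Module.module R M by (rule M)
  note Z = module_Z_module[OF M]
  interpret Z: Module.module \<Z> "Z_module M" by (rule Z)
  note s = submodule_simps[OF M B]
  have ainv: "\<ominus>\<^bsub>Z_module M\<^esub> y = \<ominus>\<^bsub>M\<^esub> y" if "y \<in> carrier M" for y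
    using that Z.M.minus_equality[of "\<ominus>\<^bsub>M\<^esub> y" y] by (simp add: M.M.l_neg)
  have powB: "add_pow M (k::int) b \<in> B" if "b \<in> B" for k b
  proof -
    have "subgroup B (add_monoid M)" using B by (simp add: submodule.axioms)
    thus ?thesis
      using M.M.add.int_pow_closed that group.int_pow_closed[OF M.M.add.subgroup_imp_group] M.M.add.int_pow_consistent
      by (metis (no_types, lifting) group.int_pow_closed partial_object.select_convs(1)
          partial_object.update_convs(1) subgroup.subgroup_is_group M.M.a_group)
  qed
  have BZ: "submodule B \<Z> (Z_module M)"
    by (rule Z.submoduleI) (use s powB ainv in auto)
  define I where "I = {k::int. add_pow M k x \<in> B}"
  have "submodule I \<Z> (regular_module \<Z>)"
  proof -
    have "(\<lambda>k. add_pow M k x) \<in> mod_hom \<Z> (regular_module \<Z>) (Z_module M)"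
      by (rule mod_homI) (use x(1) in \<open>auto simp: M.M.add.int_pow_mult M.M.add.int_pow_pow mult.commute
        intro: M.M.add.int_pow_closed\<close>)
    from submodule_vimage[OF module_self[OF int_is_cring] Z this BZ] show ?thesis by (simp add: I_def)
  qed
  then obtain n :: nat where n: "I = {k. int n dvd k}"
    using submodule_regular_iff_ideal[OF int_is_cring] int_ideal_generator by blast
  have "1 \<notin> I" using x by (simp add: I_def)
  hence n1: "n \<noteq> 1" using n by auto
  obtain z :: complex where z: "z \<noteq> 0" "z \<noteq> 1" "z ^ n = 1"
  proof (cases "n = 0")
    case True thus ?thesis using that[of 2] by simp
  next
    case False
    hence "card {z::complex. z ^ n = 1} = n" by (intro card_nth_roots) auto
    hence "{z::complex. z ^ n = 1} \<noteq> {1}" using n1 by (metis card_1_singleton_iff One_nat_def)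
    moreover have "(1::complex) \<in> {z. z ^ n = 1}" by simp
    ultimately obtain z :: complex where "z ^ n = 1" "z \<noteq> 1" by blast
    moreover have "z \<noteq> 0" using \<open>z ^ n = 1\<close> False by (metis power_0_left zero_neq_one)
    ultimately show ?thesis using that by blast
  qed
  have zI: "z powi k = 1" if "k \<in> I" for k
  proof -
    have "int n dvd k" using that n by simp
    then obtain l where "k = int n * l" ..
    thus ?thesis using z(3) by (simp add: power_int_mult)
  qed
  define A where "A = {y \<in> carrier M. \<exists>k::int. y \<ominus>\<^bsub>M\<^esub> add_pow M k x \<in> B}"
  have p0: "add_pow M (0::int) x = \<zero>\<^bsub>M\<^esub>" using Z.smult_l_null[of x] x(1) by simp
  have p1: "add_pow M (1::int) x = x" using x(1) by simp
  have px: "add_pow M (k::int) x \<in> carrier M" for k using x(1) by (rule M.M.add.int_pow_closed)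
  have pB: "(y \<ominus>\<^bsub>M\<^esub> add_pow M (k::int) x) \<oplus>\<^bsub>M\<^esub> (y' \<ominus>\<^bsub>M\<^esub> add_pow M (k'::int) x) =
      (y \<oplus>\<^bsub>M\<^esub> y') \<ominus>\<^bsub>M\<^esub> add_pow M (k + k') x" if "y \<in> carrier M" "y' \<in> carrier M" for y y' k k'
    using that px x(1) by (simp add: a_minus_def M.M.add.int_pow_mult M.M.minus_add M.M.a_ac)
  have pS: "add_pow M (l::int) (y \<ominus>\<^bsub>M\<^esub> add_pow M (k::int) x) = add_pow M l y \<ominus>\<^bsub>M\<^esub> add_pow M (l * k) x"
    if "y \<in> carrier M" for y k l
  proof -
    have "add_pow M l (y \<ominus>\<^bsub>M\<^esub> add_pow M k x) = add_pow M l y \<oplus>\<^bsub>M\<^esub> add_pow M l (\<ominus>\<^bsub>M\<^esub> add_pow M k x)"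
      using that px by (simp add: a_minus_def M.M.add.int_pow_distrib)
    also have "add_pow M l (\<ominus>\<^bsub>M\<^esub> add_pow M k x) = \<ominus>\<^bsub>M\<^esub> add_pow M (l * k) x"
      using px x(1) M.M.add.int_pow_inv[of "add_pow M k x" l] by (simp add: M.M.add.int_pow_pow mult.commute)
    finally show ?thesis by (simp add: a_minus_def)
  qed
  have uniq: "z powi k = z powi l" if "y \<ominus>\<^bsub>M\<^esub> add_pow M k x \<in> B" "y \<ominus>\<^bsub>M\<^esub> add_pow M l x \<in> B" "y \<in> carrier M" for y k l
  proof -
    have "add_pow M (l - k) x = (y \<ominus>\<^bsub>M\<^esub> add_pow M k x) \<ominus>\<^bsub>M\<^esub> (y \<ominus>\<^bsub>M\<^esub> add_pow M l x)"
    proof -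
      have "add_pow M (l - k) x = add_pow M l x \<oplus>\<^bsub>M\<^esub> \<ominus>\<^bsub>M\<^esub> add_pow M k x"
        using x(1) M.M.add.int_pow_diff[of x l k] by (simp add: a_inv_def add_pow_def)
      thus ?thesis using that(3) px by (simp add: a_minus_def M.M.minus_add M.M.a_ac M.M.r_neg1 M.M.r_neg2)
    qed
    hence "l - k \<in> I" using s(4)[OF that(1,2)] by (simp add: I_def)
    hence "z powi (l - k) = 1" by (rule zI)
    thus ?thesis using z(1) by (simp add: power_int_diff)
  qed
  define \<chi>0 where "\<chi>0 y = z powi (SOME k. y \<ominus>\<^bsub>M\<^esub> add_pow M k x \<in> B)" for y
  have \<chi>0: "\<chi>0 y = z powi k" if "y \<in> carrier M" "y \<ominus>\<^bsub>M\<^esub> add_pow M k x \<in> B" for y k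
    unfolding \<chi>0_def using uniq[OF _ that(2) that(1)] someI[of "\<lambda>k. y \<ominus>\<^bsub>M\<^esub> add_pow M k x \<in> B", OF that(2)] by blast
  have A: "submodule A \<Z> (Z_module M)"
  proof (rule Z.submoduleI)
    have "\<zero>\<^bsub>M\<^esub> \<ominus>\<^bsub>M\<^esub> add_pow M (0::int) x \<in> B" using s(2) M.M.diff_zero_right by (simp add: p0)
    thus "\<zero>\<^bsub>Z_module M\<^esub> \<in> A" unfolding A_def by auto
    show pl: "k \<odot>\<^bsub>Z_module M\<^esub> y \<in> A" if yA: "y \<in> A" for k y
    proof -
      obtain j where y: "y \<in> carrier M" "y \<ominus>\<^bsub>M\<^esub> add_pow M (j::int) x \<in> B" using yA by (auto simp: A_def)
      have "add_pow M k y \<ominus>\<^bsub>M\<^esub> add_pow M (k * j) x \<in> B" using powB[OF y(2), of k] pS[OF y(1)] by simp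
      thus ?thesis using y(1) M.M.add.int_pow_closed[OF y(1), of k] by (auto simp: A_def)
    qed
    show "y \<oplus>\<^bsub>Z_module M\<^esub> y' \<in> A" if yy: "y \<in> A" "y' \<in> A" for y y'
    proof -
      obtain j j' where y: "y \<in> carrier M" "y \<ominus>\<^bsub>M\<^esub> add_pow M (j::int) x \<in> B"
        "y' \<in> carrier M" "y' \<ominus>\<^bsub>M\<^esub> add_pow M (j'::int) x \<in> B" using yy by (auto simp: A_def)
      have "(y \<oplus>\<^bsub>M\<^esub> y') \<ominus>\<^bsub>M\<^esub> add_pow M (j + j') x \<in> B" using s(3)[OF y(2,4)] pB[OF y(1,3)] by simp
      thus ?thesis using y by (auto simp: A_def)
    qed
    show "\<ominus>\<^bsub>Z_module M\<^esub> y \<in> A" if "y \<in> A" for y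
      using pl[of y "-1"] that ainv[of y] Z.smult_l_minus[of 1 y] by (simp add: A_def)
  qed (auto simp: A_def)
  have "\<chi>0 \<in> mod_hom \<Z> ((Z_module M)\<lparr>carrier := A\<rparr>) C_star"
  proof (rule mod_homI)
    fix y assume "y \<in> carrier ((Z_module M)\<lparr>carrier := A\<rparr>)"
    then obtain k :: int where y: "y \<in> carrier M" "y \<ominus>\<^bsub>M\<^esub> add_pow M k x \<in> B" by (auto simp: A_def)
    show "\<chi>0 y \<in> carrier C_star" using z(1) by (simp add: \<chi>0_def)
    show "\<chi>0 (y \<oplus>\<^bsub>(Z_module M)\<lparr>carrier := A\<rparr>\<^esub> y') = \<chi>0 y \<oplus>\<^bsub>C_star\<^esub> \<chi>0 y'"
      if y'A: "y' \<in> carrier ((Z_module M)\<lparr>carrier := A\<rparr>)" for y'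
    proof -
      obtain k' :: int where y': "y' \<in> carrier M" "y' \<ominus>\<^bsub>M\<^esub> add_pow M k' x \<in> B" using y'A by (auto simp: A_def)
      show ?thesis using \<chi>0[OF y] \<chi>0[OF y'] \<chi>0[of "y \<oplus>\<^bsub>M\<^esub> y'" "k + k'"] pB[OF y(1) y'(1)] s(3)[OF y(2) y'(2)] y y' z(1)
        by (simp add: power_int_add)
    qed
    show "\<chi>0 (l \<odot>\<^bsub>(Z_module M)\<lparr>carrier := A\<rparr>\<^esub> y) = l \<odot>\<^bsub>C_star\<^esub> \<chi>0 y" for l
      using \<chi>0[OF y] \<chi>0[of "add_pow M l y" "l * k"] pS[OF y(1), of l k] powB[OF y(2), of l] y
      by (simp add: power_int_mult[symmetric] mult.commute M.M.add.int_pow_closed)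
  qed
  then obtain \<chi> where \<chi>: "\<chi> \<in> mod_hom \<Z> (Z_module M) C_star" "\<forall>y\<in>A. \<chi> y = \<chi>0 y"
    using baer_extend[OF baer_C_star Z A] by blast
  have "\<chi> b = 1" if "b \<in> B" for b
  proof -
    have "b \<ominus>\<^bsub>M\<^esub> add_pow M (0::int) x \<in> B" using that s(1) M.M.diff_zero_right by (simp add: p0)
    thus ?thesis using \<chi>(2) \<chi>0[of b 0] s(1)[OF that] by (auto simp: A_def)
  qed
  moreover have "\<chi> x = z"
  proof -
    have "x \<ominus>\<^bsub>M\<^esub> add_pow M (1::int) x \<in> B" using x(1) s(2) by (simp add: p1 a_minus_def M.M.r_neg)
    moreover from this have "x \<in> A" using x(1) unfolding A_def by blast
    ultimately show ?thesis using \<chi>(2) \<chi>0[of x 1] x(1) by simp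
  qed
  ultimately show ?thesis using \<chi>(1) z(2) by blast
qed
section \<open>Existence of injective resolutions\<close>

text \<open>The value off the carrier is fixed so that a character is determined by its restriction.\<close>

definition characters :: "'a ring \<Rightarrow> ('a \<Rightarrow> complex) set" where
  "characters R = {\<chi>. (\<forall>r\<in>carrier R. \<chi> r \<noteq> 0) \<and> (\<forall>r. r \<notin> carrier R \<longrightarrow> \<chi> r = 1) \<and>
     (\<forall>r\<in>carrier R. \<forall>s\<in>carrier R. \<chi> (r \<oplus>\<^bsub>R\<^esub> s) = \<chi> r * \<chi> s)}"

text \<open>An injective module, as the multiplicative group of the complex numbers is divisible; for
  suitable \<open>'x\<close> a given module embeds in it.\<close>

definition character_product :: "'a ring \<Rightarrow> ('a, 'x \<Rightarrow> 'a \<Rightarrow> complex) module" where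
  "character_product R =
     \<lparr>carrier = {\<Theta>. \<forall>x. \<Theta> x \<in> characters R}, monoid.mult = undefined, one = undefined,
      ring.zero = (\<lambda>_ _. 1), ring.add = (\<lambda>\<Theta> \<Psi> x r. \<Theta> x r * \<Psi> x r),
      smult = (\<lambda>s \<Theta> x r. if r \<in> carrier R then \<Theta> x (r \<otimes>\<^bsub>R\<^esub> s) else 1)\<rparr>"

lemma character_product_simps:
  "carrier (character_product R) = {\<Theta>. \<forall>x. \<Theta> x \<in> characters R}"
  "\<zero>\<^bsub>character_product R\<^esub> = (\<lambda>_ _. 1)"
  "\<Theta> \<oplus>\<^bsub>character_product R\<^esub> \<Psi> = (\<lambda>x r. \<Theta> x r * \<Psi> x r)"
  "s \<odot>\<^bsub>character_product R\<^esub> \<Theta> = (\<lambda>x r. if r \<in> carrier R then \<Theta> x (r \<otimes>\<^bsub>R\<^esub> s) else 1)"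
  by (auto simp: character_product_def)

lemma module_character_product:
  assumes "cring R" shows "Module.module R (character_product R :: ('a, 'x \<Rightarrow> 'a \<Rightarrow> complex) module)"
proof -
  interpret cring R by fact
  let ?Q = "character_product R :: ('a, 'x \<Rightarrow> 'a \<Rightarrow> complex) module"
  note t = character_product_simps
  have ag: "abelian_group ?Q"
  proof (rule abelian_groupI)
    fix \<Theta> assume "\<Theta> \<in> carrier ?Q"
    hence c: "\<Theta> x \<in> characters R" for x by (simp add: t)
    have "(\<lambda>x r. inverse (\<Theta> x r)) \<in> carrier ?Q"
      using c by (auto simp: t characters_def)
    moreover have "inverse (\<Theta> x r) * \<Theta> x r = 1" for x r
      using c[of x] by (cases "r \<in> carrier R") (auto simp: characters_def)
    ultimately show "\<exists>\<Psi>\<in>carrier ?Q. \<Psi> \<oplus>\<^bsub>?Q\<^esub> \<Theta> = \<zero>\<^bsub>?Q\<^esub>"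
      by (intro bexI[of _ "\<lambda>x r. inverse (\<Theta> x r)"]) (simp_all add: t)
  qed (auto simp: t characters_def mult_ac)
  show ?thesis
  proof (rule moduleI)
    have c: "\<Theta> x \<in> characters R" if "\<Theta> \<in> carrier ?Q" for \<Theta> x using that by (simp add: t)
    fix a assume a: "a \<in> carrier R"
    show "a \<odot>\<^bsub>?Q\<^esub> \<Theta> \<in> carrier ?Q" if "\<Theta> \<in> carrier ?Q" for \<Theta>
      using c[OF that] a by (auto simp: t characters_def l_distr)
    show "(a \<oplus>\<^bsub>R\<^esub> b) \<odot>\<^bsub>?Q\<^esub> \<Theta> = a \<odot>\<^bsub>?Q\<^esub> \<Theta> \<oplus>\<^bsub>?Q\<^esub> b \<odot>\<^bsub>?Q\<^esub> \<Theta>"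
      if "b \<in> carrier R" "\<Theta> \<in> carrier ?Q" for b \<Theta>
      using c[OF that(2)] a that(1) by (auto simp: t characters_def r_distr fun_eq_iff)
    show "(a \<otimes>\<^bsub>R\<^esub> b) \<odot>\<^bsub>?Q\<^esub> \<Theta> = a \<odot>\<^bsub>?Q\<^esub> (b \<odot>\<^bsub>?Q\<^esub> \<Theta>)" if "b \<in> carrier R" for b \<Theta>
      using a that by (auto simp: t fun_eq_iff m_assoc)
    show "a \<odot>\<^bsub>?Q\<^esub> (\<Theta> \<oplus>\<^bsub>?Q\<^esub> \<Psi>) = a \<odot>\<^bsub>?Q\<^esub> \<Theta> \<oplus>\<^bsub>?Q\<^esub> a \<odot>\<^bsub>?Q\<^esub> \<Psi>" for \<Theta> \<Psi>
      by (auto simp: t fun_eq_iff)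
  next
    fix \<Theta> assume "\<Theta> \<in> carrier ?Q"
    hence "\<Theta> x \<in> characters R" for x by (simp add: t)
    thus "\<one>\<^bsub>R\<^esub> \<odot>\<^bsub>?Q\<^esub> \<Theta> = \<Theta>"
      by (auto simp: t characters_def fun_eq_iff)
  qed (rule ag assms)+
qed

lemma baer_character_product:
  assumes "cring R" shows "baer R (character_product R :: ('a, 'x \<Rightarrow> 'a \<Rightarrow> complex) module)"
  unfolding baer_def
proof (intro conjI allI impI module_character_product assms)
  interpret cring R by fact
  let ?Q = "character_product R :: ('a, 'x \<Rightarrow> 'a \<Rightarrow> complex) module"
  note t = character_product_simps
  note RR = module_self[OF assms] and ZR = module_Z_module[OF module_self[OF assms]]
  interpret Z: Module.module \<Z> "Z_module (regular_module R)" by (rule ZR)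
  interpret M: Module.module R "regular_module R" by (rule RR)
  fix I f assume "submodule I R (regular_module R) \<and> f \<in> mod_hom R ((regular_module R)\<lparr>carrier := I\<rparr>) ?Q"
  hence I: "submodule I R (regular_module R)" and f: "f \<in> mod_hom R ((regular_module R)\<lparr>carrier := I\<rparr>) ?Q" by auto
  note s = submodule_simps[OF RR I, simplified]
  have fc: "f i x \<in> characters R" if "i \<in> I" for i x
    using mod_hom_closed[OF f, of i] that by (simp add: t)
  have fadd: "f (i \<oplus>\<^bsub>R\<^esub> j) x r = f i x r * f j x r" if "i \<in> I" "j \<in> I" for i j x r
    using mod_hom_add[OF f, of i j] that by (simp add: t)
  have fmul: "f (r \<otimes>\<^bsub>R\<^esub> i) x q = f i x (q \<otimes>\<^bsub>R\<^esub> r)" if "i \<in> I" "r \<in> carrier R" "q \<in> carrier R" for i r x q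
    using mod_hom_smult[OF f, of r i] that by (simp add: t)
  interpret MI: Module.module R "(regular_module R)\<lparr>carrier := I\<rparr>"
    by (rule submodule.submodule_is_module[OF I RR])
  have powI: "add_pow (regular_module R) (k::int) i \<in> I \<and> f (add_pow (regular_module R) k i) x \<one>\<^bsub>R\<^esub> = (f i x \<one>\<^bsub>R\<^esub>) powi k"
    if i: "i \<in> I" for k i x
  proof -
    have nz: "f i x \<one>\<^bsub>R\<^esub> \<noteq> 0" using fc[OF i, of x] by (simp add: characters_def)
    have nat: "add_pow (regular_module R) (int n) i \<in> I \<and>
        f (add_pow (regular_module R) (int n) i) x \<one>\<^bsub>R\<^esub> = (f i x \<one>\<^bsub>R\<^esub>) powi (int n)" for n
    proof (induction n)
      case 0
      have "f \<zero>\<^bsub>R\<^esub> = \<zero>\<^bsub>?Q\<^esub>"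
        using mod_hom_zero[OF submodule.submodule_is_module[OF I RR] module_character_product[OF assms] f] by simp
      moreover have "add_pow (regular_module R) (0::int) i = \<zero>\<^bsub>R\<^esub>"
        using Z.smult_l_null[of i] s(1)[OF i] by simp
      ultimately show ?case using s(2) by (simp add: t)
    next
      case (Suc n)
      have "add_pow (regular_module R) (int (Suc n)) i = add_pow (regular_module R) (int n) i \<oplus>\<^bsub>R\<^esub> i"
        using Z.smult_l_distr[of "int n" 1 i] Z.smult_one[of i] s(1)[OF i] by (simp add: add.commute)
      thus ?case using Suc fadd[of "add_pow (regular_module R) (int n) i" i] i s(3) nz by (simp add: power_int_add)
    qed
    show ?thesis
    proof (cases "k \<ge> 0")
      case True thus ?thesis using nat[of "nat k"] by simp
    next
      case False
      then obtain n where k: "k = - int n" by (metis int_cases2 of_nat_0_le_iff)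
      define j where "j = add_pow (regular_module R) (int n) i"
      have jI: "j \<in> I" and fj: "f j x \<one>\<^bsub>R\<^esub> = (f i x \<one>\<^bsub>R\<^esub>) powi (int n)" using nat[of n] by (auto simp: j_def)
      have e: "add_pow (regular_module R) k i \<oplus>\<^bsub>R\<^esub> j = \<zero>\<^bsub>R\<^esub>"
        using Z.smult_l_distr[of k "int n" i] Z.smult_l_null[of i] s(1)[OF i] by (simp add: k j_def)
      have kR: "add_pow (regular_module R) k i \<in> carrier R" using Z.smult_closed[of k i] s(1)[OF i] by simp
      have "add_pow (regular_module R) k i = \<ominus>\<^bsub>R\<^esub> j" using minus_equality[OF e s(1)[OF jI] kR] by simp
      also have "\<dots> = (\<ominus>\<^bsub>R\<^esub> \<one>\<^bsub>R\<^esub>) \<otimes>\<^bsub>R\<^esub> j" using s(1)[OF jI] by (simp add: l_minus)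
      also have "\<dots> \<in> I" using s(6)[OF _ jI] by simp
      finally have kI: "add_pow (regular_module R) k i \<in> I" .
      have "f \<zero>\<^bsub>R\<^esub> = \<zero>\<^bsub>?Q\<^esub>"
        using mod_hom_zero[OF submodule.submodule_is_module[OF I RR] module_character_product[OF assms] f] by simp
      hence "f (add_pow (regular_module R) k i) x \<one>\<^bsub>R\<^esub> * f j x \<one>\<^bsub>R\<^esub> = 1"
        using fadd[OF kI jI, of x "\<one>\<^bsub>R\<^esub>"] e by (simp add: t)
      thus ?thesis using kI nz by (simp add: fj k power_int_minus field_simps)
    qed
  qed
  have IZ: "submodule I \<Z> (Z_module (regular_module R))"
  proof (rule Z.submoduleI)
    show "\<ominus>\<^bsub>Z_module (regular_module R)\<^esub> i \<in> I" if "i \<in> I" for i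
      using Z.smult_l_minus[of 1 i] Z.smult_one[of i] powI[OF that, of "-1"] s(1)[OF that] by simp
  qed (use s powI in auto)
  have "\<exists>g\<in>mod_hom \<Z> (Z_module (regular_module R)) C_star. \<forall>i\<in>I. g i = f i x \<one>\<^bsub>R\<^esub>" for x
  proof (rule baer_extend[OF baer_C_star ZR IZ])
    show "(\<lambda>i. f i x \<one>\<^bsub>R\<^esub>) \<in> mod_hom \<Z> ((Z_module (regular_module R))\<lparr>carrier := I\<rparr>) C_star"
      by (rule mod_homI) (use fc fadd powI in \<open>auto simp: characters_def\<close>)
  qed
  then obtain g where g: "\<And>x. g x \<in> mod_hom \<Z> (Z_module (regular_module R)) C_star"
    "\<And>x i. i \<in> I \<Longrightarrow> g x i = f i x \<one>\<^bsub>R\<^esub>" by metis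
  define e where "e x r = (if r \<in> carrier R then g x r else 1)" for x r
  have "e \<in> carrier ?Q"
    using mod_hom_closed[OF g(1)] mod_hom_add[OF g(1)] by (auto simp: t characters_def e_def)
  moreover have "f r = r \<odot>\<^bsub>?Q\<^esub> e" if r: "r \<in> I" for r
  proof (intro ext)
    fix x q
    show "f r x q = (r \<odot>\<^bsub>?Q\<^esub> e) x q"
    proof (cases "q \<in> carrier R")
      case True
      have "(r \<odot>\<^bsub>?Q\<^esub> e) x q = f (q \<otimes>\<^bsub>R\<^esub> r) x \<one>\<^bsub>R\<^esub>"
        using True r s(1)[OF r] g(2)[OF s(6)[OF True r]] by (simp add: t e_def)
      also have "\<dots> = f r x q" using fmul[OF r True, of "\<one>\<^bsub>R\<^esub>" x] True by simp
      finally show ?thesis by simp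
    next
      case False thus ?thesis using fc[OF r, of x] by (simp add: t characters_def)
    qed
  qed
  ultimately show "\<exists>e\<in>carrier ?Q. \<forall>r\<in>I. f r = r \<odot>\<^bsub>?Q\<^esub> e" by blast
qed

text \<open>One factor for each x: a character trivial on \<open>B\<close> and, if x is not in
  \<open>B\<close>, nontrivial at x. The factor indexed by n itself detects n. Prescribing the
  kernel \<open>B\<close> embeds N/B without forming the quotient.\<close>

lemma character_product_embedding:
  fixes N :: "('a, 'x) module"
  assumes N: "Module.module R N" and B: "submodule B R N"
  shows "\<exists>\<iota>\<in>mod_hom R N (character_product R :: ('a, 'x \<Rightarrow> 'a \<Rightarrow> complex) module).
    \<forall>n\<in>carrier N. \<iota> n = \<zero>\<^bsub>character_product R\<^esub> \<longleftrightarrow> n \<in> B"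
proof -
  interpret N: Module.module R N by (rule N)
  let ?Q = "character_product R :: ('a, 'x \<Rightarrow> 'a \<Rightarrow> complex) module"
  note t = character_product_simps
  have one: "(\<lambda>_. 1) \<in> mod_hom \<Z> (Z_module N) C_star" by (rule mod_homI) auto
  have "\<exists>\<chi>\<in>mod_hom \<Z> (Z_module N) C_star. (\<forall>b\<in>B. \<chi> b = 1) \<and> (x \<in> carrier N - B \<longrightarrow> \<chi> x \<noteq> 1)" for x
    using character_separates[OF N B, of x] one by (cases "x \<in> carrier N - B") auto
  then obtain \<chi> where \<chi>: "\<And>x. \<chi> x \<in> mod_hom \<Z> (Z_module N) C_star" "\<And>x b. b \<in> B \<Longrightarrow> \<chi> x b = 1"
    "\<And>x. x \<in> carrier N \<Longrightarrow> x \<notin> B \<Longrightarrow> \<chi> x x \<noteq> 1" by (metis DiffI)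
  define \<iota> where "\<iota> n = (\<lambda>x r. if r \<in> carrier R then \<chi> x (r \<odot>\<^bsub>N\<^esub> n) else 1)" for n
  have nz: "\<chi> x n \<noteq> 0" if "n \<in> carrier N" for x n using mod_hom_closed[OF \<chi>(1), of n x] that by simp
  have add: "\<chi> x (n \<oplus>\<^bsub>N\<^esub> m) = \<chi> x n * \<chi> x m" if "n \<in> carrier N" "m \<in> carrier N" for x n m
    using mod_hom_add[OF \<chi>(1), of n m x] that by simp
  have "\<iota> \<in> mod_hom R N ?Q"
    by (rule mod_homI)
      (auto simp: t \<iota>_def characters_def nz add N.smult_r_distr N.smult_l_distr N.smult_assoc1 fun_eq_iff)
  moreover have "\<iota> n = \<zero>\<^bsub>?Q\<^esub> \<longleftrightarrow> n \<in> B" if n: "n \<in> carrier N" for n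
  proof
    assume "\<iota> n = \<zero>\<^bsub>?Q\<^esub>"
    hence "\<iota> n n \<one>\<^bsub>R\<^esub> = 1" by (simp add: t)
    thus "n \<in> B" using \<chi>(3)[OF n] n by (auto simp: \<iota>_def)
  next
    assume "n \<in> B" thus "\<iota> n = \<zero>\<^bsub>?Q\<^esub>"
      using submodule_simps(6)[OF N B] \<chi>(2) by (auto simp: \<iota>_def t fun_eq_iff)
  qed
  ultimately show ?thesis by blast
qed

text \<open>Terms naming the elements of a submodule closed under the extension problems of Baer's
  criterion: \<open>Solve rs ts\<close> names a solution \<open>e\<close> of the equations \<open>r e = t\<close>.\<close>

datatype ('a, 'x) closure_term =
  Base 'x | Add "('a, 'x) closure_term" "('a, 'x) closure_term" | Scale 'a "('a, 'x) closure_term"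
  | Solve "'a list" "('a, 'x) closure_term list"

text \<open>The default zero for unsolvable systems makes every term name an element of the carrier,
  so that terms need no well-formedness condition.\<close>

definition solution :: "('a, 'q) module \<Rightarrow> 'a list \<Rightarrow> 'q list \<Rightarrow> 'q" where
  "solution Q rs us =
     (let P = \<lambda>e. e \<in> carrier Q \<and> (\<forall>(r, u)\<in>set (zip rs us). r \<odot>\<^bsub>Q\<^esub> e = u)
      in if Ex P then Eps P else \<zero>\<^bsub>Q\<^esub>)"

primrec closure_eval :: "'a ring \<Rightarrow> ('a, 'q) module \<Rightarrow> ('x \<Rightarrow> 'q) \<Rightarrow> ('a, 'x) closure_term \<Rightarrow> 'q" where
  "closure_eval R Q \<iota> (Base x) = (if \<iota> x \<in> carrier Q then \<iota> x else \<zero>\<^bsub>Q\<^esub>)"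
| "closure_eval R Q \<iota> (Add s t) = closure_eval R Q \<iota> s \<oplus>\<^bsub>Q\<^esub> closure_eval R Q \<iota> t"
| "closure_eval R Q \<iota> (Scale r t) = (if r \<in> carrier R then r \<odot>\<^bsub>Q\<^esub> closure_eval R Q \<iota> t else \<zero>\<^bsub>Q\<^esub>)"
| "closure_eval R Q \<iota> (Solve rs ts) = solution Q rs (map (closure_eval R Q \<iota>) ts)"

context
  fixes R :: "'a ring" and Q :: "('a, 'q) module" and \<iota> :: "'x \<Rightarrow> 'q"
  assumes noeth: "noetherian_ring R" and baer: "baer R Q"
begin

lemma solution_closed: "solution Q rs us \<in> carrier Q"
proof -
  interpret Q: Module.module R Q using baer by (simp add: baer_def)
  let ?P = "\<lambda>e. e \<in> carrier Q \<and> (\<forall>(r, u)\<in>set (zip rs us). r \<odot>\<^bsub>Q\<^esub> e = u)"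
  show ?thesis using someI_ex[of ?P] by (auto simp: solution_def Let_def)
qed

lemma solution_solves:
  assumes "e \<in> carrier Q" "\<And>r u. (r, u) \<in> set (zip rs us) \<Longrightarrow> r \<odot>\<^bsub>Q\<^esub> e = u" "(r, u) \<in> set (zip rs us)"
  shows "r \<odot>\<^bsub>Q\<^esub> solution Q rs us = u"
proof -
  let ?P = "\<lambda>e. e \<in> carrier Q \<and> (\<forall>(r, u)\<in>set (zip rs us). r \<odot>\<^bsub>Q\<^esub> e = u)"
  have "?P e" using assms by auto
  hence "?P (Eps ?P)" by (rule someI)
  thus ?thesis using assms(3) \<open>?P e\<close> by (auto simp: solution_def Let_def)
qed

lemma closure_eval_closed: "closure_eval R Q \<iota> t \<in> carrier Q"
proof -
  interpret Q: Module.module R Q using baer by (simp add: baer_def)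
  show ?thesis by (induction t) (auto simp: solution_closed)
qed

lemma closure_submodule: "submodule (range (closure_eval R Q \<iota>)) R Q"
proof -
  interpret Q: Module.module R Q using baer by (simp add: baer_def)
  let ?S = "range (closure_eval R Q \<iota>)"
  have sm: "r \<odot>\<^bsub>Q\<^esub> a \<in> ?S" if r: "r \<in> carrier R" and a: "a \<in> ?S" for r a
  proof -
    obtain t where "a = closure_eval R Q \<iota> t" using a by blast
    hence "r \<odot>\<^bsub>Q\<^esub> a = closure_eval R Q \<iota> (Scale r t)" using r by simp
    thus ?thesis by blast
  qed
  show ?thesis
  proof (rule Q.submoduleI)
    show "a \<oplus>\<^bsub>Q\<^esub> b \<in> ?S" if ab: "a \<in> ?S" "b \<in> ?S" for a b
    proof -
      obtain s t where "a = closure_eval R Q \<iota> s" "b = closure_eval R Q \<iota> t" using ab by blast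
      hence "a \<oplus>\<^bsub>Q\<^esub> b = closure_eval R Q \<iota> (Add s t)" by simp
      thus ?thesis by blast
    qed
    have "\<zero>\<^bsub>Q\<^esub> = closure_eval R Q \<iota> (Scale \<zero>\<^bsub>R\<^esub> (Base undefined))"
      using closure_eval_closed[of "Base undefined"] by simp
    thus "\<zero>\<^bsub>Q\<^esub> \<in> ?S" by blast
    show "\<ominus>\<^bsub>Q\<^esub> a \<in> ?S" if "a \<in> ?S" for a
    proof -
      have "\<ominus>\<^bsub>Q\<^esub> a = (\<ominus>\<^bsub>R\<^esub> \<one>\<^bsub>R\<^esub>) \<odot>\<^bsub>Q\<^esub> a" using that closure_eval_closed by (auto simp: Q.smult_l_minus)
      thus ?thesis using sm[OF _ that] by simp
    qed
  qed (use sm closure_eval_closed in auto)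
qed

text \<open>A map on an ideal is determined by its values on finitely many generators. These values
  are named by terms, so a \<open>Solve\<close> term names an element with the right products on the
  generators; the elements of the ideal where both maps agree form an ideal, hence
  everything.\<close>

lemma baer_closure: "baer R (Q\<lparr>carrier := range (closure_eval R Q \<iota>)\<rparr>)"
  unfolding baer_def
proof (intro conjI allI impI)
  have Q: "Module.module R Q" using baer by (simp add: baer_def)
  interpret Q: Module.module R Q by (rule Q)
  let ?S = "range (closure_eval R Q \<iota>)"
  note sS = submodule_simps[OF Q closure_submodule]
  show "Module.module R (Q\<lparr>carrier := ?S\<rparr>)" by (rule submodule.submodule_is_module[OF closure_submodule Q])
  fix I f assume If: "submodule I R (regular_module R) \<and> f \<in> mod_hom R ((regular_module R)\<lparr>carrier := I\<rparr>) (Q\<lparr>carrier := ?S\<rparr>)"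
  note RR = module_self[OF Q.R.is_cring]
  note sI = submodule_simps[OF RR conjunct1[OF If], simplified]
  have fS: "f r \<in> ?S" if "r \<in> I" for r using If that by (auto simp: mod_hom_def)
  have fQ: "f \<in> mod_hom R ((regular_module R)\<lparr>carrier := I\<rparr>) Q"
    using If closure_eval_closed by (auto simp: mod_hom_def Pi_iff)
  have I: "ideal I R" using If submodule_regular_iff_ideal[OF Q.R.is_cring] by blast
  obtain A where A: "A \<subseteq> carrier R" "finite A" "I = Idl\<^bsub>R\<^esub> A"
    using noetherian_ring.finetely_gen[OF noeth I] by blast
  obtain rs where rs: "set rs = A" using finite_list[OF A(2)] by blast
  have AI: "A \<subseteq> I" unfolding A(3) by (rule Q.R.genideal_self[OF A(1)])
  have "\<exists>t. closure_eval R Q \<iota> t = f r" if "r \<in> I" for r using fS[OF that] by force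
  then obtain \<tau> where \<tau>: "\<And>r. r \<in> I \<Longrightarrow> closure_eval R Q \<iota> (\<tau> r) = f r" by metis
  \<comment> \<open>This element only certifies that the system is solvable in \<open>Q\<close>; it
    may lie outside the closure, unlike the solution named by the term below.\<close>
  obtain e0 where e0: "e0 \<in> carrier Q" "\<And>r. r \<in> I \<Longrightarrow> f r = r \<odot>\<^bsub>Q\<^esub> e0"
    using baer fQ conjunct1[OF If] unfolding baer_def by blast
  define e where "e = closure_eval R Q \<iota> (Solve rs (map \<tau> rs))"
  have us: "map (closure_eval R Q \<iota>) (map \<tau> rs) = map f rs" using \<tau> rs AI by auto
  have zip: "(r, u) \<in> set (zip rs (map f rs)) \<longleftrightarrow> r \<in> A \<and> u = f r" for r u
    using rs by (auto simp: zip_map2 zip_same_conv_map)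
  have eA: "r \<odot>\<^bsub>Q\<^esub> e = f r" if "r \<in> A" for r
    unfolding e_def closure_eval.simps us
    by (rule solution_solves[OF e0(1)]) (use that zip e0(2) AI in auto)
  have eQ: "e \<in> carrier Q" unfolding e_def by (rule closure_eval_closed)
  have "I \<subseteq> {r \<in> I. f r = r \<odot>\<^bsub>Q\<^esub> e}"
    unfolding A(3)
  proof (rule Q.R.genideal_minimal)
    have "submodule {r \<in> I. f r = r \<odot>\<^bsub>Q\<^esub> e} R (regular_module R)"
    proof (rule module.submoduleI[OF RR])
      show *: "r \<odot>\<^bsub>regular_module R\<^esub> a \<in> {r \<in> I. f r = r \<odot>\<^bsub>Q\<^esub> e}"
        if "r \<in> carrier R" "a \<in> {r \<in> I. f r = r \<odot>\<^bsub>Q\<^esub> e}" for r a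
        using that mod_hom_smult[OF fQ, of r a] sI eQ by (simp add: Q.smult_assoc1)
      show "\<ominus>\<^bsub>regular_module R\<^esub> a \<in> {r \<in> I. f r = r \<odot>\<^bsub>Q\<^esub> e}" if "a \<in> {r \<in> I. f r = r \<odot>\<^bsub>Q\<^esub> e}" for a
      proof -
        have "\<ominus>\<^bsub>regular_module R\<^esub> a = (\<ominus>\<^bsub>R\<^esub> \<one>\<^bsub>R\<^esub>) \<odot>\<^bsub>regular_module R\<^esub> a"
          using module.smult_l_minus[OF RR, of "\<one>\<^bsub>R\<^esub>" a] that sI(1) by simp
        thus ?thesis using *[OF _ that] by simp
      qed
      show "a \<oplus>\<^bsub>regular_module R\<^esub> b \<in> {r \<in> I. f r = r \<odot>\<^bsub>Q\<^esub> e}"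
        if "a \<in> {r \<in> I. f r = r \<odot>\<^bsub>Q\<^esub> e}" "b \<in> {r \<in> I. f r = r \<odot>\<^bsub>Q\<^esub> e}" for a b
        using that mod_hom_add[OF fQ, of a b] sI eQ by (simp add: Q.smult_l_distr)
      show "\<zero>\<^bsub>regular_module R\<^esub> \<in> {r \<in> I. f r = r \<odot>\<^bsub>Q\<^esub> e}"
        using mod_hom_zero[OF submodule.submodule_is_module[OF conjunct1[OF If] RR] Q fQ] sI eQ by simp
    qed (use sI in auto)
    thus "ideal {r \<in> Idl\<^bsub>R\<^esub> A. f r = r \<odot>\<^bsub>Q\<^esub> e} R"
      using submodule_regular_iff_ideal[OF Q.R.is_cring] A(3) by simp
    show "A \<subseteq> {r \<in> Idl\<^bsub>R\<^esub> A. f r = r \<odot>\<^bsub>Q\<^esub> e}" using eA AI A(3) by auto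
  qed
  moreover have "e \<in> ?S" unfolding e_def by (rule rangeI)
  ultimately show "\<exists>e\<in>carrier (Q\<lparr>carrier := ?S\<rparr>). \<forall>r\<in>I. f r = r \<odot>\<^bsub>Q\<lparr>carrier := ?S\<rparr>\<^esub> e"
    by auto
qed

end

text \<open>Numerals inside \<open>res_elem\<close>, marking the constructors of encoded
  terms.\<close>

definition res_tag :: "nat \<Rightarrow> ('a, 'b) res_elem" where
  "res_tag n = Res_Node (replicate n (Res_Node []))"

lemma res_tag_inject [simp]: "res_tag m = res_tag n \<longleftrightarrow> m = n"
  by (auto simp: res_tag_def replicate_eq_replicate)

text \<open>Terms over \<open>res_elem\<close> embed back into \<open>res_elem\<close>. This keeps
  all members of an injective resolution in one type.\<close>

primrec encode_term :: "('a, ('a, 'b) res_elem) closure_term \<Rightarrow> ('a, 'b) res_elem" where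
  "encode_term (Base x) = Res_Node [res_tag 0, x]"
| "encode_term (Add s t) = Res_Node [res_tag 1, encode_term s, encode_term t]"
| "encode_term (Scale r t) = Res_Node [res_tag 2, Ring_Elem r, encode_term t]"
| "encode_term (Solve rs ts) = Res_Node (res_tag 3 # Res_Node (map Ring_Elem rs) # map encode_term ts)"

lemma encode_term_inject: "encode_term s = encode_term t \<Longrightarrow> s = t"
proof (induction s arbitrary: t)
  case (Base x) thus ?case by (cases t) auto
next
  case (Add s1 s2) thus ?case by (cases t) auto
next
  case (Scale r s) thus ?case by (cases t) auto
next
  case (Solve rs ss)
  then obtain rs' ts where t: "t = Solve rs' ts" by (cases t) auto
  have "map Ring_Elem rs = (map Ring_Elem rs' :: ('a, 'b) res_elem list)" "map encode_term ss = map encode_term ts"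
    using Solve.prems t by auto
  hence "rs = rs'" by (metis inj_map_eq_map injI res_elem.inject(1))
  moreover have "ss = ts"
  proof (rule nth_equalityI)
    show "length ss = length ts" using \<open>map encode_term ss = map encode_term ts\<close> by (rule map_eq_imp_length_eq)
    show "ss ! i = ts ! i" if "i < length ss" for i
    proof (rule Solve.IH)
      show "ss ! i \<in> set ss" using that by simp
      show "encode_term (ss ! i) = encode_term (ts ! i)"
        using that \<open>map encode_term ss = map encode_term ts\<close> by (metis map_eq_imp_length_eq nth_map)
    qed
  qed
  ultimately show ?case using t by simp
qed

text \<open>One step of a resolution: N/B is embedded in an injective module of the same type as
  \<open>N\<close>. The character product is injective but lives in a larger type; the closure of
  the image of \<open>N\<close> inside it is still injective, and its elements can be replaced by
  codes of terms naming them.\<close>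

lemma injective_embedding:
  fixes R :: "'a ring" and N :: "('a, ('a, 'b) res_elem) module"
  assumes noeth: "noetherian_ring R" and N: "Module.module R N" and B: "submodule B R N"
  shows "\<exists>(E :: ('a, ('a, 'b) res_elem) module) \<delta>. is_injective_module R E \<and> \<delta> \<in> mod_hom R N E \<and>
    (\<forall>n\<in>carrier N. \<delta> n = \<zero>\<^bsub>E\<^esub> \<longleftrightarrow> n \<in> B)"
proof -
  interpret N: Module.module R N by (rule N)
  let ?Q = "character_product R :: ('a, ('a, 'b) res_elem \<Rightarrow> 'a \<Rightarrow> complex) module"
  have bQ: "baer R ?Q" by (rule baer_character_product[OF N.R.is_cring])
  have Q: "Module.module R ?Q" by (rule module_character_product[OF N.R.is_cring])
  obtain \<iota> where \<iota>: "\<iota> \<in> mod_hom R N ?Q" "\<And>n. n \<in> carrier N \<Longrightarrow> \<iota> n = \<zero>\<^bsub>?Q\<^esub> \<longleftrightarrow> n \<in> B"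
    using character_product_embedding[OF N B] by blast
  let ?S = "range (closure_eval R ?Q \<iota>)"
  let ?QS = "?Q\<lparr>carrier := ?S\<rparr>"
  have bS: "baer R ?QS" by (rule baer_closure[OF noeth bQ])
  have QS: "Module.module R ?QS" using bS by (simp add: baer_def)
  have \<iota>S: "\<iota> n \<in> ?S" if "n \<in> carrier N" for n
    using mod_hom_closed[OF \<iota>(1) that] by (intro image_eqI[of _ _ "Base n"]) auto
  have \<iota>': "\<iota> \<in> mod_hom R N ?QS" using \<iota>(1) \<iota>S by (auto simp: mod_hom_def)
  \<comment> \<open>A code of some term naming u. Evaluating the chosen term gives u back, so
    distinct elements receive distinct codes.\<close>
  define h where "h u = encode_term (SOME t. closure_eval R ?Q \<iota> t = u)" for u
  have h: "inj_on h (carrier ?QS)"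
  proof (rule inj_onI)
    fix u v assume "u \<in> carrier ?QS" "v \<in> carrier ?QS" "h u = h v"
    moreover have "closure_eval R ?Q \<iota> (SOME t. closure_eval R ?Q \<iota> t = w) = w" if w: "w \<in> carrier ?QS" for w
    proof -
      obtain t where "closure_eval R ?Q \<iota> t = w" using w by auto
      thus ?thesis by (rule someI)
    qed
    ultimately show "u = v" using encode_term_inject unfolding h_def by metis
  qed
  have "is_injective_module R (transport h ?QS)"
    by (rule baer_injective_module[OF baer_transport[OF QS h bS]])
  moreover have "(\<lambda>n. h (\<iota> n)) \<in> mod_hom R N (transport h ?QS)"
    by (rule mod_hom_compose[OF \<iota>' transport_hom[OF QS h]])
  moreover have "h (\<iota> n) = \<zero>\<^bsub>transport h ?QS\<^esub> \<longleftrightarrow> n \<in> B" if n: "n \<in> carrier N" for n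
  proof -
    have "h (\<iota> n) = h \<zero>\<^bsub>?QS\<^esub> \<longleftrightarrow> \<iota> n = \<zero>\<^bsub>?QS\<^esub>"
      by (rule inj_on_eq_iff[OF h]) (use \<iota>S[OF n] submodule_simps(2)[OF Q closure_submodule[OF noeth bQ]] in auto)
    thus ?thesis using \<iota>(2)[OF n] by (simp add: transport_simps[OF QS h])
  qed
  ultimately show ?thesis by blast
qed

theorem injective_resolution_exists:
  fixes R :: "'a ring" and M :: "('a, 'b) module"
  assumes noeth: "noetherian_ring R" and M: "Module.module R M"
  shows "is_injective_resolution R M (injective_resolution R M)"
proof -
  have hM: "inj_on Mod_Elem (carrier M)" by (simp add: inj_on_def)
  let ?N = "transport Mod_Elem M :: ('a, ('a, 'b) res_elem) module"
  note N = module_transport[OF M hM]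
  interpret M: Module.module R M by (rule M)
  obtain E0 :: "('a, ('a, 'b) res_elem) module" and \<delta>' where E0: "is_injective_module R E0"
    "\<delta>' \<in> mod_hom R ?N E0" "\<And>n. n \<in> carrier ?N \<Longrightarrow> \<delta>' n = \<zero>\<^bsub>E0\<^esub> \<longleftrightarrow> n \<in> {\<zero>\<^bsub>?N\<^esub>}"
    using injective_embedding[OF noeth N submodule_zero[OF N]] by blast
  define \<eta> where "\<eta> x = \<delta>' (Mod_Elem x)" for x
  have E0m: "Module.module R E0" using E0(1) by (simp add: is_injective_module_def)
  have \<eta>: "\<eta> \<in> mod_hom R M E0"
    unfolding \<eta>_def by (rule mod_hom_compose[OF transport_hom[OF M hM] E0(2)])
  have \<eta>inj: "inj_on \<eta> (carrier M)"
  proof (rule inj_onI)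
    interpret E0: Module.module R E0 by (rule E0m)
    fix x y assume xy: "x \<in> carrier M" "y \<in> carrier M" "\<eta> x = \<eta> y"
    have "\<eta> (x \<ominus>\<^bsub>M\<^esub> y) = \<zero>\<^bsub>E0\<^esub>"
      using mod_hom_minus[OF M E0m \<eta> xy(1,2)] xy(3) E0.M.diff_eq_zero_iff mod_hom_closed[OF \<eta>] xy(1,2) by simp
    hence "x \<ominus>\<^bsub>M\<^esub> y = \<zero>\<^bsub>M\<^esub>"
      using E0(3)[of "Mod_Elem (x \<ominus>\<^bsub>M\<^esub> y)"] xy(1,2) by (simp add: \<eta>_def transport_simps[OF M hM])
    thus "x = y" using M.M.diff_eq_zero_iff xy(1,2) by simp
  qed
  \<comment> \<open>The state of the recursion pairs a member of the resolution with the image of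
    the preceding map, which the next map must have as its kernel.\<close>
  define P where "P p \<longleftrightarrow> is_injective_module R (fst p) \<and> submodule (snd p) R (fst p)"
    for p :: "('a, ('a, 'b) res_elem) module \<times> ('a, 'b) res_elem set"
  define S where "S p p' \<longleftrightarrow> (\<exists>\<delta>\<in>mod_hom R (fst p) (fst p').
      (\<forall>n\<in>carrier (fst p). \<delta> n = \<zero>\<^bsub>fst p'\<^esub> \<longleftrightarrow> n \<in> snd p) \<and> snd p' = \<delta> ` carrier (fst p))"
    for p p' :: "('a, ('a, 'b) res_elem) module \<times> ('a, 'b) res_elem set"
  have start: "P (E0, \<eta> ` carrier M)"
    using E0(1) submodule_image[OF M E0m \<eta> M.carrier_is_submodule] by (simp add: P_def)
  have step: "\<exists>p'. P p' \<and> S p p'" if p: "P p" for p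
  proof -
    have Em: "Module.module R (fst p)" using p by (simp add: P_def is_injective_module_def)
    obtain E' :: "('a, ('a, 'b) res_elem) module" and \<delta> where E': "is_injective_module R E'" "\<delta> \<in> mod_hom R (fst p) E'"
      "\<forall>n\<in>carrier (fst p). \<delta> n = \<zero>\<^bsub>E'\<^esub> \<longleftrightarrow> n \<in> snd p"
      using injective_embedding[OF noeth Em, of "snd p"] p by (auto simp: P_def)
    have E'm: "Module.module R E'" using E'(1) by (simp add: is_injective_module_def)
    have "submodule (\<delta> ` carrier (fst p)) R E'"
      by (rule submodule_image[OF Em E'm E'(2) module.carrier_is_submodule[OF Em]])
    thus ?thesis using E' by (intro exI[of _ "(E', \<delta> ` carrier (fst p))"]) (auto simp: P_def S_def)
  qed
  have "\<exists>f. \<forall>n. (P (f n) \<and> (n = 0 \<longrightarrow> f n = (E0, \<eta> ` carrier M))) \<and> S (f n) (f (Suc n))"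
    by (rule dependent_nat_choice) (use start step in auto)
  then obtain f where f0: "f 0 = (E0, \<eta> ` carrier M)" and fP: "\<And>n. P (f n)" and fS: "\<And>n. S (f n) (f (Suc n))"
    by blast
  define E where "E n = fst (f n)" for n
  define B where "B n = snd (f n)" for n
  have "\<exists>\<delta>\<in>mod_hom R (E n) (E (Suc n)). (\<forall>x\<in>carrier (E n). \<delta> x = \<zero>\<^bsub>E (Suc n)\<^esub> \<longleftrightarrow> x \<in> B n) \<and> B (Suc n) = \<delta> ` carrier (E n)" for n
    using fS[of n] by (simp add: E_def B_def S_def)
  then obtain \<delta> where \<delta>: "\<And>n. \<delta> n \<in> mod_hom R (E n) (E (Suc n))"
    "\<And>n x. x \<in> carrier (E n) \<Longrightarrow> \<delta> n x = \<zero>\<^bsub>E (Suc n)\<^esub> \<longleftrightarrow> x \<in> B n" "\<And>n. B (Suc n) = \<delta> n ` carrier (E n)" by metis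
  have EP: "is_injective_module R (E n)" "submodule (B n) R (E n)" for n
    using fP[of n] by (auto simp: E_def B_def P_def)
  have Bsub: "B n \<subseteq> carrier (E n)" for n
    using submodule_simps(1)[OF _ EP(2)] EP(1) by (auto simp: is_injective_module_def)
  have ker: "{x \<in> carrier (E n). \<delta> n x = \<zero>\<^bsub>E (Suc n)\<^esub>} = B n" for n
    using \<delta>(2)[of _ n] Bsub[of n] by blast
  have E00: "E 0 = E0" "B 0 = \<eta> ` carrier M" using f0 by (auto simp: E_def B_def)
  have "is_injective_resolution R M (E, \<delta>, \<eta>)"
    unfolding is_injective_resolution_def using EP(1) \<delta>(1) \<eta> \<eta>inj ker[of 0] ker \<delta>(3) E00 by auto
  thus ?thesis unfolding injective_resolution_def by (rule someI)
qed
section \<open>Free modules and free resolutions\<close>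

definition free_ext :: "'a ring \<Rightarrow> ('a, 'c) module \<Rightarrow> ('x \<Rightarrow> 'c) \<Rightarrow> ('x \<Rightarrow> 'a) \<Rightarrow> 'c" where
  "free_ext R Q g = copower_ext (regular_module R) Q (\<lambda>b r. r \<odot>\<^bsub>Q\<^esub> g b)"

context
  fixes R :: "'a ring" and Q :: "('a, 'c) module" and g :: "'x \<Rightarrow> 'c" and T :: "'x set"
  assumes Q: "Module.module R Q" and g: "\<And>b. b \<in> T \<Longrightarrow> g b \<in> carrier Q"
begin

lemma smult_gen_hom:
  assumes "b \<in> T" shows "(\<lambda>r. r \<odot>\<^bsub>Q\<^esub> g b) \<in> mod_hom R (regular_module R) Q"
proof -
  interpret Q: Module.module R Q by (rule Q)
  show ?thesis by (rule mod_homI) (use g[OF assms] in \<open>auto simp: Q.smult_l_distr Q.smult_assoc1\<close>)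
qed

lemma free_ext_hom: "free_ext R Q g \<in> mod_hom R (free_module_on R T) Q"
proof -
  interpret Q: Module.module R Q by (rule Q)
  show ?thesis
    unfolding free_ext_def free_module_on_copower
    by (rule copower_ext_hom[OF module_self[OF Q.R.is_cring] Q smult_gen_hom])
qed

lemma free_ext_gen:
  assumes "b \<in> T" shows "free_ext R Q g (free_gen R b) = g b"
proof -
  interpret Q: Module.module R Q by (rule Q)
  have "free_ext R Q g (free_gen R b) = \<one>\<^bsub>R\<^esub> \<odot>\<^bsub>Q\<^esub> g b"
    unfolding free_ext_def free_gen_single
    by (rule copower_ext_single[OF module_self[OF Q.R.is_cring] Q, where T=T, OF smult_gen_hom assms]) simp_all
  thus ?thesis using g[OF assms] by simp
qed

lemma free_ext_submodule:
  assumes B: "submodule B R Q" and "\<And>b. b \<in> T \<Longrightarrow> g b \<in> B" and u: "u \<in> carrier (free_module_on R T)"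
  shows "free_ext R Q g u \<in> B"
proof -
  interpret Q: Module.module R Q by (rule Q)
  note F = module_free[OF Q.R.is_cring]
  have u': "u \<in> fin_supp T (regular_module R) (carrier (regular_module R))" using u by (simp add: free_carrier)
  note s = submodule_simps[OF Q B]
  from module_self[OF Q.R.is_cring] module.carrier_is_submodule[OF module_self[OF Q.R.is_cring]] u' show ?thesis
  proof (induction rule: fin_supp_induct)
    case zero show ?case using mod_hom_zero[OF F Q free_ext_hom] s(2) by simp
  next
    case (single b a)
    have "free_ext R Q g (single (regular_module R) b a) = a \<odot>\<^bsub>Q\<^esub> g b"
      unfolding free_ext_def
      by (rule copower_ext_single[OF module_self[OF Q.R.is_cring] Q, where T=T, OF smult_gen_hom single])
    thus ?case using s(6) single assms(2) by simp
  next
    case (add \<phi> \<psi>)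
    have "free_ext R Q g (\<phi> \<oplus>\<^bsub>free_module_on R T\<^esub> \<psi>) = free_ext R Q g \<phi> \<oplus>\<^bsub>Q\<^esub> free_ext R Q g \<psi>"
      by (rule mod_hom_add[OF free_ext_hom]) (use add(1,2) in \<open>simp_all add: free_carrier\<close>)
    thus ?case using s(3)[OF add(3,4)] by simp
  qed
qed

end

lemma is_basis_free_ext:
  assumes "Module.module R F"
  shows "is_basis R F T \<longleftrightarrow> T \<subseteq> carrier F \<and>
    bij_betw (free_ext R F (\<lambda>b. b)) (carrier (free_module_on R T)) (carrier F)"
  by (simp add: is_basis_def free_ext_def copower_ext_def[abs_def])

lemma mod_hom_inv_into:
  assumes M: "Module.module R M" and f: "f \<in> mod_hom R M N" "bij_betw f (carrier M) (carrier N)"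
  shows "inv_into (carrier M) f \<in> mod_hom R N M"
proof -
  interpret M: Module.module R M by (rule M)
  have inv: "inv_into (carrier M) f x \<in> carrier M" "f (inv_into (carrier M) f x) = x" if "x \<in> carrier N" for x
    using bij_betw_inv_into_right[OF f(2) that] bij_betw_apply[OF bij_betw_inv_into[OF f(2)] that] by auto
  have eq: "inv_into (carrier M) f x = a" if "a \<in> carrier M" "f a = x" for a x
    using that f(2) by (auto simp: bij_betw_def)
  show ?thesis
    by (rule mod_homI) (auto simp: inv mod_hom_add[OF f(1)] mod_hom_smult[OF f(1)] intro!: eq)
qed

text \<open>A basis must consist of elements of \<open>F\<close>, while \<phi> is indexed by
  \<open>Y\<close>. The index set is replaced by the images k x of the generators; k is injective
  because 1 is not 0, and \<rho> translates the coordinates.\<close>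

lemma free_module_of_iso:
  fixes F :: "('a, 'c) module" and \<phi> :: "('x \<Rightarrow> 'a) \<Rightarrow> 'c"
  assumes R: "cring R" and nontriv: "\<one>\<^bsub>R\<^esub> \<noteq> \<zero>\<^bsub>R\<^esub>" and F: "Module.module R F"
    and \<phi>: "\<phi> \<in> mod_hom R (free_module_on R Y) F" "bij_betw \<phi> (carrier (free_module_on R Y)) (carrier F)"
  shows "is_free_module R F"
proof -
  interpret cring R by (rule R)
  define k where "k x = \<phi> (free_gen R x)" for x
  have gY: "free_gen R x \<in> carrier (free_module_on R Y)" if "x \<in> Y" for x by (rule free_gen_closed[OF R that])
  have kF: "k x \<in> carrier F" if "x \<in> Y" for x
    unfolding k_def by (rule mod_hom_closed[OF \<phi>(1) gY[OF that]])
  have kinj: "x = y" if "x \<in> Y" "y \<in> Y" "k x = k y" for x y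
  proof -
    have "free_gen R x = free_gen R y"
      using \<phi>(2) gY that unfolding k_def bij_betw_def inj_on_def by blast
    thus ?thesis using nontriv by (metis free_gen_def)
  qed
  let ?T = "k ` Y"
  have T: "?T \<subseteq> carrier F" using kF by blast
  define \<rho> where "\<rho> u x = (if x \<in> Y then u (k x) else \<zero>\<^bsub>R\<^esub>)" for u :: "'c \<Rightarrow> 'a" and x
  have \<rho>c: "\<rho> u \<in> carrier (free_module_on R Y)" if u: "u \<in> carrier (free_module_on R ?T)" for u
  proof -
    have "{x. \<rho> u x \<noteq> \<zero>\<^bsub>R\<^esub>} \<subseteq> Y \<inter> k -` {b. u b \<noteq> \<zero>\<^bsub>R\<^esub>}" by (auto simp: \<rho>_def)
    moreover have "finite (Y \<inter> k -` {b. u b \<noteq> \<zero>\<^bsub>R\<^esub>})"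
    proof (rule finite_imageD)
      show "finite (k ` (Y \<inter> k -` {b. u b \<noteq> \<zero>\<^bsub>R\<^esub>}))"
        by (rule finite_subset[OF _ free_carrierD(2)[OF u]]) auto
      show "inj_on k (Y \<inter> k -` {b. u b \<noteq> \<zero>\<^bsub>R\<^esub>})" using kinj by (auto simp: inj_on_def)
    qed
    ultimately have "finite {x. \<rho> u x \<noteq> \<zero>\<^bsub>R\<^esub>}" by (rule finite_subset)
    thus ?thesis using free_carrierD(1)[OF u] by (auto simp: free_module_on_def \<rho>_def)
  qed
  have \<rho>h: "\<rho> \<in> mod_hom R (free_module_on R ?T) (free_module_on R Y)"
    by (rule mod_homI) (auto simp: \<rho>c, auto simp: \<rho>_def fun_eq_iff)
  have \<rho>bij: "bij_betw \<rho> (carrier (free_module_on R ?T)) (carrier (free_module_on R Y))"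
    unfolding bij_betw_def
  proof
    show "inj_on \<rho> (carrier (free_module_on R ?T))"
    proof (rule inj_onI, rule ext)
      fix u v b assume uv: "u \<in> carrier (free_module_on R ?T)" "v \<in> carrier (free_module_on R ?T)" "\<rho> u = \<rho> v"
      show "u b = v b"
      proof (cases "b \<in> ?T")
        case True
        then obtain x where "x \<in> Y" "b = k x" by blast
        thus ?thesis using fun_cong[OF uv(3), of x] by (simp add: \<rho>_def)
      next
        case False
        hence "u b = \<zero>\<^bsub>R\<^esub>" "v b = \<zero>\<^bsub>R\<^esub>"
          using free_carrierD(3)[OF uv(1)] free_carrierD(3)[OF uv(2)] by blast+
        thus ?thesis by simp
      qed
    qed
    show "\<rho> ` carrier (free_module_on R ?T) = carrier (free_module_on R Y)"
    proof
      show "\<rho> ` carrier (free_module_on R ?T) \<subseteq> carrier (free_module_on R Y)" using \<rho>c by blast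
      show "carrier (free_module_on R Y) \<subseteq> \<rho> ` carrier (free_module_on R ?T)"
      proof
        fix v assume v: "v \<in> carrier (free_module_on R Y)"
        define u where "u b = (if b \<in> ?T then v (inv_into Y k b) else \<zero>\<^bsub>R\<^esub>)" for b
        have kx: "inv_into Y k (k x) = x" if "x \<in> Y" for x
          using kinj that by (intro inv_into_f_f) (auto simp: inj_on_def)
        have "{b. u b \<noteq> \<zero>\<^bsub>R\<^esub>} \<subseteq> k ` {x. v x \<noteq> \<zero>\<^bsub>R\<^esub>}" using kx by (auto simp: u_def)
        hence "finite {b. u b \<noteq> \<zero>\<^bsub>R\<^esub>}" using free_carrierD(2)[OF v] by (rule finite_subset[OF _ finite_imageI])
        hence "u \<in> carrier (free_module_on R ?T)"
          using free_carrierD(1)[OF v] by (auto simp: free_module_on_def u_def)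
        moreover have "v x = \<zero>\<^bsub>R\<^esub>" if "x \<notin> Y" for x using free_carrierD(3)[OF v] that by blast
        hence "\<rho> u = v" using kx by (auto simp: \<rho>_def u_def fun_eq_iff)
        ultimately show "v \<in> \<rho> ` carrier (free_module_on R ?T)" by blast
      qed
    qed
  qed
  have eq: "free_ext R F (\<lambda>b. b) u = \<phi> (\<rho> u)" if "u \<in> carrier (free_module_on R ?T)" for u
  proof (rule free_hom_eqI[OF R F _ _ _ that])
    show "free_ext R F (\<lambda>b. b) \<in> mod_hom R (free_module_on R ?T) F" by (rule free_ext_hom[OF F]) (use T in blast)
    show "(\<lambda>u. \<phi> (\<rho> u)) \<in> mod_hom R (free_module_on R ?T) F" by (rule mod_hom_compose[OF \<rho>h \<phi>(1)])
    fix b assume b: "b \<in> ?T"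
    then obtain x where x: "x \<in> Y" "b = k x" by blast
    have "\<rho> (free_gen R b) = free_gen R x"
      using x kinj by (auto simp: \<rho>_def free_gen_def fun_eq_iff)
    thus "free_ext R F (\<lambda>b. b) (free_gen R b) = \<phi> (\<rho> (free_gen R b))"
      using free_ext_gen[OF F, of ?T "\<lambda>b. b" b] T b x by (auto simp: k_def)
  qed
  have "bij_betw (free_ext R F (\<lambda>b. b)) (carrier (free_module_on R ?T)) (carrier F)"
    using bij_betw_trans[OF \<rho>bij \<phi>(2)] eq by (subst bij_betw_cong[where g="\<phi> \<circ> \<rho>"]) auto
  thus ?thesis using F T by (auto simp: is_free_module_def is_basis_free_ext)
qed

text \<open>A finitely supported function is coded by a list of its nonzero values with their
  places. Thus the free module on a set of \<open>res_elem\<close> has a copy carried by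
  \<open>res_elem\<close>.\<close>

definition encode_fin_supp :: "'a ring \<Rightarrow> (('a, 'b) res_elem \<Rightarrow> 'a) \<Rightarrow> ('a, 'b) res_elem" where
  "encode_fin_supp R u =
     Res_Node (map (\<lambda>x. Res_Node [x, Ring_Elem (u x)]) (SOME xs. set xs = {x. u x \<noteq> \<zero>\<^bsub>R\<^esub>}))"

lemma encode_fin_supp_inj: "inj_on (encode_fin_supp R) (carrier (free_module_on R Y))"
proof (rule inj_onI, rule ext)
  fix u v x
  assume u: "u \<in> carrier (free_module_on R Y)" and v: "v \<in> carrier (free_module_on R Y)"
    and eq: "encode_fin_supp R u = encode_fin_supp R v"
  define l where "l w = (SOME xs. set xs = {x. w x \<noteq> \<zero>\<^bsub>R\<^esub>})" for w :: "('a, 'b) res_elem \<Rightarrow> 'a"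
  have l: "set (l w) = {x. w x \<noteq> \<zero>\<^bsub>R\<^esub>}" if "w \<in> carrier (free_module_on R Y)" for w
    unfolding l_def by (rule someI_ex) (use finite_list[OF free_carrierD(2)[OF that]] in blast)
  have "map (\<lambda>x. Res_Node [x, Ring_Elem (u x)]) (l u) = map (\<lambda>x. Res_Node [x, Ring_Elem (v x)]) (l v)"
    using eq by (simp add: encode_fin_supp_def l_def)
  hence im: "(\<lambda>x. Res_Node [x, Ring_Elem (u x)]) ` {x. u x \<noteq> \<zero>\<^bsub>R\<^esub>} = (\<lambda>x. Res_Node [x, Ring_Elem (v x)]) ` {x. v x \<noteq> \<zero>\<^bsub>R\<^esub>}"
    by (metis l[OF u] l[OF v] list.set_map)
  have "w' z = w z" if "(\<lambda>x. Res_Node [x, Ring_Elem (w x)]) ` {x. w x \<noteq> \<zero>\<^bsub>R\<^esub>} =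
      (\<lambda>x. Res_Node [x, Ring_Elem (w' x)]) ` {x. w' x \<noteq> \<zero>\<^bsub>R\<^esub>}" "w z \<noteq> \<zero>\<^bsub>R\<^esub>"
    for z and w w' :: "('a, 'b) res_elem \<Rightarrow> 'a"
  proof -
    have "Res_Node [z, Ring_Elem (w z)] \<in> (\<lambda>x. Res_Node [x, Ring_Elem (w' x)]) ` {x. w' x \<noteq> \<zero>\<^bsub>R\<^esub>}"
      using that by blast
    thus ?thesis by auto
  qed
  from this[OF im] this[OF im[symmetric]] show "u x = v x" by metis
qed

text \<open>All elements of \<open>K\<close> serve as generators. Coding brings the free module back
  into the type of \<open>N\<close>, so the construction can be iterated on kernels.\<close>

lemma free_cover:
  fixes R :: "'a ring" and N :: "('a, ('a, 'b) res_elem) module"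
  assumes R: "cring R" and nontriv: "\<one>\<^bsub>R\<^esub> \<noteq> \<zero>\<^bsub>R\<^esub>" and N: "Module.module R N" and K: "submodule K R N"
  shows "\<exists>(F :: ('a, ('a, 'b) res_elem) module) \<Delta>. is_free_module R F \<and> \<Delta> \<in> mod_hom R F N \<and> \<Delta> ` carrier F = K"
proof -
  let ?F = "free_module_on R K"
  note Fm = module_free[OF R, of K] and h = encode_fin_supp_inj[of R K]
  let ?h = "encode_fin_supp R :: (('a, 'b) res_elem \<Rightarrow> 'a) \<Rightarrow> ('a, 'b) res_elem"
  let ?F' = "transport ?h ?F"
  note sK = submodule_simps[OF N K]
  have F': "Module.module R ?F'" by (rule module_transport[OF Fm h])
  have hh: "?h \<in> mod_hom R ?F ?F'" by (rule transport_hom[OF Fm h])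
  have bij: "bij_betw ?h (carrier ?F) (carrier ?F')"
    using h by (simp add: bij_betw_def transport_simps[OF Fm h])
  have "is_free_module R ?F'" by (rule free_module_of_iso[OF R nontriv F' hh bij])
  let ?c = "free_ext R N (\<lambda>b. b)"
  have c: "?c \<in> mod_hom R ?F N" by (rule free_ext_hom[OF N]) (rule sK(1))
  have "(\<lambda>x. ?c (inv_into (carrier ?F) ?h x)) \<in> mod_hom R ?F' N"
    by (rule mod_hom_compose[OF transport_inv_hom[OF Fm h] c])
  moreover have "(\<lambda>x. ?c (inv_into (carrier ?F) ?h x)) ` carrier ?F' = K"
  proof -
    have "(\<lambda>x. ?c (inv_into (carrier ?F) ?h x)) ` carrier ?F' = ?c ` carrier ?F"
      using h by (simp add: transport_simps[OF Fm h] image_image)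
    also have "\<dots> = K"
    proof
      show "?c ` carrier ?F \<subseteq> K"
        by (rule image_subsetI, rule free_ext_submodule[OF N sK(1) K]) auto
      show "K \<subseteq> ?c ` carrier ?F"
      proof
        fix b assume b: "b \<in> K"
        have "?c (free_gen R b) = b" using free_ext_gen[OF N, of K "\<lambda>b. b" b] sK(1) b by simp
        thus "b \<in> ?c ` carrier ?F" using free_gen_closed[OF R b] by (metis image_eqI)
      qed
    qed
    finally show ?thesis .
  qed
  ultimately show ?thesis using \<open>is_free_module R ?F'\<close>
    by (intro exI[of _ ?F'] exI[of _ "\<lambda>x. ?c (inv_into (carrier ?F) ?h x)"] conjI)
qed

theorem free_resolution_exists:
  fixes R :: "'a ring" and M :: "('a, 'b) module"
  assumes R: "cring R" and nontriv: "\<one>\<^bsub>R\<^esub> \<noteq> \<zero>\<^bsub>R\<^esub>" and M: "Module.module R M"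
  shows "is_free_resolution R M (free_resolution R M)"
proof -
  have hM: "inj_on Mod_Elem (carrier M)" by (simp add: inj_on_def)
  let ?N = "transport Mod_Elem M :: ('a, ('a, 'b) res_elem) module"
  note N = module_transport[OF M hM]
  obtain F0 :: "('a, ('a, 'b) res_elem) module" and \<epsilon>' where F0: "is_free_module R F0" "\<epsilon>' \<in> mod_hom R F0 ?N"
    "\<epsilon>' ` carrier F0 = carrier ?N"
    using free_cover[OF R nontriv N module.carrier_is_submodule[OF N]] by blast
  let ?inv = "inv_into (carrier M) Mod_Elem"
  define \<epsilon> where "\<epsilon> x = ?inv (\<epsilon>' x)" for x
  have F0m: "Module.module R F0" using F0(1) by (simp add: is_free_module_def)
  have \<epsilon>: "\<epsilon> \<in> mod_hom R F0 M"
    unfolding \<epsilon>_def by (rule mod_hom_compose[OF F0(2) transport_inv_hom[OF M hM]])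
  have \<epsilon>im: "\<epsilon> ` carrier F0 = carrier M"
  proof -
    have "\<epsilon> ` carrier F0 = ?inv ` (\<epsilon>' ` carrier F0)" by (auto simp: \<epsilon>_def)
    also have "\<dots> = carrier M"
      unfolding F0(3) transport_simps(1)[OF M hM] by (rule inv_into_image_cancel[OF hM subset_refl])
    finally show ?thesis .
  qed
  \<comment> \<open>The state of the recursion pairs a free module with the kernel of the map out of
    it, which the next free module has to cover.\<close>
  define P where "P p \<longleftrightarrow> is_free_module R (fst p) \<and> submodule (snd p) R (fst p)"
    for p :: "('a, ('a, 'b) res_elem) module \<times> ('a, 'b) res_elem set"
  define S where "S p p' \<longleftrightarrow> (\<exists>\<Delta>\<in>mod_hom R (fst p') (fst p).
      \<Delta> ` carrier (fst p') = snd p \<and> snd p' = {x \<in> carrier (fst p'). \<Delta> x = \<zero>\<^bsub>fst p\<^esub>})"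
    for p p' :: "('a, ('a, 'b) res_elem) module \<times> ('a, 'b) res_elem set"
  let ?K0 = "{x \<in> carrier F0. \<epsilon> x = \<zero>\<^bsub>M\<^esub>}"
  have start: "P (F0, ?K0)"
    using F0(1) submodule_vimage[OF F0m M \<epsilon> submodule_zero[OF M]] by (simp add: P_def)
  have step: "\<exists>p'. P p' \<and> S p p'" if p: "P p" for p
  proof -
    have Fm: "Module.module R (fst p)" using p by (simp add: P_def is_free_module_def)
    obtain F' :: "('a, ('a, 'b) res_elem) module" and \<Delta> where F': "is_free_module R F'" "\<Delta> \<in> mod_hom R F' (fst p)"
      "\<Delta> ` carrier F' = snd p"
      using free_cover[OF R nontriv Fm, of "snd p"] p by (auto simp: P_def)
    have F'm: "Module.module R F'" using F'(1) by (simp add: is_free_module_def)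
    have "submodule {x \<in> carrier F'. \<Delta> x \<in> {\<zero>\<^bsub>fst p\<^esub>}} R F'"
      by (rule submodule_vimage[OF F'm Fm F'(2) submodule_zero[OF Fm]])
    thus ?thesis using F'
      by (intro exI[of _ "(F', {x \<in> carrier F'. \<Delta> x = \<zero>\<^bsub>fst p\<^esub>})"]) (auto simp: P_def S_def)
  qed
  have "\<exists>f. \<forall>n. (P (f n) \<and> (n = 0 \<longrightarrow> f n = (F0, ?K0))) \<and> S (f n) (f (Suc n))"
    by (rule dependent_nat_choice) (use start step in auto)
  then obtain f where f0: "f 0 = (F0, ?K0)" and fP: "\<And>n. P (f n)" and fS: "\<And>n. S (f n) (f (Suc n))"
    by blast
  define F where "F n = fst (f n)" for n
  define K where "K n = snd (f n)" for n
  have "\<exists>\<Delta>. \<forall>n. \<Delta> n \<in> mod_hom R (F (Suc n)) (F n) \<and> \<Delta> n ` carrier (F (Suc n)) = K n \<and>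
      K (Suc n) = {x \<in> carrier (F (Suc n)). \<Delta> n x = \<zero>\<^bsub>F n\<^esub>}"
    by (intro choice allI) (use fS in \<open>simp add: F_def K_def S_def Bex_def\<close>)
  then obtain \<Delta> where \<Delta>: "\<And>n. \<Delta> n \<in> mod_hom R (F (Suc n)) (F n)" "\<And>n. \<Delta> n ` carrier (F (Suc n)) = K n"
    "\<And>n. K (Suc n) = {x \<in> carrier (F (Suc n)). \<Delta> n x = \<zero>\<^bsub>F n\<^esub>}" by blast
  have "is_free_module R (F n)" for n using fP[of n] by (auto simp: F_def P_def)
  moreover have "F 0 = F0" "K 0 = ?K0" using f0 by (auto simp: F_def K_def)
  ultimately have "is_free_resolution R M (F, \<Delta>, \<epsilon>)"
    unfolding is_free_resolution_def using \<Delta> \<epsilon> \<epsilon>im by auto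
  thus ?thesis unfolding free_resolution_def by (rule someI)
qed

text \<open>In coordinates: the terms of a free resolution replaced by modules of finitely supported
  functions on bases.\<close>

locale free_resolution_coords = free_complex R T D
  for R :: "'a ring" and T :: "nat \<Rightarrow> 'x set" and D :: "nat \<Rightarrow> ('x \<Rightarrow> 'a) \<Rightarrow> 'x \<Rightarrow> 'a" +
  fixes L :: "('a, 'b) module" and \<epsilon> :: "('x \<Rightarrow> 'a) \<Rightarrow> 'b"
  assumes L: "Module.module R L" and \<epsilon>: "\<epsilon> \<in> mod_hom R (free_module_on R (T 0)) L"
    and \<epsilon>_surj: "\<epsilon> ` carrier (free_module_on R (T 0)) = carrier L"
    and exact_0: "u \<in> carrier (free_module_on R (T 0)) \<Longrightarrow> \<epsilon> u = \<zero>\<^bsub>L\<^esub> \<longleftrightarrow> u \<in> D 0 ` carrier (free_module_on R (T 1))"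
    and exact_Suc: "u \<in> carrier (free_module_on R (T (Suc n))) \<Longrightarrow> D n u = (\<lambda>_. \<zero>\<^bsub>R\<^esub>) \<Longrightarrow>
      u \<in> D (Suc n) ` carrier (free_module_on R (T (Suc (Suc n))))"
begin

sublocale R: cring R by (rule R)

abbreviation "Fr n \<equiv> free_module_on R (T n)"

text \<open>Multiplication by \<open>y\<close> on the resolution lifts the zero map of
  \<open>L\<close>, and lifts are unique up to homotopy. The homotopy is built degree by degree on
  the bases, by exactness.\<close>

lemma annihilator_null_homotopic:
  assumes y: "y \<in> carrier R" and ann: "\<And>x. x \<in> carrier L \<Longrightarrow> y \<odot>\<^bsub>L\<^esub> x = \<zero>\<^bsub>L\<^esub>"
  shows "null_homotopic y"
proof -
  note Fm = module_free[OF R]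
  interpret L: Module.module R L by (rule L)
  have ylin: "(\<lambda>u x. y \<otimes>\<^bsub>R\<^esub> u x) \<in> mod_hom R (Fr n) (Fr n)" for n
    using mod_hom_scale[OF Fm mod_hom_id y] by simp
  define cyc where "cyc n v \<longleftrightarrow> (case n of 0 \<Rightarrow> True | Suc k \<Rightarrow> D k v = (\<lambda>_. \<zero>\<^bsub>R\<^esub>))" for n and v
  \<comment> \<open>The invariant of the recursion: on cycles the homotopy alone gives
    multiplication by y. It makes y u - s (D u) a cycle, which exactness then lifts to the next
    degree. In degree 0 every element counts as a cycle.\<close>
  define P where "P n s \<longleftrightarrow> s \<in> mod_hom R (Fr n) (Fr (Suc n)) \<and>
      (\<forall>v\<in>carrier (Fr n). cyc n v \<longrightarrow> D n (s v) = (\<lambda>x. y \<otimes>\<^bsub>R\<^esub> v x))" for n s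
  define S where "S n s s' \<longleftrightarrow> (\<forall>u\<in>carrier (Fr (Suc n)).
      (\<lambda>x. D (Suc n) (s' u) x \<oplus>\<^bsub>R\<^esub> s (D n u) x) = (\<lambda>x. y \<otimes>\<^bsub>R\<^esub> u x))" for n s s'
  have start: "\<exists>s. P 0 s"
  proof -
    have "\<exists>w\<in>carrier (Fr 1). D 0 w = (\<lambda>x. y \<otimes>\<^bsub>R\<^esub> free_gen R b x)" if b: "b \<in> T 0" for b
    proof -
      note gb = free_gen_closed[OF R b]
      have "\<epsilon> (\<lambda>x. y \<otimes>\<^bsub>R\<^esub> free_gen R b x) = \<zero>\<^bsub>L\<^esub>"
        using mod_hom_smult[OF \<epsilon> y gb] ann[OF mod_hom_closed[OF \<epsilon> gb]] by simp
      hence "(\<lambda>x. y \<otimes>\<^bsub>R\<^esub> free_gen R b x) \<in> D 0 ` carrier (Fr 1)"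
        using exact_0[OF mod_hom_closed[OF ylin gb]] by blast
      thus ?thesis by force
    qed
    then obtain w where w: "\<And>b. b \<in> T 0 \<Longrightarrow> w b \<in> carrier (Fr 1)" "\<And>b. b \<in> T 0 \<Longrightarrow> D 0 (w b) = (\<lambda>x. y \<otimes>\<^bsub>R\<^esub> free_gen R b x)"
      by metis
    let ?s = "free_ext R (Fr 1) w"
    have s: "?s \<in> mod_hom R (Fr 0) (Fr 1)" by (rule free_ext_hom[OF Fm w(1)])
    have "D 0 (?s v) = (\<lambda>x. y \<otimes>\<^bsub>R\<^esub> v x)" if v: "v \<in> carrier (Fr 0)" for v
    proof (rule free_hom_eqI[OF R Fm _ ylin _ v])
      show "(\<lambda>v. D 0 (?s v)) \<in> mod_hom R (Fr 0) (Fr 0)" using mod_hom_compose[OF s] D[of 0] by simp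
      show "D 0 (?s (free_gen R b)) = (\<lambda>x. y \<otimes>\<^bsub>R\<^esub> free_gen R b x)" if "b \<in> T 0" for b
        using free_ext_gen[OF Fm w(1) that] w(2)[OF that] by simp
    qed
    thus ?thesis using s by (auto simp: P_def)
  qed
  have step: "\<exists>s'. P (Suc n) s' \<and> S n s s'" if s: "P n s" for n s
  proof -
    have sh: "s \<in> mod_hom R (Fr n) (Fr (Suc n))" using s by (simp add: P_def)
    have sD: "(\<lambda>u. s (D n u)) \<in> mod_hom R (Fr (Suc n)) (Fr (Suc n))" by (rule mod_hom_compose[OF D sh])
    let ?g = "\<lambda>u. (\<lambda>x. y \<otimes>\<^bsub>R\<^esub> u x) \<ominus>\<^bsub>Fr (Suc n)\<^esub> s (D n u)"
    have g: "?g \<in> mod_hom R (Fr (Suc n)) (Fr (Suc n))" by (rule mod_hom_diff_hom[OF Fm Fm ylin sD])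
    interpret Fn: Module.module R "Fr n" by (rule Fm)
    interpret Fn1: Module.module R "Fr (Suc n)" by (rule Fm)
    have Dg: "D n (?g u) = (\<lambda>_. \<zero>\<^bsub>R\<^esub>)" if u: "u \<in> carrier (Fr (Suc n))" for u
    proof -
      have Du: "D n u \<in> carrier (Fr n)" by (rule mod_hom_closed[OF D u])
      have "cyc n (D n u)" using D_D u by (auto simp: cyc_def split: nat.splits)
      hence "D n (s (D n u)) = (\<lambda>x. y \<otimes>\<^bsub>R\<^esub> D n u x)" using s Du by (simp add: P_def)
      moreover have "D n (\<lambda>x. y \<otimes>\<^bsub>R\<^esub> u x) = (\<lambda>x. y \<otimes>\<^bsub>R\<^esub> D n u x)" using mod_hom_smult[OF D y u] by simp
      moreover have "(\<lambda>x. y \<otimes>\<^bsub>R\<^esub> D n u x) \<in> carrier (Fr n)" by (rule mod_hom_closed[OF ylin Du])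
      ultimately have "D n (?g u) = \<zero>\<^bsub>Fr n\<^esub>"
        using mod_hom_minus[OF Fm Fm D mod_hom_closed[OF ylin u] mod_hom_closed[OF sD u]] Fn.M.diff_eq_zero_iff by simp
      thus ?thesis by simp
    qed
    have "\<exists>w\<in>carrier (Fr (Suc (Suc n))). D (Suc n) w = ?g (free_gen R b)" if b: "b \<in> T (Suc n)" for b
      using exact_Suc[OF mod_hom_closed[OF g free_gen_closed[OF R b]] Dg[OF free_gen_closed[OF R b]]] by force
    then obtain w where w: "\<And>b. b \<in> T (Suc n) \<Longrightarrow> w b \<in> carrier (Fr (Suc (Suc n)))"
      "\<And>b. b \<in> T (Suc n) \<Longrightarrow> D (Suc n) (w b) = ?g (free_gen R b)"
      by metis
    let ?s = "free_ext R (Fr (Suc (Suc n))) w"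
    have s': "?s \<in> mod_hom R (Fr (Suc n)) (Fr (Suc (Suc n)))" by (rule free_ext_hom[OF Fm w(1)])
    have Ds: "D (Suc n) (?s v) = ?g v" if v: "v \<in> carrier (Fr (Suc n))" for v
    proof (rule free_hom_eqI[OF R Fm _ g _ v])
      show "(\<lambda>v. D (Suc n) (?s v)) \<in> mod_hom R (Fr (Suc n)) (Fr (Suc n))" by (rule mod_hom_compose[OF s' D])
      show "D (Suc n) (?s (free_gen R b)) = ?g (free_gen R b)" if "b \<in> T (Suc n)" for b
        using free_ext_gen[OF Fm w(1) that] w(2)[OF that] by simp
    qed
    have "S n s ?s"
      unfolding S_def
    proof
      fix u assume u: "u \<in> carrier (Fr (Suc n))"
      note c1 = mod_hom_closed[OF ylin u] and c2 = mod_hom_closed[OF sD u]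
      have "?g u \<oplus>\<^bsub>Fr (Suc n)\<^esub> s (D n u) = (\<lambda>x. y \<otimes>\<^bsub>R\<^esub> u x)"
        using c1 c2 by (simp only: a_minus_def Fn1.M.a_assoc Fn1.M.l_neg Fn1.M.a_inv_closed Fn1.M.r_zero)
      thus "(\<lambda>x. D (Suc n) (?s u) x \<oplus>\<^bsub>R\<^esub> s (D n u) x) = (\<lambda>x. y \<otimes>\<^bsub>R\<^esub> u x)"
        using Ds[OF u] by simp
    qed
    moreover have "P (Suc n) ?s"
      unfolding P_def
    proof (intro conjI s' ballI impI)
      fix v assume v: "v \<in> carrier (Fr (Suc n))" and "cyc (Suc n) v"
      hence "D n v = \<zero>\<^bsub>Fr n\<^esub>" by (simp add: cyc_def)
      hence "s (D n v) = \<zero>\<^bsub>Fr (Suc n)\<^esub>" using mod_hom_zero[OF Fm Fm sh] by simp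
      hence "?g v = (\<lambda>x. y \<otimes>\<^bsub>R\<^esub> v x)" using Fn1.M.diff_zero_right[OF mod_hom_closed[OF ylin v]] by simp
      thus "D (Suc n) (?s v) = (\<lambda>x. y \<otimes>\<^bsub>R\<^esub> v x)" using Ds[OF v] by simp
    qed
    ultimately show ?thesis by blast
  qed
  obtain s where s: "\<And>n. P n (s n)" "\<And>n. S n (s n) (s (Suc n))"
    using dependent_nat_choice[of P S] start step by metis
  show ?thesis
    unfolding null_homotopic_def
    using s by (intro exI[of _ s]) (auto simp: P_def S_def cyc_def)
qed

text \<open>Tor_0(L, R) is \<open>L\<close>: with coefficients \<open>R\<close>, exactness in degree
  0 makes \<open>D 0\<close> surjective, so \<epsilon> is zero as well as surjective.\<close>

lemma rel_exact_regular_0: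
  assumes "rel_exact (regular_module R) 0 (carrier (regular_module R)) {\<zero>\<^bsub>regular_module R\<^esub>}"
  shows "carrier L = {\<zero>\<^bsub>L\<^esub>}"
proof -
  interpret L: Module.module R L by (rule L)
  interpret F0: Module.module R "Fr 0" by (rule module_free[OF R])
  have "\<epsilon> u = \<zero>\<^bsub>L\<^esub>" if u: "u \<in> carrier (Fr 0)" for u
  proof -
    have "u \<in> fin_supp (T 0) (regular_module R) (carrier (regular_module R))" using u by (simp add: free_carrier)
    then obtain v where v: "v \<in> carrier (Fr 1)"
      "u \<ominus>\<^bsub>Fr 0\<^esub> d (regular_module R) 0 v \<in> fin_supp (T 0) (regular_module R) {\<zero>\<^bsub>R\<^esub>}"
      using assms unfolding rel_exact_def rel_cycle_def by (auto simp: free_carrier free_module_on_copower)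
    have dv: "d (regular_module R) 0 v = D 0 v"
      by (rule base_change_regular[OF R D]) (use v(1) in simp)
    have Dv: "D 0 v \<in> carrier (Fr 0)" using mod_hom_closed[OF D, of v 0] v(1) by simp
    have "u \<ominus>\<^bsub>Fr 0\<^esub> D 0 v = \<zero>\<^bsub>Fr 0\<^esub>" using v(2) dv by (auto simp: fin_supp_def)
    hence "u = D 0 v" using F0.M.diff_eq_zero_iff[OF u Dv] by simp
    thus ?thesis using exact_0[OF u] v(1) by blast
  qed
  hence "carrier L \<subseteq> {\<zero>\<^bsub>L\<^esub>}" unfolding \<epsilon>_surj[symmetric] by blast
  thus ?thesis using L.M.zero_closed by blast
qed

end
section \<open>Quotient modules and tensor products\<close>

context
  fixes R :: "'a ring" and N :: "('a, 'b) module" and B :: "'b set"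
  assumes N: "Module.module R N" and B: "submodule B R N"
begin

lemma mem_coset_iff:
  assumes "x \<in> carrier N" shows "y \<in> B +>\<^bsub>N\<^esub> x \<longleftrightarrow> y \<in> carrier N \<and> y \<ominus>\<^bsub>N\<^esub> x \<in> B"
proof -
  interpret N: Module.module R N by (rule N)
  note s = submodule_simps[OF N B]
  show ?thesis
  proof
    assume "y \<in> B +>\<^bsub>N\<^esub> x"
    then obtain b where b: "b \<in> B" "y = b \<oplus>\<^bsub>N\<^esub> x" by (auto simp: a_r_coset_def')
    thus "y \<in> carrier N \<and> y \<ominus>\<^bsub>N\<^esub> x \<in> B"
      using s(1)[OF b(1)] assms by (simp add: a_minus_def N.M.a_assoc N.M.r_neg)
  next
    assume y: "y \<in> carrier N \<and> y \<ominus>\<^bsub>N\<^esub> x \<in> B"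
    have "y = (y \<ominus>\<^bsub>N\<^esub> x) \<oplus>\<^bsub>N\<^esub> x" using y assms by (simp add: a_minus_def N.M.a_assoc N.M.l_neg)
    thus "y \<in> B +>\<^bsub>N\<^esub> x" using y unfolding a_r_coset_def' by blast
  qed
qed

lemma coset_self: "x \<in> carrier N \<Longrightarrow> x \<in> B +>\<^bsub>N\<^esub> x"
  using mem_coset_iff[of x x] submodule_simps(2)[OF N B] module.axioms(2)[OF N]
  by (simp add: a_minus_def abelian_group.r_neg)

lemma coset_eq_iff:
  assumes "x \<in> carrier N" "y \<in> carrier N" shows "B +>\<^bsub>N\<^esub> x = B +>\<^bsub>N\<^esub> y \<longleftrightarrow> x \<ominus>\<^bsub>N\<^esub> y \<in> B"
proof
  interpret N: Module.module R N by (rule N)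
  assume "B +>\<^bsub>N\<^esub> x = B +>\<^bsub>N\<^esub> y"
  with coset_self[OF assms(1)] show "x \<ominus>\<^bsub>N\<^esub> y \<in> B" using mem_coset_iff[OF assms(2)] by blast
next
  assume xy: "x \<ominus>\<^bsub>N\<^esub> y \<in> B"
  have yx: "y \<ominus>\<^bsub>N\<^esub> x \<in> B" by (rule submodule_diff_sym[OF N B assms xy])
  show "B +>\<^bsub>N\<^esub> x = B +>\<^bsub>N\<^esub> y"
    using submodule_diff_trans[OF N B _ assms(1,2) _ xy] submodule_diff_trans[OF N B _ assms(2,1) _ yx]
    by (auto simp: mem_coset_iff assms)
qed

lemma coset_zero: "B +>\<^bsub>N\<^esub> \<zero>\<^bsub>N\<^esub> = B"
proof -
  interpret N: Module.module R N by (rule N)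
  show ?thesis using mem_coset_iff[of "\<zero>\<^bsub>N\<^esub>"] submodule_simps(1)[OF N B] N.M.diff_zero_right by auto
qed

lemma coset_eq_self_iff: "x \<in> carrier N \<Longrightarrow> B +>\<^bsub>N\<^esub> x = B \<longleftrightarrow> x \<in> B"
  using coset_eq_iff[of x "\<zero>\<^bsub>N\<^esub>"] module.axioms(2)[OF N] abelian_group.diff_zero_right[of N x]
  by (simp add: coset_zero abelian_monoid.zero_closed abelian_group.axioms)

lemma quot_carrier: "carrier (quot_module N B) = (\<lambda>x. B +>\<^bsub>N\<^esub> x) ` carrier N"
  by (auto simp: quot_module_def A_RCOSETS_def')

lemma quot_zero: "\<zero>\<^bsub>quot_module N B\<^esub> = B"
  by (simp add: quot_module_def)

lemma quot_add:
  assumes "x \<in> carrier N" "y \<in> carrier N"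
  shows "(B +>\<^bsub>N\<^esub> x) \<oplus>\<^bsub>quot_module N B\<^esub> (B +>\<^bsub>N\<^esub> y) = B +>\<^bsub>N\<^esub> (x \<oplus>\<^bsub>N\<^esub> y)"
proof -
  interpret N: Module.module R N by (rule N)
  have "abelian_subgroup B N"
    using B by (intro abelian_subgroupI3) (auto simp: additive_subgroup_def submodule.axioms N.M.abelian_group_axioms)
  thus ?thesis using abelian_subgroup.a_rcos_sum[OF _ assms] by (simp add: quot_module_def)
qed

lemma quot_smult:
  assumes "x \<in> carrier N" "r \<in> carrier R"
  shows "r \<odot>\<^bsub>quot_module N B\<^esub> (B +>\<^bsub>N\<^esub> x) = B +>\<^bsub>N\<^esub> (r \<odot>\<^bsub>N\<^esub> x)"
proof -
  interpret N: Module.module R N by (rule N)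
  have "B +>\<^bsub>N\<^esub> (r \<odot>\<^bsub>N\<^esub> y) = B +>\<^bsub>N\<^esub> (r \<odot>\<^bsub>N\<^esub> x)" if "y \<in> B +>\<^bsub>N\<^esub> x" for y
  proof -
    have y: "y \<in> carrier N" "y \<ominus>\<^bsub>N\<^esub> x \<in> B" using that mem_coset_iff[OF assms(1)] by auto
    have "r \<odot>\<^bsub>N\<^esub> y \<ominus>\<^bsub>N\<^esub> r \<odot>\<^bsub>N\<^esub> x = r \<odot>\<^bsub>N\<^esub> (y \<ominus>\<^bsub>N\<^esub> x)"
      using y assms by (simp add: a_minus_def N.smult_r_distr N.smult_r_minus)
    thus ?thesis using coset_eq_iff y assms submodule_simps(6)[OF N B assms(2) y(2)] by simp
  qed
  hence "(\<Union>y\<in>B +>\<^bsub>N\<^esub> x. B +>\<^bsub>N\<^esub> (r \<odot>\<^bsub>N\<^esub> y)) = (\<Union>y\<in>B +>\<^bsub>N\<^esub> x. B +>\<^bsub>N\<^esub> (r \<odot>\<^bsub>N\<^esub> x))"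
    by (rule SUP_cong[OF refl])
  also have "\<dots> = B +>\<^bsub>N\<^esub> (r \<odot>\<^bsub>N\<^esub> x)" using coset_self[OF assms(1)] by blast
  finally show ?thesis by (simp add: quot_module_def)
qed

lemma module_quot: "Module.module R (quot_module N B)"
proof -
  interpret N: Module.module R N by (rule N)
  have z: "\<zero>\<^bsub>quot_module N B\<^esub> = B +>\<^bsub>N\<^esub> \<zero>\<^bsub>N\<^esub>" by (simp add: quot_zero coset_zero)
  have ag: "abelian_group (quot_module N B)"
  proof (rule abelian_groupI)
    fix c assume "c \<in> carrier (quot_module N B)"
    then obtain x where x: "x \<in> carrier N" "c = B +>\<^bsub>N\<^esub> x" by (auto simp: quot_carrier)
    thus "\<exists>d\<in>carrier (quot_module N B). d \<oplus>\<^bsub>quot_module N B\<^esub> c = \<zero>\<^bsub>quot_module N B\<^esub>"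
      by (intro bexI[of _ "B +>\<^bsub>N\<^esub> (\<ominus>\<^bsub>N\<^esub> x)"]) (auto simp: quot_carrier quot_add z N.M.l_neg)
  qed (auto simp: quot_carrier quot_add z N.M.a_ac)
  show ?thesis
    by (rule moduleI)
      (auto simp: ag N.R.is_cring quot_carrier quot_add quot_smult N.smult_l_distr N.smult_r_distr N.smult_assoc1)
qed

lemma quot_hom: "(\<lambda>x. B +>\<^bsub>N\<^esub> x) \<in> mod_hom R N (quot_module N B)"
  by (rule mod_homI) (auto simp: quot_carrier quot_add quot_smult)

lemma quot_lift:
  assumes Q: "Module.module R Q" and g: "g \<in> mod_hom R N Q" and ker: "\<And>b. b \<in> B \<Longrightarrow> g b = \<zero>\<^bsub>Q\<^esub>"
  shows "\<exists>k\<in>mod_hom R (quot_module N B) Q. \<forall>x\<in>carrier N. k (B +>\<^bsub>N\<^esub> x) = g x"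
proof -
  interpret N: Module.module R N by (rule N)
  interpret Q: Module.module R Q by (rule Q)
  define k where "k c = g (SOME x. x \<in> carrier N \<and> c = B +>\<^bsub>N\<^esub> x)" for c
  have k: "k (B +>\<^bsub>N\<^esub> x) = g x" if x: "x \<in> carrier N" for x
  proof -
    define y where "y = (SOME y. y \<in> carrier N \<and> B +>\<^bsub>N\<^esub> x = B +>\<^bsub>N\<^esub> y)"
    have "y \<in> carrier N \<and> B +>\<^bsub>N\<^esub> x = B +>\<^bsub>N\<^esub> y" unfolding y_def by (rule someI[of _ x]) (use x in simp)
    hence y: "y \<in> carrier N" "x \<ominus>\<^bsub>N\<^esub> y \<in> B" using coset_eq_iff[OF x] by auto
    hence "g x = g y"
      using mod_hom_minus[OF N Q g x y(1)] ker[OF y(2)] Q.M.diff_eq_zero_iff[OF mod_hom_closed[OF g x] mod_hom_closed[OF g y(1)]]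
      by simp
    thus ?thesis by (simp add: k_def y_def)
  qed
  have "k \<in> mod_hom R (quot_module N B) Q"
    by (rule mod_homI)
      (auto simp: quot_carrier quot_add quot_smult k mod_hom_closed[OF g] mod_hom_add[OF g] mod_hom_smult[OF g])
  thus ?thesis using k by blast
qed

end

lemma is_zero_quot_iff:
  fixes R :: "'a ring" and N :: "('a, 'b) module"
  assumes "Module.module R N" "submodule B R N"
  shows "is_zero_module (quot_module N B) \<longleftrightarrow> carrier N \<subseteq> B"
proof -
  interpret N: Module.module R N by fact
  have "(\<lambda>x. B +>\<^bsub>N\<^esub> x) ` carrier N = {B} \<longleftrightarrow> (\<forall>x\<in>carrier N. B +>\<^bsub>N\<^esub> x = B)"
    using N.M.zero_closed by blast
  thus ?thesis
    using coset_eq_self_iff[OF assms] by (auto simp: is_zero_module_def quot_carrier[OF assms] quot_zero[OF assms])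
qed

lemma submodule_generated:
  fixes R :: "'a ring" and M :: "('a, 'b) module"
  assumes M: "Module.module R M" and S: "S \<subseteq> carrier M"
  shows "submodule (generated_submodule R M S) R M" "S \<subseteq> generated_submodule R M S"
proof -
  interpret M: Module.module R M by (rule M)
  let ?G = "{N. submodule N R M \<and> S \<subseteq> N}"
  have "carrier M \<in> ?G" using M.carrier_is_submodule S by simp
  hence sub: "\<Inter>?G \<subseteq> carrier M" by (rule Inter_lower)
  show "submodule (generated_submodule R M S) R M"
    unfolding generated_submodule_def
  proof (rule M.submoduleI[OF sub]; intro InterI)
    fix K assume K: "K \<in> ?G"
    hence s: "submodule K R M" by simp
    note s = submodule_simps[OF M s]
    show "\<zero>\<^bsub>M\<^esub> \<in> K" by (rule s(2))
    show "\<ominus>\<^bsub>M\<^esub> a \<in> K" if "a \<in> \<Inter>?G" for a using s(5) InterD[OF that K] .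
    show "a \<oplus>\<^bsub>M\<^esub> b \<in> K" if "a \<in> \<Inter>?G" "b \<in> \<Inter>?G" for a b
      using s(3) InterD[OF that(1) K] InterD[OF that(2) K] .
    show "r \<odot>\<^bsub>M\<^esub> a \<in> K" if "r \<in> carrier R" "a \<in> \<Inter>?G" for r a
      using s(6) that(1) InterD[OF that(2) K] .
  qed
  show "S \<subseteq> generated_submodule R M S" by (auto simp: generated_submodule_def)
qed

lemma generated_submodule_least: "submodule K R M \<Longrightarrow> S \<subseteq> K \<Longrightarrow> generated_submodule R M S \<subseteq> K"
  by (auto simp: generated_submodule_def)

section \<open>Tensor products and their universal property\<close>

context
  fixes R :: "'a ring" and M :: "('a, 'b) module" and N :: "('a, 'c) module"
  assumes M: "Module.module R M" and N: "Module.module R N"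
begin

abbreviation (input) "MN \<equiv> free_module_on R (carrier M \<times> carrier N)"

lemma tensor_cring: "cring R"
  using M module.axioms(1) by blast

lemma gen_MN: "x \<in> carrier M \<Longrightarrow> y \<in> carrier N \<Longrightarrow> free_gen R (x, y) \<in> carrier MN"
  by (rule free_gen_closed[OF tensor_cring]) simp

lemma bilinear_relations_cases [consumes 1, case_names left right scale_left scale_right]:
  assumes "w \<in> bilinear_relations R M N"
  obtains x x' y where "x \<in> carrier M" "x' \<in> carrier M" "y \<in> carrier N"
      "w = free_gen R (x \<oplus>\<^bsub>M\<^esub> x', y) \<ominus>\<^bsub>MN\<^esub> (free_gen R (x, y) \<oplus>\<^bsub>MN\<^esub> free_gen R (x', y))"
  | x y y' where "x \<in> carrier M" "y \<in> carrier N" "y' \<in> carrier N"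
      "w = free_gen R (x, y \<oplus>\<^bsub>N\<^esub> y') \<ominus>\<^bsub>MN\<^esub> (free_gen R (x, y) \<oplus>\<^bsub>MN\<^esub> free_gen R (x, y'))"
  | r x y where "r \<in> carrier R" "x \<in> carrier M" "y \<in> carrier N"
      "w = free_gen R (r \<odot>\<^bsub>M\<^esub> x, y) \<ominus>\<^bsub>MN\<^esub> (r \<odot>\<^bsub>MN\<^esub> free_gen R (x, y))"
  | r x y where "r \<in> carrier R" "x \<in> carrier M" "y \<in> carrier N"
      "w = free_gen R (x, r \<odot>\<^bsub>N\<^esub> y) \<ominus>\<^bsub>MN\<^esub> (r \<odot>\<^bsub>MN\<^esub> free_gen R (x, y))"
  using assms unfolding bilinear_relations_def Let_def Un_iff mem_Collect_eq by (elim disjE exE conjE) blast+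

lemma bilinear_relations_carrier: "bilinear_relations R M N \<subseteq> carrier MN"
proof
  interpret M: Module.module R M by (rule M)
  interpret N: Module.module R N by (rule N)
  interpret F: Module.module R MN by (rule module_free[OF tensor_cring])
  fix w assume "w \<in> bilinear_relations R M N"
  thus "w \<in> carrier MN"
  proof (cases rule: bilinear_relations_cases)
    case (left x x' y)
    show ?thesis unfolding left(4) by (intro F.M.minus_closed F.M.a_closed gen_MN M.M.a_closed left(1-3))
  next
    case (right x y y')
    show ?thesis unfolding right(4) by (intro F.M.minus_closed F.M.a_closed gen_MN N.M.a_closed right(1-3))
  next
    case (scale_left r x y)
    show ?thesis unfolding scale_left(4) by (intro F.M.minus_closed F.smult_closed gen_MN M.smult_closed scale_left(1-3))
  next
    case (scale_right r x y)
    show ?thesis unfolding scale_right(4) by (intro F.M.minus_closed F.smult_closed gen_MN N.smult_closed scale_right(1-3))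
  qed
qed

lemma tensor_relations_submodule: "submodule (tensor_relations R M N) R MN"
  unfolding tensor_relations_def
  by (rule submodule_generated[OF module_free[OF tensor_cring] bilinear_relations_carrier])

lemma module_tensor: "Module.module R (tensor R M N)"
  unfolding tensor_def by (rule module_quot[OF module_free[OF tensor_cring] tensor_relations_submodule])

lemma tensor_proj_hom:
  "(\<lambda>w. tensor_relations R M N +>\<^bsub>MN\<^esub> w) \<in> mod_hom R MN (tensor R M N)"
  unfolding tensor_def by (rule quot_hom[OF module_free[OF tensor_cring] tensor_relations_submodule])

lemma pure_tensor_closed: "x \<in> carrier M \<Longrightarrow> y \<in> carrier N \<Longrightarrow> pure_tensor R M N x y \<in> carrier (tensor R M N)"
  unfolding pure_tensor_def by (rule mod_hom_closed[OF tensor_proj_hom gen_MN])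

lemma bilinear_relation_zero:
  assumes "a \<in> carrier MN" "b \<in> carrier MN" "a \<ominus>\<^bsub>MN\<^esub> b \<in> bilinear_relations R M N"
  shows "tensor_relations R M N +>\<^bsub>MN\<^esub> a = tensor_relations R M N +>\<^bsub>MN\<^esub> b"
proof -
  have "bilinear_relations R M N \<subseteq> tensor_relations R M N"
    unfolding tensor_relations_def
    by (rule submodule_generated(2)[OF module_free[OF tensor_cring] bilinear_relations_carrier])
  thus ?thesis
    using coset_eq_iff[OF module_free[OF tensor_cring] tensor_relations_submodule assms(1,2)] assms(3) by blast
qed

lemma pure_tensor_hom_left:
  assumes y: "y \<in> carrier N"
  shows "(\<lambda>x. pure_tensor R M N x y) \<in> mod_hom R M (tensor R M N)"
proof (rule mod_homI)
  interpret M: Module.module R M by (rule M)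
  interpret F: Module.module R MN by (rule module_free[OF tensor_cring])
  fix x assume x: "x \<in> carrier M"
  show "pure_tensor R M N x y \<in> carrier (tensor R M N)" by (rule pure_tensor_closed[OF x y])
  show "pure_tensor R M N (x \<oplus>\<^bsub>M\<^esub> x') y = pure_tensor R M N x y \<oplus>\<^bsub>tensor R M N\<^esub> pure_tensor R M N x' y"
    if x': "x' \<in> carrier M" for x'
    unfolding pure_tensor_def mod_hom_add[OF tensor_proj_hom gen_MN[OF x y] gen_MN[OF x' y], symmetric]
    by (rule bilinear_relation_zero; (intro F.M.a_closed gen_MN M.M.a_closed x x' y)?)
      (use x x' y in \<open>unfold bilinear_relations_def Let_def, blast\<close>)
  show "pure_tensor R M N (r \<odot>\<^bsub>M\<^esub> x) y = r \<odot>\<^bsub>tensor R M N\<^esub> pure_tensor R M N x y" if r: "r \<in> carrier R" for r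
    unfolding pure_tensor_def mod_hom_smult[OF tensor_proj_hom r gen_MN[OF x y], symmetric]
    by (rule bilinear_relation_zero; (intro F.smult_closed gen_MN M.smult_closed x y r)?)
      (use x r y in \<open>unfold bilinear_relations_def Let_def, blast\<close>)
qed

lemma pure_tensor_hom_right:
  assumes x: "x \<in> carrier M"
  shows "pure_tensor R M N x \<in> mod_hom R N (tensor R M N)"
proof (rule mod_homI)
  interpret N: Module.module R N by (rule N)
  interpret F: Module.module R MN by (rule module_free[OF tensor_cring])
  fix y assume y: "y \<in> carrier N"
  show "pure_tensor R M N x y \<in> carrier (tensor R M N)" by (rule pure_tensor_closed[OF x y])
  show "pure_tensor R M N x (y \<oplus>\<^bsub>N\<^esub> y') = pure_tensor R M N x y \<oplus>\<^bsub>tensor R M N\<^esub> pure_tensor R M N x y'"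
    if y': "y' \<in> carrier N" for y'
    unfolding pure_tensor_def mod_hom_add[OF tensor_proj_hom gen_MN[OF x y] gen_MN[OF x y'], symmetric]
    by (rule bilinear_relation_zero; (intro F.M.a_closed gen_MN N.M.a_closed x y' y)?)
      (use x y' y in \<open>unfold bilinear_relations_def Let_def, blast\<close>)
  show "pure_tensor R M N x (r \<odot>\<^bsub>N\<^esub> y) = r \<odot>\<^bsub>tensor R M N\<^esub> pure_tensor R M N x y" if r: "r \<in> carrier R" for r
    unfolding pure_tensor_def mod_hom_smult[OF tensor_proj_hom r gen_MN[OF x y], symmetric]
    by (rule bilinear_relation_zero; (intro F.smult_closed gen_MN N.smult_closed x y r)?)
      (use x r y in \<open>unfold bilinear_relations_def Let_def, blast\<close>)
qed

lemma tensor_hom_eqI: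
  assumes Q: "Module.module R Q" and f: "f \<in> mod_hom R (tensor R M N) Q" and g: "g \<in> mod_hom R (tensor R M N) Q"
    and eq: "\<And>x y. x \<in> carrier M \<Longrightarrow> y \<in> carrier N \<Longrightarrow> f (pure_tensor R M N x y) = g (pure_tensor R M N x y)"
    and t: "t \<in> carrier (tensor R M N)"
  shows "f t = g t"
proof -
  obtain w where w: "w \<in> carrier MN" "t = tensor_relations R M N +>\<^bsub>MN\<^esub> w"
    using t unfolding tensor_def quot_carrier[OF module_free[OF tensor_cring] tensor_relations_submodule] by blast
  show ?thesis
    unfolding w(2)
    by (rule free_hom_eqI[OF tensor_cring Q mod_hom_compose[OF tensor_proj_hom f]
          mod_hom_compose[OF tensor_proj_hom g] _ w(1)])
      (use eq in \<open>auto simp: pure_tensor_def\<close>)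
qed

text \<open>The prescribed values define a map on the free module on pairs; linearity in each
  argument puts the four families of relations into its kernel.\<close>

lemma tensor_lift:
  assumes Q: "Module.module R Q"
    and left: "\<And>y. y \<in> carrier N \<Longrightarrow> (\<lambda>x. \<beta> x y) \<in> mod_hom R M Q"
    and right: "\<And>x. x \<in> carrier M \<Longrightarrow> \<beta> x \<in> mod_hom R N Q"
  shows "\<exists>k\<in>mod_hom R (tensor R M N) Q. \<forall>x\<in>carrier M. \<forall>y\<in>carrier N. k (pure_tensor R M N x y) = \<beta> x y"
proof -
  interpret M: Module.module R M by (rule M)
  interpret N: Module.module R N by (rule N)
  interpret Q: Module.module R Q by (rule Q)
  note F = module_free[OF tensor_cring, of "carrier M \<times> carrier N"]
  interpret F: Module.module R MN by (rule F)
  have \<beta>c: "\<beta> x y \<in> carrier Q" if "x \<in> carrier M" "y \<in> carrier N" for x y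
    using mod_hom_closed[OF right] that by blast
  let ?g = "free_ext R Q (\<lambda>(x, y). \<beta> x y)"
  have g: "?g \<in> mod_hom R MN Q" by (rule free_ext_hom[OF Q]) (use \<beta>c in auto)
  have gg: "?g (free_gen R (x, y)) = \<beta> x y" if "x \<in> carrier M" "y \<in> carrier N" for x y
    using free_ext_gen[OF Q, of "carrier M \<times> carrier N" "\<lambda>(x, y). \<beta> x y" "(x, y)"] \<beta>c that by auto
  have ker: "submodule {w \<in> carrier MN. ?g w \<in> {\<zero>\<^bsub>Q\<^esub>}} R MN"
    by (rule submodule_vimage[OF F Q g submodule_zero[OF Q]])
  have diff: "?g (a \<ominus>\<^bsub>MN\<^esub> b) = \<zero>\<^bsub>Q\<^esub>" if "a \<in> carrier MN" "b \<in> carrier MN" "?g a = ?g b" for a b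
    using mod_hom_minus[OF F Q g that(1,2)] that(3) Q.M.diff_eq_zero_iff mod_hom_closed[OF g] that(1,2) by simp
  have "bilinear_relations R M N \<subseteq> {w \<in> carrier MN. ?g w \<in> {\<zero>\<^bsub>Q\<^esub>}}"
  proof
    fix w assume w: "w \<in> bilinear_relations R M N"
    hence "?g w = \<zero>\<^bsub>Q\<^esub>"
    proof (cases rule: bilinear_relations_cases)
      case (left x x' y)
      show ?thesis unfolding left(4)
      proof (rule diff; (intro F.M.a_closed gen_MN M.M.a_closed left(1-3))?)
        show "?g (free_gen R (x \<oplus>\<^bsub>M\<^esub> x', y)) = ?g (free_gen R (x, y) \<oplus>\<^bsub>MN\<^esub> free_gen R (x', y))"
          using mod_hom_add[OF g gen_MN gen_MN, OF left(1,3) left(2,3)] left(1-3)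
            mod_hom_add[OF assms(2)[OF left(3)] left(1,2)] by (simp add: gg del: free_simps)
      qed
    next
      case (right x y y')
      show ?thesis unfolding right(4)
      proof (rule diff; (intro F.M.a_closed gen_MN N.M.a_closed right(1-3))?)
        show "?g (free_gen R (x, y \<oplus>\<^bsub>N\<^esub> y')) = ?g (free_gen R (x, y) \<oplus>\<^bsub>MN\<^esub> free_gen R (x, y'))"
          using mod_hom_add[OF g gen_MN gen_MN, OF right(1,2) right(1,3)] right(1-3)
            mod_hom_add[OF assms(3)[OF right(1)] right(2,3)] by (simp add: gg del: free_simps)
      qed
    next
      case (scale_left r x y)
      show ?thesis unfolding scale_left(4)
      proof (rule diff; (intro F.smult_closed gen_MN M.smult_closed scale_left(1-3))?)
        show "?g (free_gen R (r \<odot>\<^bsub>M\<^esub> x, y)) = ?g (r \<odot>\<^bsub>MN\<^esub> free_gen R (x, y))"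
          using mod_hom_smult[OF g scale_left(1) gen_MN, OF scale_left(2,3)] scale_left(1-3)
            mod_hom_smult[OF assms(2)[OF scale_left(3)] scale_left(1,2)] by (simp add: gg del: free_simps)
      qed
    next
      case (scale_right r x y)
      show ?thesis unfolding scale_right(4)
      proof (rule diff; (intro F.smult_closed gen_MN N.smult_closed scale_right(1-3))?)
        show "?g (free_gen R (x, r \<odot>\<^bsub>N\<^esub> y)) = ?g (r \<odot>\<^bsub>MN\<^esub> free_gen R (x, y))"
          using mod_hom_smult[OF g scale_right(1) gen_MN, OF scale_right(2,3)] scale_right(1-3)
            mod_hom_smult[OF assms(3)[OF scale_right(2)] scale_right(1,3)] by (simp add: gg del: free_simps)
      qed
    qed
    thus "w \<in> {w \<in> carrier MN. ?g w \<in> {\<zero>\<^bsub>Q\<^esub>}}" using w bilinear_relations_carrier by blast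
  qed
  from generated_submodule_least[OF ker this]
  have "\<And>w. w \<in> tensor_relations R M N \<Longrightarrow> ?g w = \<zero>\<^bsub>Q\<^esub>" unfolding tensor_relations_def by blast
  from quot_lift[OF F tensor_relations_submodule Q g this]
  obtain k where "k \<in> mod_hom R (tensor R M N) Q" "\<And>w. w \<in> carrier MN \<Longrightarrow> k (tensor_relations R M N +>\<^bsub>MN\<^esub> w) = ?g w"
    unfolding tensor_def by blast
  thus ?thesis using gg gen_MN unfolding pure_tensor_def by (intro bexI[of _ k]) auto
qed

end

section \<open>Tor in coordinates\<close>

locale based_module =
  fixes R :: "'a ring" and F :: "('a, 'x) module" and T :: "'x set"
  assumes F: "Module.module R F" and T: "is_basis R F T"
begin

sublocale R: cring R
  using F module.axioms(1) by blast

abbreviation "comb \<equiv> free_ext R F (\<lambda>b. b)"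

definition coord :: "'x \<Rightarrow> 'x \<Rightarrow> 'a" where
  "coord = inv_into (carrier (free_module_on R T)) comb"

lemma T_carrier: "b \<in> T \<Longrightarrow> b \<in> carrier F"
  using T F by (auto simp: is_basis_free_ext)

lemma comb_hom: "comb \<in> mod_hom R (free_module_on R T) F"
  by (rule free_ext_hom[OF F]) (rule T_carrier)

lemma comb_gen: "b \<in> T \<Longrightarrow> comb (free_gen R b) = b"
  by (rule free_ext_gen[OF F, where T=T]) (rule T_carrier)

lemma comb_bij: "bij_betw comb (carrier (free_module_on R T)) (carrier F)"
  using T F by (simp add: is_basis_free_ext)

lemma coord_hom: "coord \<in> mod_hom R F (free_module_on R T)"
  unfolding coord_def by (rule mod_hom_inv_into[OF module_free[OF R.is_cring] comb_hom comb_bij])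

lemma coord_comb: "u \<in> carrier (free_module_on R T) \<Longrightarrow> coord (comb u) = u"
  unfolding coord_def using comb_bij by (simp add: bij_betw_def)

lemma comb_coord: "x \<in> carrier F \<Longrightarrow> comb (coord x) = x"
  unfolding coord_def by (rule bij_betw_inv_into_right[OF comb_bij])

lemma coord_gen: "b \<in> T \<Longrightarrow> coord b = free_gen R b"
  using coord_comb[OF free_gen_closed[OF R.is_cring]] by (simp add: comb_gen)

text \<open>Tensor products commute with direct sums. Each of the two inverse maps comes from the
  universal property of its source, and both composites are checked on generators.\<close>

lemma tensor_copower:
  assumes N: "Module.module R N"
  shows "\<exists>\<Phi>\<in>mod_hom R (tensor R F N) (copower T N). bij_betw \<Phi> (carrier (tensor R F N)) (carrier (copower T N)) \<and>
    (\<forall>x\<in>carrier F. \<forall>n\<in>carrier N. \<Phi> (pure_tensor R F N x n) = tens N (coord x) n)"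
proof -
  note TT = module_tensor[OF F N] and C = module_copower[OF N, of T]
  have "\<exists>k\<in>mod_hom R (tensor R F N) (copower T N).
      \<forall>x\<in>carrier F. \<forall>n\<in>carrier N. k (pure_tensor R F N x n) = tens N (coord x) n"
  proof (rule tensor_lift[OF F N C])
    show "(\<lambda>x. tens N (coord x) n) \<in> mod_hom R F (copower T N)" if "n \<in> carrier N" for n
      by (rule mod_hom_compose[OF coord_hom tens_hom_left[OF N that]])
    show "tens N (coord x) \<in> mod_hom R N (copower T N)" if "x \<in> carrier F" for x
      by (rule tens_hom_right[OF N mod_hom_closed[OF coord_hom that]])
  qed
  then obtain \<Phi> where \<Phi>: "\<Phi> \<in> mod_hom R (tensor R F N) (copower T N)"
    "\<And>x n. x \<in> carrier F \<Longrightarrow> n \<in> carrier N \<Longrightarrow> \<Phi> (pure_tensor R F N x n) = tens N (coord x) n" by blast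
  let ?\<Psi> = "copower_ext N (tensor R F N) (pure_tensor R F N)"
  have ph: "pure_tensor R F N b \<in> mod_hom R N (tensor R F N)" if "b \<in> T" for b
    by (rule pure_tensor_hom_right[OF F N T_carrier[OF that]])
  have \<Psi>: "?\<Psi> \<in> mod_hom R (copower T N) (tensor R F N)" by (rule copower_ext_hom[OF N TT ph])
  have \<Psi>1: "?\<Psi> (single N b n) = pure_tensor R F N b n" if "b \<in> T" "n \<in> carrier N" for b n
    by (rule copower_ext_single[OF N TT, where T=T, OF ph that])
  have \<Psi>t: "?\<Psi> (tens N v n) = pure_tensor R F N (comb v) n"
    if v: "v \<in> carrier (free_module_on R T)" and n: "n \<in> carrier N" for v n
  proof (rule free_hom_eqI[OF R.is_cring TT _ _ _ v])
    show "(\<lambda>v. ?\<Psi> (tens N v n)) \<in> mod_hom R (free_module_on R T) (tensor R F N)"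
      by (rule mod_hom_compose[OF tens_hom_left[OF N n] \<Psi>])
    show "(\<lambda>v. pure_tensor R F N (comb v) n) \<in> mod_hom R (free_module_on R T) (tensor R F N)"
      by (rule mod_hom_compose[OF comb_hom pure_tensor_hom_left[OF F N n]])
    show "?\<Psi> (tens N (free_gen R b) n) = pure_tensor R F N (comb (free_gen R b)) n" if "b \<in> T" for b
      by (simp add: tens_free_gen[OF N n] \<Psi>1[OF that n] comb_gen[OF that])
  qed
  have id1: "?\<Psi> (\<Phi> t) = t" if t: "t \<in> carrier (tensor R F N)" for t
  proof (rule tensor_hom_eqI[OF F N TT mod_hom_compose[OF \<Phi>(1) \<Psi>] mod_hom_id _ t])
    show "?\<Psi> (\<Phi> (pure_tensor R F N x n)) = pure_tensor R F N x n" if "x \<in> carrier F" "n \<in> carrier N" for x n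
      using \<Phi>(2)[OF that] \<Psi>t[OF mod_hom_closed[OF coord_hom that(1)] that(2)] comb_coord[OF that(1)] by simp
  qed
  have id2: "\<Phi> (?\<Psi> \<phi>) = \<phi>" if p: "\<phi> \<in> fin_supp T N (carrier N)" for \<phi>
  proof (rule copower_hom_eqI[OF N C mod_hom_compose[OF \<Psi> \<Phi>(1)] mod_hom_id _ p])
    show "\<Phi> (?\<Psi> (single N b n)) = single N b n" if "b \<in> T" "n \<in> carrier N" for b n
      using \<Psi>1[OF that] \<Phi>(2)[OF T_carrier[OF that(1)] that(2)] coord_gen[OF that(1)] tens_free_gen[OF N that(2)] by simp
  qed
  have "bij_betw \<Phi> (carrier (tensor R F N)) (carrier (copower T N))"
    by (rule bij_betw_byWitness[where f'="?\<Psi>"])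
      (use id1 id2 mod_hom_closed[OF \<Phi>(1)] mod_hom_closed[OF \<Psi>] in auto)
  thus ?thesis using \<Phi> by blast
qed

end

text \<open>\<open>tensor_map\<close> is a choice among maps with given values on pure tensors, so
  nothing is known of it until such a map is exhibited. The base change, carried back along \<Phi>',
  is one; agreement on pure tensors then determines the chosen map.\<close>

lemma tensor_map_copower:
  assumes "based_module R F T" "based_module R F' T'" and N: "Module.module R N" and f: "f \<in> mod_hom R F F'"
    and \<Phi>: "\<Phi> \<in> mod_hom R (tensor R F N) (copower T N)"
      "bij_betw \<Phi> (carrier (tensor R F N)) (carrier (copower T N))"
      "\<And>x n. x \<in> carrier F \<Longrightarrow> n \<in> carrier N \<Longrightarrow> \<Phi> (pure_tensor R F N x n) = tens N (based_module.coord R F T x) n"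
    and \<Phi>': "\<Phi>' \<in> mod_hom R (tensor R F' N) (copower T' N)"
      "bij_betw \<Phi>' (carrier (tensor R F' N)) (carrier (copower T' N))"
      "\<And>x n. x \<in> carrier F' \<Longrightarrow> n \<in> carrier N \<Longrightarrow> \<Phi>' (pure_tensor R F' N x n) = tens N (based_module.coord R F' T' x) n"
  shows "tensor_map R F F' N f \<in> mod_hom R (tensor R F N) (tensor R F' N) \<and>
    (\<forall>t\<in>carrier (tensor R F N). \<Phi>' (tensor_map R F F' N f t) =
      base_change R N (\<lambda>u. based_module.coord R F' T' (f (free_ext R F (\<lambda>b. b) u))) (\<Phi> t))"
proof -
  interpret B: based_module R F T by fact
  interpret B': based_module R F' T' by fact
  note C' = module_copower[OF N, of T']
  have Fm: "Module.module R F" and F'm: "Module.module R F'" by (rule B.F, rule B'.F)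
  define g where "g u = B'.coord (f (B.comb u))" for u
  have g: "g \<in> mod_hom R (free_module_on R T) (free_module_on R T')"
    unfolding g_def by (rule mod_hom_compose[OF mod_hom_compose[OF B.comb_hom f] B'.coord_hom])
  note bc = base_change_hom[OF N g]
  let ?h = "\<lambda>t. inv_into (carrier (tensor R F' N)) \<Phi>' (base_change R N g (\<Phi> t))"
  have inv: "inv_into (carrier (tensor R F' N)) \<Phi>' \<in> mod_hom R (copower T' N) (tensor R F' N)"
    by (rule mod_hom_inv_into[OF module_tensor[OF F'm N] \<Phi>'(1,2)])
  have h: "?h \<in> mod_hom R (tensor R F N) (tensor R F' N)"
    by (rule mod_hom_compose[OF mod_hom_compose[OF \<Phi>(1) bc] inv])
  have gp: "base_change R N g (\<Phi> (pure_tensor R F N x n)) = \<Phi>' (pure_tensor R F' N (f x) n)"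
    if "x \<in> carrier F" "n \<in> carrier N" for x n
  proof -
    have "base_change R N g (\<Phi> (pure_tensor R F N x n)) = tens N (g (B.coord x)) n"
      using \<Phi>(3)[OF that] base_change_tens[OF N g mod_hom_closed[OF B.coord_hom that(1)] that(2)] by simp
    also have "g (B.coord x) = B'.coord (f x)" by (simp add: g_def B.comb_coord[OF that(1)])
    finally show ?thesis using \<Phi>'(3)[OF mod_hom_closed[OF f that(1)] that(2)] by simp
  qed
  have hp: "?h (pure_tensor R F N x n) = pure_tensor R F' N (f x) n" if "x \<in> carrier F" "n \<in> carrier N" for x n
    using gp[OF that] \<Phi>'(2) pure_tensor_closed[OF F'm N mod_hom_closed[OF f that(1)] that(2)]
    by (simp add: bij_betw_def)
  let ?P = "\<lambda>h. h \<in> mod_hom R (tensor R F N) (tensor R F' N) \<and>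
      (\<forall>x\<in>carrier F. \<forall>n\<in>carrier N. h (pure_tensor R F N x n) = pure_tensor R F' N (f x) n)"
  have "Ex ?P" using h hp by (intro exI[of _ ?h] conjI) blast+
  hence tm: "?P (tensor_map R F F' N f)" unfolding tensor_map_def by (rule someI_ex)
  have "\<Phi>' (tensor_map R F F' N f t) = base_change R N g (\<Phi> t)" if t: "t \<in> carrier (tensor R F N)" for t
    by (rule tensor_hom_eqI[OF Fm N C' mod_hom_compose[OF conjunct1[OF tm] \<Phi>'(1)] mod_hom_compose[OF \<Phi>(1) bc] _ t])
      (use tm gp in simp)
  thus ?thesis using tm by (simp add: g_def[abs_def])
qed

lemma exact_transfer:
  assumes \<Phi>: "\<And>n. bij_betw (\<Phi> n) (carrier (C n)) (carrier (C' n))"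
    and \<Delta>: "\<And>n x. x \<in> carrier (C (Suc n)) \<Longrightarrow> \<Delta> n x \<in> carrier (C n)"
    and comm: "\<And>n x. x \<in> carrier (C (Suc n)) \<Longrightarrow> \<Phi> n (\<Delta> n x) = \<Delta>' n (\<Phi> (Suc n) x)"
    and x: "x \<in> carrier (C n)"
  shows "x \<in> \<Delta> n ` carrier (C (Suc n)) \<longleftrightarrow> \<Phi> n x \<in> \<Delta>' n ` carrier (C' (Suc n))"
proof
  assume "x \<in> \<Delta> n ` carrier (C (Suc n))"
  then obtain z where "z \<in> carrier (C (Suc n))" "x = \<Delta> n z" by blast
  thus "\<Phi> n x \<in> \<Delta>' n ` carrier (C' (Suc n))" using comm bij_betw_apply[OF \<Phi>] by force
next
  assume "\<Phi> n x \<in> \<Delta>' n ` carrier (C' (Suc n))"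
  then obtain z' where z': "z' \<in> carrier (C' (Suc n))" "\<Phi> n x = \<Delta>' n z'" by blast
  then obtain z where z: "z \<in> carrier (C (Suc n))" "z' = \<Phi> (Suc n) z" using \<Phi>[of "Suc n"] by (auto simp: bij_betw_def)
  have "\<Phi> n x = \<Phi> n (\<Delta> n z)" using z z' comm by simp
  hence "x = \<Delta> n z" using \<Phi>[of n] x \<Delta>[OF z(1)] by (auto simp: bij_betw_def inj_on_def)
  thus "x \<in> \<Delta> n ` carrier (C (Suc n))" using z(1) by blast
qed

lemma chain_homology_zero_iff:
  fixes R :: "'a ring" and C :: "nat \<Rightarrow> ('a, 'c) module"
  assumes C: "\<And>n. Module.module R (C n)" and \<Delta>: "\<And>n. \<Delta> n \<in> mod_hom R (C (Suc n)) (C n)"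
    and \<Delta>\<Delta>: "\<And>n x. x \<in> carrier (C (Suc (Suc n))) \<Longrightarrow> \<Delta> n (\<Delta> (Suc n) x) = \<zero>\<^bsub>C n\<^esub>"
  shows "is_zero_module (chain_homology C \<Delta> i) \<longleftrightarrow>
    (\<forall>x\<in>carrier (C i). (case i of 0 \<Rightarrow> True | Suc k \<Rightarrow> \<Delta> k x = \<zero>\<^bsub>C k\<^esub>) \<longrightarrow> x \<in> \<Delta> i ` carrier (C (Suc i)))"
proof -
  define Z where "Z = (case i of 0 \<Rightarrow> carrier (C 0) | Suc k \<Rightarrow> {x \<in> carrier (C (Suc k)). \<Delta> k x = \<zero>\<^bsub>C k\<^esub>})"
  have Z: "submodule Z R (C i)"
  proof (cases i)
    case 0 thus ?thesis using module.carrier_is_submodule[OF C] by (simp add: Z_def)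
  next
    case (Suc k) thus ?thesis
      using submodule_vimage[OF C C \<Delta>[of k] submodule_zero[OF C]] by (simp add: Z_def)
  qed
  have im: "submodule (\<Delta> i ` carrier (C (Suc i))) R (C i)"
    by (rule submodule_image[OF C C \<Delta> module.carrier_is_submodule[OF C]])
  have sub: "\<Delta> i ` carrier (C (Suc i)) \<subseteq> Z"
    using \<Delta>\<Delta> mod_hom_closed[OF \<Delta>] by (auto simp: Z_def split: nat.split)
  have "is_zero_module (chain_homology C \<Delta> i) \<longleftrightarrow> Z \<subseteq> \<Delta> i ` carrier (C (Suc i))"
    using is_zero_quot_iff[OF submodule.submodule_is_module[OF Z C] submodule_restrict[OF C Z im sub]]
    by (simp add: chain_homology_def Z_def)
  thus ?thesis by (cases i) (auto simp: Z_def)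
qed

text \<open>The coordinates are fixed before the coefficient module: one resolution serves all
  \<open>N\<close> and all degrees, and the same resolution is later used with coefficients in
  subquotients of the injective modules.\<close>

theorem Tor_zero_iff:
  fixes R :: "'a ring" and L :: "('a, 'b) module"
  assumes R: "cring R" and nontriv: "\<one>\<^bsub>R\<^esub> \<noteq> \<zero>\<^bsub>R\<^esub>" and L: "Module.module R L"
  shows "\<exists>(T :: nat \<Rightarrow> ('a, 'b) res_elem set) D \<epsilon>. free_resolution_coords R T D L \<epsilon> \<and>
    (\<forall>N :: ('a, 'c) module. Module.module R N \<longrightarrow>
      (\<forall>i. is_zero_module (Tor R i L N) \<longleftrightarrow> free_complex.rel_exact R T D N i (carrier N) {\<zero>\<^bsub>N\<^esub>}))"
proof -
  obtain F \<Delta> \<epsilon> where FR: "free_resolution R L = (F, \<Delta>, \<epsilon>)" by (metis prod_cases3)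
  have res: "is_free_resolution R L (F, \<Delta>, \<epsilon>)" using free_resolution_exists[OF R nontriv L] by (simp add: FR)
  hence free: "\<And>n. is_free_module R (F n)" and \<Delta>: "\<And>n. \<Delta> n \<in> mod_hom R (F (Suc n)) (F n)"
    and \<epsilon>: "\<epsilon> \<in> mod_hom R (F 0) L" "\<epsilon> ` carrier (F 0) = carrier L"
    and ex0: "\<Delta> 0 ` carrier (F 1) = {x \<in> carrier (F 0). \<epsilon> x = \<zero>\<^bsub>L\<^esub>}"
    and exS: "\<And>n. \<Delta> (Suc n) ` carrier (F (Suc (Suc n))) = {x \<in> carrier (F (Suc n)). \<Delta> n x = \<zero>\<^bsub>F n\<^esub>}"
    unfolding is_free_resolution_def by auto
  have Fm: "Module.module R (F n)" for n using free[of n] by (simp add: is_free_module_def)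
  obtain T where T: "\<And>n. is_basis R (F n) (T n)" using free unfolding is_free_module_def by metis
  have based: "based_module R (F n) (T n)" for n using Fm T by (simp add: based_module_def)
  define co where "co n = based_module.coord R (F n) (T n)" for n
  define cb where "cb n = free_ext R (F n) (\<lambda>b. b)" for n
  define D where "D n u = co n (\<Delta> n (cb (Suc n) u))" for n u
  have cb: "cb n \<in> mod_hom R (free_module_on R (T n)) (F n)" for n
    unfolding cb_def by (rule based_module.comb_hom[OF based])
  have co: "co n \<in> mod_hom R (F n) (free_module_on R (T n))" for n
    unfolding co_def by (rule based_module.coord_hom[OF based])
  have cocb: "co n (cb n u) = u" if "u \<in> carrier (free_module_on R (T n))" for n u
    unfolding co_def cb_def by (rule based_module.coord_comb[OF based that])
  have cbco: "cb n (co n x) = x" if "x \<in> carrier (F n)" for n x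
    unfolding co_def cb_def by (rule based_module.comb_coord[OF based that])
  have Dh: "D n \<in> mod_hom R (free_module_on R (T (Suc n))) (free_module_on R (T n))" for n
    unfolding D_def by (rule mod_hom_compose[OF mod_hom_compose[OF cb \<Delta>] co])
  have cbD: "cb n (D n u) = \<Delta> n (cb (Suc n) u)" if "u \<in> carrier (free_module_on R (T (Suc n)))" for n u
    unfolding D_def by (rule cbco[OF mod_hom_closed[OF \<Delta> mod_hom_closed[OF cb that]]])
  have coz: "co n \<zero>\<^bsub>F n\<^esub> = (\<lambda>_. \<zero>\<^bsub>R\<^esub>)" for n using mod_hom_zero[OF Fm module_free[OF R] co] by simp
  have cbz: "cb n (\<lambda>_. \<zero>\<^bsub>R\<^esub>) = \<zero>\<^bsub>F n\<^esub>" for n using mod_hom_zero[OF module_free[OF R] Fm cb] by simp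
  have cbbij: "bij_betw (cb n) (carrier (free_module_on R (T n))) (carrier (F n))" for n
    unfolding cb_def by (rule based_module.comb_bij[OF based])
  have im: "u \<in> D n ` carrier (free_module_on R (T (Suc n))) \<longleftrightarrow> cb n u \<in> \<Delta> n ` carrier (F (Suc n))"
    if "u \<in> carrier (free_module_on R (T n))" for n u
    by (rule exact_transfer[where C="\<lambda>n. free_module_on R (T n)" and C'=F and \<Phi>=cb and \<Delta>=D and \<Delta>'=\<Delta> and n=n, OF cbbij mod_hom_closed[OF Dh] cbD that])
  interpret FC: free_complex R T D
  proof (rule free_complex.intro)
    show "D n (D (Suc n) u) = (\<lambda>_. \<zero>\<^bsub>R\<^esub>)" if u: "u \<in> carrier (free_module_on R (T (Suc (Suc n))))" for n u
    proof -
      have "\<Delta> n (\<Delta> (Suc n) (cb (Suc (Suc n)) u)) = \<zero>\<^bsub>F n\<^esub>" using exS[of n] mod_hom_closed[OF cb u] by blast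
      thus ?thesis using cbD[OF u] by (simp add: D_def[of n] coz)
    qed
  qed (rule R Dh)+
  have coords: "free_resolution_coords R T D L (\<lambda>u. \<epsilon> (cb 0 u))"
  proof (rule free_resolution_coords.intro[OF FC.free_complex_axioms free_resolution_coords_axioms.intro])
    show "(\<lambda>u. \<epsilon> (cb 0 u)) \<in> mod_hom R (free_module_on R (T 0)) L" by (rule mod_hom_compose[OF cb \<epsilon>(1)])
    have "(\<lambda>u. \<epsilon> (cb 0 u)) ` carrier (free_module_on R (T 0)) = \<epsilon> ` (cb 0 ` carrier (free_module_on R (T 0)))" by (simp add: image_image)
    thus "(\<lambda>u. \<epsilon> (cb 0 u)) ` carrier (free_module_on R (T 0)) = carrier L"
      using cbbij[of 0] \<epsilon>(2) by (simp add: bij_betw_def)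
    show "\<epsilon> (cb 0 u) = \<zero>\<^bsub>L\<^esub> \<longleftrightarrow> u \<in> D 0 ` carrier (free_module_on R (T 1))"
      if u: "u \<in> carrier (free_module_on R (T 0))" for u
      using im[OF u] ex0 mod_hom_closed[OF cb u] by auto
    show "u \<in> D (Suc n) ` carrier (free_module_on R (T (Suc (Suc n))))"
      if u: "u \<in> carrier (free_module_on R (T (Suc n)))" and z: "D n u = (\<lambda>_. \<zero>\<^bsub>R\<^esub>)" for n u
    proof -
      have "\<Delta> n (cb (Suc n) u) = \<zero>\<^bsub>F n\<^esub>" using cbD[OF u] z cbz by simp
      thus ?thesis using im[OF u] exS[of n] mod_hom_closed[OF cb u] by auto
    qed
  qed (rule L)
  have main: "is_zero_module (Tor R i L N) \<longleftrightarrow> FC.rel_exact N i (carrier N) {\<zero>\<^bsub>N\<^esub>}"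
    if N: "Module.module R N" for N :: "('a, 'c) module" and i
  proof -
    interpret N: Module.module R N by (rule N)
    note P = module_copower[OF N]
    have "\<exists>\<Phi>. \<forall>n. \<Phi> n \<in> mod_hom R (tensor R (F n) N) (copower (T n) N) \<and>
        bij_betw (\<Phi> n) (carrier (tensor R (F n) N)) (carrier (copower (T n) N)) \<and>
        (\<forall>x\<in>carrier (F n). \<forall>m\<in>carrier N. \<Phi> n (pure_tensor R (F n) N x m) = tens N (co n x) m)"
      using based_module.tensor_copower[OF based N] unfolding co_def Bex_def by (intro choice allI) blast
    then obtain \<Phi> where \<Phi>: "\<And>n. \<Phi> n \<in> mod_hom R (tensor R (F n) N) (copower (T n) N)"
      "\<And>n. bij_betw (\<Phi> n) (carrier (tensor R (F n) N)) (carrier (copower (T n) N))"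
      "\<And>n x m. x \<in> carrier (F n) \<Longrightarrow> m \<in> carrier N \<Longrightarrow> \<Phi> n (pure_tensor R (F n) N x m) = tens N (co n x) m" by blast
    define tm where "tm n = tensor_map R (F (Suc n)) (F n) N (\<Delta> n)" for n
    have tm: "tm n \<in> mod_hom R (tensor R (F (Suc n)) N) (tensor R (F n) N)"
      "\<And>t. t \<in> carrier (tensor R (F (Suc n)) N) \<Longrightarrow> \<Phi> n (tm n t) = FC.d N n (\<Phi> (Suc n) t)" for n
      using tensor_map_copower[OF based based N \<Delta>[of n] \<Phi>(1,2) \<Phi>(3)[unfolded co_def] \<Phi>(1,2) \<Phi>(3)[unfolded co_def]]
      by (simp_all add: tm_def D_def[abs_def] co_def cb_def)
    note TT = module_tensor[OF Fm N]
    have \<Phi>z: "\<Phi> n t = (\<lambda>_. \<zero>\<^bsub>N\<^esub>) \<longleftrightarrow> t = \<zero>\<^bsub>tensor R (F n) N\<^esub>" if t: "t \<in> carrier (tensor R (F n) N)" for n t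
    proof -
      interpret TN: Module.module R "tensor R (F n) N" by (rule TT)
      have "\<Phi> n \<zero>\<^bsub>tensor R (F n) N\<^esub> = (\<lambda>_. \<zero>\<^bsub>N\<^esub>)" using mod_hom_zero[OF TT P \<Phi>(1)[of n]] by simp
      thus ?thesis using \<Phi>(2)[of n] t TN.M.zero_closed by (metis bij_betw_imp_inj_on inj_on_eq_iff)
    qed
    have tmtm: "tm n (tm (Suc n) t) = \<zero>\<^bsub>tensor R (F n) N\<^esub>" if t: "t \<in> carrier (tensor R (F (Suc (Suc n))) N)" for n t
    proof -
      have "\<Phi> n (tm n (tm (Suc n) t)) = (\<lambda>_. \<zero>\<^bsub>N\<^esub>)"
        using tm(2)[OF mod_hom_closed[OF tm(1) t]] tm(2)[OF t] FC.d_d[OF N, of "\<Phi> (Suc (Suc n)) t" n] mod_hom_closed[OF \<Phi>(1) t]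
        by simp
      thus ?thesis using \<Phi>z[OF mod_hom_closed[OF tm(1) mod_hom_closed[OF tm(1) t]]] by simp
    qed
    have im': "t \<in> tm n ` carrier (tensor R (F (Suc n)) N) \<longleftrightarrow> \<Phi> n t \<in> FC.d N n ` carrier (copower (T (Suc n)) N)"
      if "t \<in> carrier (tensor R (F n) N)" for n t
      by (rule exact_transfer[where C="\<lambda>n. tensor R (F n) N" and C'="\<lambda>n. copower (T n) N" and \<Phi>=\<Phi> and \<Delta>=tm
              and \<Delta>'="FC.d N" and n=n, OF \<Phi>(2) mod_hom_closed[OF tm(1)] tm(2) that])
    have "tm = (\<lambda>n. tensor_map R (F (Suc n)) (F n) N (\<Delta> n))" by (simp add: tm_def[abs_def])
    hence "Tor R i L N = chain_homology (\<lambda>n. tensor R (F n) N) tm i" by (simp add: Tor_def FR)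
    hence "is_zero_module (Tor R i L N) \<longleftrightarrow>
      (\<forall>t\<in>carrier (tensor R (F i) N). (case i of 0 \<Rightarrow> True | Suc k \<Rightarrow> tm k t = \<zero>\<^bsub>tensor R (F k) N\<^esub>) \<longrightarrow>
        t \<in> tm i ` carrier (tensor R (F (Suc i)) N))"
      using chain_homology_zero_iff[where C="\<lambda>n. tensor R (F n) N" and \<Delta>=tm, OF TT tm(1) tmtm, of i] by simp
    also have "\<dots> \<longleftrightarrow> (\<forall>t\<in>carrier (tensor R (F i) N). FC.rel_cycle N i {\<zero>\<^bsub>N\<^esub>} (\<Phi> i t) \<longrightarrow>
        \<Phi> i t \<in> FC.d N i ` carrier (copower (T (Suc i)) N))"
    proof (intro ball_cong refl imp_cong im')
      fix t assume t: "t \<in> carrier (tensor R (F i) N)"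
      have fz: "\<phi> \<in> fin_supp U N {\<zero>\<^bsub>N\<^esub>} \<longleftrightarrow> \<phi> = (\<lambda>_. \<zero>\<^bsub>N\<^esub>)" for \<phi> and U :: "('a, 'b) res_elem set"
        by (auto simp: fin_supp_def)
      show "(case i of 0 \<Rightarrow> True | Suc k \<Rightarrow> tm k t = \<zero>\<^bsub>tensor R (F k) N\<^esub>) \<longleftrightarrow> FC.rel_cycle N i {\<zero>\<^bsub>N\<^esub>} (\<Phi> i t)"
      proof (cases i)
        case (Suc k)
        hence t': "t \<in> carrier (tensor R (F (Suc k)) N)" using t by simp
        show ?thesis using Suc \<Phi>z[OF mod_hom_closed[OF tm(1) t']] tm(2)[OF t'] by (simp add: FC.rel_cycle_def fz)
      qed (simp add: FC.rel_cycle_def)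
    qed
    also have "\<dots> \<longleftrightarrow> (\<forall>\<phi>\<in>carrier (copower (T i) N). FC.rel_cycle N i {\<zero>\<^bsub>N\<^esub>} \<phi> \<longrightarrow>
        \<phi> \<in> FC.d N i ` carrier (copower (T (Suc i)) N))"
      by (subst bij_betw_imp_surj_on[OF \<Phi>(2)[of i], symmetric]) (simp only: ball_simps)
    also have "\<dots> \<longleftrightarrow> FC.rel_exact N i (carrier N) {\<zero>\<^bsub>N\<^esub>}"
    proof -
      interpret Pi: Module.module R "copower (T i) N" by (rule P)
      have "\<phi> \<ominus>\<^bsub>copower (T i) N\<^esub> FC.d N i \<psi> \<in> fin_supp (T i) N {\<zero>\<^bsub>N\<^esub>} \<longleftrightarrow> \<phi> = FC.d N i \<psi>"
        if "\<phi> \<in> fin_supp (T i) N (carrier N)" "\<psi> \<in> fin_supp (T (Suc i)) N (carrier N)" for \<phi> \<psi>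
      proof -
        have "FC.d N i \<psi> \<in> fin_supp (T i) N (carrier N)"
          by (rule FC.d_fin_supp[OF N N.carrier_is_submodule that(2)])
        hence "\<phi> \<ominus>\<^bsub>copower (T i) N\<^esub> FC.d N i \<psi> = \<zero>\<^bsub>copower (T i) N\<^esub> \<longleftrightarrow> \<phi> = FC.d N i \<psi>"
          using that(1) by (intro Pi.M.diff_eq_zero_iff) auto
        thus ?thesis by (auto simp: fin_supp_def)
      qed
      thus ?thesis unfolding FC.rel_exact_def by (simp add: image_iff)
    qed
    finally show ?thesis .
  qed
  show ?thesis using coords main by blast
qed
section \<open>Primes of a Noetherian local ring\<close>

lemma noetherian_ideal_induct [consumes 2, case_names step]:
  assumes "noetherian_ring R" "ideal J R"
    and step: "\<And>J. ideal J R \<Longrightarrow> (\<And>K. ideal K R \<Longrightarrow> J \<subset> K \<Longrightarrow> P K) \<Longrightarrow> P J"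
  shows "P J"
proof (rule ccontr)
  assume "\<not> P J"
  let ?A = "{J. ideal J R \<and> \<not> P J}"
  have "\<exists>M\<in>?A. \<forall>K\<in>?A. M \<subseteq> K \<longrightarrow> K = M"
  proof (rule subset_Zorn_nonempty)
    show "?A \<noteq> {}" using assms(2) \<open>\<not> P J\<close> by blast
    fix C assume C: "C \<noteq> {}" "subset.chain ?A C"
    hence "subset.chain {I. ideal I R} C" by (auto simp: pred_on.chain_def)
    hence "\<Union>C \<in> C" by (rule noetherian_ring.ideal_chain_is_trivial[OF assms(1) C(1)])
    thus "\<Union>C \<in> ?A" using C(2) by (auto simp: pred_on.chain_def)
  qed
  thus False using step by blast
qed

text \<open>The head is multiplied on the right, to match the recursion of
  \<open>ideal_power\<close>.\<close>

primrec ideal_list_prod :: "'a ring \<Rightarrow> 'a set list \<Rightarrow> 'a set" where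
  "ideal_list_prod R [] = carrier R"
| "ideal_list_prod R (P # Ps) = ideal_prod R (ideal_list_prod R Ps) P"

lemma ideal_power_list: "ideal_power R I n = ideal_list_prod R (replicate n I)"
  by (induction n) simp_all

lemma ideal_list_prod_ideal:
  assumes "ring R" "\<And>P. P \<in> set Ps \<Longrightarrow> ideal P R" shows "ideal (ideal_list_prod R Ps) R"
  using assms(2) by (induction Ps) (simp_all add: ring.oneideal[OF assms(1)] ring.ideal_prod_is_ideal[OF assms(1)])

lemma ideal_list_prod_append:
  assumes "ring R" "\<And>P. P \<in> set (Ps @ Qs) \<Longrightarrow> ideal P R"
  shows "ideal_list_prod R (Ps @ Qs) = ideal_prod R (ideal_list_prod R Qs) (ideal_list_prod R Ps)"
  using assms(2)
proof (induction Ps)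
  case Nil
  thus ?case using ring.ideal_prod_one[OF assms(1) ideal_list_prod_ideal[OF assms(1)], of Qs] by simp
next
  case (Cons P Ps)
  thus ?case
    using ring.ideal_prod_assoc[OF assms(1) ideal_list_prod_ideal[OF assms(1)] ideal_list_prod_ideal[OF assms(1)], of Qs Ps P]
    by simp
qed

text \<open>Noetherian induction. If J is proper and not prime, there are ideals I and K outside J
  with product inside J; then (J + I)(J + K) \<subseteq> J, and both factors contain prime products
  by induction. The lemma takes the place of the finiteness of the set of minimal primes over
  J.\<close>

lemma contains_prime_product:
  fixes R :: "'a ring"
  assumes "cring R" "noetherian_ring R" "ideal J R"
  shows "\<exists>Ps. (\<forall>P\<in>set Ps. primeideal P R \<and> J \<subseteq> P) \<and> ideal_list_prod R Ps \<subseteq> J"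
  using assms(2,3)
proof (induction rule: noetherian_ideal_induct)
  case (step J)
  interpret cring R by fact
  interpret J: ideal J R by (rule step(1))
  show ?case
  proof (cases "J = carrier R \<or> primeideal J R")
    case True
    moreover have ?thesis if "J = carrier R" using that by (intro exI[of _ "[]"]) simp
    moreover have ?thesis if P: "primeideal J R"
      using ideal_prod_inter[OF oneideal step(1)] P by (intro exI[of _ "[J]"]) auto
    ultimately show ?thesis by blast
  next
    case False
    then obtain I K where IK: "ideal I R" "ideal K R" "ideal_prod R I K \<subseteq> J" "\<not> I \<subseteq> J" "\<not> K \<subseteq> J"
      using divides_ideal_prod_imp_primeideal[OF step(1)] by blast
    have sum: "ideal (J <+>\<^bsub>R\<^esub> I) R" "J \<subset> J <+>\<^bsub>R\<^esub> I" if I: "ideal I R" "\<not> I \<subseteq> J" for I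
    proof -
      interpret I: ideal I R by (rule I(1))
      show "ideal (J <+>\<^bsub>R\<^esub> I) R" by (rule add_ideals[OF step(1) I(1)])
      have "J \<subseteq> J <+>\<^bsub>R\<^esub> I"
      proof
        fix j assume j: "j \<in> J"
        have "j = j \<oplus>\<^bsub>R\<^esub> \<zero>\<^bsub>R\<^esub>" using J.a_Hcarr[OF j] by simp
        thus "j \<in> J <+>\<^bsub>R\<^esub> I" unfolding set_add_def' using j I.zero_closed by blast
      qed
      moreover have "I \<subseteq> J <+>\<^bsub>R\<^esub> I"
      proof
        fix j assume j: "j \<in> I"
        have "j = \<zero>\<^bsub>R\<^esub> \<oplus>\<^bsub>R\<^esub> j" using I.a_Hcarr[OF j] by simp
        thus "j \<in> J <+>\<^bsub>R\<^esub> I" unfolding set_add_def' using j J.zero_closed by blast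
      qed
      ultimately show "J \<subset> J <+>\<^bsub>R\<^esub> I" using I(2) by blast
    qed
    obtain Ps where Ps: "\<And>P. P \<in> set Ps \<Longrightarrow> primeideal P R \<and> J <+>\<^bsub>R\<^esub> I \<subseteq> P" "ideal_list_prod R Ps \<subseteq> J <+>\<^bsub>R\<^esub> I"
      using step(2)[OF sum[OF IK(1,4)]] by blast
    obtain Qs where Qs: "\<And>P. P \<in> set Qs \<Longrightarrow> primeideal P R \<and> J <+>\<^bsub>R\<^esub> K \<subseteq> P" "ideal_list_prod R Qs \<subseteq> J <+>\<^bsub>R\<^esub> K"
      using step(2)[OF sum[OF IK(2,5)]] by blast
    have prod: "p \<otimes>\<^bsub>R\<^esub> q \<in> J" if pq: "p \<in> J <+>\<^bsub>R\<^esub> I" "q \<in> J <+>\<^bsub>R\<^esub> K" for p q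
    proof -
      obtain j i j' k where e: "j \<in> J" "i \<in> I" "p = j \<oplus>\<^bsub>R\<^esub> i" "j' \<in> J" "k \<in> K" "q = j' \<oplus>\<^bsub>R\<^esub> k"
        using pq unfolding set_add_def' by blast
      have c: "j \<in> carrier R" "i \<in> carrier R" "j' \<in> carrier R" "k \<in> carrier R"
        using e ideal.Icarr[OF step(1)] ideal.Icarr[OF IK(1)] ideal.Icarr[OF IK(2)] by auto
      have "p \<otimes>\<^bsub>R\<^esub> q = j \<otimes>\<^bsub>R\<^esub> q \<oplus>\<^bsub>R\<^esub> (i \<otimes>\<^bsub>R\<^esub> j' \<oplus>\<^bsub>R\<^esub> i \<otimes>\<^bsub>R\<^esub> k)"
        using c e by (simp add: l_distr r_distr a_ac)
      moreover have "i \<otimes>\<^bsub>R\<^esub> k \<in> J" using IK(3) ideal_prod.prod[OF e(2,5)] by blast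
      moreover have "j \<otimes>\<^bsub>R\<^esub> q \<in> J" "i \<otimes>\<^bsub>R\<^esub> j' \<in> J" using J.I_r_closed J.I_l_closed e c by auto
      ultimately show ?thesis using J.a_closed by auto
    qed
    have "ideal_prod R (ideal_list_prod R Ps) (ideal_list_prod R Qs) \<subseteq> J"
    proof
      fix s assume "s \<in> ideal_prod R (ideal_list_prod R Ps) (ideal_list_prod R Qs)"
      thus "s \<in> J"
      proof (induction rule: ideal_prod.induct)
        case (prod i j)
        have "i \<in> J <+>\<^bsub>R\<^esub> I" "j \<in> J <+>\<^bsub>R\<^esub> K" using prod Ps(2) Qs(2) by auto
        thus ?case by (rule \<open>\<And>q p. p \<in> J <+>\<^bsub>R\<^esub> I \<Longrightarrow> q \<in> J <+>\<^bsub>R\<^esub> K \<Longrightarrow> p \<otimes>\<^bsub>R\<^esub> q \<in> J\<close>)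
      next
        case (sum s1 s2) thus ?case using J.a_closed by blast
      qed
    qed
    moreover have "ideal P R" if "P \<in> set (Qs @ Ps)" for P
      using that Ps(1) Qs(1) primeideal.axioms(1)[of P R] by auto
    ultimately have "ideal_list_prod R (Qs @ Ps) \<subseteq> J"
      using ideal_list_prod_append[OF ring_axioms, of Qs Ps] by simp
    moreover have "primeideal P R \<and> J \<subseteq> P" if "P \<in> set (Qs @ Ps)" for P
      using that Ps(1) Qs(1) sum(2)[OF IK(1,4)] sum(2)[OF IK(2,5)] by fastforce
    ultimately show ?thesis by (intro exI[of _ "Qs @ Ps"]) blast
  qed
qed

lemma prime_contains_list_prod:
  assumes R: "ring R" and P: "primeideal P R" and "\<And>Q. Q \<in> set Ps \<Longrightarrow> ideal Q R" "ideal_list_prod R Ps \<subseteq> P"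
  shows "\<exists>Q\<in>set Ps. Q \<subseteq> P"
  using assms(3,4)
proof (induction Ps)
  case Nil
  thus ?case using primeideal.I_notcarr[OF P] ideal.Icarr[OF primeideal.axioms(1)[OF P]] by auto
next
  case (Cons Q Ps)
  have "ideal_list_prod R Ps \<subseteq> P \<or> Q \<subseteq> P"
    by (rule ring.primeideal_divides_ideal_prod[OF R P ideal_list_prod_ideal[OF R]]) (use Cons in auto)
  thus ?case using Cons by auto
qed

text \<open>Let x in \<open>I\<close> avoid all primes but P. If x lies in P, add an element of
  \<open>I\<close> lying in all the others but not in P; such an element exists, as a product, when
  no other prime is contained in P.\<close>

lemma prime_avoidance:
  fixes R :: "'a ring"
  assumes R: "cring R" and I: "ideal I R"
  shows "finite \<P> \<Longrightarrow> (\<And>P. P \<in> \<P> \<Longrightarrow> primeideal P R \<and> \<not> I \<subseteq> P) \<Longrightarrow> \<exists>x\<in>I. \<forall>P\<in>\<P>. x \<notin> P"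
proof (induction "card \<P>" arbitrary: \<P>)
  case 0
  interpret I: ideal I R by (rule I)
  show ?case using 0 I.zero_closed by (intro bexI[of _ "\<zero>\<^bsub>R\<^esub>"]) auto
next
  case (Suc n)
  interpret cring R by (rule R)
  interpret I: ideal I R by (rule I)
  obtain P \<Q> where PQ: "\<P> = insert P \<Q>" "P \<notin> \<Q>" "card \<Q> = n"
    using Suc.hyps(2) by (metis card_Suc_eq)
  have fQ: "finite \<Q>" using Suc.prems(1) PQ(1) by simp
  have prime: "primeideal P R" "\<not> I \<subseteq> P" using Suc.prems(2) PQ(1) by auto
  interpret P: primeideal P R by (rule prime(1))
  show ?case
  proof (cases "\<exists>Q\<in>\<Q>. Q \<subseteq> P")
    case True
    then obtain Q where Q: "Q \<in> \<Q>" "Q \<subseteq> P" by blast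
    let ?P = "insert P (\<Q> - {Q})"
    have "n > 0" using Q(1) PQ(3) fQ by (metis card_gt_0_iff empty_iff)
    hence "card ?P = n" using PQ Q fQ by (simp add: card_Diff_singleton)
    hence "\<exists>x\<in>I. \<forall>P\<in>?P. x \<notin> P" using Suc.hyps(1)[of ?P] fQ Suc.prems(2) PQ(1) by auto
    thus ?thesis using Q PQ(1) by blast
  next
    case False
    obtain x where x: "x \<in> I" "\<And>Q. Q \<in> \<Q> \<Longrightarrow> x \<notin> Q"
      using Suc.hyps(1)[of \<Q>] fQ Suc.prems(2) PQ by auto
    show ?thesis
    proof (cases "x \<in> P")
      case False thus ?thesis using x PQ(1) by blast
    next
      case xP: True
      have "\<exists>z\<in>I. (\<forall>Q\<in>S. z \<in> Q) \<and> z \<notin> P" if "finite S" "S \<subseteq> \<Q>" for S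
        using that
      proof (induction S rule: finite_induct)
        case empty thus ?case using prime(2) by blast
      next
        case (insert Q S)
        then obtain z where z: "z \<in> I" "\<forall>Q\<in>S. z \<in> Q" "z \<notin> P" by auto
        obtain q where q: "q \<in> Q" "q \<notin> P" using False insert.prems by blast
        have ids: "ideal Q' R" if "Q' \<in> insert Q S" for Q'
          using that insert.prems Suc.prems(2) PQ(1) primeideal.axioms(1) by blast
        have c: "q \<in> carrier R" "z \<in> carrier R" using ideal.Icarr[OF ids q(1)] I.Icarr[OF z(1)] by auto
        have "z \<otimes>\<^bsub>R\<^esub> q \<notin> P" using P.I_prime[OF c(2,1)] z(3) q(2) by blast
        moreover have "z \<otimes>\<^bsub>R\<^esub> q \<in> I" using I.I_r_closed[OF z(1) c(1)] .
        moreover have "z \<otimes>\<^bsub>R\<^esub> q \<in> Q'" if "Q' \<in> insert Q S" for Q'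
          using that ideal.I_l_closed[OF ids[OF that]] ideal.I_r_closed[OF ids[OF that]] q(1) z(2) c by auto
        ultimately show ?case by blast
      qed
      from this[OF fQ subset_refl] obtain z where z: "z \<in> I" "\<And>Q. Q \<in> \<Q> \<Longrightarrow> z \<in> Q" "z \<notin> P" by blast
      have c: "x \<in> carrier R" "z \<in> carrier R" using I.Icarr x(1) z(1) by auto
      have sub: "x \<oplus>\<^bsub>R\<^esub> z \<notin> Q" if "ideal Q R" "(x \<in> Q) \<noteq> (z \<in> Q)" for Q
      proof
        interpret Q: ideal Q R by (rule that(1))
        assume s: "x \<oplus>\<^bsub>R\<^esub> z \<in> Q"
        have "(x \<oplus>\<^bsub>R\<^esub> z) \<oplus>\<^bsub>R\<^esub> \<ominus>\<^bsub>R\<^esub> z = x" using c by (simp add: a_assoc r_neg)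
        moreover have "\<ominus>\<^bsub>R\<^esub> x \<oplus>\<^bsub>R\<^esub> (x \<oplus>\<^bsub>R\<^esub> z) = z" using c by (simp add: r_neg1)
        ultimately show False using that(2) s Q.a_closed Q.a_inv_closed by metis
      qed
      have "x \<oplus>\<^bsub>R\<^esub> z \<notin> P'" if "P' \<in> \<P>" for P'
        by (rule sub) (use that PQ(1) Suc.prems(2)[OF that] xP x(2) z(2,3) primeideal.axioms(1) in auto)
      thus ?thesis using I.a_closed[OF x(1) z(1)] by blast
    qed
  qed
qed

section \<open>Local rings, systems of parameters and torsion\<close>

locale noetherian_local =
  fixes R :: "'a ring" and \<mm> :: "'a set"
  assumes local_ring: "noetherian_local_ring R \<mm>"
begin

sublocale R: cring R
  using local_ring by (simp add: noetherian_local_ring_def)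

lemma noeth: "noetherian_ring R" and maximal: "maximalideal \<mm> R"
  and unique_maximal: "maximalideal J R \<Longrightarrow> J = \<mm>"
  using local_ring by (auto simp: noetherian_local_ring_def)

lemma max_ideal: "ideal \<mm> R"
  using maximal by (rule maximalideal.axioms)

lemma max_prime: "primeideal \<mm> R"
  by (rule R.maximalideal_prime[OF maximal])

lemma one_not_max: "\<one>\<^bsub>R\<^esub> \<notin> \<mm>"
  using ideal.one_imp_carrier[OF max_ideal] maximalideal.I_notcarr[OF maximal] by blast

lemma one_not_zero: "\<one>\<^bsub>R\<^esub> \<noteq> \<zero>\<^bsub>R\<^esub>"
  using one_not_max additive_subgroup.zero_closed[OF ideal.axioms(1)[OF max_ideal]] by auto

text \<open>A proper ideal that is not maximal lies in a larger proper ideal, to which Noetherian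
  induction applies.\<close>

lemma proper_ideal_subset:
  assumes "ideal J R" "J \<noteq> carrier R" shows "J \<subseteq> \<mm>"
  using noeth assms
proof (induction rule: noetherian_ideal_induct)
  case (step J)
  show ?case
  proof (cases "\<exists>K. ideal K R \<and> J \<subset> K \<and> K \<noteq> carrier R")
    case True thus ?thesis using step(2) by blast
  next
    case False
    have "maximalideal J R"
      by (rule maximalidealI[OF step(1) step(3)[symmetric]]) (use False in blast)
    thus ?thesis using unique_maximal by blast
  qed
qed

lemma prime_subset: "primeideal P R \<Longrightarrow> P \<subseteq> \<mm>"
  using proper_ideal_subset[of P] primeideal.axioms(1)[of P R] primeideal.I_notcarr[of P R] by blast

text \<open>For a prime \<open>P\<close>: its height is at least \<open>n\<close>.\<close>

definition prime_chain :: "nat \<Rightarrow> 'a set \<Rightarrow> bool" where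
  "prime_chain n P \<longleftrightarrow> (\<exists>Q :: nat \<Rightarrow> 'a set. Q n = P \<and> (\<forall>i\<le>n. primeideal (Q i) R) \<and> (\<forall>i<n. Q i \<subset> Q (Suc i)))"

lemma prime_chain_Suc:
  assumes "prime_chain n P" "primeideal P' R" "P \<subset> P'" shows "prime_chain (Suc n) P'"
proof -
  obtain Q :: "nat \<Rightarrow> 'a set" where Q: "Q n = P" "\<And>i. i \<le> n \<Longrightarrow> primeideal (Q i) R" "\<And>i. i < n \<Longrightarrow> Q i \<subset> Q (Suc i)"
    using assms(1) by (auto simp: prime_chain_def)
  show ?thesis
    unfolding prime_chain_def
    by (rule exI[of _ "Q(Suc n := P')"]) (use Q assms(2,3) in \<open>auto simp: le_Suc_eq less_Suc_eq\<close>)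
qed

lemma prime_chain_krull_dim:
  assumes "prime_chain n P" shows "ereal (real n) \<le> krull_dim R"
proof -
  obtain Q :: "nat \<Rightarrow> 'a set" where "\<forall>i\<le>n. Q i \<in> {P. primeideal P R}" "\<forall>i<n. Q i \<subset> Q (Suc i)"
    using assms by (auto simp: prime_chain_def)
  thus ?thesis unfolding krull_dim_def chain_dim_def by (intro Sup_upper) blast
qed

text \<open>Each new parameter avoids the finitely many primes, other than the maximal ideal, in a
  prime product inside the ideal of the previous ones. Any prime P over the previous parameters
  contains a member Q of that list; if P also contains the new parameter and Q is not maximal, then
  Q is strictly smaller than P, and the height grows by one.\<close>

lemma parameters_step:
  "\<exists>y :: nat \<Rightarrow> 'a. (\<forall>l. y l \<in> \<mm>) \<and> (\<forall>P. primeideal P R \<longrightarrow> (\<forall>l<j. y l \<in> P) \<longrightarrow> P = \<mm> \<or> prime_chain j P)"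
proof (induction j)
  case 0
  have "prime_chain 0 P" if "primeideal P R" for P
    unfolding prime_chain_def using that by (intro exI[of _ "\<lambda>_. P"]) simp
  thus ?case
    using additive_subgroup.zero_closed[OF ideal.axioms(1)[OF max_ideal]]
    by (intro exI[of _ "\<lambda>_. \<zero>\<^bsub>R\<^esub>"]) auto
next
  case (Suc j)
  then obtain y :: "nat \<Rightarrow> 'a" where y: "\<And>l. y l \<in> \<mm>"
    "\<And>P. primeideal P R \<Longrightarrow> (\<And>l. l < j \<Longrightarrow> y l \<in> P) \<Longrightarrow> P = \<mm> \<or> prime_chain j P" by blast
  have yR: "y ` {..<j} \<subseteq> carrier R" using y(1) ideal.Icarr[OF max_ideal] by blast
  let ?J = "Idl\<^bsub>R\<^esub> (y ` {..<j})"
  have J: "ideal ?J R" by (rule R.genideal_ideal[OF yR])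
  obtain Ps where Ps: "\<And>P. P \<in> set Ps \<Longrightarrow> primeideal P R \<and> ?J \<subseteq> P" "ideal_list_prod R Ps \<subseteq> ?J"
    using contains_prime_product[OF R.is_cring noeth J] by blast
  have "\<exists>z\<in>\<mm>. \<forall>P\<in>{P \<in> set Ps. P \<noteq> \<mm>}. z \<notin> P"
    by (rule prime_avoidance[OF R.is_cring max_ideal]) (use Ps(1) prime_subset in auto)
  then obtain z where z: "z \<in> \<mm>" "\<And>P. P \<in> set Ps \<Longrightarrow> P \<noteq> \<mm> \<Longrightarrow> z \<notin> P" by blast
  let ?y = "y(j := z)"
  have "P = \<mm> \<or> prime_chain (Suc j) P" if P: "primeideal P R" and yP: "\<forall>l<Suc j. ?y l \<in> P" for P
  proof -
    have "y ` {..<j} \<subseteq> P"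
    proof
      fix w assume "w \<in> y ` {..<j}"
      then obtain l where "l < j" "w = y l" by blast
      thus "w \<in> P" using spec[OF yP, of l] by simp
    qed
    hence "?J \<subseteq> P" by (rule R.genideal_minimal[OF primeideal.axioms(1)[OF P]])
    hence "ideal_list_prod R Ps \<subseteq> P" using Ps(2) by blast
    then obtain Q where Q: "Q \<in> set Ps" "Q \<subseteq> P"
      using prime_contains_list_prod[OF R.ring_axioms P, of Ps] Ps(1) primeideal.axioms(1) by blast
    show ?thesis
    proof (cases "Q = \<mm>")
      case True thus ?thesis using Q(2) prime_subset[OF P] by blast
    next
      case False
      have "z \<in> P" using spec[OF yP, of j] by simp
      hence "Q \<subset> P" using z(2)[OF Q(1) False] Q(2) by blast
      moreover have "y l \<in> Q" if "l < j" for l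
        using R.genideal_self[OF yR] Ps(1)[OF Q(1)] that by blast
      hence "prime_chain j Q" using y(2)[of Q] Ps(1)[OF Q(1)] False by blast
      ultimately show ?thesis using prime_chain_Suc P by blast
    qed
  qed
  moreover have "?y l \<in> \<mm>" for l using y(1) z(1) by simp
  ultimately show ?case by blast
qed

text \<open>A nonmaximal prime containing d parameters would have height at least d, and the maximal
  ideal above it height at least d + 1.\<close>

lemma system_of_parameters:
  assumes "krull_dim R = ereal (real d)"
  obtains y :: "nat \<Rightarrow> 'a" where "\<And>l. y l \<in> \<mm>"
    "\<And>P. primeideal P R \<Longrightarrow> (\<And>l. l < d \<Longrightarrow> y l \<in> P) \<Longrightarrow> P = \<mm>"
proof -
  obtain y :: "nat \<Rightarrow> 'a" where y: "\<And>l. y l \<in> \<mm>"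
    "\<And>P. primeideal P R \<Longrightarrow> (\<And>l. l < d \<Longrightarrow> y l \<in> P) \<Longrightarrow> P = \<mm> \<or> prime_chain d P"
    using parameters_step[of d] by blast
  have "P = \<mm>" if "primeideal P R" "\<And>l. l < d \<Longrightarrow> y l \<in> P" for P
  proof (rule ccontr)
    assume ne: "P \<noteq> \<mm>"
    hence "prime_chain d P" using y(2) that by blast
    hence "prime_chain (Suc d) \<mm>" using prime_chain_Suc max_prime prime_subset[OF that(1)] ne by blast
    hence "ereal (real (Suc d)) \<le> krull_dim R" by (rule prime_chain_krull_dim)
    thus False using assms by simp
  qed
  thus ?thesis using that y(1) by blast
qed

text \<open>All primes in a product contained in J and lying over J equal the maximal ideal, so the
  product is one of its powers.\<close>

lemma max_power_subset:
  assumes "ideal J R" "\<And>P. primeideal P R \<Longrightarrow> J \<subseteq> P \<Longrightarrow> P = \<mm>"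
  shows "\<exists>n. ideal_power R \<mm> n \<subseteq> J"
proof -
  obtain Ps where Ps: "\<And>P. P \<in> set Ps \<Longrightarrow> primeideal P R \<and> J \<subseteq> P" "ideal_list_prod R Ps \<subseteq> J"
    using contains_prime_product[OF R.is_cring noeth assms(1)] by blast
  have "Ps = replicate (length Ps) \<mm>" using Ps(1) assms(2) by (intro replicate_eqI) auto
  hence "ideal_power R \<mm> (length Ps) \<subseteq> J" using Ps(2) by (metis ideal_power_list)
  thus ?thesis by blast
qed

lemma power_in_max_power: "y \<in> \<mm> \<Longrightarrow> y [^]\<^bsub>R\<^esub> (n::nat) \<in> ideal_power R \<mm> n"
  by (induction n) (auto intro: ideal_prod.prod)

text \<open>If x is power torsion for each parameter, its annihilator contains powers of all of
  them. A prime over the annihilator then contains the parameters, so it is maximal, and the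
  annihilator contains a power of the maximal ideal.\<close>

lemma torsion_submodule_eq:
  fixes E :: "('a, 'c) module"
  assumes E: "Module.module R E" and y: "\<And>l. y l \<in> \<mm>"
    "\<And>P. primeideal P R \<Longrightarrow> (\<And>l. l < d \<Longrightarrow> y l \<in> P) \<Longrightarrow> P = \<mm>"
  shows "{x \<in> carrier E. \<exists>n. \<forall>r\<in>ideal_power R \<mm> n. r \<odot>\<^bsub>E\<^esub> x = \<zero>\<^bsub>E\<^esub>} =
    {x \<in> carrier E. \<forall>l<d. \<exists>n::nat. y l [^]\<^bsub>R\<^esub> n \<odot>\<^bsub>E\<^esub> x = \<zero>\<^bsub>E\<^esub>}" (is "?A = ?B")
proof
  show "?A \<subseteq> ?B" using power_in_max_power[OF y(1)] by blast
  show "?B \<subseteq> ?A"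
  proof
    interpret E: Module.module R E by (rule E)
    fix x assume x: "x \<in> ?B"
    hence xE: "x \<in> carrier E" by simp
    define J where "J = {r \<in> carrier R. r \<odot>\<^bsub>E\<^esub> x \<in> {\<zero>\<^bsub>E\<^esub>}}"
    have "(\<lambda>r. r \<odot>\<^bsub>E\<^esub> x) \<in> mod_hom R (regular_module R) E"
      by (rule mod_homI) (use xE in \<open>auto simp: E.smult_l_distr E.smult_assoc1\<close>)
    from submodule_vimage[OF module_self[OF R.is_cring] E this submodule_zero[OF E]]
    have J: "ideal J R" by (simp add: J_def submodule_regular_iff_ideal[OF R.is_cring])
    have "P = \<mm>" if P: "primeideal P R" "J \<subseteq> P" for P
    proof (rule y(2)[OF P(1)])
      interpret P: primeideal P R by (rule P(1))
      fix l assume "l < d"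
      then obtain n :: nat where n: "y l [^]\<^bsub>R\<^esub> n \<odot>\<^bsub>E\<^esub> x = \<zero>\<^bsub>E\<^esub>" using x by blast
      have yl: "y l \<in> carrier R" using ideal.Icarr[OF max_ideal y(1)] .
      have "y l [^]\<^bsub>R\<^esub> n \<in> P" using n yl P(2) by (auto simp: J_def)
      thus "y l \<in> P"
      proof (induction n)
        case 0 thus ?case using P.one_imp_carrier P.I_notcarr by simp
      next
        case (Suc n) thus ?case using P.I_prime[of "y l [^]\<^bsub>R\<^esub> n" "y l"] yl by auto
      qed
    qed
    then obtain n where "ideal_power R \<mm> n \<subseteq> J" using max_power_subset[OF J] by blast
    thus "x \<in> ?A" using xE by (auto simp: J_def)
  qed
qed

text \<open>The module is Rx modulo \<mm>x for a nonzero x, a copy of the residue field. It has to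
  be carried by the type of \<open>M\<close> itself.\<close>

lemma residue_module_exists:
  fixes M :: "('a, 'b) module"
  assumes M: "Module.module R M" and nz: "carrier M \<noteq> {\<zero>\<^bsub>M\<^esub>}"
  shows "\<exists>L :: ('a, 'b) module. Module.module R L \<and> carrier L \<noteq> {\<zero>\<^bsub>L\<^esub>} \<and>
    (\<forall>r\<in>\<mm>. \<forall>x\<in>carrier L. r \<odot>\<^bsub>L\<^esub> x = \<zero>\<^bsub>L\<^esub>)"
proof -
  interpret M: Module.module R M by (rule M)
  note RR = module_self[OF R.is_cring]
  obtain x where x: "x \<in> carrier M" "x \<noteq> \<zero>\<^bsub>M\<^esub>" using nz M.M.zero_closed by blast
  let ?f = "\<lambda>r. r \<odot>\<^bsub>M\<^esub> x"
  have f: "?f \<in> mod_hom R (regular_module R) M"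
    by (rule mod_homI) (use x(1) in \<open>auto simp: M.smult_l_distr M.smult_assoc1\<close>)
  define A where "A = ?f ` carrier R"
  define K where "K = ?f ` \<mm>"
  have A: "submodule A R M"
    unfolding A_def using submodule_image[OF RR M f module.carrier_is_submodule[OF RR]] by simp
  have K: "submodule K R M"
    unfolding K_def using submodule_image[OF RR M f] max_ideal submodule_regular_iff_ideal[OF R.is_cring] by blast
  have KA: "K \<subseteq> A" unfolding A_def K_def using ideal.Icarr[OF max_ideal] by blast
  have ann: "r \<in> \<mm>" if "r \<in> carrier R" "r \<odot>\<^bsub>M\<^esub> x = \<zero>\<^bsub>M\<^esub>" for r
  proof -
    have "ideal {r \<in> carrier R. ?f r \<in> {\<zero>\<^bsub>M\<^esub>}} R"
      using submodule_vimage[OF RR M f submodule_zero[OF M]] by (simp add: submodule_regular_iff_ideal[OF R.is_cring])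
    moreover have "{r \<in> carrier R. ?f r \<in> {\<zero>\<^bsub>M\<^esub>}} \<noteq> carrier R"
    proof -
      have "\<one>\<^bsub>R\<^esub> \<notin> {r \<in> carrier R. ?f r \<in> {\<zero>\<^bsub>M\<^esub>}}" using x by simp
      thus ?thesis using R.one_closed by blast
    qed
    ultimately show ?thesis using proper_ideal_subset that by blast
  qed
  have xA: "x \<in> A" unfolding A_def using x(1) by (intro image_eqI[of _ _ "\<one>\<^bsub>R\<^esub>"]) auto
  \<comment> \<open>Nakayama's lemma for a cyclic module: x = r x with r in \<mm> puts 1 - r into
    the annihilator of x, which is a proper ideal and so lies in \<mm>.\<close>
  have xK: "x \<notin> K"
  proof
    assume "x \<in> K"
    then obtain r where r: "r \<in> \<mm>" "x = r \<odot>\<^bsub>M\<^esub> x" by (auto simp: K_def)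
    have rR: "r \<in> carrier R" by (rule ideal.Icarr[OF max_ideal r(1)])
    have "(\<one>\<^bsub>R\<^esub> \<ominus>\<^bsub>R\<^esub> r) \<odot>\<^bsub>M\<^esub> x = x \<ominus>\<^bsub>M\<^esub> r \<odot>\<^bsub>M\<^esub> x"
      using rR x(1) by (simp add: R.minus_eq a_minus_def M.smult_l_distr M.smult_l_minus)
    also have "\<dots> = \<zero>\<^bsub>M\<^esub>" using r(2) x(1) by (simp add: a_minus_def M.M.r_neg)
    finally have "\<one>\<^bsub>R\<^esub> \<ominus>\<^bsub>R\<^esub> r \<in> \<mm>" using ann rR by simp
    hence "(\<one>\<^bsub>R\<^esub> \<ominus>\<^bsub>R\<^esub> r) \<oplus>\<^bsub>R\<^esub> r \<in> \<mm>"
      using r(1) additive_subgroup.a_closed[OF ideal.axioms(1)[OF max_ideal]] by blast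
    moreover have "(\<one>\<^bsub>R\<^esub> \<ominus>\<^bsub>R\<^esub> r) \<oplus>\<^bsub>R\<^esub> r = \<one>\<^bsub>R\<^esub>" using rR by (simp add: R.minus_eq R.a_assoc R.l_neg)
    ultimately show False using one_not_max by simp
  qed
  let ?MA = "M\<lparr>carrier := A\<rparr>"
  have MA: "Module.module R ?MA" by (rule submodule.submodule_is_module[OF A M])
  have K': "submodule K R ?MA" by (rule submodule_restrict[OF M A K KA])
  let ?Q = "quot_module ?MA K"
  have Q: "Module.module R ?Q" by (rule module_quot[OF MA K'])
  note qc = quot_carrier[OF MA K'] and qz = quot_zero[OF MA K'] and qs = quot_smult[OF MA K']
  \<comment> \<open>A representative of each coset brings the quotient back from sets to elements of
    \<open>'b\<close>.\<close>
  define h where "h c = (SOME z. z \<in> c)" for c :: "'b set"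
  have hc: "h c \<in> c" if "c \<in> carrier ?Q" for c
  proof -
    obtain z where "z \<in> carrier ?MA" "c = K +>\<^bsub>?MA\<^esub> z" using \<open>c \<in> carrier ?Q\<close> qc by blast
    hence "z \<in> c" using coset_self[OF MA K'] by blast
    thus ?thesis unfolding h_def by (rule someI)
  qed
  have inj: "inj_on h (carrier ?Q)"
  proof (rule inj_onI)
    fix c c' assume cc: "c \<in> carrier ?Q" "c' \<in> carrier ?Q" "h c = h c'"
    have *: "c = K +>\<^bsub>?MA\<^esub> w" if c: "c \<in> carrier ?Q" and w: "w \<in> c" for c w
    proof -
      obtain z where z: "z \<in> carrier ?MA" "c = K +>\<^bsub>?MA\<^esub> z" using c qc by blast
      have wz: "w \<in> carrier ?MA" "w \<ominus>\<^bsub>?MA\<^esub> z \<in> K" using w mem_coset_iff[OF MA K' z(1)] z(2) by auto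
      have "K +>\<^bsub>?MA\<^esub> w = K +>\<^bsub>?MA\<^esub> z" using coset_eq_iff[OF MA K' wz(1) z(1)] wz(2) by blast
      thus ?thesis using z(2) by (rule trans[OF _ sym, rotated])
    qed
    show "c = c'" using *[OF cc(1) hc[OF cc(1)]] *[OF cc(2) hc[OF cc(2)]] cc(3) by simp
  qed
  let ?L = "transport h ?Q"
  have L: "Module.module R ?L" by (rule module_transport[OF Q inj])
  have zQ: "\<zero>\<^bsub>?Q\<^esub> \<in> carrier ?Q" using module.axioms(2)[OF Q] by (simp add: abelian_group.axioms abelian_monoid.zero_closed)
  have xQ: "K +>\<^bsub>?MA\<^esub> x \<in> carrier ?Q" using xA qc by auto
  have "K +>\<^bsub>?MA\<^esub> x \<noteq> \<zero>\<^bsub>?Q\<^esub>" using coset_eq_self_iff[OF MA K', of x] xA xK qz by simp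
  hence "h (K +>\<^bsub>?MA\<^esub> x) \<noteq> \<zero>\<^bsub>?L\<^esub>"
    using inj xQ zQ by (simp add: transport_simps[OF Q inj] inj_on_eq_iff)
  moreover have "h (K +>\<^bsub>?MA\<^esub> x) \<in> carrier ?L" using xQ by (simp add: transport_simps[OF Q inj])
  ultimately have "carrier ?L \<noteq> {\<zero>\<^bsub>?L\<^esub>}" by blast
  moreover have "r \<odot>\<^bsub>?L\<^esub> w = \<zero>\<^bsub>?L\<^esub>" if r: "r \<in> \<mm>" and w: "w \<in> carrier ?L" for r w
  proof -
    obtain c where c: "c \<in> carrier ?Q" "w = h c" using w by (auto simp: transport_simps[OF Q inj])
    then obtain z where z: "z \<in> carrier ?MA" "c = K +>\<^bsub>?MA\<^esub> z" using qc by blast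
    have rR: "r \<in> carrier R" by (rule ideal.Icarr[OF max_ideal r])
    obtain s where s: "s \<in> carrier R" "z = s \<odot>\<^bsub>M\<^esub> x" using z(1) by (auto simp: A_def)
    have "r \<odot>\<^bsub>M\<^esub> z = (r \<otimes>\<^bsub>R\<^esub> s) \<odot>\<^bsub>M\<^esub> x" using s rR x(1) by (simp add: M.smult_assoc1)
    moreover have "r \<otimes>\<^bsub>R\<^esub> s \<in> \<mm>" by (rule ideal.I_r_closed[OF max_ideal r s(1)])
    ultimately have "r \<odot>\<^bsub>M\<^esub> z \<in> K" by (auto simp: K_def)
    hence "r \<odot>\<^bsub>?Q\<^esub> c = \<zero>\<^bsub>?Q\<^esub>"
      using qs[OF z(1) rR] coset_eq_self_iff[OF MA K', of "r \<odot>\<^bsub>M\<^esub> z"] KA by (auto simp: z(2) qz)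
    thus ?thesis using c by (simp add: transport_simps[OF Q inj])
  qed
  ultimately show ?thesis using L by blast
qed

text \<open>The fraction 1/1 is nonzero at every prime, since an element u with u 1 = 0 is zero and
  so not outside P. Hence the dimension of \<open>R\<close> as a module is its Krull
  dimension.\<close>

lemma support_regular: "support R (regular_module R) = {P. primeideal P R}"
proof -
  have "P \<in> support R (regular_module R)" if P: "primeideal P R" for P
  proof -
    interpret P: primeideal P R by (rule P)
    let ?S = "carrier R - P"
    let ?rel = "fraction_rel R ?S (regular_module R)"
    have "\<one>\<^bsub>R\<^esub> \<in> ?S" using P.one_imp_carrier P.I_notcarr by auto
    hence mem: "?rel `` {(\<one>\<^bsub>R\<^esub>, \<one>\<^bsub>R\<^esub>)} \<in> fractions R ?S (regular_module R)"
      unfolding fractions_def by (intro quotientI) simp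
    interpret M: Module.module R "regular_module R" by (rule module_self[OF R.is_cring])
    have amz: "\<one>\<^bsub>R\<^esub> \<ominus>\<^bsub>regular_module R\<^esub> \<zero>\<^bsub>R\<^esub> = \<one>\<^bsub>R\<^esub>" "\<one>\<^bsub>R\<^esub> \<ominus>\<^bsub>regular_module R\<^esub> \<one>\<^bsub>R\<^esub> = \<zero>\<^bsub>R\<^esub>"
      using M.M.diff_zero_right[of "\<one>\<^bsub>R\<^esub>"] M.M.diff_eq_zero_iff[of "\<one>\<^bsub>R\<^esub>" "\<one>\<^bsub>R\<^esub>"] by auto
    have "((\<one>\<^bsub>R\<^esub>, \<one>\<^bsub>R\<^esub>), (\<one>\<^bsub>R\<^esub>, \<one>\<^bsub>R\<^esub>)) \<in> ?rel"
      using \<open>\<one>\<^bsub>R\<^esub> \<in> ?S\<close> unfolding fraction_rel_def by (auto simp: amz intro!: bexI[of _ "\<one>\<^bsub>R\<^esub>"])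
    moreover have "((\<zero>\<^bsub>R\<^esub>, \<one>\<^bsub>R\<^esub>), (\<one>\<^bsub>R\<^esub>, \<one>\<^bsub>R\<^esub>)) \<notin> ?rel"
    proof
      assume "((\<zero>\<^bsub>R\<^esub>, \<one>\<^bsub>R\<^esub>), (\<one>\<^bsub>R\<^esub>, \<one>\<^bsub>R\<^esub>)) \<in> ?rel"
      then obtain u where u: "u \<in> ?S" "u \<otimes>\<^bsub>R\<^esub> (\<zero>\<^bsub>R\<^esub> \<ominus>\<^bsub>regular_module R\<^esub> \<one>\<^bsub>R\<^esub>) = \<zero>\<^bsub>R\<^esub>"
        by (auto simp: fraction_rel_def)
      let ?w = "\<zero>\<^bsub>R\<^esub> \<ominus>\<^bsub>regular_module R\<^esub> \<one>\<^bsub>R\<^esub>"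
      have "?w \<in> carrier R" using M.M.minus_closed[of "\<zero>\<^bsub>R\<^esub>" "\<one>\<^bsub>R\<^esub>"] by simp
      moreover have "?w \<oplus>\<^bsub>R\<^esub> \<one>\<^bsub>R\<^esub> = \<zero>\<^bsub>R\<^esub>"
        using M.M.l_neg[of "\<one>\<^bsub>R\<^esub>"] M.M.l_zero[of "\<ominus>\<^bsub>regular_module R\<^esub> \<one>\<^bsub>R\<^esub>"] M.M.a_inv_closed[of "\<one>\<^bsub>R\<^esub>"]
        by (simp add: a_minus_def)
      ultimately have "?w = \<ominus>\<^bsub>R\<^esub> \<one>\<^bsub>R\<^esub>" using R.minus_equality by fastforce
      hence "u = \<zero>\<^bsub>R\<^esub>" using u by (simp add: R.r_minus)
      thus False using u(1) P.zero_closed by simp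
    qed
    ultimately have "?rel `` {(\<one>\<^bsub>R\<^esub>, \<one>\<^bsub>R\<^esub>)} \<noteq> ?rel `` {(\<zero>\<^bsub>R\<^esub>, \<one>\<^bsub>R\<^esub>)}"
      by (metis Image_singleton_iff)
    hence "fractions R ?S (regular_module R) \<noteq> {?rel `` {(\<zero>\<^bsub>R\<^esub>, \<one>\<^bsub>R\<^esub>)}}"
      using mem by (metis singletonD)
    thus ?thesis using P by (simp add: support_def)
  qed
  thus ?thesis by (auto simp: support_def)
qed

text \<open>All fractions are equal. With empty support the dimension is -\<infinity>, so a module
  of finite dimension \<open>d\<^sub>0\<close> is nonzero.\<close>

lemma support_zero_module:
  assumes M: "Module.module R M" and z: "carrier M = {\<zero>\<^bsub>M\<^esub>}" shows "support R M = {}"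
proof -
  interpret M: Module.module R M by (rule M)
  have "fractions R (carrier R - P) M = {fraction_rel R (carrier R - P) M `` {(\<zero>\<^bsub>M\<^esub>, \<one>\<^bsub>R\<^esub>)}}"
    if P: "primeideal P R" for P
  proof -
    interpret P: primeideal P R by (rule P)
    have 1: "\<one>\<^bsub>R\<^esub> \<in> carrier R - P" using P.one_imp_carrier P.I_notcarr by auto
    have "fraction_rel R (carrier R - P) M = (carrier M \<times> (carrier R - P)) \<times> (carrier M \<times> (carrier R - P))"
      using 1 M.M.diff_zero_right[of "\<zero>\<^bsub>M\<^esub>"] unfolding fraction_rel_def z
      by (auto intro!: bexI[of _ "\<one>\<^bsub>R\<^esub>"])
    thus ?thesis using 1 by (auto simp: fractions_def quotient_def z)
  qed
  thus ?thesis by (auto simp: support_def)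
qed

end

lemma chain_dim_empty: "chain_dim {} = -\<infinity>"
proof -
  have "{ereal (real n) |n. \<exists>P :: nat \<Rightarrow> 'a set. (\<forall>i\<le>n. P i \<in> {}) \<and> (\<forall>i<n. P i \<subset> P (Suc i))} = {}"
    by auto
  thus ?thesis unfolding chain_dim_def by (simp only: Sup_empty bot_ereal_def)
qed

section \<open>Local cohomology from the torsion subcomplex, and the conclusion\<close>

context divisible_complex
begin

lemma tors_cocycles_submodule: "submodule {x \<in> tors j i. \<delta> i x = \<zero>\<^bsub>E (Suc i)\<^esub>} R (E i)"
proof -
  have "{x \<in> tors j i. \<delta> i x = \<zero>\<^bsub>E (Suc i)\<^esub>} = tors j i \<inter> {x \<in> carrier (E i). \<delta> i x \<in> {\<zero>\<^bsub>E (Suc i)\<^esub>}}"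
    using tors_carrier by auto
  thus ?thesis
    using submodule_Int[OF E tors_submodule submodule_vimage[OF E E \<delta> submodule_zero[OF E]]] by simp
qed

lemma tors_coboundaries_submodule:
  "submodule (case i of 0 \<Rightarrow> {\<zero>\<^bsub>E 0\<^esub>} | Suc k \<Rightarrow> \<delta> k ` tors j k) R
     ((E i)\<lparr>carrier := {x \<in> tors j i. \<delta> i x = \<zero>\<^bsub>E (Suc i)\<^esub>}\<rparr>)"
proof (cases i)
  case 0
  thus ?thesis
    using submodule_restrict[OF E tors_cocycles_submodule submodule_zero[OF E], of i j]
      submodule_simps(2)[OF E tors_cocycles_submodule, of i j] by simp
next
  case (Suc k)
  have "\<delta> k ` tors j k \<subseteq> {x \<in> tors j (Suc k). \<delta> (Suc k) x = \<zero>\<^bsub>E (Suc (Suc k))\<^esub>}"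
    using \<delta>_tors \<delta>_\<delta> tors_carrier by blast
  thus ?thesis
    using submodule_restrict[OF E tors_cocycles_submodule submodule_image[OF E E \<delta> tors_submodule]] Suc by simp
qed

end

context tor_setup
begin

text \<open>The differential identifies the top local cohomology module \<open>H\<close> with \<open>pre_G / im_plus_G\<close>.\<close>

lemma rel_exact_cohomology:
  fixes Z B defines "Z \<equiv> {x \<in> G (Suc (Suc p)). \<delta> (Suc (Suc p)) x = \<zero>\<^bsub>E (Suc (Suc (Suc p)))\<^esub>}"
    and "B \<equiv> \<delta> (Suc p) ` G (Suc p)"
    and "H \<equiv> quot_module ((E (Suc (Suc p)))\<lparr>carrier := Z\<rparr>) B"
  shows "rel_exact (E (Suc p)) i (pre_G (Suc p)) (im_plus_G p) \<longleftrightarrow> rel_exact H i (carrier H) {\<zero>\<^bsub>H\<^esub>}"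
proof -
  let ?N = "(E (Suc (Suc p)))\<lparr>carrier := Z\<rparr>"
  have Z: "submodule Z R (E (Suc (Suc p)))" unfolding Z_def by (rule tors_cocycles_submodule)
  have N: "Module.module R ?N" by (rule submodule.submodule_is_module[OF Z E])
  have B: "submodule B R ?N"
    using tors_coboundaries_submodule[of "Suc (Suc p)" "Suc (Suc p)"] by (simp add: Z_def B_def)
  have H: "Module.module R H" unfolding H_def by (rule module_quot[OF N B])
  interpret E1: Module.module R "E (Suc p)" by (rule E)
  interpret H: Module.module R H by (rule H)
  let ?h = "\<lambda>e. B +>\<^bsub>?N\<^esub> \<delta> (Suc p) e"
  have \<delta>Z: "\<delta> (Suc p) e \<in> Z" if "e \<in> pre_G (Suc p)" for e
    using that \<delta>_\<delta> by (auto simp: pre_G_def Z_def)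
  have "\<delta> (Suc p) \<in> mod_hom R ((E (Suc p))\<lparr>carrier := pre_G (Suc p)\<rparr>) ?N"
    by (rule mod_homI)
      (use \<delta>Z mod_hom_add[OF \<delta>] mod_hom_smult[OF \<delta>] in \<open>auto simp: pre_G_def\<close>)
  from mod_hom_compose[OF this quot_hom[OF N B]]
  have h: "?h \<in> mod_hom R ((E (Suc p))\<lparr>carrier := pre_G (Suc p)\<rparr>) H" by (simp add: H_def)
  show ?thesis
  proof (rule rel_exact_iso[OF E H pre_G_submodule im_plus_G_submodule H.carrier_is_submodule
        submodule_zero[OF H] h im_plus_G_sub_pre_G])
    show "{\<zero>\<^bsub>H\<^esub>} \<subseteq> carrier H" by simp
    show hc: "?h a \<in> carrier H" if "a \<in> pre_G (Suc p)" for a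
      using mod_hom_closed[OF h] that by simp
    show "?h a \<in> {\<zero>\<^bsub>H\<^esub>} \<longleftrightarrow> a \<in> im_plus_G p" if a: "a \<in> pre_G (Suc p)" for a
    proof -
      have aE: "a \<in> carrier (E (Suc p))" using a by (simp add: pre_G_def)
      have "?h a \<in> {\<zero>\<^bsub>H\<^esub>} \<longleftrightarrow> \<delta> (Suc p) a \<in> B"
        using coset_eq_self_iff[OF N B] \<delta>Z[OF a] by (simp add: H_def quot_zero[OF N B])
      also have "\<dots> \<longleftrightarrow> (\<exists>g\<in>G (Suc p). \<delta> (Suc p) (a \<ominus>\<^bsub>E (Suc p)\<^esub> g) = \<zero>\<^bsub>E (Suc (Suc p))\<^esub>)"
      proof -
        have "\<delta> (Suc p) (a \<ominus>\<^bsub>E (Suc p)\<^esub> g) = \<zero>\<^bsub>E (Suc (Suc p))\<^esub> \<longleftrightarrow> \<delta> (Suc p) a = \<delta> (Suc p) g"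
          if g: "g \<in> G (Suc p)" for g
          using abelian_group.diff_eq_zero_iff[OF module.axioms(2)[OF E[of "Suc (Suc p)"]]]
            mod_hom_minus[OF E E \<delta> aE tors_carrier[OF g]] mod_hom_closed[OF \<delta>] aE tors_carrier[OF g] by simp
        thus ?thesis by (auto simp: B_def)
      qed
      \<comment> \<open>Exactness of \<open>E\<close> turns cocycles into coboundaries: the kernel
        of the map to the cohomology consists of torsion elements plus coboundaries.\<close>
      also have "\<dots> \<longleftrightarrow> (\<exists>g\<in>G (Suc p). a \<ominus>\<^bsub>E (Suc p)\<^esub> g \<in> \<delta> p ` carrier (E p))"
        using exact[of p] aE tors_carrier by auto
      also have "\<dots> \<longleftrightarrow> a \<in> im_plus_G p"
      proof
        assume "\<exists>g\<in>G (Suc p). a \<ominus>\<^bsub>E (Suc p)\<^esub> g \<in> \<delta> p ` carrier (E p)"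
        then obtain g w where gw: "g \<in> G (Suc p)" "w \<in> carrier (E p)" "a \<ominus>\<^bsub>E (Suc p)\<^esub> g = \<delta> p w" by blast
        have "a \<ominus>\<^bsub>E (Suc p)\<^esub> \<delta> p w = g"
          using gw(3)[symmetric] aE tors_carrier[OF gw(1)] by (simp add: a_minus_def E1.M.minus_add E1.M.r_neg1 E1.M.r_neg2)
        thus "a \<in> im_plus_G p" using gw aE by (auto simp: im_plus_G_def)
      next
        assume "a \<in> im_plus_G p"
        then obtain w where w: "w \<in> carrier (E p)" "a \<ominus>\<^bsub>E (Suc p)\<^esub> \<delta> p w \<in> G (Suc p)"
          by (auto simp: im_plus_G_def)
        have "a \<ominus>\<^bsub>E (Suc p)\<^esub> (a \<ominus>\<^bsub>E (Suc p)\<^esub> \<delta> p w) = \<delta> p w"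
          using aE mod_hom_closed[OF \<delta> w(1)] by (simp add: a_minus_def E1.M.minus_add E1.M.r_neg2)
        thus "\<exists>g\<in>G (Suc p). a \<ominus>\<^bsub>E (Suc p)\<^esub> g \<in> \<delta> p ` carrier (E p)" using w by (metis imageI)
      qed
      finally show ?thesis .
    qed
    show "\<exists>a\<in>pre_G (Suc p). c \<ominus>\<^bsub>H\<^esub> ?h a \<in> {\<zero>\<^bsub>H\<^esub>}" if c: "c \<in> carrier H" for c
    proof -
      obtain z where z: "z \<in> Z" "c = B +>\<^bsub>?N\<^esub> z" using c by (auto simp: H_def quot_carrier[OF N B])
      \<comment> \<open>A cocycle of the torsion subcomplex need not bound there, but it bounds in
        \<open>E\<close>, which is exact in positive degrees.\<close>
      have "z \<in> \<delta> (Suc p) ` carrier (E (Suc p))"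
        using z(1) tors_carrier unfolding exact by (auto simp: Z_def)
      then obtain e where e: "e \<in> carrier (E (Suc p))" "z = \<delta> (Suc p) e" by blast
      have "e \<in> pre_G (Suc p)" using e z(1) by (simp add: pre_G_def Z_def)
      thus ?thesis using z(2) e(2) c H.M.diff_eq_zero_iff by auto
    qed
  qed
qed

end

theorem proposition3p15:
  fixes R :: "'a ring" and \<mm> :: "'a set" and M :: "('a, 'b) module" and d d\<^sub>0 t :: nat
  assumes "cohen_macaulay_local_ring R \<mm>"
    and "krull_dim R = ereal (real d)"
    and "Module.module R M"
    and "\<not> cohen_macaulay_module R \<mm> M"
    and "module_dim R M = ereal (real d\<^sub>0)"
    and "int d\<^sub>0 < int d - 1"
    and "depth R \<mm> M = enat t"
    and "int t \<le> int d - 2"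
  shows "\<not> tor_rigid TYPE('b) R (local_cohomology R \<mm> d (regular_module R))"
proof
  let ?H = "\<lambda>i. local_cohomology R \<mm> i (regular_module R)"
  assume rigid: "tor_rigid TYPE('b) R (?H d)"
  interpret noetherian_local R \<mm>
    using assms(1) by unfold_locales (simp add: cohen_macaulay_local_ring_def)
  note RR = module_self[OF R.is_cring]
  \<comment> \<open>As \<open>d\<^sub>0\<close> is a natural number,
    \<open>d\<^sub>0 < d - 1\<close> gives d at least 2, so degree 1 lies strictly below d.\<close>
  obtain p where d: "d = Suc (Suc p)" using assms(6) by (cases d rule: nat.exhaust; cases "d - 1") auto
  have "module_dim R (regular_module R) = ereal (real d)"
    using assms(2) by (simp add: module_dim_def support_regular krull_dim_def)
  hence "ereal_of_enat (depth R \<mm> (regular_module R)) = ereal_of_enat (enat d)"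
    using assms(1) by (simp add: cohen_macaulay_local_ring_def cohen_macaulay_module_def)
  hence depth: "depth R \<mm> (regular_module R) = enat d" by (cases "depth R \<mm> (regular_module R)") auto
  have vanish: "is_zero_module (?H i)" if "i < d" for i
  proof (rule ccontr)
    assume "\<not> is_zero_module (?H i)"
    hence "depth R \<mm> (regular_module R) \<le> enat i" unfolding depth_def by (intro Inf_lower) blast
    thus False using depth that by simp
  qed
  have "carrier M \<noteq> {\<zero>\<^bsub>M\<^esub>}"
  proof
    assume "carrier M = {\<zero>\<^bsub>M\<^esub>}"
    thus False using support_zero_module[OF assms(3)] assms(5) by (simp add: module_dim_def chain_dim_empty)
  qed
  \<comment> \<open>\<open>L\<close> is carried by \<open>'b\<close>, the type over which the
    assumed rigidity ranges.\<close>
  then obtain L :: "('a, 'b) module" where L: "Module.module R L" "carrier L \<noteq> {\<zero>\<^bsub>L\<^esub>}"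
    and ann: "\<And>r x. r \<in> \<mm> \<Longrightarrow> x \<in> carrier L \<Longrightarrow> r \<odot>\<^bsub>L\<^esub> x = \<zero>\<^bsub>L\<^esub>"
    using residue_module_exists[OF assms(3)] by blast
  obtain E \<delta> \<eta> where res: "injective_resolution R (regular_module R) = (E, \<delta>, \<eta>)" by (metis prod_cases3)
  have "is_injective_resolution R (regular_module R) (E, \<delta>, \<eta>)"
    using injective_resolution_exists[OF noeth RR] by (simp add: res)
  hence inj: "\<And>n. is_injective_module R (E n)" and \<delta>: "\<And>n. \<delta> n \<in> mod_hom R (E n) (E (Suc n))"
    and \<eta>: "\<eta> \<in> mod_hom R (regular_module R) (E 0)" "inj_on \<eta> (carrier (regular_module R))"
      "\<eta> ` carrier (regular_module R) = {x \<in> carrier (E 0). \<delta> 0 x = \<zero>\<^bsub>E 1\<^esub>}"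
    and exact: "\<And>n. \<delta> n ` carrier (E n) = {x \<in> carrier (E (Suc n)). \<delta> (Suc n) x = \<zero>\<^bsub>E (Suc (Suc n))\<^esub>}"
    by (auto simp: is_injective_resolution_def)
  have baer: "baer R (E n)" for n by (rule injective_module_baer[OF inj])
  have E: "Module.module R (E n)" for n using baer by (simp add: baer_def)
  obtain y :: "nat \<Rightarrow> 'a" where y: "\<And>l. y l \<in> \<mm>"
    "\<And>P. primeideal P R \<Longrightarrow> (\<And>l. l < d \<Longrightarrow> y l \<in> P) \<Longrightarrow> P = \<mm>"
    using system_of_parameters[OF assms(2)] by blast
  have yR: "y l \<in> carrier R" for l using ideal.Icarr[OF max_ideal y(1)] .
  interpret X: divisible_complex R E \<delta> y
    by (rule divisible_complex.intro) (fact E \<delta> exact yR baer_divisible[OF noeth baer])+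
  \<comment> \<open>Describing torsion by the parameters turns local cohomology into the cohomology
    of \<open>X.tors d\<close>, the form needed by the filtration arguments.\<close>
  have coh: "?H i = quot_module ((E i)\<lparr>carrier := {x \<in> X.tors d i. \<delta> i x = \<zero>\<^bsub>E (Suc i)\<^esub>}\<rparr>)
      (case i of 0 \<Rightarrow> {\<zero>\<^bsub>E 0\<^esub>} | Suc k \<Rightarrow> \<delta> k ` X.tors d k)" for i
  proof -
    have "torsion_submodule R \<mm> (E n) = (E n)\<lparr>carrier := X.tors d n\<rparr>" for n
      using torsion_submodule_eq[where y = y and d = d, OF E[of n] y] by (simp add: torsion_submodule_def X.tors_def)
    thus ?thesis by (simp add: local_cohomology_def res cochain_cohomology_def cong: nat.case_cong)
  qed
  have cohM: "Module.module R ((E i)\<lparr>carrier := {x \<in> X.tors d i. \<delta> i x = \<zero>\<^bsub>E (Suc i)\<^esub>}\<rparr>)" for i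
    by (rule submodule.submodule_is_module[OF X.tors_cocycles_submodule E])
  have H: "Module.module R (?H i)" for i
    unfolding coh by (rule module_quot[OF cohM X.tors_coboundaries_submodule])
  have below: "{x \<in> X.tors d i. \<delta> i x = \<zero>\<^bsub>E (Suc i)\<^esub>} \<subseteq> (case i of 0 \<Rightarrow> {\<zero>\<^bsub>E 0\<^esub>} | Suc k \<Rightarrow> \<delta> k ` X.tors d k)"
    if "i < d" for i
    using vanish[OF that] unfolding coh is_zero_quot_iff[OF cohM X.tors_coboundaries_submodule] by simp
  obtain T :: "nat \<Rightarrow> ('a, 'b) res_elem set" and D \<epsilon> where coords: "free_resolution_coords R T D L \<epsilon>"
    and Tor: "\<And>i. is_zero_module (Tor R i L (?H d)) \<longleftrightarrow>
      free_complex.rel_exact R T D (?H d) i (carrier (?H d)) {\<zero>\<^bsub>?H d\<^esub>}"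
    using Tor_zero_iff[OF R.is_cring one_not_zero L(1)] H by blast
  interpret F: free_resolution_coords R T D L \<epsilon> by (rule coords)
  interpret S: tor_setup R T D E \<delta> y p
  proof unfold_locales
    show "F.null_homotopic (y l)" for l by (rule F.annihilator_null_homotopic[OF yR ann[OF y(1)]])
    show "z = \<zero>\<^bsub>E 0\<^esub>" if "z \<in> X.tors (Suc (Suc p)) 0" "\<delta> 0 z = \<zero>\<^bsub>E 1\<^esub>" for z
      using below[of 0] that by (auto simp: d)
    show "\<exists>w\<in>X.tors (Suc (Suc p)) i. \<delta> i w = z"
      if "i < Suc p" "z \<in> X.tors (Suc (Suc p)) (Suc i)" "\<delta> (Suc i) z = \<zero>\<^bsub>E (Suc (Suc i))\<^esub>" for i z
      using below[of "Suc i"] that by (auto simp: d)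
  qed
  have Tor': "is_zero_module (Tor R i L (?H d)) \<longleftrightarrow> F.rel_exact (E (Suc p)) i (S.pre_G (Suc p)) (S.im_plus_G p)" for i
    using Tor[of i] S.rel_exact_cohomology[of i] by (simp add: coh d)
  have "is_zero_module (Tor R 1 L (?H d))" unfolding Tor' by (rule S.rel_exact_1)
  \<comment> \<open>Rigidity carries the vanishing from degree 1 up to degree d, where Tor is
    \<open>L\<close> itself.\<close>
  hence "is_zero_module (Tor R (Suc (Suc p)) L (?H d))"
    using rigid L(1) unfolding tor_rigid_def by (metis Suc_le_eq le_refl One_nat_def zero_less_Suc)
  hence "F.rel_exact (regular_module R) 0 (carrier (regular_module R)) {\<zero>\<^bsub>regular_module R\<^esub>}"
    unfolding Tor' by (rule S.rel_exact_top[OF _ RR \<eta>])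
  thus False using F.rel_exact_regular_0 L(2) by blast
qed

end
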